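(* For every $\bar i\in I_\sigma$, the positive prefundamental representation $L^+_{\bar i,1}$ of $\mathcal U_q(\mathfrak b^\sigma)$ lies in the category $\mathcal O$.
   Context: Twisted data. $\mathfrak g$ is a simple complex Lie algebra of type $A_m$ ($m\ge2$), $D_m$ ($m\ge4$) or $E_6$ with Dynkin nodes $I$ and Cartan matrix $C$; $\sigma:I\to I$ is a non-trivial diagram automorphism of order $M\in\{2,3\}$; $\omega=e^{2\pi\sqrt{-1}/M}$. $I_\sigma$ is the set of $\sigma$-orbits, $\bar i$ the orbit of $i$; in each orbit a representative is fixed, the smallest node in the standard labelling ($1,\dots,n$ for $A_{2n}^{(2)},A_{2n-1}^{(2)},D_{n+1}^{(2)}$; $1$ and the trivalent node $2$ for $D_4^{(3)}$; in all cases a connected subdiagram); given $\bar i$, $i$ is this representative. $d_{\bar i}=\frac12\sum_{r=1}^MC_{i,\sigma^r(i)}$. $\hat I_\sigma=I_\sigma\sqcup\{\epsilon\}$; $C^\sigma$ is the generalized Cartan matrix of the twisted affine type, $\epsilon$ the affine node (for $A_{2n}^{(2)}$ the end node with longest root), so $d_{\bar i}C^\sigma_{\bar i,\bar j}=\sum_{r=1}^MC_{i,\sigma^r(j)}$ on $I_\sigma$; $d_\epsilon$ makes $(d_iC^\sigma_{i,j})$ symmetric; $(a_i)_{i\in\hat I_\sigma}$ are the positive integers with $\sum_ia_id_iC^\sigma_{i,j}=0$ for all $j$, $a_\epsilon=1$. $q\in\mathbb C^*$ is not a root of unity (with a fixed square root), $q_i=q^{d_i}$, $[m]_p=\frac{p^m-p^{-m}}{p-p^{-1}}$.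 Algebra. $\mathcal U_q(\mathcal L\mathfrak g^\sigma)$ has generators $e_i^\pm,k_i^{\pm1}$ ($i\in\hat I_\sigma$) and relations: the $k_i$ are invertible and commute, $k_ie_j^\pm=q_i^{\pm C^\sigma_{i,j}}e_j^\pm k_i$, $[e_i^+,e_j^-]=\delta_{i,j}\frac{k_i-k_i^{-1}}{q_i-q_i^{-1}}$, the quantum Serre relations of $C^\sigma$, and $\prod_ik_i^{a_i}=1$. It is also generated by the Drinfeld generators $x_{i,m}^\pm$ ($m\in\mathbb Z$), $h_{i,r}$ ($r\neq0$), $k_i^{\pm1}$, $i\in I$, of its Drinfeld presentation (Chari–Pressley, Damiani), where $x_{i,0}^\pm=e_{\bar i}^\pm$, $k_i=k_{\bar i}$ for representatives $i$, $e_\epsilon^\pm$ has degree $\pm1$ for the grading $\deg x_{i,m}^\pm=m,\deg h_{i,r}=r,\deg k_i=0$, and $x_{\sigma(i),m}^\pm=\omega^mx_{i,m}^\pm$, $h_{\sigma(i),r}=\omega^rh_{i,r}$, $k_{\sigma(i)}=k_i$, the $h$'s and $k$'s commute, $k_ix_{j,m}^\pm=q^{\pm\sum_{r=1}^MC_{i,\sigma^r(j)}}x_{j,m}^\pm k_i$, $[h_{i,s},x_{j,l}^\pm]=\pm\frac1s\left(\sum_{r=1}^M[sC_{i,\sigma^r(j)}/d_{\bar i}]_{q_{\bar i}}\omega^{sr}\right)x_{j,s+l}^\pm$, $[x_{i,s}^+,x_{j,l}^-]=\frac{\sum_{r=1}^M\delta_{\sigma^r(i),j}\omega^{rl}}{N_i}\frac{\phi_{i,s+l}^+-\phi_{i,s+l}^-}{q_{\bar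 i}-q_{\bar i}^{-1}}$ with $N_i=M$ if $\sigma(i)=i$, $N_i=1$ otherwise, and $\phi_i^\pm(u)=\sum_{m\ge0}\phi^\pm_{i,\pm m}u^{\pm m}=k_i^{\pm1}\exp(\pm(q_{\bar i}-q_{\bar i}^{-1})\sum_{l\ge1}h_{i,\pm l}u^{\pm l})$ (other $\phi^\pm_{i,m}$ are $0$). Borel subalgebra and category $\mathcal O$. $\mathcal U_q(\mathfrak b^\sigma)$ is the subalgebra generated by $e_i^+,k_i^{\pm1}$ ($i\in\hat I_\sigma$); it contains $x^+_{i,r}$, $\phi^+_{i,r}$ ($r\ge0$). For a tuple $\gamma=(\gamma_i(u))_{i\in I}$ in $\mathbb C[[u]]^I$ with $\gamma_i(0)\ne0$, $\gamma_{\sigma(i)}(u)=\gamma_i(\omega u)$, $L(\gamma)$ is the unique simple $\mathcal U_q(\mathfrak b^\sigma)$-module generated by a vector $v$ with $x^+_{i,r}v=0$ ($i\in I,r\ge0$), $\phi_i^+(u)v=\gamma_i(u)v$. $\mathfrak t$ is the subalgebra generated by the $k_{\bar i}^{\pm1}$, $\bar i\in I_\sigma$; $\mathfrak t^*$ is the group of its algebra characters, written additively; $\alpha_{\bar i}(k_{\bar j})=q_{\bar i}^{C^\sigma_{\bar i,\bar j}}$; $\lambda\le\mu$ iff $\mu-\lambda\in\sum\mathbb N\alpha_{\bar i}$; $D(\lambda)=\{\mu\le\lambda\}$. $\mathcal O$ is the category of $\mathcal U_q(\mathfrak b^\sigma)$-modules that are $\mathfrak t$-diagonalizable with finite-dimensional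 weight spaces and weights in a finite union of sets $D(\lambda_s)$. $L^+_{\bar i,1}=L(\gamma)$ with: if $\sigma(i)\ne i$, $\gamma_{\sigma^k(i)}(u)=1-\omega^ku$; if $\sigma(i)=i$, $\gamma_i(u)=1-u^M$; and $\gamma_j(u)=1$ for $j\notin\bar i$. *)

theory Defs
  imports
    Complex_Main
    "HOL-Library.Poly_Mapping"
    "HOL-Computational_Algebra.Formal_Power_Series"
    "HOL-Algebra.QuotRing"
    "HOL-Algebra.Generated_Rings"
begin

section \<open>Twisted data\<close>

datatype dynkin = TypeA nat | TypeD nat | TypeE6

record twisted_datum =
  dtype :: dynkin
  aut :: "nat \<Rightarrow> nat"     \<comment> \<open>the diagram automorphism \<open>\<sigma>\<close>\<close>
  aord :: nat              \<comment> \<open>its order \<open>M\<close>\<close>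
  sqrtq :: complex         \<comment> \<open>the fixed square root of \<open>q\<close>\<close>

text \<open>Nodes carry Bourbaki's labels: in type \<open>D\<^sub>m\<close> the nodes \<open>m - 1\<close> and \<open>m\<close> are joined
  to \<open>m - 2\<close> (so \<open>2\<close> is the trivalent node of \<open>D\<^sub>4\<close>); in type \<open>E\<^sub>6\<close> the chain is
  \<open>1, 3, 4, 5, 6\<close> and \<open>2\<close> is joined to \<open>4\<close>.\<close>

fun nodes_of :: "dynkin \<Rightarrow> nat set" where
  "nodes_of (TypeA m) = {1..m}"
| "nodes_of (TypeD m) = {1..m}"
| "nodes_of TypeE6 = {1..6}"

fun edges_of :: "dynkin \<Rightarrow> nat set set" where
  "edges_of (TypeA m) = {{i, i + 1} | i. 1 \<le> i \<and> i < m}"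
| "edges_of (TypeD m) = {{i, i + 1} | i. 1 \<le> i \<and> i < m - 1} \<union> {{m - 2, m}}"
| "edges_of TypeE6 = {{1, 3}, {3, 4}, {4, 5}, {5, 6}, {2, 4}}"

fun admissible_type :: "dynkin \<Rightarrow> bool" where
  "admissible_type (TypeA m) \<longleftrightarrow> 2 \<le> m"
| "admissible_type (TypeD m) \<longleftrightarrow> 4 \<le> m"
| "admissible_type TypeE6 \<longleftrightarrow> True"

definition nodes :: "twisted_datum \<Rightarrow> nat set" where
  "nodes T = nodes_of (dtype T)"

definition cartan :: "twisted_datum \<Rightarrow> nat \<Rightarrow> nat \<Rightarrow> int" where
  "cartan T i j = (if i = j then 2 else if {i, j} \<in> edges_of (dtype T) then - 1 else 0)"

definition sig :: "twisted_datum \<Rightarrow> nat \<Rightarrow> nat \<Rightarrow> nat" where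
  "sig T r i = (aut T ^^ r) i"

definition qpar :: "twisted_datum \<Rightarrow> complex" where
  "qpar T = (sqrtq T)\<^sup>2"

definition valid_datum :: "twisted_datum \<Rightarrow> bool" where
  "valid_datum T \<longleftrightarrow>
     admissible_type (dtype T) \<and>
     bij_betw (aut T) (nodes T) (nodes T) \<and>
     (\<forall>i\<in>nodes T. \<forall>j\<in>nodes T. cartan T (aut T i) (aut T j) = cartan T i j) \<and>
     aord T \<in> {2, 3} \<and>
     (\<exists>i\<in>nodes T. aut T i \<noteq> i) \<and>
     (\<forall>i\<in>nodes T. sig T (aord T) i = i) \<and>
     sqrtq T \<noteq> 0 \<and>
     (\<forall>n>0. qpar T ^ n \<noteq> 1)"

definition omega :: "twisted_datum \<Rightarrow> complex" where
  "omega T = exp (2 * of_real pi * \<i> / of_nat (aord T))"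

definition orb :: "twisted_datum \<Rightarrow> nat \<Rightarrow> nat set" where
  "orb T i = (\<lambda>r. sig T r i) ` {..<aord T}"

definition Isig :: "twisted_datum \<Rightarrow> nat set set" where
  "Isig T = orb T ` nodes T"

definition rep :: "nat set \<Rightarrow> nat" where
  "rep P = Min P"

text \<open>Index set of the affine diagram: \<open>None\<close> is the affine node \<open>\<epsilon>\<close>.\<close>

type_synonym anode = "nat set option"

definition Ihat :: "twisted_datum \<Rightarrow> anode set" where
  "Ihat T = insert None (Some ` Isig T)"

definition csum :: "twisted_datum \<Rightarrow> nat \<Rightarrow> nat \<Rightarrow> int" where
  "csum T i j = (\<Sum>r = 1..aord T. cartan T i (sig T r j))"

text \<open>The affine node is joined to exactly one orbit.  In type \<open>D\<^sub>m\<close> with \<open>M = 2\<close> this is the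
  orbit of the \<open>\<sigma>\<close>-fixed end node: node \<open>1\<close> if \<open>m > 4\<close>, but possibly \<open>3\<close> or \<open>4\<close> for the
  non-standard involutions of \<open>D\<^sub>4\<close>.  The two numbers given for the join are
  \<open>C\<^sup>\<sigma>(\<epsilon>, P)\<close> and \<open>C\<^sup>\<sigma>(P, \<epsilon>)\<close>.\<close>

definition eps_orbit :: "twisted_datum \<Rightarrow> nat set" where
  "eps_orbit T = (case dtype T of
      TypeA m \<Rightarrow> if even m then orb T 1 else orb T 2
    | TypeD m \<Rightarrow> if aord T = 2 then orb T (THE j. j \<in> {1, m - 1, m} \<and> aut T j = j) else orb T 1
    | TypeE6 \<Rightarrow> orb T 1)"

definition eps_entries :: "twisted_datum \<Rightarrow> int \<times> int" where
  "eps_entries T = (case dtype T of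
      TypeA m \<Rightarrow>
        if even m then (if m = 2 then (- 1, - 4) else (- 1, - 2))
        else (if m = 3 then (- 2, - 1) else (- 1, - 1))
    | TypeD m \<Rightarrow> if aord T = 2 then (- 2, - 1) else (- 1, - 1)
    | TypeE6 \<Rightarrow> (- 1, - 1))"

text \<open>\<open>dd T i\<close> is the integer \<open>2 d\<^sub>i\<close>; the \<open>d\<^sub>i\<close> themselves may be half-integral.  For \<open>\<epsilon>\<close> it is
  forced by \<open>d\<^sub>\<epsilon> C\<^sup>\<sigma>(\<epsilon>, P) = d\<^sub>P C\<^sup>\<sigma>(P, \<epsilon>)\<close>.  The divisions here and in \<open>csig\<close> are exact.\<close>

definition dd :: "twisted_datum \<Rightarrow> anode \<Rightarrow> int" where
  "dd T x = (case x of
      Some P \<Rightarrow> csum T (rep P) (rep P)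
    | None \<Rightarrow> (let P = eps_orbit T in
        csum T (rep P) (rep P) * snd (eps_entries T) div fst (eps_entries T)))"

definition csig :: "twisted_datum \<Rightarrow> anode \<Rightarrow> anode \<Rightarrow> int" where
  "csig T x y = (case (x, y) of
      (Some P, Some Q) \<Rightarrow> 2 * csum T (rep P) (rep Q) div dd T (Some P)
    | (None, None) \<Rightarrow> 2
    | (None, Some Q) \<Rightarrow> if Q = eps_orbit T then fst (eps_entries T) else 0
    | (Some P, None) \<Rightarrow> if P = eps_orbit T then snd (eps_entries T) else 0)"

definition marks :: "twisted_datum \<Rightarrow> anode \<Rightarrow> nat" where
  "marks T = (THE a. a None = 1 \<and> (\<forall>x\<in>Ihat T. 0 < a x) \<and> (\<forall>x. x \<notin> Ihat T \<longrightarrow> a x = 0) \<and>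
     (\<forall>y\<in>Ihat T. (\<Sum>x\<in>Ihat T. int (a x) * dd T x * csig T x y) = 0))"

definition qi :: "twisted_datum \<Rightarrow> anode \<Rightarrow> complex" where
  "qi T x = sqrtq T powi dd T x"

definition qint :: "complex \<Rightarrow> nat \<Rightarrow> complex" where
  "qint p m = (p ^ m - inverse p ^ m) / (p - inverse p)"

definition qfact :: "complex \<Rightarrow> nat \<Rightarrow> complex" where
  "qfact p m = (\<Prod>k = 1..m. qint p k)"

definition qbinom :: "complex \<Rightarrow> nat \<Rightarrow> nat \<Rightarrow> complex" where
  "qbinom p m r = qfact p m / (qfact p r * qfact p (m - r))"


section \<open>The twisted quantum loop algebra by generators and relations\<close>

text \<open>Words form a monoid under concatenation, so that \<open>'g word \<Rightarrow>\<^sub>0 complex\<close> with the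
  convolution product of \<^theory>\<open>HOL-Library.Poly_Mapping\<close> is the free associative algebra.\<close>

datatype 'g word = Word (letters: "'g list")

instantiation word :: (type) monoid_add
begin

definition "0 = Word []"
definition "v + w = Word (letters v @ letters w)"

instance
  by standard (auto simp: zero_word_def plus_word_def)

end

datatype sign = Pos | Neg

fun sgi :: "sign \<Rightarrow> int" where
  "sgi Pos = 1"
| "sgi Neg = - 1"

datatype gen = GE sign anode | GK anode | GKinv anode

type_synonym falg = "gen word \<Rightarrow>\<^sub>0 complex"
type_synonym uq = "falg set"

definition Gens :: "twisted_datum \<Rightarrow> gen set" where
  "Gens T = {GE b x | b x. x \<in> Ihat T} \<union> GK ` Ihat T \<union> GKinv ` Ihat T"

definition free_algebra :: "gen set \<Rightarrow> falg ring" where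
  "free_algebra G =
     \<lparr>carrier = {p. \<forall>w\<in>Poly_Mapping.keys p. set (letters w) \<subseteq> G},
      mult = (*), one = 1, zero = 0, add = (+)\<rparr>"

definition fscal :: "complex \<Rightarrow> falg" where
  "fscal c = Poly_Mapping.single 0 c"

definition fgen :: "gen \<Rightarrow> falg" where
  "fgen g = Poly_Mapping.single (Word [g]) 1"

abbreviation FE :: "sign \<Rightarrow> anode \<Rightarrow> falg" where "FE b x \<equiv> fgen (GE b x)"
abbreviation FK :: "anode \<Rightarrow> falg" where "FK x \<equiv> fgen (GK x)"
abbreviation FKinv :: "anode \<Rightarrow> falg" where "FKinv x \<equiv> fgen (GKinv x)"

text \<open>A relation \<open>l = r\<close> is recorded as the element \<open>l - r\<close>.\<close>

definition rel_torus :: "twisted_datum \<Rightarrow> falg set" where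
  "rel_torus T =
     {FK x * FKinv x - 1 | x. x \<in> Ihat T} \<union> {FKinv x * FK x - 1 | x. x \<in> Ihat T} \<union>
     {FK x * FK y - FK y * FK x | x y. x \<in> Ihat T \<and> y \<in> Ihat T}"

definition rel_weight :: "twisted_datum \<Rightarrow> falg set" where
  "rel_weight T =
     {FK x * FE b y - fscal (qi T x powi (sgi b * csig T x y)) * FE b y * FK x
       | b x y. x \<in> Ihat T \<and> y \<in> Ihat T}"

definition rel_comm :: "twisted_datum \<Rightarrow> falg set" where
  "rel_comm T =
     {FE Pos x * FE Neg y - FE Neg y * FE Pos x
        - (if x = y then fscal (1 / (qi T x - inverse (qi T x))) * (FK x - FKinv x) else 0)
       | x y. x \<in> Ihat T \<and> y \<in> Ihat T}"

definition rel_serre :: "twisted_datum \<Rightarrow> falg set" where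
  "rel_serre T =
     {(\<Sum>r\<le>N. fscal ((- 1) ^ r * qbinom (qi T x) N r) * FE b x ^ (N - r) * FE b y * FE b x ^ r)
       | b x y N. x \<in> Ihat T \<and> y \<in> Ihat T \<and> x \<noteq> y \<and> int N = 1 - csig T x y}"

text \<open>The central relation is imposed for every enumeration of \<open>Ihat T\<close>; these are all
  equivalent since the \<open>k\<^sub>i\<close> commute.\<close>

definition rel_central :: "twisted_datum \<Rightarrow> falg set" where
  "rel_central T =
     {prod_list (map (\<lambda>x. FK x ^ marks T x) xs) - 1 | xs. distinct xs \<and> set xs = Ihat T}"

definition relations :: "twisted_datum \<Rightarrow> falg set" where
  "relations T = rel_torus T \<union> rel_weight T \<union> rel_comm T \<union> rel_serre T \<union> rel_central T"

definition rel_ideal :: "twisted_datum \<Rightarrow> falg set" where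
  "rel_ideal T = genideal (free_algebra (Gens T)) (relations T)"

definition Uq :: "twisted_datum \<Rightarrow> uq ring" where
  "Uq T = free_algebra (Gens T) Quot rel_ideal T"

definition ucls :: "twisted_datum \<Rightarrow> falg \<Rightarrow> uq" where
  "ucls T p = rel_ideal T +>\<^bsub>free_algebra (Gens T)\<^esub> p"

definition uscal :: "twisted_datum \<Rightarrow> complex \<Rightarrow> uq" where
  "uscal T c = ucls T (fscal c)"

definition usmult :: "twisted_datum \<Rightarrow> complex \<Rightarrow> uq \<Rightarrow> uq" where
  "usmult T c a = uscal T c \<otimes>\<^bsub>Uq T\<^esub> a"

definition ucomm :: "twisted_datum \<Rightarrow> uq \<Rightarrow> uq \<Rightarrow> uq" where
  "ucomm T a b = a \<otimes>\<^bsub>Uq T\<^esub> b \<ominus>\<^bsub>Uq T\<^esub> b \<otimes>\<^bsub>Uq T\<^esub> a"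

definition ue :: "twisted_datum \<Rightarrow> sign \<Rightarrow> anode \<Rightarrow> uq" where
  "ue T b x = ucls T (FE b x)"

text \<open>\<open>kk T Pos x\<close> is \<open>k\<^sub>x\<close> and \<open>kk T Neg x\<close> its inverse.\<close>

definition kk :: "twisted_datum \<Rightarrow> sign \<Rightarrow> anode \<Rightarrow> uq" where
  "kk T b x = ucls T (case b of Pos \<Rightarrow> FK x | Neg \<Rightarrow> FKinv x)"

definition subalgebra_gen :: "twisted_datum \<Rightarrow> uq set \<Rightarrow> uq set" where
  "subalgebra_gen T S = generate_ring (Uq T) (range (uscal T) \<union> S)"

definition borel :: "twisted_datum \<Rightarrow> uq set" where
  "borel T = subalgebra_gen T ({ue T Pos x | x. x \<in> Ihat T} \<union> {kk T b x | b x. x \<in> Ihat T})"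

definition torus :: "twisted_datum \<Rightarrow> uq set" where
  "torus T = subalgebra_gen T {kk T b (Some P) | b P. P \<in> Isig T}"


subsection \<open>Well-definedness\<close>

lemma keys_uminus: "Poly_Mapping.keys (- p :: 'a \<Rightarrow>\<^sub>0 'b::ab_group_add) = Poly_Mapping.keys p"
  by (auto simp: in_keys_iff)

lemma free_algebra_ring: "ring (free_algebra G)"
proof (rule ringI)
  show "abelian_group (free_algebra G)"
  proof (rule abelian_groupI)
    fix p assume p: "p \<in> carrier (free_algebra G)"
    show "\<exists>q\<in>carrier (free_algebra G). q \<oplus>\<^bsub>free_algebra G\<^esub> p = \<zero>\<^bsub>free_algebra G\<^esub>"
      by (rule bexI[of _ "- p"]) (use p in \<open>auto simp: free_algebra_def keys_uminus\<close>)
  next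
    fix p q assume "p \<in> carrier (free_algebra G)" "q \<in> carrier (free_algebra G)"
    then show "p \<oplus>\<^bsub>free_algebra G\<^esub> q \<in> carrier (free_algebra G)"
      unfolding free_algebra_def using Poly_Mapping.keys_add[of p q] by auto
  qed (auto simp: free_algebra_def add.commute add.left_commute)
next
  show "Group.monoid (free_algebra G)"
  proof
    fix p q assume "p \<in> carrier (free_algebra G)" "q \<in> carrier (free_algebra G)"
    then show "p \<otimes>\<^bsub>free_algebra G\<^esub> q \<in> carrier (free_algebra G)"
      unfolding free_algebra_def using keys_mult[of p q]
      by (force simp: plus_word_def)
  qed (auto simp: free_algebra_def mult.assoc zero_word_def)
qed (auto simp: free_algebra_def algebra_simps)

lemma free_algebra_closed:
  assumes "p \<in> carrier (free_algebra G)" "q \<in> carrier (free_algebra G)"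
  shows "p * q \<in> carrier (free_algebra G)" "p + q \<in> carrier (free_algebra G)"
    "- p \<in> carrier (free_algebra G)" "p - q \<in> carrier (free_algebra G)"
proof -
  interpret ring "free_algebra G" by (rule free_algebra_ring)
  show m: "p * q \<in> carrier (free_algebra G)" and a: "p + q \<in> carrier (free_algebra G)"
    using assms m_closed[of p q] a_closed[of p q] by (auto simp: free_algebra_def)
  show "- p \<in> carrier (free_algebra G)"
    using assms by (auto simp: free_algebra_def keys_uminus)
  have "p + - q \<in> carrier (free_algebra G)"
    using assms a_closed[of p "- q"] by (auto simp: free_algebra_def keys_uminus)
  then show "p - q \<in> carrier (free_algebra G)" by simp
qed

lemma free_algebra_basic:
  "fscal c \<in> carrier (free_algebra G)" "1 \<in> carrier (free_algebra G)"
  "0 \<in> carrier (free_algebra G)" "g \<in> G \<Longrightarrow> fgen g \<in> carrier (free_algebra G)"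
  by (auto simp: free_algebra_def fscal_def fgen_def zero_word_def)

lemma free_algebra_power:
  "p \<in> carrier (free_algebra G) \<Longrightarrow> p ^ n \<in> carrier (free_algebra G)"
  by (induction n) (auto intro: free_algebra_closed free_algebra_basic)

lemma free_algebra_sum:
  "(\<And>x. x \<in> A \<Longrightarrow> f x \<in> carrier (free_algebra G)) \<Longrightarrow> sum f A \<in> carrier (free_algebra G)"
  by (induction A rule: infinite_finite_induct)
     (auto intro: free_algebra_closed free_algebra_basic)

lemma free_algebra_prod_list:
  "(\<And>p. p \<in> set ps \<Longrightarrow> p \<in> carrier (free_algebra G)) \<Longrightarrow> prod_list ps \<in> carrier (free_algebra G)"
  by (induction ps) (auto intro: free_algebra_closed free_algebra_basic)

lemma relations_carrier: "relations T \<subseteq> carrier (free_algebra (Gens T))"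
proof -
  have g: "FE b x \<in> carrier (free_algebra (Gens T))" "FK x \<in> carrier (free_algebra (Gens T))"
    "FKinv x \<in> carrier (free_algebra (Gens T))" if "x \<in> Ihat T" for b x
    using that by (auto intro!: free_algebra_basic simp: Gens_def)
  show ?thesis
    unfolding relations_def rel_torus_def rel_weight_def rel_comm_def rel_serre_def rel_central_def
    by (auto intro!: free_algebra_closed free_algebra_power free_algebra_basic
        free_algebra_sum free_algebra_prod_list g)
qed

lemma rel_ideal_ideal: "ideal (rel_ideal T) (free_algebra (Gens T))"
  unfolding rel_ideal_def
  by (rule ring.genideal_ideal[OF free_algebra_ring relations_carrier])

lemma Uq_ring: "ring (Uq T)"
  unfolding Uq_def by (rule ideal.quotient_is_ring[OF rel_ideal_ideal])


section \<open>Drinfeld generators\<close>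

text \<open>Formal power series over the ring \<open>Uq T\<close>, given by their coefficient sequences.  The
  exponential is only meant for series without constant term, whose \<open>n\<close>-th power has no
  coefficients below degree \<open>n\<close>; hence the sum over \<open>n \<le> m\<close>.\<close>

definition ser_mult :: "twisted_datum \<Rightarrow> (nat \<Rightarrow> uq) \<Rightarrow> (nat \<Rightarrow> uq) \<Rightarrow> nat \<Rightarrow> uq" where
  "ser_mult T f g m = (\<Oplus>\<^bsub>Uq T\<^esub>l\<in>{..m}. f l \<otimes>\<^bsub>Uq T\<^esub> g (m - l))"

definition ser_power :: "twisted_datum \<Rightarrow> (nat \<Rightarrow> uq) \<Rightarrow> nat \<Rightarrow> nat \<Rightarrow> uq" where
  "ser_power T f n = (ser_mult T f ^^ n) (\<lambda>m. if m = 0 then \<one>\<^bsub>Uq T\<^esub> else \<zero>\<^bsub>Uq T\<^esub>)"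

definition ser_exp :: "twisted_datum \<Rightarrow> (nat \<Rightarrow> uq) \<Rightarrow> nat \<Rightarrow> uq" where
  "ser_exp T f m = (\<Oplus>\<^bsub>Uq T\<^esub>n\<in>{..m}. usmult T (1 / fact n) (ser_power T f n m))"

text \<open>\<open>q\<close>-parameter and \<open>k\<close>-generator attached to a node of the finite diagram through its orbit.\<close>

definition qn :: "twisted_datum \<Rightarrow> nat \<Rightarrow> complex" where
  "qn T i = qi T (Some (orb T i))"

definition kn :: "twisted_datum \<Rightarrow> sign \<Rightarrow> nat \<Rightarrow> uq" where
  "kn T b i = kk T b (Some (orb T i))"

definition phi :: "twisted_datum \<Rightarrow> (nat \<Rightarrow> int \<Rightarrow> uq) \<Rightarrow> sign \<Rightarrow> nat \<Rightarrow> int \<Rightarrow> uq" where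
  "phi T h b i m =
     (if 0 \<le> sgi b * m then
        kn T b i \<otimes>\<^bsub>Uq T\<^esub>
          ser_exp T (\<lambda>l. if l = 0 then \<zero>\<^bsub>Uq T\<^esub>
            else usmult T (of_int (sgi b) * (qn T i - inverse (qn T i))) (h i (sgi b * int l)))
          (nat \<bar>m\<bar>)
      else \<zero>\<^bsub>Uq T\<^esub>)"

text \<open>\<open>qbr T i n\<close> is \<open>[n / d\<^sub>i]\<close> at \<open>q\<^sub>i\<close>, written without fractional exponents by
  \<open>q\<^sub>i\<close> to the power \<open>n / d\<^sub>i\<close> being \<open>q\<close> to the power \<open>n\<close>.\<close>

definition qbr :: "twisted_datum \<Rightarrow> nat \<Rightarrow> int \<Rightarrow> complex" where
  "qbr T i n = (qpar T powi n - qpar T powi (- n)) / (qn T i - inverse (qn T i))"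

definition h_coeff :: "twisted_datum \<Rightarrow> nat \<Rightarrow> nat \<Rightarrow> int \<Rightarrow> complex" where
  "h_coeff T i j s =
     (1 / of_int s) *
       (\<Sum>r = 1..aord T. qbr T i (s * cartan T i (sig T r j)) * omega T powi (s * int r))"

definition x_coeff :: "twisted_datum \<Rightarrow> nat \<Rightarrow> nat \<Rightarrow> int \<Rightarrow> complex" where
  "x_coeff T i j l =
     (\<Sum>r = 1..aord T. if sig T r i = j then omega T powi (int r * l) else 0)
       / of_nat (if aut T i = i then aord T else 1)
       / (qn T i - inverse (qn T i))"

definition algebra_grading :: "twisted_datum \<Rightarrow> (int \<Rightarrow> uq set) \<Rightarrow> bool" where
  "algebra_grading T V \<longleftrightarrow>
     (\<forall>m. V m \<subseteq> carrier (Uq T) \<and> \<zero>\<^bsub>Uq T\<^esub> \<in> V m \<and>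
        (\<forall>a\<in>V m. \<forall>b\<in>V m. a \<oplus>\<^bsub>Uq T\<^esub> b \<in> V m) \<and> (\<forall>c. \<forall>a\<in>V m. usmult T c a \<in> V m)) \<and>
     \<one>\<^bsub>Uq T\<^esub> \<in> V 0 \<and>
     (\<forall>m n. \<forall>a\<in>V m. \<forall>b\<in>V n. a \<otimes>\<^bsub>Uq T\<^esub> b \<in> V (m + n)) \<and>
     (\<forall>a\<in>carrier (Uq T). \<exists>!f. (\<forall>m. f m \<in> V m) \<and> finite {m. f m \<noteq> \<zero>\<^bsub>Uq T\<^esub>} \<and>
        a = (\<Oplus>\<^bsub>Uq T\<^esub>m\<in>{m. f m \<noteq> \<zero>\<^bsub>Uq T\<^esub>}. f m))"

text \<open>\<open>x b i m\<close> and \<open>h i r\<close> (the latter for \<open>r \<noteq> 0\<close> only) are Drinfeld generators of \<open>Uq T\<close>.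
  The quadratic and Serre relations among the \<open>x\<close> are not part of the predicate.\<close>

definition drinfeld_generators ::
    "twisted_datum \<Rightarrow> (sign \<Rightarrow> nat \<Rightarrow> int \<Rightarrow> uq) \<Rightarrow> (nat \<Rightarrow> int \<Rightarrow> uq) \<Rightarrow> bool" where
  "drinfeld_generators T x h \<longleftrightarrow>
     (\<forall>b. \<forall>i\<in>nodes T. \<forall>m. x b i m \<in> carrier (Uq T)) \<and>
     (\<forall>i\<in>nodes T. \<forall>r. r \<noteq> 0 \<longrightarrow> h i r \<in> carrier (Uq T)) \<and>
     subalgebra_gen T ({x b i m | b i m. i \<in> nodes T} \<union> {h i r | i r. i \<in> nodes T \<and> r \<noteq> 0} \<union>
        {kn T b i | b i. i \<in> nodes T}) = carrier (Uq T) \<and>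
     (\<forall>b. \<forall>P\<in>Isig T. x b (rep P) 0 = ue T b (Some P)) \<and>
     (\<exists>V. algebra_grading T V \<and>
        (\<forall>b. \<forall>i\<in>nodes T. \<forall>m. x b i m \<in> V m) \<and>
        (\<forall>i\<in>nodes T. \<forall>r. r \<noteq> 0 \<longrightarrow> h i r \<in> V r) \<and>
        (\<forall>b. \<forall>i\<in>nodes T. kn T b i \<in> V 0) \<and>
        (\<forall>b. ue T b None \<in> V (sgi b))) \<and>
     (\<forall>i\<in>nodes T. \<forall>r\<ge>0. x Pos i r \<in> borel T \<and> phi T h Pos i r \<in> borel T) \<and>
     (\<forall>b. \<forall>i\<in>nodes T. \<forall>m. x b (aut T i) m = usmult T (omega T powi m) (x b i m)) \<and>
     (\<forall>i\<in>nodes T. \<forall>r. r \<noteq> 0 \<longrightarrow> h (aut T i) r = usmult T (omega T powi r) (h i r)) \<and>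
     (\<forall>i\<in>nodes T. \<forall>j\<in>nodes T. \<forall>r s. r \<noteq> 0 \<and> s \<noteq> 0 \<longrightarrow> ucomm T (h i r) (h j s) = \<zero>\<^bsub>Uq T\<^esub>) \<and>
     (\<forall>b. \<forall>i\<in>nodes T. \<forall>j\<in>nodes T. \<forall>r. r \<noteq> 0 \<longrightarrow> ucomm T (kn T b i) (h j r) = \<zero>\<^bsub>Uq T\<^esub>) \<and>
     (\<forall>b. \<forall>i\<in>nodes T. \<forall>j\<in>nodes T. \<forall>m.
        kn T Pos i \<otimes>\<^bsub>Uq T\<^esub> x b j m =
          usmult T (qpar T powi (sgi b * csum T i j)) (x b j m \<otimes>\<^bsub>Uq T\<^esub> kn T Pos i)) \<and>
     (\<forall>b. \<forall>i\<in>nodes T. \<forall>j\<in>nodes T. \<forall>s l. s \<noteq> 0 \<longrightarrow>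
        ucomm T (h i s) (x b j l) = usmult T (of_int (sgi b) * h_coeff T i j s) (x b j (s + l))) \<and>
     (\<forall>i\<in>nodes T. \<forall>j\<in>nodes T. \<forall>s l.
        ucomm T (x Pos i s) (x Neg j l) =
          usmult T (x_coeff T i j l) (phi T h Pos i (s + l) \<ominus>\<^bsub>Uq T\<^esub> phi T h Neg i (s + l)))"


section \<open>Modules over the Borel subalgebra\<close>

text \<open>A module is a complex vector space, given by its scalar multiplication \<open>sc\<close> on a type \<open>'v\<close>,
  with an action \<open>act a\<close> for \<open>a \<in> borel T\<close>.\<close>

definition borel_module ::
    "twisted_datum \<Rightarrow> (complex \<Rightarrow> 'v \<Rightarrow> 'v::ab_group_add) \<Rightarrow> (uq \<Rightarrow> 'v \<Rightarrow> 'v) \<Rightarrow> bool" where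
  "borel_module T sc act \<longleftrightarrow>
     vector_space sc \<and>
     (\<forall>a\<in>borel T. Vector_Spaces.linear sc sc (act a)) \<and>
     (\<forall>a\<in>borel T. \<forall>b\<in>borel T. \<forall>w. act (a \<oplus>\<^bsub>Uq T\<^esub> b) w = act a w + act b w) \<and>
     (\<forall>a\<in>borel T. \<forall>b\<in>borel T. \<forall>w. act (a \<otimes>\<^bsub>Uq T\<^esub> b) w = act a (act b w)) \<and>
     (\<forall>c w. act (uscal T c) w = sc c w)"

definition simple_borel_module ::
    "twisted_datum \<Rightarrow> (complex \<Rightarrow> 'v \<Rightarrow> 'v::ab_group_add) \<Rightarrow> (uq \<Rightarrow> 'v \<Rightarrow> 'v) \<Rightarrow> bool" where
  "simple_borel_module T sc act \<longleftrightarrow>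
     borel_module T sc act \<and> (\<exists>w::'v. w \<noteq> 0) \<and>
     (\<forall>W. module.subspace sc W \<and> (\<forall>a\<in>borel T. act a ` W \<subseteq> W) \<longrightarrow> W = {0} \<or> W = UNIV)"

definition is_L ::
    "twisted_datum \<Rightarrow> (sign \<Rightarrow> nat \<Rightarrow> int \<Rightarrow> uq) \<Rightarrow> (nat \<Rightarrow> int \<Rightarrow> uq) \<Rightarrow>
     (nat \<Rightarrow> complex fps) \<Rightarrow> (complex \<Rightarrow> 'v \<Rightarrow> 'v::ab_group_add) \<Rightarrow> (uq \<Rightarrow> 'v \<Rightarrow> 'v) \<Rightarrow> bool" where
  "is_L T x h \<gamma> sc act \<longleftrightarrow>
     simple_borel_module T sc act \<and>
     (\<exists>v. (\<forall>w. \<exists>a\<in>borel T. w = act a v) \<and>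
        (\<forall>i\<in>nodes T. \<forall>r\<ge>0. act (x Pos i r) v = 0) \<and>
        (\<forall>i\<in>nodes T. \<forall>r::nat. act (phi T h Pos i (int r)) v = sc (fps_nth (\<gamma> i) r) v))"

text \<open>The positive prefundamental loop weight; the exponent \<open>k\<close> of \<open>\<omega>\<close> is read off from
  \<open>j = \<sigma>\<^sup>k(i)\<close>, \<open>i\<close> the representative of the orbit \<open>P\<close>.\<close>

definition gamma_plus :: "twisted_datum \<Rightarrow> nat set \<Rightarrow> nat \<Rightarrow> complex fps" where
  "gamma_plus T P j =
     (if j \<in> P then
        if aut T (rep P) = rep P then 1 - fps_X ^ aord T
        else 1 - fps_const (omega T ^ (LEAST k. sig T k (rep P) = j)) * fps_X
      else 1)"


section \<open>Category O\<close>

definition torus_character :: "twisted_datum \<Rightarrow> (uq \<Rightarrow> complex) \<Rightarrow> bool" where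
  "torus_character T \<chi> \<longleftrightarrow>
     (\<forall>a\<in>torus T. \<forall>b\<in>torus T. \<chi> (a \<oplus>\<^bsub>Uq T\<^esub> b) = \<chi> a + \<chi> b \<and> \<chi> (a \<otimes>\<^bsub>Uq T\<^esub> b) = \<chi> a * \<chi> b) \<and>
     (\<forall>c. \<chi> (uscal T c) = c)"

text \<open>The group law on characters is multiplication of their values at the \<open>k\<close>'s, by which they
  are determined; so \<open>\<nu> - \<mu> = \<Sum> n\<^sub>P \<alpha>\<^sub>P\<close> reads as below, with
  \<open>\<alpha>\<^sub>P(k\<^sub>Q)\<close> equal to \<open>q\<^sub>P\<close> to the power \<open>C\<^sup>\<sigma>(P, Q)\<close>.\<close>

definition weight_le :: "twisted_datum \<Rightarrow> (uq \<Rightarrow> complex) \<Rightarrow> (uq \<Rightarrow> complex) \<Rightarrow> bool" where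
  "weight_le T \<mu> \<nu> \<longleftrightarrow>
     (\<exists>n :: nat set \<Rightarrow> nat. \<forall>Q\<in>Isig T.
        \<nu> (kk T Pos (Some Q)) = \<mu> (kk T Pos (Some Q)) *
          (\<Prod>P\<in>Isig T. (qi T (Some P) powi csig T (Some P) (Some Q)) ^ n P))"

definition Dcone :: "twisted_datum \<Rightarrow> (uq \<Rightarrow> complex) \<Rightarrow> (uq \<Rightarrow> complex) set" where
  "Dcone T \<nu> = {\<mu>. torus_character T \<mu> \<and> weight_le T \<mu> \<nu>}"

definition weight_space ::
    "twisted_datum \<Rightarrow> (complex \<Rightarrow> 'v \<Rightarrow> 'v) \<Rightarrow> (uq \<Rightarrow> 'v \<Rightarrow> 'v) \<Rightarrow> (uq \<Rightarrow> complex) \<Rightarrow> 'v set" where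
  "weight_space T sc act \<chi> = {w. \<forall>a\<in>torus T. act a w = sc (\<chi> a) w}"

definition in_category_O ::
    "twisted_datum \<Rightarrow> (complex \<Rightarrow> 'v \<Rightarrow> 'v::ab_group_add) \<Rightarrow> (uq \<Rightarrow> 'v \<Rightarrow> 'v) \<Rightarrow> bool" where
  "in_category_O T sc act \<longleftrightarrow>
     borel_module T sc act \<and>
     module.span sc (\<Union>\<chi>\<in>{\<chi>. torus_character T \<chi>}. weight_space T sc act \<chi>) = UNIV \<and>
     (\<forall>\<chi>. torus_character T \<chi> \<longrightarrow>
        (\<exists>B. finite B \<and> weight_space T sc act \<chi> \<subseteq> module.span sc B)) \<and>
     (\<exists>S. finite S \<and> (\<forall>\<nu>\<in>S. torus_character T \<nu>) \<and>
        (\<forall>\<chi>. torus_character T \<chi> \<and> weight_space T sc act \<chi> \<noteq> {0} \<longrightarrow> \<chi> \<in> (\<Union>\<nu>\<in>S. Dcone T \<nu>)))"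

end

theory Submission
  imports Defs
begin

text \<open>Write \<open>B\<close> for the Borel subalgebra. Inducing \<open>B\<close>-modules freely along the lowering generators
  \<open>f\<^sub>x\<close> yields linear functionals on the whole algebra \<open>U\<close>. They show that \<open>B\<close> meets the right ideal
  generated by the \<open>f\<^sub>x\<close> trivially, and that \<open>b f\<^sub>j = f\<^sub>j \<tau>\<^sub>j(b) + D\<^sub>j(b)\<close> for a twist \<open>\<tau>\<^sub>j\<close> and a skew
  derivation \<open>D\<^sub>j\<close> of \<open>B\<close>. Hence the elements of \<open>B\<close> in the left ideal \<open>J\<close> of \<open>U\<close> generated by the
  \<open>x\<^sup>+\<^bsub>i,r\<^esub>\<close> and \<open>\<phi>\<^sup>+\<^bsub>i,r\<^esub> - \<gamma>\<^bsub>i,r\<^esub>\<close>, \<open>r \<ge> 0\<close>, annihilate the highest weight vector \<open>v\<close>.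

  The iterated skew derivatives of the \<open>h\<^bsub>i,1\<^esub>\<close> by the \<open>f\<^sub>j\<close>, \<open>j \<noteq> \<epsilon>\<close>, lie in the subalgebra \<open>U'\<close> generated
  by the \<open>x\<^sup>\<plusminus>\<^bsub>i,r\<^esub>\<close> and \<open>\<phi>\<^sup>+\<^bsub>i,r\<^esub>\<close> with \<open>r \<ge> 0\<close> and the inverses of the \<open>k\<^sub>i\<close>. If none of them had the
  weight of \<open>e\<^sub>\<epsilon>\<close>, there would be a right ideal that contains all Drinfeld generators modulo scalars, but
  not \<open>e\<^sub>\<epsilon>\<close>. Therefore \<open>e\<^sub>\<epsilon> \<in> U'\<close> and \<open>B \<subseteq> U'\<close>.

  Modulo \<open>J\<close> the algebra \<open>U'\<close> is spanned by monomials in the \<open>x\<^sup>-\<^bsub>i,r\<^esub>\<close>, \<open>r \<ge> 0\<close>. As the \<open>\<gamma>\<^sub>i\<close> are polynomials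
  of degree at most \<open>M\<close>, those monomials that have a suffix of some length \<open>n\<close> with modes summing to more
  than \<open>M n\<close> span, together with \<open>J\<close>, a left \<open>U'\<close>-module; since \<open>L(\<gamma>)\<close> is simple, the elements of \<open>B\<close> in it
  annihilate \<open>v\<close>. Only finitely many of the other monomials have a given weight.\<close>

section \<open>Complex algebras\<close>

text \<open>\<open>L(gamma)\<close> is a module over B only: the \<open>x^-\<close> do not act on
  it. The monomials of the last step therefore live in U, and every conclusion about them has to be
  carried back to B. Modulo the right ideal of the f's, an element of B in J is congruent to an
  element of B that kills v; since B meets that right ideal trivially, the two are equal.

  The hypotheses on the Drinfeld generators contain no formula for the affine generator, hence the
  indirect proof that it lies in U'. The obstacle there is that
  \<open>D_j(b) = b f_j - f_j tau_j(b)\<close> is visibly in U' only if \<open>tau_j(b)\<close> is.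
  For \<open>h_{i,1}\<close> with \<open>\<sigma> i \<noteq> i\<close> it is shown that every twist
  fixes it and that one of the two halves of \<open>D_j\<close>, the one producing
  \<open>k_j^{-1}\<close>, annihilates it. Iterated derivatives inherit the second property and
  become eigenvectors of the twists, so that on them \<open>D_j\<close> is a q-commutator with
  \<open>f_j\<close>. The input is that a certain component of \<open>h_{i,1}\<close> would be an
  impossible highest weight vector for \<open>sl_2\<close>.

  The bound M per factor is the exact loss of modes that the removal of one factor can
  cause.\<close>

class cvec = ab_group_add +
  fixes csc :: "complex \<Rightarrow> 'a \<Rightarrow> 'a" (infixr "\<star>" 75)
  assumes csc_add_right: "a \<star> (u + v) = a \<star> u + a \<star> v"
    and csc_add_left: "(a + b) \<star> u = a \<star> u + b \<star> u"
    and csc_csc: "a \<star> b \<star> u = (a * b) \<star> u"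
    and csc_one: "1 \<star> u = u"

text \<open>The class \<open>ring_1\<close> would include \<open>0 \<noteq> 1\<close>, which is not
  known for an algebra given by a presentation and fails for the endomorphisms of the zero
  space.\<close>

class calg = ring + monoid_mult + cvec +
  assumes csc_mult_left: "(a \<star> u) * v = a \<star> (u * v)"
    and csc_mult_right: "u * (a \<star> v) = a \<star> (u * v)"

interpretation cvec: vector_space "csc :: complex \<Rightarrow> 'a \<Rightarrow> 'a::cvec"
  by standard (auto simp: csc_add_right csc_add_left csc_csc csc_one)

lemma csc_zero [simp]: "0 \<star> u = (0::'a::cvec)" "a \<star> (0::'a::cvec) = 0"
  by simp_all

lemma csc_minus: "a \<star> (- u) = - (a \<star> (u::'a::cvec))" "(- a) \<star> u = - (a \<star> u)"
  by simp_all

lemma csc_diff: "a \<star> (u - v) = a \<star> u - a \<star> (v::'a::cvec)" "(a - b) \<star> u = a \<star> u - b \<star> u"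
  by (simp_all add: cvec.scale_right_diff_distrib cvec.scale_left_diff_distrib)

lemma csc_sum: "a \<star> (\<Sum>i\<in>I. u i) = (\<Sum>i\<in>I. a \<star> (u i :: 'a::cvec))"
  by (rule cvec.scale_sum_right)

lemmas csc_norm = csc_add_right csc_minus csc_diff(1) csc_csc csc_one

lemmas calg_norm = csc_norm csc_mult_left csc_mult_right ring_distribs mult.assoc

lemma csc_cancel: "a \<noteq> 0 \<Longrightarrow> a \<star> u = a \<star> v \<longleftrightarrow> u = (v::'a::cvec)"
  by simp

lemma csc_eq_0: "a \<star> u = 0 \<longleftrightarrow> a = 0 \<or> u = (0::'a::cvec)"
  by simp

instantiation complex :: calg
begin
definition "csc_complex (a::complex) (b::complex) = a * b"
instance by standard (auto simp: csc_complex_def algebra_simps)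
end

section \<open>Quantum integers\<close>

lemma qint_nonzero:
  assumes "\<forall>n>0. q ^ n \<noteq> 1" "q \<noteq> 0" "0 < m"
  shows "qint q m \<noteq> 0"
proof -
  have "q ^ m - inverse q ^ m \<noteq> 0"
  proof
    assume "q ^ m - inverse q ^ m = 0"
    then have "q ^ m * q ^ m = q ^ m * inverse (q ^ m)" by (simp add: power_inverse)
    then have "q ^ m * q ^ m = 1" using assms(2) by simp
    then have "q ^ (m + m) = 1" by (simp add: power_add)
    then show False using assms(1,3) by (metis add_pos_pos)
  qed
  moreover have "q - inverse q \<noteq> 0"
  proof
    assume "q - inverse q = 0"
    then have "q ^ 2 = 1" using assms(2) by (simp add: power2_eq_square field_simps)
    then show False using assms(1) by (metis zero_less_numeral)
  qed
  ultimately show ?thesis by (simp add: qint_def)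
qed

lemma qfact_Suc: "qfact q (Suc m) = qint q (Suc m) * qfact q m"
  by (simp add: qfact_def)

lemma qfact_nonzero:
  assumes "\<forall>n>0. q ^ n \<noteq> 1" "q \<noteq> 0"
  shows "qfact q m \<noteq> 0"
  using qint_nonzero[OF assms] by (simp add: qfact_def)

lemma qbinom_0 [simp]:
  assumes "\<forall>n>0. q ^ n \<noteq> 1" "q \<noteq> 0"
  shows "qbinom q m 0 = 1" "qbinom q m m = 1"
  using qfact_nonzero[OF assms] by (auto simp: qbinom_def) (simp_all add: qfact_def)

lemma qint_split:
  assumes "q \<noteq> 0" "r \<le> n"
  shows "qint q n = inverse q ^ r * qint q (n - r) + q ^ (n - r) * qint q r"
proof -
  obtain m where n: "n = m + r" using assms(2) by (metis add.commute le_Suc_ex)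
  show ?thesis
    using assms(1) unfolding n qint_def
    by (simp add: power_add add_divide_distrib[symmetric] right_diff_distrib)
qed

text \<open>The bound \<open>r < m\<close> matters: because of truncated subtraction
  \<open>qbinom q m (Suc m)\<close> is not zero, so the top coefficient has to be treated
  apart.\<close>

lemma qbinom_pascal:
  assumes q: "\<forall>n>0. q ^ n \<noteq> 1" "q \<noteq> 0" and r: "r < m"
  shows "qbinom q (Suc m) (Suc r) =
    inverse q ^ Suc r * qbinom q m (Suc r) + q ^ (m - r) * qbinom q m r"
proof -
  obtain d where m: "m = Suc (d + r)" using r by (metis add.commute less_iff_Suc_add add_Suc_right)
  note nz = qfact_nonzero[OF q] qint_nonzero[OF q]
  have s: "qint q (Suc m) = inverse q ^ Suc r * qint q (Suc d) + q ^ (Suc d) * qint q (Suc r)"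
    using qint_split[OF q(2), of "Suc r" "Suc m"] by (simp add: m)
  have "qbinom q (Suc m) (Suc r) = qint q (Suc m) * (qfact q m / (qfact q (Suc r) * qfact q (Suc d)))"
    by (simp add: qbinom_def qfact_Suc m)
  also have "\<dots> = inverse q ^ Suc r * (qint q (Suc d) * (qfact q m / (qfact q (Suc r) * qfact q (Suc d))))
      + q ^ Suc d * (qint q (Suc r) * (qfact q m / (qfact q (Suc r) * qfact q (Suc d))))"
    unfolding s by (simp add: algebra_simps)
  also have "qint q (Suc d) * (qfact q m / (qfact q (Suc r) * qfact q (Suc d))) = qbinom q m (Suc r)"
    using nz by (simp add: qbinom_def m qfact_Suc[of q d])
  also have "qint q (Suc r) * (qfact q m / (qfact q (Suc r) * qfact q (Suc d))) = qbinom q m r"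
    using nz by (simp add: qbinom_def m qfact_Suc[of q r])
  finally show ?thesis by (simp add: m)
qed

section \<open>Quantum Serre elements\<close>

text \<open>Iterated q-commutator of \<open>e\<close> with \<open>y\<close>. If k commutes past
  \<open>e\<close> with factor \<open>q ^ 2\<close> and past \<open>y\<close> with factor
  \<open>p\<close>, then \<open>p * q ^ (2 * m)\<close> is the factor for the m-th iterate.\<close>

primrec sX :: "complex \<Rightarrow> complex \<Rightarrow> 'a::calg \<Rightarrow> 'a \<Rightarrow> nat \<Rightarrow> 'a" where
  "sX q p e y 0 = y"
| "sX q p e y (Suc m) = e * sX q p e y m - (p * q ^ (2 * m)) \<star> (sX q p e y m * e)"

definition serre :: "complex \<Rightarrow> nat \<Rightarrow> 'a::calg \<Rightarrow> 'a \<Rightarrow> 'a" where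
  "serre q N e y = (\<Sum>r\<le>N. ((- 1) ^ r * qbinom q N r) \<star> (e ^ (N - r) * y * e ^ r))"

text \<open>The extra base \<open>p * q ^ m / q\<close> equals 1 exactly when m is the Serre
  exponent, so the Serre element is an iterated q-commutator. Commutators with f are then computed
  by recursion on m.\<close>

lemma sX_expand:
  fixes e y :: "'a::calg"
  assumes q: "\<forall>n>0. q ^ n \<noteq> 1" "q \<noteq> 0"
  shows "sX q p e y m =
    (\<Sum>r\<le>m. ((- 1) ^ r * (p * q ^ m / q) ^ r * qbinom q m r) \<star> (e ^ (m - r) * y * e ^ r))"
proof (induction m)
  case 0
  then show ?case using q by (simp add: csc_one)
next
  case (Suc m)
  let ?t = "\<lambda>r. e ^ (Suc m - r) * y * e ^ r"
  let ?a = "\<lambda>m r. (- 1) ^ r * (p * q ^ m / q) ^ r * qbinom q m r"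
  have 1: "e * sX q p e y m = (\<Sum>r\<le>m. ?a m r \<star> ?t r)"
    unfolding Suc sum_distrib_left
    by (intro sum.cong) (auto simp: csc_mult_right mult.assoc[symmetric] Suc_diff_le)
  have 2: "(p * q ^ (2 * m)) \<star> (sX q p e y m * e) = (\<Sum>r\<le>m. (p * q ^ (2 * m) * ?a m r) \<star> ?t (Suc r))"
    unfolding Suc sum_distrib_right csc_sum
    by (intro sum.cong) (auto simp: csc_mult_left csc_csc mult.assoc power_commutes)
  define A where "A = p * q ^ m / q"
  have A': "p * q ^ Suc m / q = A * q" using q(2) by (simp add: A_def)
  have Aq: "A * q ^ Suc m = p * q ^ (2 * m)" using q(2) by (simp add: A_def mult_2 power_add)
  \<comment> \<open>Coefficient of the r-th shifted term; after the powers of q are collected this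
    is the q-Pascal rule.\<close>
  have key: "?a m (Suc r) - p * q ^ (2 * m) * ?a m r = ?a (Suc m) (Suc r)" if r: "r < m" for r
  proof -
    have 1: "q ^ Suc r * inverse q ^ Suc r = 1"
      using q(2) by (simp only: power_mult_distrib[symmetric]) simp
    have i: "(A * q) ^ Suc r * inverse q ^ Suc r = A ^ Suc r"
      by (simp only: 1 power_mult_distrib mult.assoc mult_1_right)
    have ii: "(A * q) ^ Suc r * q ^ (m - r) = p * q ^ (2 * m) * A ^ r"
    proof -
      have "q ^ Suc r * q ^ (m - r) = q ^ Suc m"
        using r by (simp add: power_add[symmetric] del: power_Suc)
      then have "(A * q) ^ Suc r * q ^ (m - r) = A ^ Suc r * q ^ Suc m"
        by (simp only: power_mult_distrib mult.assoc)
      also have "\<dots> = A ^ r * (A * q ^ Suc m)"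
        by (simp only: power_Suc2 mult.assoc)
      finally show ?thesis unfolding Aq by (simp only: mult.commute)
    qed
    have "(A * q) ^ Suc r * qbinom q (Suc m) (Suc r) =
        ((A * q) ^ Suc r * inverse q ^ Suc r) * qbinom q m (Suc r)
        + ((A * q) ^ Suc r * q ^ (m - r)) * qbinom q m r"
      unfolding qbinom_pascal[OF q r] by (simp only: distrib_left mult.assoc)
    then have "(A * q) ^ Suc r * qbinom q (Suc m) (Suc r) =
        A ^ Suc r * qbinom q m (Suc r) + p * q ^ (2 * m) * A ^ r * qbinom q m r"
      unfolding i ii .
    then have "(- 1) ^ Suc r * ((A * q) ^ Suc r * qbinom q (Suc m) (Suc r)) =
        (- 1) ^ Suc r * (A ^ Suc r * qbinom q m (Suc r)) + (- 1) ^ Suc r * (p * q ^ (2 * m) * A ^ r * qbinom q m r)"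
      by (simp only: distrib_left)
    then show ?thesis
      unfolding A' A_def[symmetric] by (simp only: mult.assoc) (simp add: mult.left_commute)
  qed
  have top: "- (p * q ^ (2 * m) * ?a m m) = ?a (Suc m) (Suc m)"
  proof -
    have "(A * q) ^ Suc m = A ^ m * (A * q ^ Suc m)"
      by (simp only: power_mult_distrib) (simp add: mult.assoc mult.left_commute)
    then show ?thesis using q unfolding A' A_def[symmetric] by (simp add: Aq del: power_Suc) (simp add: mult_ac)
  qed
  have regroup: "a + s - (s' + u) = a + s'' + v" if "s - s' = s''" "- u = v" for a s s' s'' u v :: 'a
    using that by (auto simp: algebra_simps)
  have "sX q p e y (Suc m) = (\<Sum>r\<le>m. ?a m r \<star> ?t r) - (\<Sum>r\<le>m. (p * q ^ (2 * m) * ?a m r) \<star> ?t (Suc r))"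
    by (simp only: sX.simps 1 2)
  also have "\<dots> = ?a m 0 \<star> ?t 0 + (\<Sum>r<m. ?a m (Suc r) \<star> ?t (Suc r))
     - ((\<Sum>r<m. (p * q ^ (2 * m) * ?a m r) \<star> ?t (Suc r)) + (p * q ^ (2 * m) * ?a m m) \<star> ?t (Suc m))"
  proof -
    have "(\<Sum>r\<le>m. ?a m r \<star> ?t r) = ?a m 0 \<star> ?t 0 + (\<Sum>r<m. ?a m (Suc r) \<star> ?t (Suc r))"
      by (rule sum.atMost_shift)
    moreover have "(\<Sum>r\<le>m. (p * q ^ (2 * m) * ?a m r) \<star> ?t (Suc r)) =
       (\<Sum>r<m. (p * q ^ (2 * m) * ?a m r) \<star> ?t (Suc r)) + (p * q ^ (2 * m) * ?a m m) \<star> ?t (Suc m)"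
      by (simp add: lessThan_Suc_atMost[symmetric])
    ultimately show ?thesis by (simp only:)
  qed
  also have "\<dots> = ?a m 0 \<star> ?t 0 + (\<Sum>r<m. ?a (Suc m) (Suc r) \<star> ?t (Suc r)) + ?a (Suc m) (Suc m) \<star> ?t (Suc m)"
  proof -
    have "(\<Sum>r<m. ?a m (Suc r) \<star> ?t (Suc r)) - (\<Sum>r<m. (p * q ^ (2 * m) * ?a m r) \<star> ?t (Suc r))
      = (\<Sum>r<m. ?a (Suc m) (Suc r) \<star> ?t (Suc r))"
      unfolding sum_subtractf[symmetric] csc_diff(2)[symmetric]
      by (intro sum.cong refl) (simp only: key lessThan_iff)
    moreover have "- ((p * q ^ (2 * m) * ?a m m) \<star> ?t (Suc m)) = ?a (Suc m) (Suc m) \<star> ?t (Suc m)"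
      unfolding csc_minus(2)[symmetric] top ..
    ultimately show ?thesis by (rule regroup)
  qed
  also have "?a m 0 = ?a (Suc m) 0" using q by simp
  also have "?a (Suc m) 0 \<star> ?t 0 + (\<Sum>r<m. ?a (Suc m) (Suc r) \<star> ?t (Suc r)) + ?a (Suc m) (Suc m) \<star> ?t (Suc m)
     = (\<Sum>r\<le>Suc m. ?a (Suc m) r \<star> ?t r)"
    using sum.atMost_shift[of "\<lambda>r. ?a (Suc m) r \<star> ?t r" "Suc m"] by (simp only: lessThan_Suc_atMost[symmetric] sum.lessThan_Suc add.assoc)
  finally show ?case .
qed

lemma serre_eq_sX:
  assumes q: "\<forall>n>0. q ^ n \<noteq> 1" "q \<noteq> 0" and N: "p * q ^ N = q"
  shows "serre q N e y = sX q p e y N"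
proof -
  have "p * q ^ N / q = 1" using N q(2) by simp
  then show ?thesis by (simp add: sX_expand[OF q] serre_def)
qed

lemma sX_weight:
  assumes "k * e = a \<star> (e * k)" "k * y = b \<star> (y * k)"
  shows "k * sX q p e y m = (a ^ m * b) \<star> (sX q p e y m * k)"
proof (induction m)
  case (Suc m)
  let ?x = "sX q p e y m"
  have "k * (e * ?x) = (k * e) * ?x" by (simp only: mult.assoc)
  also have "\<dots> = a \<star> (e * (k * ?x))" by (simp only: assms csc_mult_left mult.assoc)
  also have "\<dots> = (a ^ Suc m * b) \<star> (e * ?x * k)"
    by (simp only: Suc csc_mult_right csc_csc mult.assoc power_Suc)
  finally have 1: "k * (e * ?x) = (a ^ Suc m * b) \<star> (e * ?x * k)" .
  have "k * (?x * e) = (k * ?x) * e" by (simp only: mult.assoc)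
  also have "\<dots> = (a ^ m * b) \<star> (?x * (k * e))" by (simp only: Suc csc_mult_left mult.assoc)
  also have "\<dots> = (a ^ Suc m * b) \<star> (?x * e * k)"
    by (simp only: assms(1) csc_mult_right csc_csc mult.assoc power_Suc mult.commute mult.left_commute)
  finally have 2: "k * (?x * e) = (a ^ Suc m * b) \<star> (?x * e * k)" .
  show ?case
    by (simp only: sX.simps right_diff_distrib left_diff_distrib csc_mult_left csc_mult_right 1 2 csc_diff csc_csc mult.commute)
qed (use assms in auto)

text \<open>The twist P of the q-commutator is the weight of the current iterate under k, so the
  terms with k cancel and only \<open>k'\<close> survives, with one summand
  \<open>P - inverse P\<close> per step.\<close>

lemma sX_commutator_same:
  fixes e y f k k' :: "'a::calg"
  assumes ef: "e * f = f * e + c \<star> (k - k')" and yf: "y * f = f * y"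
    and ke: "k * e = (q ^ 2) \<star> (e * k)" and k'e: "k' * e = (inverse (q ^ 2)) \<star> (e * k')"
    and ky: "k * y = p \<star> (y * k)" and k'y: "k' * y = inverse p \<star> (y * k')"
    and q0: "q \<noteq> 0"
  shows "sX q p e y (Suc m) * f = f * sX q p e y (Suc m)
     + (\<Sum>t\<le>m. c * (p * q ^ (2 * t) - inverse (p * q ^ (2 * t)))) \<star> (sX q p e y m * k')"
proof (induction m)
  case 0
  have e1: "e * (y * f) = f * (e * y) + (c * p) \<star> (y * k) - (c * inverse p) \<star> (y * k')"
  proof -
    have "e * (y * f) = (e * f) * y" by (simp add: yf mult.assoc)
    then show ?thesis by (simp add: ef calg_norm ky k'y)
  qed
  have e2: "y * (e * f) = f * (y * e) + c \<star> (y * k) - c \<star> (y * k')"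
  proof -
    have "y * (e * f) = (y * f) * e + c \<star> (y * (k - k'))" by (simp add: ef calg_norm)
    then show ?thesis by (simp add: yf calg_norm)
  qed
  show ?case
    by (simp add: calg_norm e1 e2 csc_add_left csc_diff mult.commute)
next
  case (Suc m)
  define x where "x = sX q p e y (Suc m)"
  define x0 where "x0 = sX q p e y m"
  define g where "g = (\<Sum>t\<le>m. c * (p * q ^ (2 * t) - inverse (p * q ^ (2 * t))))"
  define P where "P = p * q ^ (2 * Suc m)"
  define R where "R = p * q ^ (2 * m)"
  have xf: "x * f = f * x + g \<star> (x0 * k')" using Suc by (simp add: x_def x0_def g_def)
  have x: "x = e * x0 - R \<star> (x0 * e)" by (simp add: x_def x0_def R_def)
  have x': "sX q p e y (Suc (Suc m)) = e * x - P \<star> (x * e)" by (simp add: x_def P_def)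
  have kx: "k * x = P \<star> (x * k)"
    unfolding x_def P_def using sX_weight[OF ke ky, of q p "Suc m"]
    by (simp only: power_mult[symmetric] mult.commute)
  have k'x: "k' * x = inverse P \<star> (x * k')"
    unfolding x_def P_def using sX_weight[OF k'e k'y, of q p "Suc m"]
    by (simp only: power_mult[symmetric] mult.commute power_inverse inverse_mult_distrib)
  have Pq: "P * inverse (q ^ 2) = R" using q0 by (simp add: P_def R_def field_simps power2_eq_square)
  have e1: "e * (x * f) = f * (e * x) + (c * P) \<star> (x * k) - (c * inverse P) \<star> (x * k') + g \<star> (e * (x0 * k'))"
  proof -
    have "e * (x * f) = (e * f) * x + g \<star> (e * (x0 * k'))" by (simp add: xf calg_norm)
    then show ?thesis by (simp add: ef calg_norm kx k'x)
  qed
  have e2: "x * (e * f) = f * (x * e) + (g * inverse (q ^ 2)) \<star> (x0 * (e * k')) + c \<star> (x * k) - c \<star> (x * k')"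
  proof -
    have "x * (e * f) = (x * f) * e + c \<star> (x * (k - k'))" by (simp add: ef calg_norm)
    then show ?thesis by (simp add: xf k'e calg_norm)
  qed
  have xk': "g \<star> (x * k') = g \<star> (e * (x0 * k')) - (P * (g * inverse (q ^ 2))) \<star> (x0 * (e * k'))"
    using Pq by (simp add: x calg_norm mult.left_commute mult.commute)
  have "sX q p e y (Suc (Suc m)) * f = e * (x * f) - P \<star> (x * (e * f))"
    by (simp only: x' left_diff_distrib csc_mult_left mult.assoc)
  also have "\<dots> = f * (e * x - P \<star> (x * e)) + (c * (P - inverse P)) \<star> (x * k') + g \<star> (x * k')"
    unfolding e1 e2 xk'
    by (simp add: calg_norm csc_add_left csc_diff(2) right_diff_distrib mult.commute)
  finally show ?case
    by (simp only: x' x_def[symmetric] P_def[symmetric] sum.atMost_Suc g_def[symmetric] csc_add_left)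
      (simp add: algebra_simps)
qed

text \<open>Here f pairs with \<open>y\<close>, so every step multiplies the terms in k and
  \<open>k'\<close> by a scalar each. The two products are kept apart because at the Serre exponent
  they vanish for different reasons.\<close>

lemma sX_commutator_other:
  fixes e y f k k' :: "'a::calg"
  assumes yf: "y * f = f * y + c \<star> (k - k')" and ef: "e * f = f * e"
    and ke: "k * e = p \<star> (e * k)" and k'e: "k' * e = inverse p \<star> (e * k')"
  shows "sX q p e y m * f = f * sX q p e y m + c \<star> e ^ m *
     ((\<Prod>t<m. 1 - p * p * q ^ (2 * t)) \<star> k - (\<Prod>t<m. 1 - p * inverse p * q ^ (2 * t)) \<star> k')"
proof (induction m)
  case 0
  then show ?case by (simp add: yf csc_mult_left)
next
  case (Suc m)
  define x where "x = sX q p e y m"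
  define a where "a = (\<Prod>t<m. 1 - p * p * q ^ (2 * t))"
  define b where "b = (\<Prod>t<m. 1 - p * inverse p * q ^ (2 * t))"
  have xf: "x * f = f * x + c \<star> e ^ m * (a \<star> k - b \<star> k')" using Suc by (simp add: x_def a_def b_def)
  have 1: "e * x * f = f * e * x + c \<star> e ^ Suc m * (a \<star> k - b \<star> k')"
    by (simp add: mult.assoc xf calg_norm) (simp add: mult.assoc[symmetric] ef)
  have 2: "x * e * f = f * x * e + c \<star> e ^ Suc m * ((p * a) \<star> k - (inverse p * b) \<star> k')"
  proof -
    have "x * e * f = x * f * e" by (simp add: mult.assoc ef)
    moreover have "(a \<star> k - b \<star> k') * e = e * ((p * a) \<star> k - (inverse p * b) \<star> k')"
      by (simp add: calg_norm ke k'e mult.commute)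
    ultimately show ?thesis
      by (simp add: xf distrib_right csc_mult_left csc_mult_right mult.assoc power_Suc2 del: power_Suc)
  qed
  have "sX q p e y (Suc m) * f = e * x * f - (p * q ^ (2 * m)) \<star> (x * e * f)"
    by (simp add: x_def calg_norm)
  also have "\<dots> = f * sX q p e y (Suc m) + c \<star> e ^ Suc m *
     ((a * (1 - p * p * q ^ (2 * m))) \<star> k - (b * (1 - p * inverse p * q ^ (2 * m))) \<star> k')"
    unfolding 1 2 by (simp add: calg_norm x_def[symmetric] csc_diff algebra_simps)
  finally show ?case by (simp add: a_def b_def)
qed

lemma serre_commutator_same:
  fixes e y f k k' :: "'a::calg"
  assumes q: "\<forall>n>0. q ^ n \<noteq> 1" "q \<noteq> 0" and N: "p * q ^ N = q" "0 < N"
    and ef: "e * f = f * e + c \<star> (k - k')" and yf: "y * f = f * y"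
    and ke: "k * e = (q ^ 2) \<star> (e * k)" and k'e: "k' * e = (inverse (q ^ 2)) \<star> (e * k')"
    and ky: "k * y = p \<star> (y * k)" and k'y: "k' * y = inverse p \<star> (y * k')"
  shows "serre q N e y * f = f * serre q N e y"
proof -
  obtain m where m: "N = Suc m" using N(2) by (cases N) auto
  have pm: "p * q ^ m = 1" using N(1) q(2) by (simp add: m)
  define t where "t i = p * q ^ (2 * i) - inverse (p * q ^ (2 * i))" for i
  \<comment> \<open>Since \<open>p * q ^ m = 1\<close>, the arguments belonging to \<open>i\<close>
    and \<open>m - i\<close> are inverse to each other; the sum is antisymmetric under this
    reflection and hence zero.\<close>
  have refl: "t (m - i) = - t i" if "i \<le> m" for i
  proof -
    have "(p * q ^ (2 * (m - i))) * (p * q ^ (2 * i)) = (p * q ^ m) * (p * q ^ m)"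
    proof -
      have "q ^ (2 * (m - i)) * q ^ (2 * i) = q ^ m * q ^ m"
        using that by (simp add: power_add[symmetric] mult_2[symmetric] diff_mult_distrib2)
      then show ?thesis by (metis mult.assoc mult.left_commute)
    qed
    then have "p * q ^ (2 * (m - i)) = inverse (p * q ^ (2 * i))"
      unfolding pm by (metis inverse_unique mult.commute mult_1)
    then show ?thesis by (simp add: t_def)
  qed
  have "(\<Sum>i\<le>m. t i) = (\<Sum>i\<le>m. t (m - i))"
    by (rule sum.reindex_bij_witness[of _ "\<lambda>i. m - i" "\<lambda>i. m - i"]) auto
  also have "\<dots> = - (\<Sum>i\<le>m. t i)" by (simp add: refl sum_negf)
  finally have "(\<Sum>i\<le>m. t i) = 0" by simp
  then have "(\<Sum>i\<le>m. c * (p * q ^ (2 * i) - inverse (p * q ^ (2 * i)))) = 0"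
    by (simp add: t_def sum_distrib_left[symmetric])
  then show ?thesis
    using sX_commutator_same[OF ef yf ke k'e ky k'y q(2), of m] serre_eq_sX[OF q N(1), of e y] by (simp add: m)
qed

text \<open>The k-product contains the factor with \<open>t = N - 1\<close>, where
  \<open>p * q ^ t = 1\<close>; the \<open>k'\<close>-product contains the factor with
  \<open>t = 0\<close>.\<close>

lemma serre_commutator_other:
  fixes e y f k k' :: "'a::calg"
  assumes q: "\<forall>n>0. q ^ n \<noteq> 1" "q \<noteq> 0" and N: "p * q ^ N = q" "0 < N"
    and yf: "y * f = f * y + c \<star> (k - k')" and ef: "e * f = f * e"
    and ke: "k * e = p \<star> (e * k)" and k'e: "k' * e = inverse p \<star> (e * k')"
  shows "serre q N e y * f = f * serre q N e y"
proof -
  obtain m where m: "N = Suc m" using N(2) by (cases N) auto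
  have pm: "p * q ^ m = 1" using N(1) q(2) by (simp add: m)
  then have p0: "p \<noteq> 0" by auto
  have "p * p * q ^ (2 * m) = (p * q ^ m) * (p * q ^ m)" by (simp add: mult_2 power_add)
  then have 1: "(\<Prod>t<N. 1 - p * p * q ^ (2 * t)) = 0" unfolding pm by (simp add: m)
  have 2: "(\<Prod>t<N. 1 - p * inverse p * q ^ (2 * t)) = 0"
    using p0 N(2) by (intro prod_zero) (auto intro!: bexI[of _ 0])
  have s: "serre q N e y = sX q p e y N" by (rule serre_eq_sX[OF q N(1)])
  show ?thesis
    using sX_commutator_other[OF yf ef ke k'e, of q N] unfolding 1 2 s by simp
qed

lemma serre_commutator_none:
  fixes e y f :: "'a::calg"
  assumes "e * f = f * e" "y * f = f * y"
  shows "serre q N e y * f = f * serre q N e y"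
proof -
  have p: "e ^ n * f = f * e ^ n" for n
    by (rule power_commuting_commutes) (simp add: assms)
  have "e ^ a * y * e ^ b * f = f * (e ^ a * y * e ^ b)" for a b
    by (metis assms(2) mult.assoc p)
  then show ?thesis
    by (simp add: serre_def sum_distrib_left sum_distrib_right csc_mult_left csc_mult_right)
qed

section \<open>Endomorphisms and induced modules\<close>

definition clin :: "('a::cvec \<Rightarrow> 'b::cvec) \<Rightarrow> bool" where
  "clin f \<longleftrightarrow> (\<forall>x y. f (x + y) = f x + f y) \<and> (\<forall>a x. f (a \<star> x) = a \<star> f x)"

lemma clinD:
  assumes "clin f"
  shows "f (x + y) = f x + f y" "f (a \<star> x) = a \<star> f x" "f 0 = 0" "f (- x) = - f x" "f (x - y) = f x - f y"
    "f (\<Sum>i\<in>I. g i) = (\<Sum>i\<in>I. f (g i))"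
proof -
  show a: "f (x + y) = f x + f y" and s: "f (a \<star> x) = a \<star> f x" for x y a
    using assms by (auto simp: clin_def)
  show z: "f 0 = 0" using s[of 0 0] by simp
  show m: "f (- x) = - f x" for x using s[of "- 1" x] by (simp add: csc_one)
  show "f (x - y) = f x - f y" using a[of x "- y"] by (simp add: m)
  show "f (\<Sum>i\<in>I. g i) = (\<Sum>i\<in>I. f (g i))"
    by (induction I rule: infinite_finite_induct) (auto simp: z a)
qed

lemma clinI: "(\<And>x y. f (x + y) = f x + f y) \<Longrightarrow> (\<And>a x. f (a \<star> x) = a \<star> f x) \<Longrightarrow> clin f"
  by (simp add: clin_def)

lemma clin_mult: "clin (\<lambda>v. u * v)" "clin (\<lambda>v. v * (u :: 'a::calg))"
  by (rule clinI; simp add: distrib_left distrib_right csc_mult_left csc_mult_right)+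

text \<open>Operators form a type of class \<open>calg\<close>, so that the identities for Serre
  elements apply to the operators on an induced module.\<close>

typedef (overloaded) 'a endo = "{f :: 'a::cvec \<Rightarrow> 'a. clin f}"
  morphisms app Endo
  by (rule exI[of _ "\<lambda>x. x"]) (simp add: clin_def)

setup_lifting type_definition_endo

lemma clin_app: "clin (app A)"
  using app[of A] by simp

lemmas app_lin = clinD[OF clin_app]

lemma app_Endo: "clin f \<Longrightarrow> app (Endo f) = f"
  by (simp add: Endo_inverse)

lemma endo_eqI: "(\<And>x. app A x = app B x) \<Longrightarrow> A = B"
  by (metis app_inject ext)

instantiation endo :: (cvec) calg
begin
lift_definition zero_endo :: "'a endo" is "\<lambda>x. 0" by (simp add: clin_def)
lift_definition one_endo :: "'a endo" is "\<lambda>x. x" by (simp add: clin_def)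
lift_definition plus_endo :: "'a endo \<Rightarrow> 'a endo \<Rightarrow> 'a endo" is "\<lambda>f g x. f x + g x"
  by (auto simp: clin_def csc_add_right algebra_simps)
lift_definition minus_endo :: "'a endo \<Rightarrow> 'a endo \<Rightarrow> 'a endo" is "\<lambda>f g x. f x - g x"
  by (auto simp: clin_def csc_diff algebra_simps)
lift_definition uminus_endo :: "'a endo \<Rightarrow> 'a endo" is "\<lambda>f x. - f x"
  by (auto simp: clin_def csc_minus algebra_simps)
lift_definition times_endo :: "'a endo \<Rightarrow> 'a endo \<Rightarrow> 'a endo" is "\<lambda>f g x. f (g x)"
  by (auto simp: clin_def)
lift_definition csc_endo :: "complex \<Rightarrow> 'a endo \<Rightarrow> 'a endo" is "\<lambda>a f x. a \<star> f x"
  by (auto simp: clin_def csc_add_right csc_csc mult.commute)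
instance
  by (standard; transfer)
    (auto simp: clinD csc_add_right csc_add_left csc_csc csc_one fun_eq_iff algebra_simps)
end

lemma app_simps [simp]:
  "app 0 x = 0" "app 1 x = x" "app (A + B) x = app A x + app B x"
  "app (A - B) x = app A x - app B x" "app (- A) x = - app A x"
  "app (A * B) x = app A (app B x)" "app (a \<star> A) x = a \<star> app A x"
  by (transfer, simp)+

lemma app_sum: "app (\<Sum>i\<in>I. A i) x = (\<Sum>i\<in>I. app (A i) x)"
  by (induction I rule: infinite_finite_induct) auto

instantiation poly_mapping :: (type, cvec) cvec
begin
lift_definition csc_poly_mapping :: "complex \<Rightarrow> ('a \<Rightarrow>\<^sub>0 'b) \<Rightarrow> 'a \<Rightarrow>\<^sub>0 'b" is "\<lambda>a f x. a \<star> f x"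
  by (erule finite_subset[rotated]) auto
instance
  by (standard; transfer) (auto simp: csc_add_right csc_add_left csc_csc csc_one)
end

lemma lookup_csc [simp]: "Poly_Mapping.lookup (a \<star> p) x = a \<star> Poly_Mapping.lookup p x"
  by transfer simp

lemma csc_single: "a \<star> Poly_Mapping.single w l = Poly_Mapping.single w (a \<star> l)"
  by (rule poly_mapping_eqI) (simp add: lookup_single when_def)

text \<open>Finitely supported maps to \<open>'l\<close> model the tensor product of the space with
  basis \<open>'w\<close> and \<open>'l\<close>; this is the linear extension from pure
  tensors.\<close>

definition lext :: "('w \<Rightarrow> 'l::cvec \<Rightarrow> 'm::cvec) \<Rightarrow> ('w \<Rightarrow>\<^sub>0 'l) \<Rightarrow> 'm" where
  "lext \<phi> p = (\<Sum>w\<in>Poly_Mapping.keys p. \<phi> w (Poly_Mapping.lookup p w))"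

lemma lext_superset:
  assumes "\<And>w. clin (\<phi> w)" "finite A" "Poly_Mapping.keys p \<subseteq> A"
  shows "lext \<phi> p = (\<Sum>w\<in>A. \<phi> w (Poly_Mapping.lookup p w))"
  unfolding lext_def using assms
  by (intro sum.mono_neutral_left) (auto simp: in_keys_iff clinD)

lemma lext_single: "(\<And>w. clin (\<phi> w)) \<Longrightarrow> lext \<phi> (Poly_Mapping.single w l) = \<phi> w l"
  by (subst lext_superset[where A = "{w}"]) auto

lemma clin_lext:
  assumes "\<And>w. clin (\<phi> w)"
  shows "clin (lext \<phi>)"
proof (rule clinI)
  fix p r :: "'a \<Rightarrow>\<^sub>0 'b" and a
  let ?A = "Poly_Mapping.keys p \<union> Poly_Mapping.keys r"
  have "Poly_Mapping.keys (p + r) \<subseteq> ?A" by (rule Poly_Mapping.keys_add)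
  then show "lext \<phi> (p + r) = lext \<phi> p + lext \<phi> r"
    by (simp add: lext_superset[where A = ?A] assms lookup_add clinD[OF assms] sum.distrib)
  have "Poly_Mapping.keys (a \<star> p) \<subseteq> Poly_Mapping.keys p" by (auto simp: in_keys_iff)
  then show "lext \<phi> (a \<star> p) = a \<star> lext \<phi> p"
    by (simp add: lext_superset[where A = "Poly_Mapping.keys p"] assms clinD[OF assms] csc_sum)
qed

lemma pm_single_induct:
  assumes "P 0" "\<And>p r. P p \<Longrightarrow> P r \<Longrightarrow> P (p + r)" "\<And>w l. P (Poly_Mapping.single w l)"
  shows "P (p :: 'a \<Rightarrow>\<^sub>0 'b::ab_group_add)"
proof -
  have "P (\<Sum>w\<in>A. Poly_Mapping.single w (Poly_Mapping.lookup p w))" if "finite A" for A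
    using that by induction (auto intro: assms)
  then have "P (\<Sum>w\<in>Poly_Mapping.keys p. Poly_Mapping.single w (Poly_Mapping.lookup p w))" by simp
  moreover have "(\<Sum>w\<in>Poly_Mapping.keys p. Poly_Mapping.single w (Poly_Mapping.lookup p w)) = p"
    by (rule poly_mapping_eqI) (auto simp: lookup_sum lookup_single when_def in_keys_iff sum.delta)
  ultimately show ?thesis by simp
qed

lemma endo_pm_eqI:
  assumes "\<And>w l. app A (Poly_Mapping.single w l) = app B (Poly_Mapping.single w l)"
  shows "A = B"
proof (rule endo_eqI)
  fix p show "app A p = app B p"
    by (induction p rule: pm_single_induct) (auto simp: app_lin assms)
qed

subsection \<open>Evaluation of the free algebra\<close>

definition feval :: "(gen \<Rightarrow> 'a::calg) \<Rightarrow> falg \<Rightarrow> 'a" where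
  "feval op p = (\<Sum>w\<in>Poly_Mapping.keys p. Poly_Mapping.lookup p w \<star> prod_list (map op (letters w)))"

lemma feval_superset:
  assumes "finite A" "Poly_Mapping.keys p \<subseteq> A"
  shows "feval op p = (\<Sum>w\<in>A. Poly_Mapping.lookup p w \<star> prod_list (map op (letters w)))"
  unfolding feval_def using assms
  by (intro sum.mono_neutral_left) (auto simp: in_keys_iff)

lemma feval_single: "feval op (Poly_Mapping.single w a) = a \<star> prod_list (map op (letters w))"
  by (subst feval_superset[where A = "{w}"]) auto

lemma feval_add: "feval op (p + r) = feval op p + feval op r"
proof -
  let ?A = "Poly_Mapping.keys p \<union> Poly_Mapping.keys r"
  have "Poly_Mapping.keys (p + r) \<subseteq> ?A" by (rule Poly_Mapping.keys_add)
  then show ?thesis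
    by (simp add: feval_superset[where A = ?A] lookup_add csc_add_left sum.distrib)
qed

lemma feval_zero [simp]: "feval op 0 = 0"
  by (simp add: feval_def)

lemma feval_minus: "feval op (- p) = - feval op p"
  using feval_add[of op p "- p"] by (simp add: eq_neg_iff_add_eq_0 add.commute)

lemma feval_diff: "feval op (p - r) = feval op p - feval op r"
  using feval_add[of op p "- r"] by (simp add: feval_minus)

lemma feval_mult: "feval op (p * r) = feval op p * feval op r"
proof (induction p rule: pm_single_induct)
  case (3 w a)
  show ?case
  proof (induction r rule: pm_single_induct)
    case (3 v b)
    show ?case
      by (simp add: mult_single feval_single plus_word_def csc_mult_left csc_mult_right csc_csc)
  qed (auto simp: feval_add algebra_simps)
qed (auto simp: feval_add algebra_simps)

lemma feval_one [simp]: "feval op 1 = 1"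
  by (simp add: single_one[symmetric] feval_single zero_word_def csc_one del: single_one)

lemma feval_fscal: "feval op (fscal a) = a \<star> 1"
  by (simp add: fscal_def feval_single zero_word_def)

lemma feval_fgen: "feval op (fgen g) = op g"
  by (simp add: fgen_def feval_single csc_one)

lemma feval_power: "feval op (p ^ n) = feval op p ^ n"
  by (induction n) (auto simp: feval_mult)

lemma feval_sum: "feval op (\<Sum>i\<in>I. p i) = (\<Sum>i\<in>I. feval op (p i))"
  by (induction I rule: infinite_finite_induct) (auto simp: feval_add)

lemma feval_prod_list: "feval op (prod_list ps) = prod_list (map (feval op) ps)"
  by (induction ps) (auto simp: feval_mult)

lemmas feval_simps = feval_add feval_minus feval_diff feval_mult feval_fscal feval_fgen feval_power
  feval_sum feval_prod_list

subsection \<open>Induced modules\<close>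

text \<open>The numerical content of the affine Cartan datum: \<open>Q x y\<close> is q to the inner
  product of two simple roots, \<open>N x y\<close> the Serre exponent, \<open>c x\<close> the
  coefficient in the commutator of \<open>e_x\<close> and \<open>f_x\<close>. \<open>N_Q\<close>
  encodes \<open>d_x C_{xy} + d_x (1 - C_{xy}) = d_x\<close>, and \<open>mk_Q\<close> that the null
  root lies in the radical.\<close>

locale root_datum =
  fixes Ih :: "'i set" and Q :: "'i \<Rightarrow> 'i \<Rightarrow> complex" and q c :: "'i \<Rightarrow> complex"
    and N :: "'i \<Rightarrow> 'i \<Rightarrow> nat" and mk :: "'i \<Rightarrow> nat"
  assumes Q_sym: "Q x y = Q y x"
    and Q_nz [simp]: "Q x y \<noteq> 0"
    and Q_diag: "x \<in> Ih \<Longrightarrow> Q x x = q x ^ 2"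
    and q_nz: "x \<in> Ih \<Longrightarrow> q x \<noteq> 0"
    and q_root: "x \<in> Ih \<Longrightarrow> \<forall>n>0. q x ^ n \<noteq> 1"
    and N_pos: "x \<in> Ih \<Longrightarrow> y \<in> Ih \<Longrightarrow> x \<noteq> y \<Longrightarrow> 0 < N x y"
    and N_Q: "x \<in> Ih \<Longrightarrow> y \<in> Ih \<Longrightarrow> x \<noteq> y \<Longrightarrow> Q x y * q x ^ N x y = q x"
    and fin_Ih: "finite Ih"
    and mk_Q: "(\<Prod>x\<in>Ih. Q x y ^ mk x) = 1"
begin

text \<open>The torus and weight relations range over all indices; in the application
  \<open>Q\<close> is 1 and the generators have conventional values off \<open>Ih\<close>.\<close>

definition borel_rep :: "('i \<Rightarrow> 'a::calg) \<Rightarrow> ('i \<Rightarrow> 'a) \<Rightarrow> ('i \<Rightarrow> 'a) \<Rightarrow> bool" where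
  "borel_rep e k k' \<longleftrightarrow>
     (\<forall>x. k x * k' x = 1 \<and> k' x * k x = 1) \<and> (\<forall>x y. k x * k y = k y * k x) \<and>
     (\<forall>x y. k x * e y = Q x y \<star> (e y * k x)) \<and>
     (\<forall>x\<in>Ih. \<forall>y\<in>Ih. x \<noteq> y \<longrightarrow> serre (q x) (N x y) (e x) (e y) = 0) \<and>
     (\<forall>xs. distinct xs \<and> set xs = Ih \<longrightarrow> prod_list (map (\<lambda>x. k x ^ mk x) xs) = 1)"

lemma commute_inverse:
  fixes a b b' :: "'a::monoid_mult"
  assumes "a * b = b * a" "b * b' = 1" "b' * b = 1"
  shows "a * b' = b' * a"
proof -
  have "a * b' = b' * b * a * b'" by (simp add: assms)
  also have "\<dots> = b' * (a * b) * b'" by (simp only: assms(1) mult.assoc)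
  also have "\<dots> = b' * a" by (simp add: mult.assoc assms(2))
  finally show ?thesis .
qed

lemma inv_weight:
  fixes e k k' :: "'a::calg"
  assumes "k * k' = 1" "k' * k = 1" "k * e = a \<star> (e * k)" "a \<noteq> 0"
  shows "k' * e = inverse a \<star> (e * k')"
proof -
  have "e * k' = k' * (k * e) * k'" by (simp add: assms(2) mult.assoc[symmetric])
  also have "\<dots> = a \<star> (k' * e * (k * k'))" by (simp only: assms(3) csc_mult_left csc_mult_right mult.assoc)
  finally have "e * k' = a \<star> (k' * e)" by (simp add: assms(1))
  then show ?thesis using assms(4) by (simp add: csc_csc csc_one)
qed

definition Qw :: "'i \<Rightarrow> 'i list \<Rightarrow> complex" where
  "Qw x w = prod_list (map (Q x) w)"

lemma Qw_simps [simp]: "Qw x [] = 1" "Qw x (y # w) = Q x y * Qw x w" "Qw x (v @ w) = Qw x v * Qw x w"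
  by (simp_all add: Qw_def)

lemma Qw_nz [simp]: "Qw x w \<noteq> 0"
  by (induction w) auto

lemma Qw_mk: "(\<Prod>x\<in>Ih. Qw x w ^ mk x) = 1"
  by (induction w) (auto simp: power_mult_distrib prod.distrib mk_Q)

end

text \<open>The induced space is the free algebra on the f's tensored with the given representation,
  a word being the list of f's applied. The f's satisfy no relation among themselves here.\<close>

locale induced = root_datum Ih Q q c N mk
  for Ih :: "'i set" and Q :: "'i \<Rightarrow> 'i \<Rightarrow> complex" and q c :: "'i \<Rightarrow> complex"
    and N :: "'i \<Rightarrow> 'i \<Rightarrow> nat" and mk :: "'i \<Rightarrow> nat" +
  fixes \<epsilon> \<kappa> \<kappa>' :: "'i \<Rightarrow> 'l::cvec endo"
  assumes rep: "borel_rep \<epsilon> \<kappa> \<kappa>'"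
begin

lemma rep_rules:
  "\<kappa> x * \<kappa>' x = 1" "\<kappa>' x * \<kappa> x = 1" "\<kappa> x * \<kappa> y = \<kappa> y * \<kappa> x"
  "\<kappa> x * \<epsilon> y = Q x y \<star> (\<epsilon> y * \<kappa> x)"
  "x \<in> Ih \<Longrightarrow> y \<in> Ih \<Longrightarrow> x \<noteq> y \<Longrightarrow> serre (q x) (N x y) (\<epsilon> x) (\<epsilon> y) = 0"
  "distinct xs \<Longrightarrow> set xs = Ih \<Longrightarrow> prod_list (map (\<lambda>x. \<kappa> x ^ mk x) xs) = 1"
  using rep by (auto simp: borel_rep_def)

definition F :: "'i \<Rightarrow> ('i list \<Rightarrow>\<^sub>0 'l) endo" where
  "F x = Endo (lext (\<lambda>w l. Poly_Mapping.single (x # w) l))"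

definition K :: "'i \<Rightarrow> ('i list \<Rightarrow>\<^sub>0 'l) endo" where
  "K x = Endo (lext (\<lambda>w l. Poly_Mapping.single w (inverse (Qw x w) \<star> app (\<kappa> x) l)))"

definition K' :: "'i \<Rightarrow> ('i list \<Rightarrow>\<^sub>0 'l) endo" where
  "K' x = Endo (lext (\<lambda>w l. Poly_Mapping.single w (Qw x w \<star> app (\<kappa>' x) l)))"

text \<open>Dictated by the commutator relation: E is pushed through the letters from the left until
  it meets the given representation.\<close>

primrec Ef :: "'i \<Rightarrow> 'i list \<Rightarrow> 'l \<Rightarrow> 'i list \<Rightarrow>\<^sub>0 'l" where
  "Ef x [] l = Poly_Mapping.single [] (app (\<epsilon> x) l)"
| "Ef x (y # w) l = app (F y) (Ef x w l) +
     (if x = y then c x \<star> (app (K x) (Poly_Mapping.single w l) - app (K' x) (Poly_Mapping.single w l)) else 0)"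

definition E :: "'i \<Rightarrow> ('i list \<Rightarrow>\<^sub>0 'l) endo" where
  "E x = Endo (lext (Ef x))"

lemma clin_single: "clin (\<lambda>l. Poly_Mapping.single w l)"
  by (rule clinI) (auto simp: single_add csc_single)

lemma clin_comp_single: "clin f \<Longrightarrow> clin (\<lambda>l. Poly_Mapping.single w (f l))"
  by (rule clinI) (auto simp: single_add csc_single clinD)

lemma clin_scale_app: "clin (\<lambda>l. a \<star> app A l)"
  by (rule clinI) (auto simp: app_lin csc_add_right csc_csc mult.commute)

lemma F_single [simp]: "app (F x) (Poly_Mapping.single w l) = Poly_Mapping.single (x # w) l"
  unfolding F_def by (subst app_Endo) (auto intro!: clin_lext clin_single simp: lext_single clin_single)

lemma K_single [simp]: "app (K x) (Poly_Mapping.single w l) =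
    Poly_Mapping.single w (inverse (Qw x w) \<star> app (\<kappa> x) l)"
  unfolding K_def
  by (subst app_Endo) (auto intro!: clin_lext clin_comp_single clin_scale_app
      simp: lext_single clin_comp_single clin_scale_app)

lemma K'_single [simp]: "app (K' x) (Poly_Mapping.single w l) =
    Poly_Mapping.single w (Qw x w \<star> app (\<kappa>' x) l)"
  unfolding K'_def
  by (subst app_Endo) (auto intro!: clin_lext clin_comp_single clin_scale_app
      simp: lext_single clin_comp_single clin_scale_app)

lemma clin_Ef: "clin (Ef x w)"
proof (induction w)
  case Nil
  then show ?case by (auto intro!: clin_comp_single clin_app)
next
  case (Cons y w)
  show ?case
    by (rule clinI)
      (auto simp: clinD[OF Cons] app_lin single_add csc_single[symmetric] csc_norm algebra_simps)
qed

lemma E_single: "app (E x) (Poly_Mapping.single w l) = Ef x w l"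
  unfolding E_def by (subst app_Endo) (auto intro!: clin_lext clin_Ef simp: lext_single clin_Ef)

lemma E_single_Nil [simp]: "app (E x) (Poly_Mapping.single [] l) = Poly_Mapping.single [] (app (\<epsilon> x) l)"
  by (simp add: E_single)

lemma EF: "E x * F y = F y * E x + (if x = y then c x \<star> (K x - K' x) else 0)"
  by (rule endo_pm_eqI) (auto simp: E_single)

lemma EF_same: "E x * F x = F x * E x + c x \<star> (K x - K' x)"
  and EF_other: "x \<noteq> y \<Longrightarrow> E x * F y = F y * E x"
  by (simp_all add: EF)

lemma KF: "K x * F y = inverse (Q x y) \<star> (F y * K x)"
  by (rule endo_pm_eqI) (simp add: csc_single csc_csc)

lemma K'F: "K' x * F y = Q x y \<star> (F y * K' x)"
  by (rule endo_pm_eqI) (simp add: csc_single csc_csc)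

lemma KK': "K x * K' x = 1" "K' x * K x = 1"
proof -
  have 1: "app (\<kappa> x) (app (\<kappa>' x) l) = l" "app (\<kappa>' x) (app (\<kappa> x) l) = l" for l
    using rep_rules(1,2)[of x] by (metis app_simps(2,6))+
  show "K x * K' x = 1" "K' x * K x = 1"
    by (rule endo_pm_eqI; simp add: 1 app_lin csc_csc csc_one)+
qed

lemma KK_comm: "K x * K y = K y * K x"
proof -
  have 1: "app (\<kappa> x) (app (\<kappa> y) l) = app (\<kappa> y) (app (\<kappa> x) l)" for l
    using rep_rules(3)[of x y] by (metis app_simps(6))
  show ?thesis
    by (rule endo_pm_eqI) (simp add: 1 app_lin csc_csc mult.commute)
qed

text \<open>The empty-word layer generates the space under the F, so an operator identity need only
  hold there and be inherited along F.\<close>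

lemma endo_F_induct:
  assumes "\<And>l. app A (Poly_Mapping.single [] l) = app B (Poly_Mapping.single [] l)"
    and "\<And>z m. app A m = app B m \<Longrightarrow> app A (app (F z) m) = app B (app (F z) m)"
  shows "A = B"
proof (rule endo_pm_eqI)
  fix w and l :: 'l
  show "app A (Poly_Mapping.single w l) = app B (Poly_Mapping.single w l)"
  proof (induction w)
    case (Cons z w)
    then show ?case using assms(2)[OF Cons, of z] by simp
  qed (rule assms(1))
qed

lemma KE: "K x * E y = Q x y \<star> (E y * K x)"
proof (rule endo_F_induct)
  fix l
  have "app (\<kappa> x) (app (\<epsilon> y) l) = Q x y \<star> app (\<epsilon> y) (app (\<kappa> x) l)"
    using rep_rules(4)[of x y] by (metis app_simps(6,7))
  then show "app (K x * E y) (Poly_Mapping.single [] l) = app (Q x y \<star> (E y * K x)) (Poly_Mapping.single [] l)"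
    by (simp add: csc_single csc_one)
next
  fix z m
  assume IH: "app (K x * E y) m = app (Q x y \<star> (E y * K x)) m"
  have KK: "K x * (K y - K' y) = (K y - K' y) * K x"
  proof -
    have "K x * K' y = K' y * K x"
      by (rule commute_inverse[OF KK_comm KK'])
    then show ?thesis by (simp only: right_diff_distrib left_diff_distrib KK_comm)
  qed
  have 1: "K x * E y * F z = inverse (Q x z) \<star> (F z * (K x * E y)) +
      (if y = z then c y \<star> ((K y - K' y) * K x) else 0)"
  proof -
    have "K x * E y * F z = K x * F z * E y + (if y = z then c y \<star> (K x * (K y - K' y)) else 0)"
      by (auto simp: mult.assoc EF distrib_left csc_mult_right)
    then show ?thesis by (simp only: KK) (simp add: KF csc_mult_left mult.assoc)
  qed
  have 2: "Q x y \<star> (E y * K x) * F z = inverse (Q x z) \<star> (F z * (Q x y \<star> (E y * K x))) +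
      (if y = z then c y \<star> ((K y - K' y) * K x) else 0)"
  proof -
    have "Q x y \<star> (E y * K x) * F z = (Q x y * inverse (Q x z)) \<star> (E y * F z * K x)"
      by (simp add: mult.assoc KF csc_mult_left csc_mult_right csc_csc)
    then show ?thesis
      by (auto simp: EF distrib_right csc_add_right csc_mult_left csc_mult_right csc_csc mult.assoc mult.commute csc_one)
  qed
  have "app (K x * E y) (app (F z) m) = app (K x * E y * F z) m" by simp
  also have "\<dots> = app (Q x y \<star> (E y * K x) * F z) m"
    unfolding 1 2 using IH by simp
  finally show "app (K x * E y) (app (F z) m) = app (Q x y \<star> (E y * K x)) (app (F z) m)" by simp
qed

lemma K'E: "K' x * E y = inverse (Q x y) \<star> (E y * K' x)"
  by (rule inv_weight[OF KK' KE Q_nz])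

lemma serre_E_F:
  assumes "x \<in> Ih" "y \<in> Ih" "x \<noteq> y"
  shows "serre (q x) (N x y) (E x) (E y) * F z = F z * serre (q x) (N x y) (E x) (E y)"
proof -
  note r = q_root[OF assms(1)] q_nz[OF assms(1)] N_Q[OF assms] N_pos[OF assms]
  consider "z = x" | "z = y" | "z \<noteq> x" "z \<noteq> y" by blast
  then show ?thesis
  proof cases
    case 1
    show ?thesis unfolding 1
      by (rule serre_commutator_same[OF r EF_same EF_other])
        (use assms in \<open>auto simp: KE K'E Q_diag[symmetric]\<close>)
  next
    case 2
    show ?thesis unfolding 2
      by (rule serre_commutator_other[OF r EF_same EF_other])
        (use assms in \<open>auto simp: KE K'E Q_sym[of y x]\<close>)
  next
    case 3
    show ?thesis by (rule serre_commutator_none) (use 3 in \<open>auto simp: EF\<close>)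
  qed
qed

lemma E_power_single: "app (E x ^ n) (Poly_Mapping.single [] l) = Poly_Mapping.single [] (app (\<epsilon> x ^ n) l)"
  by (induction n arbitrary: l) auto

lemma single_sum: "Poly_Mapping.single w (\<Sum>i\<in>I. f i) = (\<Sum>i\<in>I. Poly_Mapping.single w (f i :: 'l))"
  by (induction I rule: infinite_finite_induct) (auto simp: single_add)

text \<open>The Serre element commutes with every F and vanishes on the empty-word layer, where it
  is the Serre element of the given representation.\<close>

lemma serre_E:
  assumes "x \<in> Ih" "y \<in> Ih" "x \<noteq> y"
  shows "serre (q x) (N x y) (E x) (E y) = 0"
proof (rule endo_F_induct)
  fix l
  have "app (serre (q x) (N x y) (E x) (E y)) (Poly_Mapping.single [] l) =
     Poly_Mapping.single [] (app (serre (q x) (N x y) (\<epsilon> x) (\<epsilon> y)) l)"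
    by (simp add: serre_def app_sum E_power_single csc_single single_sum)
  then show "app (serre (q x) (N x y) (E x) (E y)) (Poly_Mapping.single [] l) = app 0 (Poly_Mapping.single [] l)"
    by (simp add: rep_rules(5)[OF assms])
next
  fix z m
  assume "app (serre (q x) (N x y) (E x) (E y)) m = app 0 m"
  then show "app (serre (q x) (N x y) (E x) (E y)) (app (F z) m) = app 0 (app (F z) m)"
    using serre_E_F[OF assms, of z] by (metis app_simps(1,6) app_lin(3))
qed

text \<open>The same commutator computations with E and F exchanged; \<open>K'\<close> takes the
  part of k because it passes F with the factor \<open>Q\<close>.\<close>

lemma serre_F_E:
  assumes "x \<in> Ih" "y \<in> Ih" "x \<noteq> y"
  shows "E z * serre (q x) (N x y) (F x) (F y) = serre (q x) (N x y) (F x) (F y) * E z"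
proof -
  note r = q_root[OF assms(1)] q_nz[OF assms(1)] N_Q[OF assms] N_pos[OF assms]
  have FE: "F x * E x = E x * F x + c x \<star> (K' x - K x)" for x
    by (simp add: EF_same csc_diff)
  have FE2: "F x * E y = E y * F x" if "x \<noteq> y" for x y using that EF_other[of y x] by simp
  consider "z = x" | "z = y" | "z \<noteq> x" "z \<noteq> y" by blast
  then have "serre (q x) (N x y) (F x) (F y) * E z = E z * serre (q x) (N x y) (F x) (F y)"
  proof cases
    case 1
    show ?thesis unfolding 1
      by (rule serre_commutator_same[OF r FE FE2])
        (use assms in \<open>auto simp: KF K'F Q_diag[symmetric]\<close>)
  next
    case 2
    show ?thesis unfolding 2
      by (rule serre_commutator_other[OF r FE FE2])
        (use assms in \<open>auto simp: KF K'F Q_sym[of y x]\<close>)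
  next
    case 3
    show ?thesis by (rule serre_commutator_none) (use 3 in \<open>auto simp: EF\<close>)
  qed
  then show ?thesis by simp
qed

lemma K_power_single: "app (K x ^ n) (Poly_Mapping.single w l) =
    Poly_Mapping.single w (inverse (Qw x w) ^ n \<star> app (\<kappa> x ^ n) l)"
  by (induction n arbitrary: l) (auto simp: csc_one app_lin csc_csc mult.commute)

text \<open>On the layer of a word the product differs from that of the representation by a scalar,
  which is 1 by \<open>mk_Q\<close>.\<close>

lemma K_central:
  assumes "distinct xs" "set xs = Ih"
  shows "prod_list (map (\<lambda>x. K x ^ mk x) xs) = 1"
proof (rule endo_pm_eqI)
  fix w l
  have "app (prod_list (map (\<lambda>x. K x ^ mk x) ys)) (Poly_Mapping.single w l) =
      Poly_Mapping.single w (prod_list (map (\<lambda>x. inverse (Qw x w) ^ mk x) ys) \<star>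
         app (prod_list (map (\<lambda>x. \<kappa> x ^ mk x) ys)) l)" for ys
    by (induction ys) (auto simp: csc_one app_lin csc_csc K_power_single mult.commute)
  moreover have "prod_list (map (\<lambda>x. inverse (Qw x w) ^ mk x) xs) = 1"
  proof -
    have "prod_list (map (\<lambda>x. inverse (Qw x w) ^ mk x) xs) = (\<Prod>x\<in>Ih. inverse (Qw x w) ^ mk x)"
      using assms by (simp add: prod.distinct_set_conv_list[symmetric])
    also have "\<dots> = inverse (\<Prod>x\<in>Ih. Qw x w ^ mk x)"
      by (simp add: prod_inversef[symmetric] power_inverse)
    finally show ?thesis by (simp add: Qw_mk)
  qed
  ultimately show "app (prod_list (map (\<lambda>x. K x ^ mk x) xs)) (Poly_Mapping.single w l) = app 1 (Poly_Mapping.single w l)"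
    using rep_rules(6)[OF assms] by (simp add: csc_one)
qed

text \<open>The Serre relations of the f's fail on the free module. Their images are collected with
  arbitrary words on the left and, \<open>m\<close> being arbitrary, anything on the right;
  \<open>R\<close> is thus a subrepresentation that measures the failure.\<close>

definition Rgen :: "('i list \<Rightarrow>\<^sub>0 'l) set" where
  "Rgen = {app (prod_list (map F w) * serre (q x) (N x y) (F x) (F y)) m | w x y m.
     x \<in> Ih \<and> y \<in> Ih \<and> x \<noteq> y}"

definition R :: "('i list \<Rightarrow>\<^sub>0 'l) set" where
  "R = cvec.span Rgen"

lemma RgenI: "x \<in> Ih \<Longrightarrow> y \<in> Ih \<Longrightarrow> x \<noteq> y \<Longrightarrow>
    app (prod_list (map F w)) (app (serre (q x) (N x y) (F x) (F y)) m) \<in> R"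
  unfolding R_def by (rule cvec.span_base) (auto simp: Rgen_def)

lemmas R_closed = cvec.span_add[of _ Rgen, folded R_def] cvec.span_diff[of _ Rgen, folded R_def]
  cvec.span_scale[of _ Rgen, folded R_def] cvec.span_zero[of Rgen, folded R_def]
  cvec.span_neg[of _ Rgen, folded R_def] cvec.span_sum[of _ _ Rgen, folded R_def]

lemma R_stableI:
  assumes "\<And>x y w m. x \<in> Ih \<Longrightarrow> y \<in> Ih \<Longrightarrow> x \<noteq> y \<Longrightarrow>
     app A (app (prod_list (map F w)) (app (serre (q x) (N x y) (F x) (F y)) m)) \<in> R"
    and "m \<in> R"
  shows "app A m \<in> R"
  using assms(2) unfolding R_def
proof (induction rule: cvec.span_induct_alt)
  case base
  then show ?case by (simp add: app_lin cvec.span_zero)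
next
  case (step a g m)
  have "app A g \<in> cvec.span Rgen" using step(1) assms(1) unfolding Rgen_def R_def by auto
  then show ?case using step(2) by (auto simp: app_lin intro!: cvec.span_add cvec.span_scale)
qed

lemma R_F: "m \<in> R \<Longrightarrow> app (F z) m \<in> R"
  by (rule R_stableI) (use RgenI[where w = "z # _"] in auto)

lemma serre_F_weight:
  assumes "x \<in> Ih" "y \<in> Ih" "x \<noteq> y" and "A * F x = a \<star> (F x * A)" "A * F y = b \<star> (F y * A)"
  shows "\<exists>d. A * serre (q x) (N x y) (F x) (F y) = d \<star> (serre (q x) (N x y) (F x) (F y) * A)"
  unfolding serre_eq_sX[OF q_root[OF assms(1)] q_nz[OF assms(1)] N_Q[OF assms(1-3)]]
  using sX_weight[OF assms(4,5)] by blast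

lemma R_weight:
  assumes A: "\<And>x. \<exists>a. A * F x = a \<star> (F x * A)" and m: "m \<in> R"
  shows "app A m \<in> R"
proof (rule R_stableI[OF _ m])
  fix x y w m
  assume xy: "x \<in> Ih" "y \<in> Ih" "x \<noteq> y"
  let ?S = "serre (q x) (N x y) (F x) (F y)"
  obtain a b where "A * F x = a \<star> (F x * A)" "A * F y = b \<star> (F y * A)" using A by metis
  then obtain d where d: "A * ?S = d \<star> (?S * A)" using serre_F_weight[OF xy] by blast
  show "app A (app (prod_list (map F w)) (app ?S m)) \<in> R"
  proof (induction w)
    case Nil
    have "app A (app ?S m) = d \<star> app ?S (app A m)" using d by (metis app_simps(6,7))
    then show ?case using RgenI[OF xy, of "[]"] by (simp add: R_closed)
  next
    case (Cons z w)
    obtain g where "A * F z = g \<star> (F z * A)" using A by blast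
    then have "app A (app (F z) n) = g \<star> app (F z) (app A n)" for n by (metis app_simps(6,7))
    then show ?case using R_F[OF Cons] by (simp add: R_closed)
  qed
qed

lemma R_K: "m \<in> R \<Longrightarrow> app (K z) m \<in> R" and R_K': "m \<in> R \<Longrightarrow> app (K' z) m \<in> R"
  by (rule R_weight; use KF K'F in blast)+

lemma R_E:
  assumes "m \<in> R" shows "app (E z) m \<in> R"
proof (rule R_stableI[OF _ assms])
  fix x y w m
  assume xy: "x \<in> Ih" "y \<in> Ih" "x \<noteq> y"
  let ?S = "serre (q x) (N x y) (F x) (F y)"
  show "app (E z) (app (prod_list (map F w)) (app ?S m)) \<in> R"
  proof (induction w)
    case Nil
    have "app (E z) (app ?S m) = app ?S (app (E z) m)" using serre_F_E[OF xy] by (metis app_simps(6))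
    then show ?case using RgenI[OF xy, of "[]"] by simp
  next
    case (Cons u w)
    let ?n = "app (prod_list (map F w)) (app ?S m)"
    have n: "?n \<in> R" by (rule RgenI[OF xy])
    have "app (E z) (app (F u) ?n) = app (F u) (app (E z) ?n) +
       (if z = u then c z \<star> (app (K z) ?n - app (K' z) ?n) else 0)"
      using arg_cong[OF EF[of z u], of "\<lambda>A. app A ?n"] by auto
    then show ?case using R_F[OF Cons] R_K[OF n] R_K'[OF n] by (auto intro!: R_closed)
  qed
qed

definition supp_ge :: "nat \<Rightarrow> ('i list \<Rightarrow>\<^sub>0 'l) \<Rightarrow> bool" where
  "supp_ge n m \<longleftrightarrow> (\<forall>w. length w < n \<longrightarrow> Poly_Mapping.lookup m w = 0)"

lemma supp_ge_simps: "supp_ge n 0" "supp_ge n m \<Longrightarrow> supp_ge n m' \<Longrightarrow> supp_ge n (m + m')"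
   "supp_ge n m \<Longrightarrow> supp_ge n (a \<star> m)" "supp_ge 0 m"
  by (auto simp: supp_ge_def lookup_add)

lemma lookup_F: "Poly_Mapping.lookup (app (F x) m) w =
   (case w of [] \<Rightarrow> 0 | y # v \<Rightarrow> if y = x then Poly_Mapping.lookup m v else 0)"
  by (induction m rule: pm_single_induct)
    (auto simp: app_lin lookup_add lookup_single when_def split: list.splits)

lemma supp_ge_F: "supp_ge n m \<Longrightarrow> supp_ge (Suc n) (app (F x) m)"
  by (auto simp: supp_ge_def lookup_F split: list.splits)

lemma supp_ge_mono: "supp_ge n m \<Longrightarrow> k \<le> n \<Longrightarrow> supp_ge k m"
  by (auto simp: supp_ge_def)

lemma supp_ge_F_power: "supp_ge j m \<Longrightarrow> supp_ge (n + j) (app (F x ^ n) m)"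
  by (induction n) (auto dest: supp_ge_F)

lemma supp_ge_prod_F: "supp_ge n m \<Longrightarrow> supp_ge n (app (prod_list (map F w)) m)"
  by (induction w) (auto dest: supp_ge_F intro: supp_ge_mono)

text \<open>Each term of a Serre element in the F prepends \<open>N x y + 1\<close> letters, hence
  at least two. The layers of words of length 0 and 1 are therefore untouched by
  \<open>R\<close>.\<close>

lemma R_supp:
  assumes "m \<in> R" shows "supp_ge 2 m"
  using assms unfolding R_def
proof (induction rule: cvec.span_induct_alt)
  case base
  then show ?case by (simp add: supp_ge_simps)
next
  case (step a g m)
  then obtain w x y n where g: "g = app (prod_list (map F w)) (app (serre (q x) (N x y) (F x) (F y)) n)"
    and xy: "x \<in> Ih" "y \<in> Ih" "x \<noteq> y" by (auto simp: Rgen_def)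
  have "supp_ge 2 (app (F x ^ (N x y - r)) (app (F y) (app (F x ^ r) n)))" if "r \<le> N x y" for r
  proof -
    have "supp_ge (r + 0) (app (F x ^ r) n)" by (rule supp_ge_F_power) (rule supp_ge_simps(4))
    then have "supp_ge (N x y - r + Suc (r + 0)) (app (F x ^ (N x y - r)) (app (F y) (app (F x ^ r) n)))"
      by (intro supp_ge_F_power supp_ge_F supp_ge_simps(4))
    then show ?thesis by (rule supp_ge_mono) (use that N_pos[OF xy] in auto)
  qed
  then have "supp_ge 2 (\<Sum>r\<in>A. ((- 1) ^ r * qbinom (q x) (N x y) r) \<star>
      app (F x ^ (N x y - r)) (app (F y) (app (F x ^ r) n)))" if "A \<subseteq> {..N x y}" for A
    using that by (induction A rule: infinite_finite_induct) (auto intro!: supp_ge_simps)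
  then have "supp_ge 2 g"
    unfolding g serre_def by (intro supp_ge_prod_F) (simp add: app_sum)
  then show ?case using step by (intro supp_ge_simps)
qed

end

section \<open>Combinatorics of twisted data\<close>

definition adj :: "twisted_datum \<Rightarrow> nat \<Rightarrow> nat \<Rightarrow> bool" where
  "adj T i j \<longleftrightarrow> i \<noteq> j \<and> {i, j} \<in> edges_of (dtype T)"

lemma cartan_adj: "cartan T i j = (if i = j then 2 else if adj T i j then - 1 else 0)"
  by (simp add: cartan_def adj_def)

lemma adj_sym: "adj T i j \<longleftrightarrow> adj T j i"
  by (auto simp: adj_def insert_commute)

lemma cartan_sym: "cartan T i j = cartan T j i"
  by (auto simp: cartan_adj adj_sym)

lemma adj_A:
  assumes "dtype T = TypeA m"
  shows "adj T i j \<longleftrightarrow> i \<in> {1..m} \<and> j \<in> {1..m} \<and> (j = i + 1 \<or> i = j + 1)"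
  using assms by (auto simp: adj_def doubleton_eq_iff)

lemma adj_D:
  assumes "dtype T = TypeD m" "4 \<le> m"
  shows "adj T i j \<longleftrightarrow> (i \<in> {1..m - 1} \<and> j \<in> {1..m - 1} \<and> (j = i + 1 \<or> i = j + 1)) \<or>
     (i = m - 2 \<and> j = m) \<or> (j = m - 2 \<and> i = m)"
proof -
  have "{i, j} \<in> {{a, a + 1} |a. 1 \<le> a \<and> a < m - 1} \<longleftrightarrow>
     (i \<in> {1..m - 1} \<and> j \<in> {1..m - 1} \<and> (j = i + 1 \<or> i = j + 1))"
    by (auto simp: doubleton_eq_iff)
  moreover have "{i, j} = {m - 2, m} \<longleftrightarrow> (i = m - 2 \<and> j = m) \<or> (j = m - 2 \<and> i = m)"
    by (auto simp: doubleton_eq_iff)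
  moreover have "adj T i j \<longleftrightarrow> i \<noteq> j \<and> ({i, j} \<in> {{a, a + 1} |a. 1 \<le> a \<and> a < m - 1} \<or> {i, j} = {m - 2, m})"
    unfolding adj_def assms(1) edges_of.simps by blast
  moreover have "i \<noteq> j" if "j = i + 1 \<or> i = j + 1 \<or> (i = m - 2 \<and> j = m) \<or> (j = m - 2 \<and> i = m)"
    using that assms(2) by linarith
  ultimately show ?thesis by (simp only:) blast
qed

lemma adj_E:
  assumes "dtype T = TypeE6"
  shows "adj T i j \<longleftrightarrow> (i, j) \<in> {(1,3),(3,1),(3,4),(4,3),(4,5),(5,4),(5,6),(6,5),(2,4),(4,2)}"
  using assms by (auto simp: adj_def doubleton_eq_iff)

locale datum =
  fixes T :: twisted_datum
  assumes valid: "valid_datum T"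
begin

abbreviation "M \<equiv> aord T"
abbreviation "nd \<equiv> nodes T"
abbreviation "\<sigma> \<equiv> aut T"

section \<open>Orbits of the diagram automorphism\<close>

lemma finite_nodes [simp]: "finite nd"
  by (cases "dtype T") (auto simp: nodes_def)

lemma M_cases: "M = 2 \<or> M = 3"
  using valid by (auto simp: valid_datum_def)

lemma M_pos [simp]: "0 < M" "M \<noteq> 0"
  using M_cases by auto

lemma bij: "bij_betw \<sigma> nd nd"
  using valid by (auto simp: valid_datum_def)

lemma aut_nodes [simp]: "i \<in> nd \<Longrightarrow> \<sigma> i \<in> nd"
  using bij by (auto simp: bij_betw_def)

lemma aut_inj: "i \<in> nd \<Longrightarrow> j \<in> nd \<Longrightarrow> \<sigma> i = \<sigma> j \<longleftrightarrow> i = j"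
  using bij by (auto simp: bij_betw_def inj_on_def)

lemma aut_surj: "j \<in> nd \<Longrightarrow> \<exists>i\<in>nd. \<sigma> i = j"
  using bij unfolding bij_betw_def by (metis imageE)

lemma cartan_aut: "i \<in> nd \<Longrightarrow> j \<in> nd \<Longrightarrow> cartan T (\<sigma> i) (\<sigma> j) = cartan T i j"
  using valid by (auto simp: valid_datum_def)

lemma adj_aut: "i \<in> nd \<Longrightarrow> j \<in> nd \<Longrightarrow> adj T (\<sigma> i) (\<sigma> j) \<longleftrightarrow> adj T i j"
  using cartan_aut[of i j] by (auto simp: cartan_adj aut_inj split: if_splits) (auto simp: adj_def)

lemma nontrivial: "\<exists>i\<in>nd. \<sigma> i \<noteq> i"
  using valid by (auto simp: valid_datum_def)

lemma sig_M: "i \<in> nd \<Longrightarrow> sig T M i = i"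
  using valid by (auto simp: valid_datum_def)

lemma sig_simps [simp]: "sig T 0 i = i" "sig T (Suc r) i = \<sigma> (sig T r i)"
  by (simp_all add: sig_def)

lemma sig_add: "sig T (r + s) i = sig T r (sig T s i)"
  by (simp add: sig_def funpow_add)

lemma sig_nodes [simp]: "i \<in> nd \<Longrightarrow> sig T r i \<in> nd"
  by (induction r) auto

lemma sig_aut: "sig T r (\<sigma> i) = \<sigma> (sig T r i)"
  by (induction r) auto

lemma sig_fixed: "\<sigma> i = i \<Longrightarrow> sig T r i = i"
  by (induction r) auto

lemma cartan_sig: "i \<in> nd \<Longrightarrow> j \<in> nd \<Longrightarrow> cartan T (sig T r i) (sig T r j) = cartan T i j"
  by (induction r) (auto simp: cartan_aut)

lemma sig_mod: "i \<in> nd \<Longrightarrow> sig T r i = sig T (r mod M) i"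
proof -
  assume i: "i \<in> nd"
  have "sig T (n * M + s) i = sig T s i" for n s
  proof (induction n)
    case (Suc n)
    have "sig T (Suc n * M + s) i = sig T (n * M + s + M) i" by (simp add: algebra_simps)
    also have "\<dots> = sig T (n * M + s) (sig T M i)" by (rule sig_add)
    finally show ?case using Suc sig_M[OF i] by simp
  qed simp
  from this[of "r div M" "r mod M"] show ?thesis by simp
qed

lemma orb_iff: "i \<in> nd \<Longrightarrow> j \<in> orb T i \<longleftrightarrow> (\<exists>r. j = sig T r i)"
  unfolding orb_def using sig_mod[of i] by (auto intro!: rev_image_eqI[where x = "_ mod M"])

lemma orb_self [simp]: "i \<in> nd \<Longrightarrow> i \<in> orb T i"
  by (auto simp: orb_iff intro: exI[of _ 0])

lemma orb_nodes: "i \<in> nd \<Longrightarrow> j \<in> orb T i \<Longrightarrow> j \<in> nd"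
  by (auto simp: orb_def)

lemma orb_sym: assumes "i \<in> nd" "j \<in> orb T i" shows "i \<in> orb T j"
proof -
  obtain r where r: "r < M" "j = sig T r i" using assms by (auto simp: orb_def)
  have "sig T (M - r) j = sig T M i"
    using r by (simp add: sig_add[symmetric])
  then have "i = sig T (M - r) j" using sig_M[OF assms(1)] by simp
  then show ?thesis using assms orb_nodes orb_iff by blast
qed

lemma orb_eq: assumes "i \<in> nd" "j \<in> orb T i" shows "orb T j = orb T i"
proof -
  have sub: "orb T b \<subseteq> orb T a" if ab: "a \<in> nd" "b \<in> orb T a" for a b
  proof
    fix l assume l: "l \<in> orb T b"
    have b: "b \<in> nd" using ab orb_nodes by blast
    show "l \<in> orb T a"
      using ab l b by (auto simp: orb_iff) (metis sig_add)
  qed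
  show ?thesis using sub[OF assms] sub[OF orb_nodes[OF assms] orb_sym[OF assms]] by blast
qed

lemma orb_aut [simp]: "i \<in> nd \<Longrightarrow> orb T (\<sigma> i) = orb T i"
  by (rule orb_eq) (auto simp: orb_iff intro: exI[of _ 1])

lemma orb_sig [simp]: "i \<in> nd \<Longrightarrow> orb T (sig T r i) = orb T i"
  by (induction r) auto

lemma finite_Isig [simp]: "finite (Isig T)"
  by (simp add: Isig_def)

lemma IsigI [simp]: "i \<in> nd \<Longrightarrow> orb T i \<in> Isig T"
  by (simp add: Isig_def)

lemma rep_in: assumes "P \<in> Isig T" shows "rep P \<in> P" "rep P \<in> nd" "orb T (rep P) = P"
proof -
  obtain i where i: "i \<in> nd" "P = orb T i" using assms by (auto simp: Isig_def)
  have "finite P" unfolding i orb_def by simp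
  moreover have "P \<noteq> {}" using orb_self[OF i(1)] i(2) by blast
  ultimately show 1: "rep P \<in> P" unfolding rep_def by (rule Min_in)
  show "rep P \<in> nd" using 1 orb_nodes[OF i(1)] unfolding i(2) by blast
  show "orb T (rep P) = P" using orb_eq[OF i(1), of "rep P"] 1 unfolding i(2) by simp
qed

lemma rep_orb [simp]: "i \<in> nd \<Longrightarrow> orb T (rep (orb T i)) = orb T i"
  using rep_in(3)[of "orb T i"] by simp

lemma mem_Isig: "P \<in> Isig T \<Longrightarrow> i \<in> P \<Longrightarrow> i \<in> nd \<and> orb T i = P"
  unfolding Isig_def using orb_eq orb_nodes by blast

lemma finite_Ihat [simp]: "finite (Ihat T)"
  by (simp add: Ihat_def)

lemma sum_Ihat: "(\<Sum>x\<in>Ihat T. g x) = g None + (\<Sum>P\<in>Isig T. g (Some P))"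
  unfolding Ihat_def by (subst sum.insert) (auto simp: sum.reindex)

lemma prod_Ihat: "(\<Prod>x\<in>Ihat T. g x) = g None * (\<Prod>P\<in>Isig T. g (Some P))"
  unfolding Ihat_def by (subst prod.insert) (auto simp: prod.reindex)

section \<open>The folded symmetric form \<open>csum\<close> on orbits\<close>

lemma sum_period:
  fixes g :: "nat \<Rightarrow> int"
  assumes "i \<in> nd"
  shows "(\<Sum>r = 1..M. g (sig T (s + r) i)) = (\<Sum>r = 1..M. g (sig T r i))"
proof (induction s)
  case (Suc s)
  define f where "f r = g (sig T (s + r) i)" for r
  have "f (Suc M) = f 1"
  proof -
    have "(s + Suc M) mod M = (s + 1) mod M"
      by (metis add.assoc add.commute mod_add_self2 plus_1_eq_Suc)
    then show ?thesis
      unfolding f_def using sig_mod[OF assms, of "s + Suc M"] sig_mod[OF assms, of "s + 1"] by metis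
  qed
  moreover have "(\<Sum>r = 1..M. f (Suc r) - f r) = f (Suc M) - f 1"
    by (rule sum_Suc_diff) (use M_cases in auto)
  ultimately have "(\<Sum>r = 1..M. f (Suc r)) = (\<Sum>r = 1..M. f r)"
    by (simp add: sum_subtractf)
  then show ?case using Suc by (simp add: f_def)
qed simp

lemma csum_sig2: "i \<in> nd \<Longrightarrow> j \<in> nd \<Longrightarrow> csum T i (sig T s j) = csum T i j"
  unfolding csum_def using sum_period[of j "cartan T i" s]
  by (simp add: sig_add[symmetric] add.commute del: sig_simps)

lemma csum_sig1:
  assumes "i \<in> nd" "j \<in> nd" shows "csum T (sig T s i) j = csum T i j"
proof -
  have "csum T (sig T s i) (sig T s j) = csum T i j"
    unfolding csum_def
  proof (intro sum.cong refl)
    fix r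
    have "sig T r (sig T s j) = sig T s (sig T r j)" by (simp only: sig_add[symmetric] add.commute)
    then show "cartan T (sig T s i) (sig T r (sig T s j)) = cartan T i (sig T r j)"
      using assms by (simp add: cartan_sig)
  qed
  then show ?thesis using csum_sig2[of "sig T s i" j s] assms by simp
qed

lemma csum_sym:
  assumes "i \<in> nd" "j \<in> nd" shows "csum T i j = csum T j i"
proof -
  have c: "cartan T i (sig T r j) = cartan T j (sig T (M - r) i)" if "r \<le> M" for r
  proof -
    have "cartan T i (sig T r j) = cartan T (sig T (M - r) i) (sig T (M - r) (sig T r j))"
      using assms by (simp add: cartan_sig)
    also have "sig T (M - r) (sig T r j) = j"
      using that by (simp add: sig_add[symmetric] sig_M assms)
    finally show ?thesis by (simp add: cartan_sym)
  qed
  have "csum T i j = (\<Sum>r = 1..M. cartan T j (sig T (M - r) i))"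
    unfolding csum_def by (intro sum.cong refl c) auto
  also have "\<dots> = (\<Sum>r<M. cartan T j (sig T r i))"
    by (rule sum.reindex_bij_witness[of _ "\<lambda>r. M - r" "\<lambda>r. M - r"]) auto
  also have "\<dots> = csum T j i"
  proof -
    have "(\<Sum>r<M. cartan T j (sig T r i)) + cartan T j (sig T M i) =
       cartan T j (sig T 0 i) + (\<Sum>r = 1..M. cartan T j (sig T r i))"
      using sum.atLeast_Suc_atMost[of 0 M "\<lambda>r. cartan T j (sig T r i)"]
      by (simp add: lessThan_Suc_atMost[symmetric] atLeast0AtMost del: sig_simps)
    then show ?thesis using sig_M[OF assms(1)] by (simp add: csum_def)
  qed
  finally show ?thesis .
qed

lemma csum_orb:
  assumes "i \<in> nd" "j \<in> nd" "i' \<in> orb T i" "j' \<in> orb T j" shows "csum T i' j' = csum T i j"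
proof -
  obtain r s where "i' = sig T r i" "j' = sig T s j" using assms orb_iff by metis
  then show ?thesis using assms by (simp add: csum_sig1 csum_sig2)
qed

lemma csum_rep: "i \<in> nd \<Longrightarrow> j \<in> nd \<Longrightarrow> csum T (rep (orb T i)) (rep (orb T j)) = csum T i j"
  by (rule csum_orb) (auto simp: rep_in)

lemma csum_rep1: "i \<in> nd \<Longrightarrow> j \<in> nd \<Longrightarrow> csum T (rep (orb T i)) j = csum T i j"
  by (rule csum_orb) (auto simp: rep_in)

text \<open>The order M is prime, so a node that is not fixed has a full orbit.\<close>

lemma sig_inj_lt:
  assumes "i \<in> nd" "\<sigma> i \<noteq> i" shows "inj_on (\<lambda>r. sig T r i) {..<M}"
proof -
  have ne: "\<sigma> (\<sigma> i) \<noteq> i" if "M = 3"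
  proof
    assume "\<sigma> (\<sigma> i) = i"
    then show False using sig_M[OF assms(1)] that assms by (simp add: eval_nat_numeral)
  qed
  have ne2: "\<sigma> (\<sigma> i) \<noteq> \<sigma> i" using assms aut_inj[of "\<sigma> i" i] by simp
  show ?thesis
    using M_cases
  proof
    assume "M = 2"
    then have "{..<M} = {0, 1}" by auto
    then show ?thesis using assms by auto
  next
    assume m: "M = 3"
    then have "{..<M} = {0, 1, 2}" by auto
    moreover have "sig T 2 i = \<sigma> (\<sigma> i)" by (simp add: numeral_2_eq_2)
    ultimately show ?thesis using assms ne[OF m] ne2 by (auto simp: inj_on_def)
  qed
qed

lemma csum_lt:
  assumes "i \<in> nd" "j \<in> nd"
  shows "csum T i j = (\<Sum>r<M. cartan T (sig T r i) j)"
proof -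
  have "csum T j i = (\<Sum>r<M. cartan T j (sig T r i))"
  proof -
    have "(\<Sum>r<M. cartan T j (sig T r i)) + cartan T j (sig T M i) =
       cartan T j (sig T 0 i) + (\<Sum>r = 1..M. cartan T j (sig T r i))"
      using sum.atLeast_Suc_atMost[of 0 M "\<lambda>r. cartan T j (sig T r i)"]
      by (simp add: lessThan_Suc_atMost[symmetric] atLeast0AtMost del: sig_simps)
    then show ?thesis using sig_M[OF assms(1)] by (simp add: csum_def)
  qed
  then show ?thesis using csum_sym[OF assms] by (simp add: cartan_sym)
qed

lemma csum_fixed: "i \<in> nd \<Longrightarrow> j \<in> nd \<Longrightarrow> \<sigma> i = i \<Longrightarrow> csum T i j = int M * cartan T i j"
  by (simp add: csum_lt sig_fixed)

lemma orb_fixed: "i \<in> nd \<Longrightarrow> \<sigma> i = i \<Longrightarrow> orb T i = {i}"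
  by (auto simp: orb_iff sig_fixed)

lemma csum_nonfixed:
  assumes "i \<in> nd" "j \<in> nd" "\<sigma> i \<noteq> i"
  shows "csum T i j = (\<Sum>l\<in>orb T i. cartan T l j)"
  unfolding csum_lt[OF assms(1,2)] orb_def
  by (simp add: sum.reindex[OF sig_inj_lt[OF assms(1,3)]])

lemma fixed_orb: "i \<in> nd \<Longrightarrow> j \<in> orb T i \<Longrightarrow> \<sigma> j = j \<longleftrightarrow> \<sigma> i = i"
proof -
  assume i: "i \<in> nd" and "j \<in> orb T i"
  then obtain r where j: "j = sig T r i" using orb_iff by blast
  have "sig T s a = sig T s b \<Longrightarrow> a \<in> nd \<Longrightarrow> b \<in> nd \<Longrightarrow> a = b" for s a b
    by (induction s) (auto simp: aut_inj)
  note inj = this[of r "\<sigma> i" i]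
  show ?thesis
  proof
    assume "\<sigma> j = j"
    then show "\<sigma> i = i" using inj i by (simp only: j sig_aut aut_nodes)
  next
    assume "\<sigma> i = i"
    then show "\<sigma> j = j" by (simp only: j sig_aut[symmetric])
  qed
qed

text \<open>For a fixed node \<open>csum\<close> is M times the Cartan entry, otherwise it is the
  sum of Cartan entries over the orbit. Questions about the folded form thus become questions about
  the simply laced Cartan matrix, with weight M at fixed nodes.\<close>

lemma csum_expand:
  assumes "j \<in> nd"
  shows "(\<Sum>P\<in>Isig T. a P * csum T (rep P) j) =
     (\<Sum>i\<in>nd. a (orb T i) * (if \<sigma> i = i then int M else 1) * cartan T i j)"
proof -
  have 1: "a P * csum T (rep P) j = (\<Sum>i\<in>P. a (orb T i) * (if \<sigma> i = i then int M else 1) * cartan T i j)"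
    if P: "P \<in> Isig T" for P
  proof (cases "\<sigma> (rep P) = rep P")
    case True
    then have "P = {rep P}" using orb_fixed rep_in[OF P] by metis
    then obtain p where p: "P = {p}" by blast
    have r: "rep P = p" by (simp add: rep_def p)
    have "p \<in> nd" "orb T p = P" using rep_in[OF P] by (simp_all add: r)
    then show ?thesis using True assms by (simp add: csum_fixed p r[unfolded p])
  next
    case False
    have "csum T (rep P) j = (\<Sum>i\<in>P. cartan T i j)"
      using csum_nonfixed[OF rep_in(2)[OF P] assms False] rep_in(3)[OF P] by simp
    moreover have "a (orb T i) * (if \<sigma> i = i then int M else 1) = a P" if "i \<in> P" for i
      using that False fixed_orb[OF rep_in(2)[OF P], of i] rep_in(3)[OF P] mem_Isig[OF P that] by simp
    ultimately show ?thesis by (simp add: sum_distrib_left)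
  qed
  have "nd = \<Union> (Isig T)"
    using mem_Isig IsigI orb_self by blast
  moreover have "(\<Sum>i\<in>\<Union> (Isig T). g i) = (\<Sum>P\<in>Isig T. \<Sum>i\<in>P. g i)" for g :: "nat \<Rightarrow> int"
    by (subst sum.Union_disjoint) (auto simp: mem_Isig intro: finite_subset[OF _ finite_nodes] dest: mem_Isig)
  ultimately show ?thesis using 1 by simp
qed

lemma row_sum:
  assumes "j \<in> nd"
  shows "(\<Sum>i\<in>nd. g i * cartan T i j) = 2 * g j - (\<Sum>i\<in>{i\<in>nd. adj T i j}. g i)"
proof -
  have "(\<Sum>i\<in>nd. g i * cartan T i j) = g j * cartan T j j + (\<Sum>i\<in>nd - {j}. g i * cartan T i j)"
    using assms by (simp add: sum.remove)
  also have "(\<Sum>i\<in>nd - {j}. g i * cartan T i j) = (\<Sum>i\<in>{i\<in>nd. adj T i j}. - g i)"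
    by (rule sum.mono_neutral_cong_right) (auto simp: cartan_adj adj_def)
  finally show ?thesis by (simp add: cartan_adj sum_negf)
qed

section \<open>Classification of the automorphism, type by type\<close>

lemma M2I: assumes "\<And>i. i \<in> nd \<Longrightarrow> \<sigma> (\<sigma> i) = i" shows "M = 2"
proof (rule ccontr)
  assume "M \<noteq> 2"
  then have m: "M = 3" using M_cases by simp
  have "\<sigma> i = i" if "i \<in> nd" for i
    using sig_M[OF that] assms[of "i"] that by (simp add: m eval_nat_numeral)
  then show False using nontrivial by auto
qed

lemma nodes_A: "dtype T = TypeA m \<Longrightarrow> nd = {1..m} \<and> 2 \<le> m"
  and nodes_D: "dtype T = TypeD m \<Longrightarrow> nd = {1..m} \<and> 4 \<le> m"
  and nodes_E: "dtype T = TypeE6 \<Longrightarrow> nd = {1..6}"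
  using valid by (auto simp: nodes_def valid_datum_def)

lemma class_A:
  assumes dt: "dtype T = TypeA m"
  shows "M = 2" "\<And>i. i \<in> {1..m} \<Longrightarrow> \<sigma> i = m + 1 - i"
proof -
  have nd: "nd = {1..m}" and m2: "2 \<le> m" using nodes_A[OF dt] by auto
  note adj = adj_A[OF dt]
  have sn: "1 \<le> \<sigma> i \<and> \<sigma> i \<le> m" if "1 \<le> i" "i \<le> m" for i
    using aut_nodes[of i] that unfolding nd by auto
  have inj: "\<sigma> i = \<sigma> j \<longleftrightarrow> i = j" if "1 \<le> i" "i \<le> m" "1 \<le> j" "j \<le> m" for i j
    using aut_inj[of i j] that unfolding nd by auto
  have step: "\<sigma> j = \<sigma> i + 1 \<or> \<sigma> i = \<sigma> j + 1" if "1 \<le> i" "j = i + 1" "j \<le> m" for i j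
    using adj_aut[of i j] that unfolding nd adj by auto
  \<comment> \<open>An interior image would have two neighbours, whereas 1 has only one.\<close>
  have end1: "\<sigma> 1 = 1 \<or> \<sigma> 1 = m"
  proof (rule ccontr)
    assume "\<not> ?thesis"
    then have s: "1 < \<sigma> 1" "\<sigma> 1 < m" using sn[of 1] m2 by auto
    obtain a where a: "a \<in> nd" "\<sigma> a = \<sigma> 1 - 1" using aut_surj[of "\<sigma> 1 - 1"] s unfolding nd by fastforce
    obtain b where b: "b \<in> nd" "\<sigma> b = \<sigma> 1 + 1" using aut_surj[of "\<sigma> 1 + 1"] s unfolding nd by fastforce
    have "adj T (\<sigma> a) (\<sigma> 1)" "adj T (\<sigma> b) (\<sigma> 1)" unfolding a b adj using s by auto
    moreover have "1 \<in> nd" using m2 unfolding nd by simp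
    ultimately have "adj T a 1" "adj T b 1" using adj_aut a(1) b(1) by blast+
    then have "a = 2" "b = 2" unfolding adj by auto
    then show False using a b by simp
  qed
  \<comment> \<open>A fixed end propagates along the chain and would make the automorphism
    trivial.\<close>
  have not1: "\<sigma> 1 \<noteq> 1"
  proof
    assume 1: "\<sigma> 1 = 1"
    have "1 \<le> i \<Longrightarrow> i \<le> m \<Longrightarrow> \<sigma> i = i" for i
    proof (induction i rule: less_induct)
      case (less i)
      show ?case
      proof (cases "i = 1")
        case False
        then obtain j where j: "i = j + 1" "1 \<le> j" using less by (metis le_add_diff_inverse2 nat_less_le le_add_diff_inverse add.commute less_iff_Suc_add plus_1_eq_Suc le_add1)
        have "\<sigma> j = j" using less j by auto
        then consider "\<sigma> i = j + 1" | "j = \<sigma> i + 1" using step[of j i] j less by auto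
        then show ?thesis
        proof cases
          case 2
          then have "\<sigma> (\<sigma> i) = \<sigma> i" using less j sn[of i] by auto
          then have "\<sigma> i = i" using inj[of "\<sigma> i" i] less sn[of i] by auto
          then show ?thesis .
        qed (use j in auto)
      qed (use 1 in auto)
    qed
    then show False using nontrivial unfolding nd by auto
  qed
  have s: "1 \<le> i \<Longrightarrow> i \<le> m \<Longrightarrow> \<sigma> i = m + 1 - i" for i
  proof (induction i rule: less_induct)
    case (less i)
    show ?case
    proof (cases "i = 1")
      case True
      then show ?thesis using end1 not1 by auto
    next
      case False
      define j where "j = i - 1"
      have j: "i = j + 1" "1 \<le> j" using False less by (auto simp: j_def)
      have sj: "\<sigma> j = m + 1 - j" using less j by auto
      then consider "m + 1 - j = \<sigma> i + 1" | "\<sigma> i = m + 1 - j + 1" using step[of j i] j less by auto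
      then show ?thesis
      proof cases
        case 2
        then have "2 \<le> j" using sn[of i] less j by auto
        then have "\<sigma> (j - 1) = m + 1 - (j - 1)" using less(1)[of "j - 1"] less(2,3) j by auto
        then have "\<sigma> (j - 1) = \<sigma> i" using 2 \<open>2 \<le> j\<close> less j by auto
        then show ?thesis using inj[of "j - 1" i] less j \<open>2 \<le> j\<close> by auto
      qed (use j less in auto)
    qed
  qed
  then show "\<And>i. i \<in> {1..m} \<Longrightarrow> \<sigma> i = m + 1 - i" by auto
  show "M = 2"
  proof (rule M2I)
    fix i assume "i \<in> nd"
    then show "\<sigma> (\<sigma> i) = i" using s[of i] s[of "m + 1 - i"] unfolding nd by auto
  qed
qed

text \<open>The trivalent node \<open>m - 2\<close> is fixed and its three neighbours are permuted.
  If \<open>m - 3\<close> is fixed as well, so is the whole tail and the two short legs are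
  exchanged; otherwise the diagram has to be that of \<open>D_4\<close>.\<close>

lemma class_D:
  assumes dt: "dtype T = TypeD m"
  shows "(M = 2 \<and> (\<forall>i. 1 \<le> i \<and> i \<le> m - 2 \<longrightarrow> \<sigma> i = i) \<and> \<sigma> (m - 1) = m \<and> \<sigma> m = m - 1) \<or>
    (m = 4 \<and> \<sigma> 2 = 2 \<and> ((M = 2 \<and> (\<sigma> 1, \<sigma> 3, \<sigma> 4) \<in> {(3, 1, 4), (4, 3, 1)}) \<or>
       (M = 3 \<and> (\<sigma> 1, \<sigma> 3, \<sigma> 4) \<in> {(3, 4, 1), (4, 1, 3)})))"
proof -
  have nd: "nd = {1..m}" and m4: "4 \<le> m" using nodes_D[OF dt] by auto
  note adj = adj_D[OF dt m4]
  have sn: "1 \<le> \<sigma> i \<and> \<sigma> i \<le> m" if "1 \<le> i" "i \<le> m" for i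
    using aut_nodes[of i] that unfolding nd by auto
  have inj: "\<sigma> i = \<sigma> j \<longleftrightarrow> i = j" if "1 \<le> i" "i \<le> m" "1 \<le> j" "j \<le> m" for i j
    using aut_inj[of i j] that unfolding nd by auto
  have ad: "adj T (\<sigma> i) (\<sigma> j)" if "adj T i j" "1 \<le> i" "i \<le> m" "1 \<le> j" "j \<le> m" for i j
    using adj_aut[of i j] that unfolding nd by auto
  have centre: "s = m - 2" if "adj T a s" "adj T b s" "adj T d s" "a \<noteq> b" "b \<noteq> d" "a \<noteq> d" for s a b d
    using that m4 unfolding adj by auto
  have leaf: "\<not> (adj T a s \<and> adj T b s \<and> a \<noteq> b)" if "s = m - 1 \<or> s = m" for a b s
    using that m4 unfolding adj by auto
  have c: "\<sigma> (m - 2) = m - 2"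
  proof (rule centre)
    show "adj T (\<sigma> (m - 3)) (\<sigma> (m - 2))" "adj T (\<sigma> (m - 1)) (\<sigma> (m - 2))" "adj T (\<sigma> m) (\<sigma> (m - 2))"
      by (rule ad; use m4 in \<open>auto simp: adj\<close>)+
  qed (use m4 in \<open>auto simp: inj\<close>)
  have nb: "\<sigma> i \<in> {m - 3, m - 1, m}" if "i \<in> {m - 3, m - 1, m}" for i
  proof -
    have "adj T (\<sigma> i) (\<sigma> (m - 2))" by (rule ad) (use that m4 in \<open>auto simp: adj\<close>)
    then show ?thesis unfolding c using m4 by (auto simp: adj)
  qed
  have ne: "\<sigma> (m - 3) \<noteq> \<sigma> (m - 1)" "\<sigma> (m - 3) \<noteq> \<sigma> m" "\<sigma> (m - 1) \<noteq> \<sigma> m"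
    using m4 by (auto simp: inj)
  show ?thesis
  proof (cases "\<sigma> (m - 3) = m - 3")
    case True
    have fx: "n \<le> m - 3 \<Longrightarrow> \<sigma> (m - 2 - n) = m - 2 - n" for n
    proof (induction n rule: less_induct)
      case (less n)
      show ?case
      proof (cases "n \<le> 1")
        case True
        then consider "n = 0" | "n = 1" by linarith
        then show ?thesis
          using c \<open>\<sigma> (m - 3) = m - 3\<close> by cases (simp_all add: numeral_3_eq_3 numeral_2_eq_2)
      next
        case False
        define j where "j = m - 2 - n"
        have j: "1 \<le> j" "j + 2 \<le> m - 2" using less False by (auto simp: j_def)
        have e: "m - 2 - (n - 1) = j + 1" "m - 2 - (n - 2) = j + 2" using less False by (auto simp: j_def)
        have f1: "\<sigma> (j + 1) = j + 1" using less(1)[of "n - 1"] less(2) False unfolding e by auto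
        have f2: "\<sigma> (j + 2) = j + 2" using less(1)[of "n - 2"] less(2) False unfolding e by auto
        have "adj T (\<sigma> j) (\<sigma> (j + 1))" by (rule ad) (use j in \<open>auto simp: adj\<close>)
        then have "\<sigma> j = j \<or> \<sigma> j = j + 2" unfolding f1 adj using j m4 by auto
        then show ?thesis using f2 inj[of j "j + 2"] j by (auto simp: j_def)
      qed
    qed
    have fx: "\<sigma> i = i" if "1 \<le> i" "i \<le> m - 2" for i
    proof -
      have "m - 2 - (m - 2 - i) = i" "m - 2 - i \<le> m - 3" using that by auto
      then show ?thesis using fx[of "m - 2 - i"] by metis
    qed
    have "\<sigma> (m - 1) \<noteq> m - 1"
    proof
      assume a: "\<sigma> (m - 1) = m - 1"
      then have "\<sigma> m = m" using nb[of m] ne True by auto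
      then have "\<sigma> i = i" if "i \<in> nd" for i
        using fx[of i] that a unfolding nd by (cases "i = m - 1 \<or> i = m") auto
      then show False using nontrivial by auto
    qed
    then have sw: "\<sigma> (m - 1) = m" "\<sigma> m = m - 1" using nb[of "m - 1"] nb[of m] ne True by auto
    have "M = 2"
    proof (rule M2I)
      fix i assume "i \<in> nd"
      then show "\<sigma> (\<sigma> i) = i" using fx[of i] sw unfolding nd by (cases "i = m - 1 \<or> i = m") auto
    qed
    then show ?thesis using fx sw by auto
  next
    case False
    \<comment> \<open>If \<open>m - 3\<close> moves, it goes to an end node, which has a single
      neighbour; for \<open>m \<ge> 5\<close> the node \<open>m - 3\<close> has two.\<close>
    have m: "m = 4"
    proof (rule ccontr)
      assume "m \<noteq> 4"
      then have m5: "5 \<le> m" using m4 by simp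
      have "m - 4 + 1 = m - 3" "m - 3 + 1 = m - 2" "m - 3 \<le> m - 1" "m - 2 \<le> m - 1" using m5 by linarith+
      then have "adj T (m - 4) (m - 3)" "adj T (m - 2) (m - 3)"
        unfolding adj using m5 by simp_all
      then have "adj T (\<sigma> (m - 4)) (\<sigma> (m - 3))" "adj T (\<sigma> (m - 2)) (\<sigma> (m - 3))"
        using m5 ad by simp_all
      moreover have "\<sigma> (m - 4) \<noteq> \<sigma> (m - 2)" using m5 inj[of "m - 4" "m - 2"] by simp
      moreover have "\<sigma> (m - 3) = m - 1 \<or> \<sigma> (m - 3) = m" using nb[of "m - 3"] False by auto
      ultimately show False using leaf by blast
    qed
    have c2: "\<sigma> 2 = 2" using c m by simp
    have s1: "\<sigma> 1 = 3 \<or> \<sigma> 1 = 4" using nb[of 1] False m by auto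
    have s3: "\<sigma> 3 = 1 \<or> \<sigma> 3 = 3 \<or> \<sigma> 3 = 4" using nb[of 3] m by auto
    have s4: "\<sigma> 4 = 1 \<or> \<sigma> 4 = 3 \<or> \<sigma> 4 = 4" using nb[of 4] m by auto
    have d: "\<sigma> 1 \<noteq> \<sigma> 3" "\<sigma> 1 \<noteq> \<sigma> 4" "\<sigma> 3 \<noteq> \<sigma> 4" using ne m by auto
    have M2: "M = 2 \<Longrightarrow> i \<in> {1..4} \<Longrightarrow> \<sigma> (\<sigma> i) = i" and M3: "M = 3 \<Longrightarrow> i \<in> {1..4} \<Longrightarrow> \<sigma> (\<sigma> (\<sigma> i)) = i" for i
      using sig_M[of i] unfolding nd m by (auto simp: eval_nat_numeral)
    show ?thesis
      using M_cases
    proof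
      assume M: "M = 2"
      have x: "\<sigma> (\<sigma> 1) = 1" "\<sigma> (\<sigma> 3) = 3" "\<sigma> (\<sigma> 4) = 4" by (rule M2[OF M]; simp)+
      have "(\<sigma> 1, \<sigma> 3, \<sigma> 4) \<in> {(3, 1, 4), (4, 3, 1)}"
        using s1
      proof
        assume 1: "\<sigma> 1 = 3"
        then show ?thesis using x(1) s4 d by auto
      next
        assume 1: "\<sigma> 1 = 4"
        then show ?thesis using x(1) s3 d by auto
      qed
      then show ?thesis using m M c2 by blast
    next
      assume M: "M = 3"
      have x: "\<sigma> (\<sigma> (\<sigma> 1)) = 1" by (rule M3[OF M]) simp
      have "(\<sigma> 1, \<sigma> 3, \<sigma> 4) \<in> {(3, 4, 1), (4, 1, 3)}"
        using s1
      proof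
        assume 1: "\<sigma> 1 = 3"
        have "\<sigma> 3 \<noteq> 1"
        proof
          assume "\<sigma> 3 = 1"
          then show False using x unfolding 1 by (simp add: 1[unfolded One_nat_def])
        qed
        then have 3: "\<sigma> 3 = 4" using s3 d 1 by auto
        then show ?thesis using x unfolding 1 by (simp add: 3)
      next
        assume 1: "\<sigma> 1 = 4"
        have "\<sigma> 4 \<noteq> 1"
        proof
          assume "\<sigma> 4 = 1"
          then show False using x unfolding 1 by (simp add: 1[unfolded One_nat_def])
        qed
        then have 4: "\<sigma> 4 = 3" using s4 d 1 by auto
        then show ?thesis using x unfolding 1 by (simp add: 4)
      qed
      then show ?thesis using m M c2 by blast
    qed
  qed
qed

text \<open>Node 4 is the only one with three neighbours and node 2 the only end among these, so
  both are fixed. The two long legs can only be exchanged.\<close>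

lemma class_E:
  assumes dt: "dtype T = TypeE6"
  shows "M = 2 \<and> \<sigma> 1 = 6 \<and> \<sigma> 2 = 2 \<and> \<sigma> 3 = 5 \<and> \<sigma> 4 = 4 \<and> \<sigma> 5 = 3 \<and> \<sigma> 6 = 1"
proof -
  have nd: "nd = {1..6}" using nodes_E[OF dt] by auto
  have nd': "nd = {1, 2, 3, 4, 5, 6}" unfolding nd by auto
  note adj = adj_E[OF dt]
  have sn: "\<sigma> i \<in> {1, 2, 3, 4, 5, 6}" if "i \<in> {1, 2, 3, 4, 5, 6}" for i
    using aut_nodes[of i] that unfolding nd' .
  have inj: "\<sigma> i = \<sigma> j \<longleftrightarrow> i = j" if "i \<in> {1, 2, 3, 4, 5, 6}" "j \<in> {1, 2, 3, 4, 5, 6}" for i j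
    using aut_inj[of i j] that unfolding nd' by auto
  have ad: "adj T (\<sigma> i) (\<sigma> j)" if "adj T i j" for i j
  proof -
    have "i \<in> nd" "j \<in> nd" using that unfolding nd' adj by auto
    then show ?thesis using adj_aut that by blast
  qed
  have a: "adj T (\<sigma> 1) (\<sigma> 3)" "adj T (\<sigma> 3) (\<sigma> 4)" "adj T (\<sigma> 5) (\<sigma> 4)" "adj T (\<sigma> 6) (\<sigma> 5)" "adj T (\<sigma> 2) (\<sigma> 4)"
    by (rule ad; simp add: adj)+
  have ne: "\<sigma> 3 \<noteq> \<sigma> 5" "\<sigma> 3 \<noteq> \<sigma> 2" "\<sigma> 5 \<noteq> \<sigma> 2" "\<sigma> 1 \<noteq> \<sigma> 4" "\<sigma> 6 \<noteq> \<sigma> 4"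
    by (simp_all add: inj)
  have adj': "adj T x s \<longleftrightarrow> (s = 1 \<and> x = 3) \<or> (s = 2 \<and> x = 4) \<or> (s = 3 \<and> (x = 1 \<or> x = 4)) \<or>
     (s = 4 \<and> (x = 2 \<or> x = 3 \<or> x = 5)) \<or> (s = 5 \<and> (x = 4 \<or> x = 6)) \<or> (s = 6 \<and> x = 5)" for x s
    unfolding adj by auto
  have two: "\<exists>u v. \<forall>x. adj T x s \<longrightarrow> x = u \<or> x = v" if "s \<noteq> 4" for s
  proof -
    consider "s = 3" | "s = 5" | "s \<noteq> 3" "s \<noteq> 5" by blast
    then show ?thesis
    proof cases
      case 1
      then show ?thesis by (intro exI[of _ 1] exI[of _ 4]) (simp add: adj')
    next
      case 2
      then show ?thesis by (intro exI[of _ 4] exI[of _ 6]) (simp add: adj')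
    next
      case 3
      then show ?thesis
        by (intro exI[of _ "if s = 1 then 3 else if s = 2 then 4 else 5"]) (simp add: adj' that)
    qed
  qed
  have s4: "\<sigma> 4 = 4"
    using two[of "\<sigma> 4"] a(2,3,5) ne(1-3) by metis
  have n4: "x = 2 \<or> x = 3 \<or> x = 5" if "adj T x 4" for x using that unfolding adj' by simp
  have n: "\<sigma> 3 = 2 \<or> \<sigma> 3 = 3 \<or> \<sigma> 3 = 5" "\<sigma> 5 = 2 \<or> \<sigma> 5 = 3 \<or> \<sigma> 5 = 5" "\<sigma> 2 = 2 \<or> \<sigma> 2 = 3 \<or> \<sigma> 2 = 5"
    using a(2,3,5) unfolding s4 by (auto dest: n4)
  have n2: "x = 4" if "adj T x 2" for x using that unfolding adj' by simp
  have "\<sigma> 3 \<noteq> 2" using n2[of "\<sigma> 1"] a(1) ne(4) s4 by metis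
  moreover have "\<sigma> 5 \<noteq> 2" using n2[of "\<sigma> 6"] a(4) ne(5) s4 by metis
  ultimately have s35: "(\<sigma> 3 = 3 \<and> \<sigma> 5 = 5) \<or> (\<sigma> 3 = 5 \<and> \<sigma> 5 = 3)" and s2: "\<sigma> 2 = 2"
    using n ne by auto
  have n35: "x = 1" if "adj T x 3" "x \<noteq> 4" for x using that unfolding adj' by simp
  have n53: "x = 6" if "adj T x 5" "x \<noteq> 4" for x using that unfolding adj' by simp
  have s: "\<sigma> 3 = 5 \<and> \<sigma> 5 = 3 \<and> \<sigma> 1 = 6 \<and> \<sigma> 6 = 1"
    using s35
  proof
    assume b: "\<sigma> 3 = 3 \<and> \<sigma> 5 = 5"
    then have "\<sigma> 1 = 1" "\<sigma> 6 = 6" using n35[of "\<sigma> 1"] n53[of "\<sigma> 6"] a(1,4) ne(4,5) s4 by metis+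
    then have "\<sigma> i = i" if "i \<in> nd" for i
      using that s2 s4 b unfolding nd' by auto
    then show ?thesis using nontrivial by auto
  next
    assume b: "\<sigma> 3 = 5 \<and> \<sigma> 5 = 3"
    then have "\<sigma> 1 = 6" "\<sigma> 6 = 1" using n53[of "\<sigma> 1"] n35[of "\<sigma> 6"] a(1,4) ne(4,5) s4 by metis+
    then show ?thesis using b by simp
  qed
  have "M = 2"
  proof (rule M2I)
    fix i assume "i \<in> nd"
    then consider "i = 1" | "i = 2" | "i = 3" | "i = 4" | "i = 5" | "i = 6" unfolding nd' by blast
    then show "\<sigma> (\<sigma> i) = i" by cases (simp_all only: s s2 s4)
  qed
  then show ?thesis using s s2 s4 by simp
qed

text \<open>Connectedness of the Dynkin diagram as an induction principle.\<close>

lemma node_induct: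
  assumes S: "a \<in> S" "a \<in> nd" and step: "\<And>i j. i \<in> S \<Longrightarrow> i \<in> nd \<Longrightarrow> j \<in> nd \<Longrightarrow> adj T i j \<Longrightarrow> j \<in> S"
    and i: "i \<in> nd"
  shows "i \<in> S"
proof -
  \<comment> \<open>Walk along an interval of consecutively joined nodes, in either direction;
    \<open>h\<close> only ensures that the interval consists of nodes.\<close>
  have up: "b \<in> S" if "lo \<le> a'" "a' \<le> hi" "a' \<in> S" "lo \<le> b" "b \<le> hi" "1 \<le> lo" "hi \<le> h" "{1..h} \<subseteq> nd"
    "\<And>i. lo \<le> i \<Longrightarrow> i < hi \<Longrightarrow> adj T i (i + 1)" for a' lo hi b h
  proof (cases "a' \<le> b")
    case True
    have "a' + n \<le> hi \<Longrightarrow> a' + n \<in> S" for n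
    proof (induction n)
      case (Suc n)
      have x: "a' + n \<in> {1..h}" "a' + Suc n \<in> {1..h}" using that Suc by auto
      have "adj T (a' + n) (a' + n + 1)" by (rule that(9)) (use that Suc in auto)
      moreover have "a' + n \<in> nd" "a' + Suc n \<in> nd" using x that(8) by blast+
      ultimately show ?case using step[of "a' + n" "a' + Suc n"] Suc by auto
    qed (use that in auto)
    from this[of "b - a'"] show ?thesis using True that by auto
  next
    case False
    have "lo \<le> a' - n \<Longrightarrow> n < a' \<Longrightarrow> a' - n \<in> S" for n
    proof (induction n)
      case (Suc n)
      have x: "a' - n \<in> {1..h}" "a' - Suc n \<in> {1..h}" using that Suc by auto
      have "adj T (a' - Suc n) (a' - Suc n + 1)" by (rule that(9)) (use that Suc in auto)
      moreover have "a' - Suc n + 1 = a' - n" using Suc by auto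
      ultimately have "adj T (a' - n) (a' - Suc n)" using adj_sym by metis
      moreover have "a' - n \<in> nd" "a' - Suc n \<in> nd" using x that(8) by blast+
      ultimately show ?case using step[of "a' - n" "a' - Suc n"] Suc by auto
    qed (use that in auto)
    from this[of "a' - b"] show ?thesis using False that by auto
  qed
  show ?thesis
  proof (cases "dtype T")
    case (TypeA m)
    have nd: "nd = {1..m}" using nodes_A[OF TypeA] by auto
    show ?thesis
      by (rule up[of 1 a m i m]) (use S i nd in \<open>auto simp: adj_A[OF TypeA]\<close>)
  next
    case (TypeD m)
    have nd: "nd = {1..m}" and m: "4 \<le> m" using nodes_D[OF TypeD] by auto
    note adj = adj_D[OF TypeD m]
    have "m - 2 \<in> S"
    proof (cases "a = m")
      case True
      then show ?thesis using step[of m "m - 2"] S m unfolding nd adj by auto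
    next
      case False
      show ?thesis by (rule up[of 1 a "m - 1" "m - 2" m]) (use S False m nd in \<open>auto simp: adj\<close>)
    qed
    show ?thesis
    proof (cases "i = m")
      case True
      then show ?thesis using step[of "m - 2" m] \<open>m - 2 \<in> S\<close> m unfolding nd adj by auto
    next
      case False
      show ?thesis
      proof (rule up[of 1 "m - 2" "m - 1" i m])
        show "i \<le> m - 1" "1 \<le> i" using i False nd by auto
        show "adj T i (i + 1)" if "1 \<le> i" "i < m - 1" for i using that by (simp add: adj)
      qed (use m nd \<open>m - 2 \<in> S\<close> in simp_all)
    qed
  next
    case TypeE6
    have nd: "nd = {1, 2, 3, 4, 5, 6}" unfolding nodes_E[OF TypeE6] by auto
    note adj = adj_E[OF TypeE6]
    have st: "i \<in> S \<longleftrightarrow> j \<in> S" if "adj T i j" for i j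
    proof -
      have "i \<in> nd" "j \<in> nd" using that unfolding adj nd by auto
      moreover have "adj T j i" using that adj_sym by blast
      ultimately show ?thesis using step[of i j] step[of j i] that by blast
    qed
    have "adj T 1 3" "adj T 3 4" "adj T 4 5" "adj T 5 6" "adj T 2 4"
      by (simp_all add: adj)
    note e = this[THEN st]
    from i have "i = 1 \<or> i = 2 \<or> i = 3 \<or> i = 4 \<or> i = 5 \<or> i = 6" unfolding nd by blast
    moreover from S(2) have "a = 1 \<or> a = 2 \<or> a = 3 \<or> a = 4 \<or> a = 5 \<or> a = 6" unfolding nd by blast
    then have "4 \<in> S" using S(1) e by metis
    ultimately show ?thesis using e by metis
  qed
qed

section \<open>Nondegeneracy of the Cartan matrix and of the folded form\<close>

lemma nbr_A:
  fixes g :: "nat \<Rightarrow> int"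
  assumes dt: "dtype T = TypeA m" and j: "1 \<le> j" "j \<le> m"
  shows "(\<Sum>i\<in>{i\<in>nd. adj T i j}. g i) = (if 1 < j then g (j - 1) else 0) + (if j < m then g (j + 1) else 0)"
proof -
  have nd: "nd = {1..m}" using nodes_A[OF dt] by auto
  have "{i\<in>nd. adj T i j} = (if 1 < j then {j - 1} else {}) \<union> (if j < m then {j + 1} else {})"
    unfolding nd adj_A[OF dt] using j by auto
  then show ?thesis using j by (auto simp: sum.insert_if)
qed

lemma nbr_D:
  fixes g :: "nat \<Rightarrow> int"
  assumes dt: "dtype T = TypeD m"
  shows "1 \<le> j \<Longrightarrow> j < m - 2 \<Longrightarrow>
      (\<Sum>i\<in>{i\<in>nd. adj T i j}. g i) = (if 1 < j then g (j - 1) else 0) + g (j + 1)"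
    and "(\<Sum>i\<in>{i\<in>nd. adj T i (m - 2)}. g i) = g (m - 3) + g (m - 1) + g m"
    and "(\<Sum>i\<in>{i\<in>nd. adj T i (m - 1)}. g i) = g (m - 2)"
    and "(\<Sum>i\<in>{i\<in>nd. adj T i m}. g i) = g (m - 2)"
proof -
  have nd: "nd = {1..m}" and m: "4 \<le> m" using nodes_D[OF dt] by auto
  note ad = adj_D[OF dt m]
  have "{i\<in>nd. adj T i (m - 2)} = {m - 3, m - 1, m}"
    unfolding nd ad using m by auto
  moreover have "m - 3 \<noteq> m - 1" "m - 3 \<noteq> m" "m - 1 \<noteq> m" using m by auto
  ultimately show "(\<Sum>i\<in>{i\<in>nd. adj T i (m - 2)}. g i) = g (m - 3) + g (m - 1) + g m" by simp
  have "{i\<in>nd. adj T i (m - 1)} = {m - 2}" unfolding nd ad using m by auto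
  then show "(\<Sum>i\<in>{i\<in>nd. adj T i (m - 1)}. g i) = g (m - 2)" by simp
  have "{i\<in>nd. adj T i m} = {m - 2}" unfolding nd ad using m by auto
  then show "(\<Sum>i\<in>{i\<in>nd. adj T i m}. g i) = g (m - 2)" by simp
  assume j: "1 \<le> j" "j < m - 2"
  have "{i\<in>nd. adj T i j} = (if 1 < j then {j - 1} else {}) \<union> {j + 1}"
    unfolding nd ad using j by auto
  then show "(\<Sum>i\<in>{i\<in>nd. adj T i j}. g i) = (if 1 < j then g (j - 1) else 0) + g (j + 1)"
    using j by (auto simp: sum.insert_if)
qed

lemma nbr_E:
  fixes g :: "nat \<Rightarrow> int"
  assumes dt: "dtype T = TypeE6"
  shows "(\<Sum>i\<in>{i\<in>nd. adj T i 1}. g i) = g 3" "(\<Sum>i\<in>{i\<in>nd. adj T i 2}. g i) = g 4"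
    "(\<Sum>i\<in>{i\<in>nd. adj T i 3}. g i) = g 1 + g 4" "(\<Sum>i\<in>{i\<in>nd. adj T i 4}. g i) = g 2 + g 3 + g 5"
    "(\<Sum>i\<in>{i\<in>nd. adj T i 5}. g i) = g 4 + g 6" "(\<Sum>i\<in>{i\<in>nd. adj T i 6}. g i) = g 5"
proof -
  have "{i\<in>nd. adj T i 1} = {3}" "{i\<in>nd. adj T i 2} = {4}" "{i\<in>nd. adj T i 3} = {1, 4}"
    "{i\<in>nd. adj T i 4} = {2, 3, 5}" "{i\<in>nd. adj T i 5} = {4, 6}" "{i\<in>nd. adj T i 6} = {5}"
    unfolding nodes_E[OF dt] adj_E[OF dt] by auto
  then show "(\<Sum>i\<in>{i\<in>nd. adj T i 1}. g i) = g 3" "(\<Sum>i\<in>{i\<in>nd. adj T i 2}. g i) = g 4"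
    "(\<Sum>i\<in>{i\<in>nd. adj T i 3}. g i) = g 1 + g 4" "(\<Sum>i\<in>{i\<in>nd. adj T i 4}. g i) = g 2 + g 3 + g 5"
    "(\<Sum>i\<in>{i\<in>nd. adj T i 5}. g i) = g 4 + g 6" "(\<Sum>i\<in>{i\<in>nd. adj T i 6}. g i) = g 5"
    by simp_all
qed

text \<open>A kernel vector on a chain is an arithmetic progression that would continue to 0 at
  position 0.\<close>

lemma linear_growth:
  fixes g :: "nat \<Rightarrow> int"
  assumes "\<And>j. 1 \<le> j \<Longrightarrow> j < n \<Longrightarrow> 2 * g j = (if 1 < j then g (j - 1) else 0) + g (j + 1)"
  shows "1 \<le> i \<Longrightarrow> i \<le> n \<Longrightarrow> g i = int i * g 1"
proof (induction i rule: less_induct)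
  case (less i)
  consider "i = 1" | "i = 2" | "3 \<le> i" using less by linarith
  then show ?case
  proof cases
    case 2
    then have "2 * g 1 = (if 1 < (1::nat) then g (1 - 1) else 0) + g (1 + 1)" using less(3) by (intro assms) auto
    then show ?thesis using 2 by (simp add: numeral_2_eq_2)
  next
    case 3
    have i: "i - 1 + 1 = i" "i - 1 - 1 = i - 2" using 3 by auto
    have "2 * g (i - 1) = g (i - 2) + g i" using assms[of "i - 1"] 3 less(2,3) unfolding i by auto
    moreover have "g (i - 1) = int (i - 1) * g 1" "g (i - 2) = int (i - 2) * g 1"
      using less(1)[of "i - 1"] less(1)[of "i - 2"] 3 less(2,3) by auto
    ultimately have "g i = (2 * int (i - 1) - int (i - 2)) * g 1" by (simp add: algebra_simps)
    then show ?thesis using 3 by (simp add: of_nat_diff)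
  qed simp
qed

text \<open>In types A and D a kernel vector grows linearly from the end node, and the equations at
  the far end force slope 0; for \<open>E_6\<close> the six equations are solved directly.\<close>

lemma nondeg_nodes:
  fixes g :: "nat \<Rightarrow> int"
  assumes z: "\<And>j. j \<in> nd \<Longrightarrow> (\<Sum>i\<in>nd. g i * cartan T i j) = 0" and i: "i \<in> nd"
  shows "g i = 0"
proof -
  have z: "2 * g j = (\<Sum>i\<in>{i\<in>nd. adj T i j}. g i)" if "j \<in> nd" for j
    using z[OF that] row_sum[OF that, of g] by simp
  show ?thesis
  proof (cases "dtype T")
    case (TypeA m)
    have nd: "nd = {1..m}" and m: "2 \<le> m" using nodes_A[OF TypeA] by auto
    have e: "2 * g j = (if 1 < j then g (j - 1) else 0) + (if j < m then g (j + 1) else 0)" if "1 \<le> j" "j \<le> m" for j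
      using z[of j] nbr_A[OF TypeA that, of g] that unfolding nd by simp
    have gr: "g i = int i * g 1" if "1 \<le> i" "i \<le> m" for i
      by (rule linear_growth[OF _ that]) (use e in simp)
    have "2 * g m = g (m - 1)" using e[of m] m by simp
    then have "2 * (int m * g 1) = int (m - 1) * g 1" using gr[of m] gr[of "m - 1"] m by simp
    then have "(2 * int m - int (m - 1)) * g 1 = 0" by (simp add: algebra_simps)
    then have "g 1 = 0" using m by (simp add: of_nat_diff)
    then show ?thesis using gr[of i] i unfolding nd by simp
  next
    case (TypeD m)
    have nd: "nd = {1..m}" and m: "4 \<le> m" using nodes_D[OF TypeD] by auto
    have gr: "g i = int i * g 1" if "1 \<le> i" "i \<le> m - 2" for i
    proof (rule linear_growth[OF _ that])
      fix j assume "1 \<le> j" "j < m - 2"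
      then show "2 * g j = (if 1 < j then g (j - 1) else 0) + g (j + 1)"
        using z[of j] nbr_D(1)[OF TypeD, of j g] unfolding nd by simp
    qed
    have a: "2 * g (m - 2) = g (m - 3) + g (m - 1) + g m" "2 * g (m - 1) = g (m - 2)" "2 * g m = g (m - 2)"
      using z[of "m - 2"] z[of "m - 1"] z[of m] nbr_D(2-)[OF TypeD, of g] m unfolding nd by auto
    have "g (m - 2) = g (m - 3)" using a by linarith
    then have "int (m - 2) * g 1 = int (m - 3) * g 1"
      using gr[of "m - 2"] gr[of "m - 3"] m by simp
    then have g1: "g 1 = 0" using m by (auto simp: of_nat_diff)
    then have "g (m - 2) = 0" using gr[of "m - 2"] m by simp
    then have "g (m - 1) = 0" "g m = 0" using a by linarith+
    then show ?thesis using gr[of i] i g1 unfolding nd by (cases "i = m - 1 \<or> i = m") auto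
  next
    case TypeE6
    have nd: "nd = {1..6}" using nodes_E[OF TypeE6] by auto
    note nb = nbr_E[OF TypeE6, of g]
    have "2 * g 1 = g 3" "2 * g 2 = g 4" "2 * g 3 = g 1 + g 4" "2 * g 4 = g 2 + g 3 + g 5"
      "2 * g 5 = g 4 + g 6" "2 * g 6 = g 5"
      using z[of 1] z[of 2] z[of 3] z[of 4] z[of 5] z[of 6] unfolding nb unfolding nd
      by (simp_all del: One_nat_def)
    then have "g 1 = 0 \<and> g 2 = 0 \<and> g 3 = 0 \<and> g 4 = 0 \<and> g 5 = 0 \<and> g 6 = 0" by linarith
    moreover have "i = 1 \<or> i = 2 \<or> i = 3 \<or> i = 4 \<or> i = 5 \<or> i = 6" using i unfolding nd by auto
    ultimately show ?thesis by metis
  qed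
qed

text \<open>Besides the uniqueness of the marks, this is why the values on the finite torus
  determine a root-lattice element up to multiples of the null root.\<close>

lemma nondegenerate:
  fixes d :: "nat set \<Rightarrow> int"
  assumes z: "\<And>Q. Q \<in> Isig T \<Longrightarrow> (\<Sum>P\<in>Isig T. d P * csum T (rep P) (rep Q)) = 0" and P: "P \<in> Isig T"
  shows "d P = 0"
proof -
  have "d (orb T i) * (if \<sigma> i = i then int M else 1) = 0" if "i \<in> nd" for i
  proof (rule nondeg_nodes[OF _ that])
    fix j assume j: "j \<in> nd"
    have "(\<Sum>P\<in>Isig T. d P * csum T (rep P) j) = (\<Sum>P\<in>Isig T. d P * csum T (rep P) (rep (orb T j)))"
      by (intro sum.cong refl arg_cong2[of _ _ _ _ "(*)"] csum_orb[symmetric])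
        (use j rep_in in \<open>auto simp: rep_in\<close>)
    also have "\<dots> = 0" by (rule z) (use j in simp)
    finally show "(\<Sum>i\<in>nd. d (orb T i) * (if \<sigma> i = i then int M else 1) * cartan T i j) = 0"
      using csum_expand[OF j, of d] by simp
  qed
  from this[OF rep_in(2)[OF P]] show ?thesis using rep_in(3)[OF P] by (auto split: if_splits)
qed

section \<open>Diagonal values, signs and divisibility of the folded form\<close>

lemma csum_le_0:
  assumes "i \<in> nd" "j \<in> nd" "orb T i \<noteq> orb T j" shows "csum T i j \<le> 0"
  unfolding csum_def
proof (rule sum_nonpos)
  fix r
  have "i \<noteq> sig T r j" using assms by auto
  then show "cartan T i (sig T r j) \<le> 0" by (simp add: cartan_adj)
qed

lemma csum_M2: "M = 2 \<Longrightarrow> i \<in> nd \<Longrightarrow> csum T i j = cartan T i (\<sigma> j) + cartan T i (\<sigma> (\<sigma> j))"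
  by (simp add: csum_def numeral_2_eq_2)

lemma csum_M3: "M = 3 \<Longrightarrow> csum T i j = cartan T i (\<sigma> j) + cartan T i (\<sigma> (\<sigma> j)) + cartan T i (\<sigma> (\<sigma> (\<sigma> j)))"
  by (simp add: csum_def numeral_3_eq_3)

lemma sig2: "M = 2 \<Longrightarrow> i \<in> nd \<Longrightarrow> \<sigma> (\<sigma> i) = i"
  using sig_M[of i] by (simp add: numeral_2_eq_2)

lemma M3_cases:
  assumes "M = 3"
  shows "dtype T = TypeD 4 \<and> nd = {1, 2, 3, 4} \<and> \<sigma> 2 = 2 \<and> (\<sigma> 1, \<sigma> 3, \<sigma> 4) \<in> {(3, 4, 1), (4, 1, 3)}"
proof (cases "dtype T")
  case (TypeA m)
  then show ?thesis using class_A(1)[OF TypeA] assms by simp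
next
  case (TypeD m)
  then have "m = 4" "\<sigma> 2 = 2" "(\<sigma> 1, \<sigma> 3, \<sigma> 4) \<in> {(3, 4, 1), (4, 1, 3)}"
    using class_D[OF TypeD] assms by auto
  moreover have "{1..4} = {1, 2, 3, 4 :: nat}" by auto
  ultimately show ?thesis using nodes_D[OF TypeD] TypeD by simp
next
  case TypeE6
  then show ?thesis using class_E[OF TypeE6] assms by simp
qed

lemma M3_nonadj:
  assumes "M = 3" "i \<in> nd" "\<sigma> i \<noteq> i" shows "cartan T i (\<sigma> i) = 0" "cartan T i (\<sigma> (\<sigma> i)) = 0"
proof -
  note c = M3_cases[OF assms(1)]
  have n2: "j \<noteq> 2 \<Longrightarrow> l \<noteq> 2 \<Longrightarrow> \<not> adj T j l" for j l
    using adj_D[of T 4 j l] c by auto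
  have f2: "\<sigma> j \<noteq> 2" if "j \<in> nd" "j \<noteq> 2" for j
  proof -
    have "2 \<in> nd" "\<sigma> 2 = 2" using c by auto
    then show ?thesis using aut_inj[of j 2] that by metis
  qed
  have i: "i \<noteq> 2" using c assms by metis
  have s: "\<sigma> i \<noteq> 2" "\<sigma> (\<sigma> i) \<noteq> 2" using f2 i assms by auto
  have "\<sigma> (\<sigma> i) \<noteq> i"
  proof
    assume "\<sigma> (\<sigma> i) = i"
    then show False using sig_M[OF assms(2)] assms by (simp add: numeral_3_eq_3)
  qed
  then show "cartan T i (\<sigma> i) = 0" "cartan T i (\<sigma> (\<sigma> i)) = 0"
    using n2[OF i s(1)] n2[OF i s(2)] assms by (auto simp: cartan_adj)
qed

lemma csum_diag_fixed: "i \<in> nd \<Longrightarrow> \<sigma> i = i \<Longrightarrow> csum T i i = 2 * int M"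
  by (simp add: csum_fixed cartan_adj)

text \<open>The value 1 is the half-integral \<open>d_i\<close> of \<open>A_{2n}^{(2)}\<close>: it
  occurs for the middle pair of nodes, which the flip exchanges while they are joined.\<close>

lemma csum_diag_nonfixed:
  assumes "i \<in> nd" "\<sigma> i \<noteq> i"
  shows "csum T i i = (if M = 2 \<and> adj T i (\<sigma> i) then 1 else 2)"
  using M_cases
proof
  assume "M = 2"
  then show ?thesis using assms by (simp add: csum_M2 sig2 cartan_adj)
next
  assume M: "M = 3"
  have "\<sigma> (\<sigma> (\<sigma> i)) = i" using sig_M[OF assms(1)] M by (simp add: numeral_3_eq_3)
  then show ?thesis using M3_nonadj[OF M assms] M by (simp add: csum_M3 cartan_adj)
qed

lemma csum_diag_pos: "i \<in> nd \<Longrightarrow> 0 < csum T i i"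
  using csum_diag_fixed[of i] csum_diag_nonfixed[of i] by (cases "\<sigma> i = i") auto

lemma csum_dvd:
  assumes "i \<in> nd" "j \<in> nd" shows "csum T i i dvd 2 * csum T i j"
proof (cases "\<sigma> i = i")
  case True
  then show ?thesis using assms by (simp add: csum_diag_fixed csum_fixed)
next
  case False
  then show ?thesis using csum_diag_nonfixed[OF assms(1) False] by auto
qed

section \<open>The affine node: its entries and the marks, checked type by type\<close>

lemma orb_M2: "M = 2 \<Longrightarrow> orb T i = {i, \<sigma> i}"
proof -
  assume "M = 2"
  then have "{..<M} = {0, Suc 0}" by auto
  then show ?thesis by (simp add: orb_def)
qed

lemma orb_M3: "M = 3 \<Longrightarrow> orb T i = {i, \<sigma> i, \<sigma> (\<sigma> i)}"
proof -
  assume "M = 3"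
  then have "{..<M} = {0, Suc 0, Suc (Suc 0)}" by auto
  then show ?thesis by (simp add: orb_def)
qed

text \<open>A certificate for one type: p is a node joined to the affine node, a the marks on
  orbits. The sums are doubled because the symmetrized matrix is twice \<open>csum\<close>. The last
  condition is the affine column divided by \<open>dd T None\<close>, the affine node itself
  contributing 2.\<close>

definition good_eps :: "nat \<Rightarrow> (nat set \<Rightarrow> nat) \<Rightarrow> bool" where
  "good_eps p a \<longleftrightarrow> p \<in> nd \<and> eps_orbit T = orb T p \<and>
     fst (eps_entries T) < 0 \<and> snd (eps_entries T) < 0 \<and>
     fst (eps_entries T) dvd csum T p p * snd (eps_entries T) \<and> (\<forall>P. 0 < a P) \<and>
     (\<forall>j\<in>nd. 2 * (\<Sum>i\<in>nd. int (a (orb T i)) * (if \<sigma> i = i then int M else 1) * cartan T i j) =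
        - (if j \<in> orb T p then csum T p p * snd (eps_entries T) else 0)) \<and>
     int (a (orb T p)) * fst (eps_entries T) = - 2"

lemma good_epsI:
  assumes "p \<in> nd" "eps_orbit T = orb T p" "eps_entries T = (u, v)" "u < 0" "v < 0"
    "csum T p p = s" "u dvd s * v" "\<And>P. 0 < a P" "int (a (orb T p)) * u = - 2"
    and g: "\<And>i. i \<in> nd \<Longrightarrow> int (a (orb T i)) * (if \<sigma> i = i then int M else 1) = g i"
    and r: "\<And>j. j \<in> nd \<Longrightarrow> 4 * g j - 2 * (\<Sum>i\<in>{i\<in>nd. adj T i j}. g i) = - (if j \<in> orb T p then s * v else 0)"
  shows "good_eps p a"
proof -
  have "2 * (\<Sum>i\<in>nd. int (a (orb T i)) * (if \<sigma> i = i then int M else 1) * cartan T i j) =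
        - (if j \<in> orb T p then s * v else 0)" if j: "j \<in> nd" for j
  proof -
    have "(\<Sum>i\<in>nd. int (a (orb T i)) * (if \<sigma> i = i then int M else 1) * cartan T i j) = (\<Sum>i\<in>nd. g i * cartan T i j)"
      by (rule sum.cong) (auto simp only: g)
    then show ?thesis using r[OF j] row_sum[OF j, of g] by simp
  qed
  then show ?thesis using assms(1-9) by (simp add: good_eps_def)
qed

lemma good_eps_A_even:
  assumes dt: "dtype T = TypeA m" and ev: "even m"
  shows "good_eps 1 (\<lambda>_. 2)"
proof -
  have nd: "nd = {1..m}" and m: "2 \<le> m" using nodes_A[OF dt] by auto
  note s = class_A(2)[OF dt] and M = class_A(1)[OF dt]
  have one: "1 \<in> nd" using m nd by simp
  have s1: "\<sigma> 1 = m" using s[of 1] m by simp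
  have nf: "\<sigma> i \<noteq> i" if "i \<in> nd" for i
  proof
    assume "\<sigma> i = i"
    then have "m + 1 = 2 * i" using s[of i] that unfolding nd by auto
    then show False using ev by presburger
  qed
  have c: "csum T 1 1 = (if m = 2 then 1 else 2)"
    unfolding csum_diag_nonfixed[OF one nf[OF one]] s1 adj_A[OF dt] using m M by auto
  show ?thesis
  proof (rule good_epsI[OF one _ _ _ _ c, where g = "\<lambda>_. 2"])
    show "eps_orbit T = orb T 1" using dt ev by (simp add: eps_orbit_def)
    show "eps_entries T = (- 1, if m = 2 then - 4 else - 2)" using dt ev by (simp add: eps_entries_def)
    show "int 2 * (if \<sigma> i = i then int M else 1) = 2" if "i \<in> nd" for i using nf[OF that] by simp
    fix j assume j: "j \<in> nd"
    then have j': "1 \<le> j" "j \<le> m" by (auto simp: nd)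
    have "j \<in> orb T 1 \<longleftrightarrow> j = 1 \<or> j = m" unfolding orb_M2[OF M] s1 by simp
    moreover have "(\<Sum>i | i \<in> nd \<and> adj T i j. 2) = ((if 1 < j then 2 else 0) + (if j < m then 2 else 0) :: int)"
      by (rule nbr_A[OF dt j', of "\<lambda>_. 2"])
    ultimately show "4 * 2 - 2 * (\<Sum>i | i \<in> nd \<and> adj T i j. 2) =
      - (if j \<in> orb T 1 then (if m = 2 then 1 else 2) * (if m = 2 then - 4 else - 2) else (0::int))"
      using j' m by auto
  qed auto
qed

text \<open>The labels of \<open>A_{2n-1}^{(2)}\<close>. The middle node is fixed, and its mark 1
  times M gives the value 2 of the interior, so g differs from 2 only at the two ends of the
  chain.\<close>

lemma good_eps_A_odd:
  assumes dt: "dtype T = TypeA m" and od: "odd m"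
  shows "good_eps 2 (\<lambda>P. if 1 \<in> P \<or> (m + 1) div 2 \<in> P then 1 else 2)"
proof -
  have nd: "nd = {1..m}" and m: "3 \<le> m" using nodes_A[OF dt] od
    by (auto, metis One_nat_def Suc_1 Suc_leI even_numeral le_neq_implies_less numeral_3_eq_3)
  note s = class_A(2)[OF dt] and M = class_A(1)[OF dt]
  obtain n where n: "m = 2 * n + 1" using od by (elim oddE)
  have two: "2 \<in> nd" using m nd by simp
  have s2: "\<sigma> 2 = m - 1" using s[of 2] m by simp
  have fx: "\<sigma> i = i \<longleftrightarrow> i = n + 1" if "i \<in> nd" for i
    using s[of i] that n unfolding nd by auto
  have h: "(m + 1) div 2 = n + 1" using n by simp
  have o: "orb T i = {i, m + 1 - i}" if "i \<in> nd" for i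
    unfolding orb_M2[OF M] using s[of i] that unfolding nd by simp
  have c: "csum T 2 2 = (if m = 3 then 4 else 2)"
  proof (cases "m = 3")
    case True
    then show ?thesis using csum_diag_fixed[OF two] fx[OF two] n M by simp
  next
    case False
    then have "4 \<le> m" "m \<noteq> 4" using m n by auto
    then have "\<sigma> 2 \<noteq> 2" "\<not> adj T 2 (\<sigma> 2)" unfolding s2 adj_A[OF dt] by auto
    then show ?thesis using csum_diag_nonfixed[OF two] False by simp
  qed
  define g where "g i = (if i = 1 \<or> i = m then 1 else 2 :: int)" for i
  show ?thesis
  proof (rule good_epsI[OF two _ _ _ _ c, where g = g])
    show "eps_orbit T = orb T 2" using dt od by (simp add: eps_orbit_def)
    have "eps_entries T = (if m = 3 then (- 2, - 1) else (- 1, - 1))" using dt od by (auto simp: eps_entries_def)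
    then show "eps_entries T = (if m = 3 then - 2 else - 1, - 1)" by simp
    show "int (if 1 \<in> orb T 2 \<or> (m + 1) div 2 \<in> orb T 2 then 1 else 2) * (if m = 3 then - 2 else - 1) = - 2"
      unfolding o[OF two] h using n m by auto
    show "int (if 1 \<in> orb T i \<or> (m + 1) div 2 \<in> orb T i then 1 else 2) * (if \<sigma> i = i then int M else 1) = g i"
      if i: "i \<in> nd" for i
      unfolding o[OF i] h fx[OF i] M g_def using i n m unfolding nd by auto
    fix j assume j: "j \<in> nd"
    then have j': "1 \<le> j" "j \<le> m" by (auto simp: nd)
    have o2: "j \<in> orb T 2 \<longleftrightarrow> j = 2 \<or> j = m - 1" unfolding orb_M2[OF M] s2 by simp
    have nb: "(\<Sum>i | i \<in> nd \<and> adj T i j. g i) = (if 1 < j then g (j - 1) else 0) + (if j < m then g (j + 1) else 0)"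
      by (rule nbr_A[OF dt j'])
    have "4 * g j - 2 * ((if 1 < j then g (j - 1) else 0) + (if j < m then g (j + 1) else 0)) =
      - (if j = 2 \<or> j = m - 1 then (if m = 3 then 4 else 2) * - 1 else (0::int))"
    proof (cases "m = 3")
      case True
      then consider "j = 1" | "j = 2" | "j = 3" using j' by linarith
      then show ?thesis by cases (simp_all add: g_def True)
    next
      case False
      then have m5: "5 \<le> m" using n m by presburger
      then consider "j = 1" | "j = 2" | "3 \<le> j" "j \<le> m - 2" | "j = m - 1" | "j = m" using j' by linarith
      then show ?thesis
      proof cases
        case 3
        then have "g j = 2" "g (j - 1) = 2" "g (j + 1) = 2" "1 < j" "j < m" "j \<noteq> 2" "j \<noteq> m - 1"
          using m5 by (auto simp: g_def)
        then show ?thesis by simp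
      next
        case 4
        have "m - 1 - 1 \<noteq> 1" "m - 1 - 1 \<noteq> m" "m - 1 \<noteq> 1" "m - 1 \<noteq> m" "m - 1 + 1 = m" "1 < m - 1" "m - 1 < m"
          using m5 by auto
        then show ?thesis unfolding 4 g_def using m5 by simp
      next
        case 5
        have "m - 1 \<noteq> 1" "m - 1 \<noteq> m" "1 < m" "m \<noteq> 2" using m5 by auto
        then show ?thesis unfolding 5 g_def using m5 by simp
      qed (use m5 in \<open>simp_all add: g_def\<close>)
    qed
    then show "4 * g j - 2 * (\<Sum>i | i \<in> nd \<and> adj T i j. g i) =
      - (if j \<in> orb T 2 then (if m = 3 then 4 else 2) * - 1 else (0::int))"
      unfolding nb o2 .
  qed (auto split: if_splits)
qed

lemma good_eps_D:
  assumes dt: "dtype T = TypeD m" and M: "M = 2"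
    and s: "\<And>i. 1 \<le> i \<Longrightarrow> i \<le> m - 2 \<Longrightarrow> \<sigma> i = i" "\<sigma> (m - 1) = m" "\<sigma> m = m - 1"
  shows "good_eps 1 (\<lambda>_. 1)"
proof -
  have nd: "nd = {1..m}" and m: "4 \<le> m" using nodes_D[OF dt] by auto
  have one: "1 \<in> nd" using m nd by simp
  have s1: "\<sigma> 1 = 1" using s(1)[of 1] m by simp
  have c: "csum T 1 1 = 4" using csum_diag_fixed[OF one s1] M by simp
  define g where "g i = (if i \<le> m - 2 then 2 else 1 :: int)" for i
  have the: "(THE j. j \<in> {1, m - 1, m} \<and> \<sigma> j = j) = 1"
  proof (rule the_equality)
    show "1 \<in> {1, m - 1, m} \<and> \<sigma> 1 = 1" using s1 by simp
    fix j assume "j \<in> {1, m - 1, m} \<and> \<sigma> j = j"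
    then show "j = 1" using s(2,3) m by auto
  qed
  show ?thesis
  proof (rule good_epsI[OF one _ _ _ _ c, where g = g])
    show "eps_orbit T = orb T 1" using dt M the by (simp add: eps_orbit_def)
    show "eps_entries T = (- 2, - 1)" using dt M by (simp add: eps_entries_def)
    show "int 1 * (if \<sigma> i = i then int M else 1) = g i" if "i \<in> nd" for i
    proof (cases "i \<le> m - 2")
      case True
      then show ?thesis using s(1)[of i] that M by (simp add: g_def nd)
    next
      case False
      then have "i = m - 1 \<or> i = m" using that m unfolding nd by auto
      then have "\<sigma> i \<noteq> i" using s(2,3) m by auto
      then show ?thesis using False by (simp add: g_def)
    qed
    fix j assume j: "j \<in> nd"
    have o: "j \<in> orb T 1 \<longleftrightarrow> j = 1" unfolding orb_M2[OF M] s1 by simp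
    consider "1 \<le> j" "j < m - 2" | "j = m - 2" | "j = m - 1" | "j = m" using j unfolding nd by fastforce
    then show "4 * g j - 2 * (\<Sum>i | i \<in> nd \<and> adj T i j. g i) = - (if j \<in> orb T 1 then 4 * - 1 else (0::int))"
    proof cases
      case 1
      then show ?thesis unfolding o nbr_D(1)[OF dt 1] g_def by auto
    next
      case 2
      then show ?thesis unfolding o unfolding 2 nbr_D(2)[OF dt] g_def using m by auto
    next
      case 3
      then show ?thesis unfolding o unfolding 3 nbr_D(3)[OF dt] g_def using m by auto
    next
      case 4
      then show ?thesis unfolding o unfolding 4 nbr_D(4)[OF dt] g_def using m by auto
    qed
  qed auto
qed

lemma D4_nodes:
  assumes "dtype T = TypeD 4"
  shows "nd = {1, 2, 3, 4}" "\<And>g::nat \<Rightarrow> int. (\<Sum>i\<in>{i\<in>nd. adj T i 1}. g i) = g 2"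
    "\<And>g::nat \<Rightarrow> int. (\<Sum>i\<in>{i\<in>nd. adj T i 2}. g i) = g 1 + g 3 + g 4"
    "\<And>g::nat \<Rightarrow> int. (\<Sum>i\<in>{i\<in>nd. adj T i 3}. g i) = g 2"
    "\<And>g::nat \<Rightarrow> int. (\<Sum>i\<in>{i\<in>nd. adj T i 4}. g i) = g 2"
proof -
  have "{1..4} = {1, 2, 3, 4 :: nat}" by auto
  then show nd: "nd = {1, 2, 3, 4}" using nodes_D[OF assms] by (simp only:)
  show "(\<Sum>i\<in>{i\<in>nd. adj T i 1}. g i) = g 2" for g :: "nat \<Rightarrow> int"
    using nbr_D(1)[OF assms, of 1 g] by (simp add: numeral_2_eq_2)
  show "(\<Sum>i\<in>{i\<in>nd. adj T i 2}. g i) = g 1 + g 3 + g 4" "(\<Sum>i\<in>{i\<in>nd. adj T i 3}. g i) = g 2"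
    "(\<Sum>i\<in>{i\<in>nd. adj T i 4}. g i) = g 2" for g :: "nat \<Rightarrow> int"
    using nbr_D(2-4)[OF assms, of g] by simp_all
qed

text \<open>Covers the two involutions of \<open>D_4\<close> that move node 1; the affine node is
  then joined to the remaining fixed end node.\<close>

lemma good_eps_D4:
  assumes dt: "dtype T = TypeD 4" and M: "M = 2" and s2: "\<sigma> 2 = 2"
    and s: "(\<sigma> 1, \<sigma> 3, \<sigma> 4) \<in> {(3, 1, 4), (4, 3, 1)}"
  shows "\<exists>p. good_eps p (\<lambda>_. 1)"
proof -
  note nd = D4_nodes(1)[OF dt]
  define p where "p = (if \<sigma> 1 = 3 then 4 else 3 :: nat)"
  have p: "p \<in> nd" "\<sigma> p = p" using s unfolding nd p_def by auto
  have c: "csum T p p = 4" using csum_diag_fixed[OF p] M by simp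
  define g where "g i = (if \<sigma> i = i then 2 else 1 :: int)" for i
  have the: "(THE j. j \<in> {1, 4 - 1, 4} \<and> \<sigma> j = j) = p"
  proof (rule the_equality)
    show "p \<in> {1, 4 - 1, 4} \<and> \<sigma> p = p" using p by (simp add: p_def)
    fix j assume "j \<in> {1, 4 - 1, 4} \<and> \<sigma> j = j"
    then have "(j = 1 \<or> j = 3 \<or> j = 4) \<and> \<sigma> j = j" by auto
    then show "j = p" using s by (auto simp: p_def simp del: One_nat_def)
  qed
  have "good_eps p (\<lambda>_. 1)"
  proof (rule good_epsI[OF p(1) _ _ _ _ c, where g = g])
    show "eps_orbit T = orb T p" using dt M the by (simp add: eps_orbit_def)
    show "eps_entries T = (- 2, - 1)" using dt M by (simp add: eps_entries_def)
    show "int 1 * (if \<sigma> i = i then int M else 1) = g i" if "i \<in> nd" for i using M by (simp add: g_def)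
    fix j assume j: "j \<in> nd"
    have o: "j \<in> orb T p \<longleftrightarrow> j = p" unfolding orb_M2[OF M] p(2) by simp
    have gv: "g 2 = 2" "g 1 = 1" "g 3 = (if p = 3 then 2 else 1)" "g 4 = (if p = 3 then 1 else 2)"
      using s s2 unfolding g_def p_def by (auto simp del: One_nat_def)
    have pp: "p = 3 \<or> p = 4" by (simp add: p_def)
    consider "j = 1" | "j = 2" | "j = 3" | "j = 4" using j unfolding nd by blast
    then show "4 * g j - 2 * (\<Sum>i | i \<in> nd \<and> adj T i j. g i) = - (if j \<in> orb T p then 4 * - 1 else (0::int))"
      unfolding o using pp by cases (auto simp only: D4_nodes(2-)[OF dt] gv, auto)
  qed auto
  then show ?thesis ..
qed

lemma good_eps_D4_3:
  assumes M: "M = 3"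
  shows "good_eps 1 (\<lambda>P. if 2 \<in> P then 1 else 2)"
proof -
  have dt: "dtype T = TypeD 4" and nd: "nd = {1, 2, 3, 4}" and s2: "\<sigma> 2 = 2"
    and s: "(\<sigma> 1, \<sigma> 3, \<sigma> 4) \<in> {(3, 4, 1), (4, 1, 3)}" using M3_cases[OF M] by auto
  have one: "1 \<in> nd" and s1: "\<sigma> 1 \<noteq> 1" using s unfolding nd by auto
  have c: "csum T 1 1 = 2" using csum_diag_nonfixed[OF one s1] M by simp
  define g where "g i = (if i = 2 then 3 else 2 :: int)" for i :: nat
  have o1: "orb T i = {1, 3, 4}" if "i \<in> nd" "i \<noteq> 2" for i
    using that s unfolding nd orb_M3[OF M] by (auto simp del: One_nat_def)
  have fx: "\<sigma> i = i \<longleftrightarrow> i = 2" if "i \<in> nd" for i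
    using that s s2 unfolding nd by (auto simp del: One_nat_def)
  show ?thesis
  proof (rule good_epsI[OF one _ _ _ _ c, where g = g])
    show "eps_orbit T = orb T 1" using dt M by (simp add: eps_orbit_def)
    show "eps_entries T = (- 1, - 1)" using dt M by (simp add: eps_entries_def)
    show "int (if 2 \<in> orb T 1 then 1 else 2) * - 1 = - 2" using o1[OF one] by simp
    show "int (if 2 \<in> orb T i then 1 else 2) * (if \<sigma> i = i then int M else 1) = g i" if i: "i \<in> nd" for i
    proof (cases "i = 2")
      case True
      then show ?thesis using orb_fixed[of 2] i s2 M by (simp add: g_def)
    next
      case False
      then show ?thesis using o1[OF i False] fx[OF i] by (simp add: g_def)
    qed
    fix j assume j: "j \<in> nd"
    have o: "j \<in> orb T 1 \<longleftrightarrow> j \<noteq> 2" using o1[OF one] j unfolding nd by auto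
    have gv: "g 2 = 3" "g 1 = 2" "g 3 = 2" "g 4 = 2" by (auto simp: g_def)
    consider "j = 1" | "j = 2" | "j = 3" | "j = 4" using j unfolding nd by blast
    then show "4 * g j - 2 * (\<Sum>i | i \<in> nd \<and> adj T i j. g i) = - (if j \<in> orb T 1 then 2 * - 1 else (0::int))"
      unfolding o by cases (auto simp only: D4_nodes(2-)[OF dt] gv, auto)
  qed auto
qed

lemma good_eps_E:
  assumes dt: "dtype T = TypeE6"
  shows "good_eps 1 (\<lambda>P. if 2 \<in> P then 1 else if 3 \<in> P then 3 else 2)"
proof -
  have nd: "nd = {1, 2, 3, 4, 5, 6}" unfolding nodes_E[OF dt] by auto
  have M: "M = 2" and s: "\<sigma> 1 = 6" "\<sigma> 2 = 2" "\<sigma> 3 = 5" "\<sigma> 4 = 4" "\<sigma> 5 = 3" "\<sigma> 6 = 1"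
    using class_E[OF dt] by auto
  have one: "1 \<in> nd" and s1: "\<sigma> 1 \<noteq> 1" using s unfolding nd by auto
  have "\<not> adj T 1 6" unfolding adj_E[OF dt] by simp
  then have c: "csum T 1 1 = 2" using csum_diag_nonfixed[OF one s1] s by simp
  have o: "orb T 1 = {1, 6}" "orb T 2 = {2, 2}" "orb T 3 = {3, 5}" "orb T 4 = {4, 4}" "orb T 5 = {5, 3}" "orb T 6 = {6, 1}"
    unfolding orb_M2[OF M] s by (rule refl)+
  define g where "g i = (if i = 1 \<or> i = 6 \<or> i = 2 then 2 else if i = 4 then 4 else 3 :: int)" for i :: nat
  show ?thesis
  proof (rule good_epsI[OF one _ _ _ _ c, where g = g])
    show "eps_orbit T = orb T 1" using dt by (simp add: eps_orbit_def)
    show "eps_entries T = (- 1, - 1)" using dt by (simp add: eps_entries_def)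
    show "int (if 2 \<in> orb T 1 then 1 else if 3 \<in> orb T 1 then 3 else 2) * - 1 = - 2" unfolding o by simp
    show "int (if 2 \<in> orb T i then 1 else if 3 \<in> orb T i then 3 else 2) * (if \<sigma> i = i then int M else 1) = g i"
      if i: "i \<in> nd" for i
    proof -
      consider "i = 1" | "i = 2" | "i = 3" | "i = 4" | "i = 5" | "i = 6" using i unfolding nd by blast
      then show ?thesis by cases (simp_all only: o s M g_def, simp_all)
    qed
    fix j assume j: "j \<in> nd"
    have gv: "g 1 = 2" "g 2 = 2" "g 3 = 3" "g 4 = 4" "g 5 = 3" "g 6 = 2" by (auto simp: g_def)
    consider "j = 1" | "j = 2" | "j = 3" | "j = 4" | "j = 5" | "j = 6" using j unfolding nd by blast
    then show "4 * g j - 2 * (\<Sum>i | i \<in> nd \<and> adj T i j. g i) = - (if j \<in> orb T 1 then 2 * - 1 else (0::int))"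
      unfolding o by cases (simp_all only: nbr_E[OF dt] gv, simp_all)
  qed auto
qed

lemma good_eps_exists: "\<exists>p a. good_eps p a"
proof (cases "dtype T")
  case (TypeA m)
  then show ?thesis using good_eps_A_even good_eps_A_odd by (cases "even m") blast+
next
  case (TypeD m)
  then show ?thesis using class_D[OF TypeD] good_eps_D[OF TypeD] good_eps_D4 good_eps_D4_3 by blast
next
  case TypeE6
  then show ?thesis using good_eps_E by blast
qed

text \<open>Twice the invariant form on simple roots, as \<open>dd\<close> is twice
  \<open>d\<close>; integrality is the reason for working with the square root of q.\<close>

definition BB :: "anode \<Rightarrow> anode \<Rightarrow> int" where
  "BB x y = dd T x * csig T x y"

lemma dd_Some: "dd T (Some P) = csum T (rep P) (rep P)"
  by (simp add: dd_def)

lemma BB_Some: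
  assumes "P \<in> Isig T" "R \<in> Isig T"
  shows "BB (Some P) (Some R) = 2 * csum T (rep P) (rep R)"
  using csum_dvd[of "rep P" "rep R"] rep_in assms by (simp add: BB_def csig_def dd_Some)

lemma eps_facts:
  obtains p a u v where "p \<in> nd" "eps_orbit T = orb T p" "eps_entries T = (u, v)" "u < 0" "v < 0"
    "dd T None * u = csum T p p * v" "\<forall>P. 0 < a P"
    "\<forall>j\<in>nd. 2 * (\<Sum>i\<in>nd. int (a (orb T i)) * (if \<sigma> i = i then int M else 1) * cartan T i j) =
        - (if j \<in> orb T p then csum T p p * v else 0)"
    "int (a (orb T p)) * u = - 2"
proof -
  obtain p a where g: "good_eps p a" using good_eps_exists by blast
  obtain u v where uv: "eps_entries T = (u, v)" by (cases "eps_entries T")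
  note g' = g[unfolded good_eps_def uv fst_conv snd_conv]
  have "dd T None = csum T p p * v div u"
    using g' csum_rep[of p p] by (simp add: dd_def uv Let_def)
  then have "dd T None * u = csum T p p * v" using g' by simp
  then show thesis using that[of p u v a] g' uv by blast
qed

lemma dd_pos: assumes "x \<in> Ihat T" shows "0 < dd T x"
proof (cases x)
  case None
  obtain p a u v where e: "p \<in> nd" "u < 0" "v < 0" "dd T None * u = csum T p p * v"
    using eps_facts by metis
  have "0 < csum T p p" using csum_diag_pos e by blast
  then have "csum T p p * v < 0" using e by (simp add: mult_pos_neg)
  then have "dd T None * u < 0" using e by simp
  then have "0 < dd T None" using e(2) by (metis mult_less_0_iff not_less_iff_gr_or_eq)
  then show ?thesis using None by simp
next
  case (Some P)
  then have "P \<in> Isig T" using assms by (auto simp: Ihat_def)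
  then show ?thesis using Some csum_diag_pos rep_in by (simp add: dd_Some)
qed

lemma eps_Isig: "eps_orbit T \<in> Isig T"
  using eps_facts by (metis IsigI)

lemma csig_None: "csig T None (Some P) = (if P = eps_orbit T then fst (eps_entries T) else 0)"
  "csig T (Some P) None = (if P = eps_orbit T then snd (eps_entries T) else 0)"
  by (simp_all add: csig_def)

lemma BB_sym: assumes "x \<in> Ihat T" "y \<in> Ihat T" shows "BB x y = BB y x"
proof -
  obtain p a u v where e: "p \<in> nd" "eps_orbit T = orb T p" "eps_entries T = (u, v)"
    "dd T None * u = csum T p p * v" using eps_facts by metis
  have ne: "BB None (Some P) = BB (Some P) None" for P
    using e csum_rep[of p p] by (simp add: BB_def csig_None dd_Some)
  show ?thesis
    by (cases x; cases y; use assms ne in \<open>simp add: Ihat_def image_iff BB_Some csum_sym rep_in\<close>)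
qed

lemma csig_diag: "x \<in> Ihat T \<Longrightarrow> csig T x x = 2"
  using dd_pos[of x] by (auto simp: csig_def dd_Some split: option.splits)

lemma csig_le: assumes "x \<in> Ihat T" "y \<in> Ihat T" "x \<noteq> y" shows "csig T x y \<le> 0"
proof (cases "x = None \<or> y = None")
  case True
  obtain u v where "eps_entries T = (u, v)" "u < 0" "v < 0" using eps_facts by metis
  then show ?thesis using True assms by (auto simp: csig_def split: option.splits)
next
  case False
  then obtain P R where x: "x = Some P" "y = Some R" by auto
  then have PR: "P \<in> Isig T" "R \<in> Isig T" "P \<noteq> R" using assms by (auto simp: Ihat_def)
  have "BB x y \<le> 0" unfolding x BB_Some[OF PR(1,2)]
    using csum_le_0[of "rep P" "rep R"] rep_in PR by simp
  then show ?thesis using dd_pos[OF assms(1)] by (simp add: BB_def mult_le_0_iff)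
qed

lemma BB_diag: "x \<in> Ihat T \<Longrightarrow> BB x x = 2 * dd T x"
  by (simp add: BB_def csig_diag)

definition is_marks :: "(anode \<Rightarrow> nat) \<Rightarrow> bool" where
  "is_marks a \<longleftrightarrow> a None = 1 \<and> (\<forall>x\<in>Ihat T. 0 < a x) \<and> (\<forall>x. x \<notin> Ihat T \<longrightarrow> a x = 0) \<and>
     (\<forall>y\<in>Ihat T. (\<Sum>x\<in>Ihat T. int (a x) * dd T x * csig T x y) = 0)"

lemma is_marks_exists: "\<exists>a. is_marks a"
proof -
  obtain p a u v where e: "p \<in> nd" "eps_orbit T = orb T p" "eps_entries T = (u, v)" "u < 0" "v < 0"
    "dd T None * u = csum T p p * v" "\<forall>P. 0 < a P"
    and r: "\<forall>j\<in>nd. 2 * (\<Sum>i\<in>nd. int (a (orb T i)) * (if \<sigma> i = i then int M else 1) * cartan T i j) =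
        - (if j \<in> orb T p then csum T p p * v else 0)"
    and au: "int (a (orb T p)) * u = - 2" by (rule eps_facts)
  define b where "b x = (case x of None \<Rightarrow> 1 | Some P \<Rightarrow> if P \<in> Isig T then a P else 0)" for x
  have pI: "orb T p \<in> Isig T" using e by simp
  have "(\<Sum>x\<in>Ihat T. int (b x) * dd T x * csig T x y) = 0" if y: "y \<in> Ihat T" for y
  proof -
    have "(\<Sum>x\<in>Ihat T. int (b x) * dd T x * csig T x y) = (\<Sum>x\<in>Ihat T. int (b x) * BB x y)"
      by (simp add: BB_def mult.assoc)
    also have "\<dots> = BB None y + (\<Sum>P\<in>Isig T. int (a P) * BB (Some P) y)"
      by (simp add: sum_Ihat b_def)
    also have "\<dots> = 0"
    proof (cases y)
      case None
      have "(\<Sum>P\<in>Isig T. int (a P) * BB (Some P) None) =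
          (\<Sum>P\<in>Isig T. if P = orb T p then int (a P) * (csum T (rep P) (rep P) * v) else 0)"
        by (rule sum.cong) (auto simp: BB_def csig_None e dd_Some)
      also have "\<dots> = int (a (orb T p)) * (csum T p p * v)"
        using pI csum_rep[OF e(1) e(1)] by (simp add: sum.delta')
      \<comment> \<open>Symmetry of the matrix between p and the affine node moves the affine column
        to a multiple of \<open>dd T None\<close>, where the condition \<open>a u = - 2\<close>
        applies.\<close>
      also have "\<dots> = (int (a (orb T p)) * u) * dd T None" using e(6) by (simp add: algebra_simps)
      finally have "(\<Sum>P\<in>Isig T. int (a P) * BB (Some P) None) = - 2 * dd T None" using au by simp
      moreover have "BB None None = 2 * dd T None" by (rule BB_diag) (simp add: Ihat_def)
      ultimately show ?thesis using None by simp
    next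
      case (Some R)
      then have R: "R \<in> Isig T" using y by (auto simp: Ihat_def)
      have "(\<Sum>P\<in>Isig T. int (a P) * BB (Some P) y) = 2 * (\<Sum>P\<in>Isig T. int (a P) * csum T (rep P) (rep R))"
        unfolding Some sum_distrib_left by (rule sum.cong) (auto simp: BB_Some R)
      also have "\<dots> = - (if rep R \<in> orb T p then csum T p p * v else 0)"
        using csum_expand[OF rep_in(2)[OF R], of "\<lambda>P. int (a P)"] r rep_in(2)[OF R] by simp
      also have "rep R \<in> orb T p \<longleftrightarrow> R = orb T p"
        using orb_eq[OF e(1), of "rep R"] rep_in[OF R] by auto
      moreover have "BB None y = (if R = orb T p then csum T p p * v else 0)"
        unfolding Some BB_def csig_None using e by simp
      ultimately show ?thesis by simp
    qed
    finally show ?thesis .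
  qed
  then have "is_marks b" using e(7) by (auto simp: is_marks_def b_def Ihat_def)
  then show ?thesis by blast
qed

text \<open>Both have affine coordinate 1, so the difference is a kernel vector of the finite form.
  This makes the definite description in \<open>marks\<close> meaningful.\<close>

lemma is_marks_unique: assumes "is_marks a" "is_marks b" shows "a = b"
proof
  fix x
  define d where "d P = int (a (Some P)) - int (b (Some P))" for P
  have "d P = 0" if "P \<in> Isig T" for P
  proof (rule nondegenerate[OF _ that])
    fix R assume R: "R \<in> Isig T"
    then have y: "Some R \<in> Ihat T" by (simp add: Ihat_def)
    have 1: "int (f None) * BB None (Some R) + (\<Sum>P\<in>Isig T. int (f (Some P)) * BB (Some P) (Some R)) = 0"
      if "is_marks f" for f
    proof -
      have "(\<Sum>x\<in>Ihat T. int (f x) * BB x (Some R)) = 0"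
        using that y by (simp add: is_marks_def BB_def mult.assoc)
      then show ?thesis by (simp add: sum_Ihat)
    qed
    have "(\<Sum>P\<in>Isig T. int (a (Some P)) * BB (Some P) (Some R)) - (\<Sum>P\<in>Isig T. int (b (Some P)) * BB (Some P) (Some R)) = 0"
      using 1[OF assms(1)] 1[OF assms(2)] assms by (simp add: is_marks_def)
    then have "(\<Sum>P\<in>Isig T. d P * BB (Some P) (Some R)) = 0"
      by (simp add: d_def sum_subtractf left_diff_distrib)
    moreover have "(\<Sum>P\<in>Isig T. d P * BB (Some P) (Some R)) = 2 * (\<Sum>P\<in>Isig T. d P * csum T (rep P) (rep R))"
      unfolding sum_distrib_left by (rule sum.cong) (auto simp: BB_Some R)
    ultimately show "(\<Sum>P\<in>Isig T. d P * csum T (rep P) (rep R)) = 0" by simp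
  qed
  then have 1: "P \<in> Isig T \<Longrightarrow> a (Some P) = b (Some P)" for P by (simp add: d_def)
  show "a x = b x"
  proof (cases "x \<in> Ihat T")
    case True
    then show ?thesis using 1 assms unfolding is_marks_def Ihat_def by auto
  next
    case False
    then show ?thesis using assms unfolding is_marks_def by simp
  qed
qed

lemma marks: "is_marks (marks T)"
proof -
  have "marks T = (THE a. is_marks a)" unfolding marks_def is_marks_def by simp
  moreover obtain a where a: "is_marks a" using is_marks_exists by blast
  moreover have "(THE a. is_marks a) = a"
    by (rule the_equality[where P = is_marks, OF a]) (rule is_marks_unique[OF _ a])
  ultimately show ?thesis by simp
qed

section \<open>Powers of q, the root of unity and the structure constants\<close>

abbreviation "s \<equiv> sqrtq T"

lemma s_nz [simp]: "s \<noteq> 0"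
  using valid by (simp add: valid_datum_def)

lemma s_powi_eq_1: "s powi n = 1 \<longleftrightarrow> n = 0"
proof
  assume 1: "s powi n = 1"
  show "n = 0"
  proof (rule ccontr)
    assume "n \<noteq> 0"
    then have "0 < nat \<bar>n\<bar>" by simp
    have "s ^ nat \<bar>n\<bar> = 1"
      using 1 by (auto simp: power_int_def power_inverse split: if_splits)
    then have "qpar T ^ nat \<bar>n\<bar> = 1"
      by (simp add: qpar_def power_mult[symmetric] mult.commute) (simp add: power_mult)
    then show False using valid \<open>0 < nat \<bar>n\<bar>\<close> by (auto simp: valid_datum_def)
  qed
qed simp

lemma s_powi_inj: "s powi m = s powi n \<longleftrightarrow> m = n"
proof -
  have "s powi m = s powi n \<longleftrightarrow> s powi (m - n) = 1" by (simp add: power_int_diff)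
  then show ?thesis by (simp add: s_powi_eq_1)
qed

text \<open>\<open>Q x y\<close> is \<open>q\<close> to the power \<open>(\<alpha>\<^sub>x, \<alpha>\<^sub>y)\<close>.\<close>

definition Q :: "anode \<Rightarrow> anode \<Rightarrow> complex" where
  "Q x y = (if x \<in> Ihat T \<and> y \<in> Ihat T then s powi BB x y else 1)"

definition N :: "anode \<Rightarrow> anode \<Rightarrow> nat" where
  "N x y = nat (1 - csig T x y)"

lemma qi_powi: "qi T x powi n = s powi (dd T x * n)"
  by (simp add: qi_def power_int_mult)

lemma qi_pow: "qi T x ^ n = s powi (dd T x * int n)"
  using qi_powi[of x "int n"] by simp

lemma qi_csig: "x \<in> Ihat T \<Longrightarrow> y \<in> Ihat T \<Longrightarrow> qi T x powi csig T x y = Q x y"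
  by (simp add: qi_powi Q_def BB_def)

sublocale root_datum "Ihat T" Q "qi T" "\<lambda>x. 1 / (qi T x - inverse (qi T x))" N "marks T"
proof
  show "Q x y = Q y x" for x y by (auto simp: Q_def BB_sym)
  show "Q x y \<noteq> 0" for x y by (simp add: Q_def)
  show "Q x x = qi T x ^ 2" if "x \<in> Ihat T" for x
    using that by (simp add: Q_def BB_diag qi_pow mult.commute)
  show "qi T x \<noteq> 0" for x by (simp add: qi_def)
  show "\<forall>n>0. qi T x ^ n \<noteq> 1" if "x \<in> Ihat T" for x
    using dd_pos[OF that] by (auto simp: qi_pow s_powi_eq_1)
  fix x y assume xy: "x \<in> Ihat T" "y \<in> Ihat T" "x \<noteq> y"
  then have le: "csig T x y \<le> 0" by (rule csig_le)
  then show "0 < N x y" by (simp add: N_def)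
  have "BB x y + dd T x * int (N x y) = dd T x"
    using le by (simp add: N_def BB_def algebra_simps)
  then show "Q x y * qi T x ^ N x y = qi T x"
    using xy by (simp add: Q_def qi_pow power_int_add[symmetric]) (simp add: qi_def)
next
  show "finite (Ihat T)" by simp
  fix y
  show "(\<Prod>x\<in>Ihat T. Q x y ^ marks T x) = 1"
  proof (cases "y \<in> Ihat T")
    case True
    have "(\<Prod>x\<in>A. Q x y ^ marks T x) = s powi (\<Sum>x\<in>A. int (marks T x) * dd T x * csig T x y)"
      if "A \<subseteq> Ihat T" for A
      using that
    proof (induction A rule: infinite_finite_induct)
      case (insert x A)
      have "Q x y ^ marks T x = s powi (int (marks T x) * dd T x * csig T x y)"
        using insert True by (simp add: Q_def BB_def mult.commute mult.left_commute power_int_mult)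
      then show ?case using insert by (simp add: power_int_add)
    qed auto
    then show ?thesis using marks True by (simp add: is_marks_def)
  qed (simp add: Q_def)
qed

abbreviation "\<omega> \<equiv> omega T"

lemma omega_M: "\<omega> ^ M = 1"
proof -
  have "\<omega> ^ M = exp (of_nat M * (2 * of_real pi * \<i> / of_nat M))"
    unfolding omega_def by (rule exp_of_nat_mult[symmetric])
  also have "of_nat M * (2 * of_real pi * \<i> / of_nat M) = (2 * of_real pi * \<i> :: complex)" by simp
  finally show ?thesis by (simp add: exp_two_pi_i)
qed

lemma omega_nz [simp]: "\<omega> \<noteq> 0"
  by (simp add: omega_def)

lemma omega_ne_1: "\<omega> \<noteq> 1"
proof
  assume "\<omega> = 1"
  then have "Re (exp (2 * of_real pi * \<i> / of_nat M)) = 1" by (simp add: omega_def)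
  then have "cos (2 * pi / real M) = 1" by (simp add: Re_exp Re_divide_of_nat Im_divide_of_nat)
  moreover have "cos (2 * pi / real M) < cos 0"
    by (rule cos_monotone_0_pi) (use M_cases in \<open>auto simp: field_simps\<close>)
  ultimately show False by simp
qed

lemma omega_powi_eq_1: "\<omega> powi n = 1 \<longleftrightarrow> int M dvd n"
proof -
  have M1: "\<omega> powi (int M * l) = 1" for l
    by (simp add: power_int_mult omega_M)
  have "n = int M * (n div int M) + n mod int M" by simp
  then have e: "\<omega> powi n = \<omega> powi (n mod int M)"
    by (metis M1 mult_1 omega_nz power_int_add)
  \<comment> \<open>With M at most 3, only the exponents 1 and 2 remain to be excluded.\<close>
  have "n mod int M = 0 \<or> n mod int M = 1 \<or> (M = 3 \<and> n mod int M = 2)"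
    using M_cases by (elim disjE; simp; presburger)
  moreover have "\<omega> ^ 2 \<noteq> 1" if "M = 3"
  proof
    assume "\<omega> ^ 2 = 1"
    moreover have "\<omega> ^ 3 = 1" using omega_M that by simp
    ultimately have "\<omega> = 1" by (simp add: power3_eq_cube power2_eq_square)
    then show False using omega_ne_1 by simp
  qed
  ultimately show ?thesis unfolding e using omega_ne_1 by (auto simp: dvd_eq_mod_eq_0)
qed

lemma qn_eq: "i \<in> nd \<Longrightarrow> qn T i = s powi csum T i i"
  by (simp add: qn_def qi_def dd_Some csum_rep)

lemma qn_nz [simp]: "qn T i \<noteq> 0"
  by (simp add: qn_def qi_def)

lemma qn_diff: "i \<in> nd \<Longrightarrow> qn T i - inverse (qn T i) \<noteq> 0"
proof
  assume i: "i \<in> nd" and "qn T i - inverse (qn T i) = 0"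
  then have "qn T i * qn T i = 1" by (metis eq_iff_diff_eq_0 qn_nz right_inverse)
  then have "s powi (csum T i i + csum T i i) = 1" unfolding qn_eq[OF i] by (subst power_int_add) auto
  then have "csum T i i + csum T i i = 0" by (simp only: s_powi_eq_1)
  then show False using csum_diag_pos[OF i] by simp
qed

lemma qpar_powi: "qpar T powi n = s powi (2 * n)"
  by (simp add: qpar_def power_int_mult)

lemma qbr_eq_0: "i \<in> nd \<Longrightarrow> qbr T i n = 0 \<longleftrightarrow> n = 0"
  using qn_diff by (simp add: qbr_def qpar_powi s_powi_inj)

lemma qbr_0 [simp]: "qbr T i 0 = 0"
  by (simp add: qbr_def)

lemma x_coeff_diag: "i \<in> nd \<Longrightarrow> x_coeff T i i 0 \<noteq> 0"
proof -
  assume i: "i \<in> nd"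
  have "(\<Sum>r = 1..M. if sig T r i = i then \<omega> powi (int r * 0) else 0) = of_nat (card {r\<in>{1..M}. sig T r i = i})"
    by (simp add: sum.inter_filter[symmetric])
  moreover have "0 < card {r\<in>{1..M}. sig T r i = i}"
  proof (rule card_gt_0_iff[THEN iffD2], intro conjI)
    have "M \<in> {r\<in>{1..M}. sig T r i = i}" using sig_M[OF i] M_cases by auto
    then show "{r\<in>{1..M}. sig T r i = i} \<noteq> {}" by blast
  qed simp
  ultimately have "(\<Sum>r = 1..M. if sig T r i = i then \<omega> powi (int r * 0) else 0) \<noteq> 0"
    by (metis of_nat_eq_0_iff less_irrefl)
  then show ?thesis using qn_diff[OF i] unfolding x_coeff_def by simp
qed

lemma x_coeff_other: "i \<in> nd \<Longrightarrow> orb T i \<noteq> orb T j \<Longrightarrow> x_coeff T i j l = 0"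
proof -
  assume i: "i \<in> nd" and "orb T i \<noteq> orb T j"
  then have "sig T r i \<noteq> j" for r by (metis orb_sig)
  then show ?thesis by (simp add: x_coeff_def)
qed

text \<open>At a fixed node and for r divisible by M all M summands coincide, so nothing cancels.
  This lets \<open>h_{i,M}\<close> raise modes at a fixed neighbour.\<close>

lemma h_coeff_adj:
  assumes "i \<in> nd" "\<sigma> j = j" "adj T i j" "r \<noteq> 0" "int M dvd r"
  shows "h_coeff T i j r \<noteq> 0"
proof -
  have "\<omega> powi (r * int t) = 1" for t using assms(5) by (simp add: omega_powi_eq_1)
  moreover have "cartan T i j = - 1" using assms(3) by (auto simp: cartan_adj adj_def)
  ultimately show ?thesis
    using assms qbr_eq_0[OF assms(1), of "- r"] by (simp add: h_coeff_def sig_fixed)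
qed

text \<open>This makes \<open>x_{i,1}\<close> a multiple of the commutator of \<open>h_{i,1}\<close>
  and \<open>x_{i,0}\<close>. For M = 3 only the summand with \<open>\<sigma>^r(i) = i\<close> is
  nonzero; for M = 2 the delicate case is that \<open>i\<close> and \<open>\<sigma> i\<close> are
  joined.\<close>

lemma h_coeff_diag:
  assumes "i \<in> nd" "\<sigma> i \<noteq> i" shows "h_coeff T i i 1 \<noteq> 0"
  using M_cases
proof
  assume M: "M = 3"
  have "\<sigma> (\<sigma> (\<sigma> i)) = i" using sig_M[OF assms(1)] M by (simp add: numeral_3_eq_3)
  moreover have "{1..3} = {1, 2, 3 :: nat}" by auto
  moreover have "sig T 2 i = \<sigma> (\<sigma> i)" "sig T 3 i = \<sigma> (\<sigma> (\<sigma> i))"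
    by (simp_all add: numeral_2_eq_2 numeral_3_eq_3)
  ultimately show ?thesis
    using M3_nonadj[OF M assms] qbr_eq_0[OF assms(1), of 2] omega_nz
    by (simp add: h_coeff_def M cartan_adj[of T i i])
next
  assume M: "M = 2"
  have si: "\<sigma> (\<sigma> i) = i" using sig2 M assms by simp
  have w: "\<omega> = - 1"
  proof -
    have "(\<omega> - 1) * (\<omega> + 1) = 0" using omega_M M by (simp add: algebra_simps power2_eq_square)
    then show ?thesis using omega_ne_1 by (auto simp: eq_neg_iff_add_eq_0)
  qed
  have e: "h_coeff T i i 1 = qbr T i 2 - qbr T i (cartan T i (\<sigma> i))"
  proof -
    have "{1..2} = {1, 2 :: nat}" by auto
    moreover have "sig T 2 i = \<sigma> (\<sigma> i)" by (simp add: numeral_2_eq_2)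
    ultimately show ?thesis
      by (simp add: h_coeff_def M si cartan_adj[of T i i] w)
  qed
  show ?thesis
  proof (cases "adj T i (\<sigma> i)")
    case False
    then show ?thesis unfolding e using assms qbr_eq_0[OF assms(1), of 2] by (simp add: cartan_adj)
  next
    case True
    \<comment> \<open>After clearing denominators the difference is a multiple of
      \<open>(p ^ 3 - 1) * (p + 1)\<close> with p = q, which is nonzero since q is not a root of
      unity.\<close>
    have "qbr T i 2 - qbr T i (- 1) \<noteq> 0"
    proof
      define p where "p = qpar T"
      have p: "p \<noteq> 0" by (simp add: p_def qpar_def)
      have root: "p ^ n \<noteq> 1" if "0 < n" for n using valid that by (simp add: valid_datum_def p_def)
      assume "qbr T i 2 - qbr T i (- 1) = 0"
      then have "p ^ 2 - inverse (p ^ 2) = inverse p - p"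
        using qn_diff[OF assms(1)] by (simp add: qbr_def p_def power_int_minus)
      then have "(p ^ 2 - inverse (p ^ 2)) * p ^ 2 = (inverse p - p) * p ^ 2" by simp
      moreover have "(p ^ 2 - inverse (p ^ 2)) * p ^ 2 = p ^ 4 - 1"
        using p by (simp add: left_diff_distrib power_add[symmetric])
      moreover have "(inverse p - p) * p ^ 2 = p - p ^ 3"
        using p by (simp add: left_diff_distrib power2_eq_square power3_eq_cube)
      ultimately have "p ^ 4 - 1 = p - p ^ 3" by simp
      then have "(p ^ 3 - 1) * (p + 1) = 0"
        by (simp add: algebra_simps power3_eq_cube power4_eq_xxxx)
      moreover have "p + 1 \<noteq> 0" using root[of 2] by (auto simp: eq_neg_iff_add_eq_0[symmetric])
      ultimately show False using root[of 3] by simp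
    qed
    then show ?thesis unfolding e using True by (simp add: cartan_adj adj_def)
  qed
qed

end

section \<open>The relations act on induced modules\<close>

lemma free_ideal_I:
  assumes "J \<subseteq> carrier (free_algebra G)" "0 \<in> J"
    "\<And>p r. p \<in> J \<Longrightarrow> r \<in> J \<Longrightarrow> p + r \<in> J" "\<And>p. p \<in> J \<Longrightarrow> - p \<in> J"
    "\<And>p r. p \<in> carrier (free_algebra G) \<Longrightarrow> r \<in> J \<Longrightarrow> p * r \<in> J"
    "\<And>p r. p \<in> carrier (free_algebra G) \<Longrightarrow> r \<in> J \<Longrightarrow> r * p \<in> J"
  shows "ideal J (free_algebra G)"
proof (rule idealI[OF free_algebra_ring])
  interpret ring "free_algebra G" by (rule free_algebra_ring)
  show "subgroup J (add_monoid (free_algebra G))"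
  proof
    fix p assume p: "p \<in> J"
    have "\<ominus>\<^bsub>free_algebra G\<^esub> p = - p"
      by (rule minus_equality) (use p assms(1) in \<open>auto simp: free_algebra_def keys_uminus\<close>)
    then show "inv\<^bsub>add_monoid (free_algebra G)\<^esub> p \<in> J"
      using assms(4)[OF p] by (simp add: a_inv_def)
  qed (use assms in \<open>auto simp: free_algebra_def\<close>)
qed (use assms in \<open>auto simp: free_algebra_def\<close>)

locale datum_rep = datum +
  fixes \<epsilon> \<kappa> \<kappa>' :: "anode \<Rightarrow> 'l::cvec endo"
  assumes rep: "borel_rep \<epsilon> \<kappa> \<kappa>'"
begin

sublocale induced "Ihat T" Q "qi T" "\<lambda>x. 1 / (qi T x - inverse (qi T x))" N "marks T" \<epsilon> \<kappa> \<kappa>'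
  by unfold_locales (rule rep)

fun opM :: "gen \<Rightarrow> (anode list \<Rightarrow>\<^sub>0 'l) endo" where
  "opM (GE Pos x) = E x"
| "opM (GE Neg x) = F x"
| "opM (GK x) = K x"
| "opM (GKinv x) = K' x"

lemma R_opM: "m \<in> R \<Longrightarrow> app (opM g) m \<in> R"
  by (cases g rule: opM.cases) (auto intro: R_E R_F R_K R_K')

lemma R_feval: "m \<in> R \<Longrightarrow> app (feval opM p) m \<in> R"
proof -
  assume m: "m \<in> R"
  have w: "app (prod_list (map opM w)) m \<in> R" for w
    by (induction w) (auto simp: m R_opM)
  have "app (feval opM p) m = (\<Sum>w\<in>Poly_Mapping.keys p. Poly_Mapping.lookup p w \<star> app (prod_list (map opM (letters w))) m)"
    by (simp add: feval_def app_sum)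
  then show ?thesis using w by (auto intro!: R_closed)
qed

lemma N_eq: "int n = 1 - csig T x y \<Longrightarrow> n = N x y"
  by (simp add: N_def)

lemma serre_zero_or_R:
  assumes "x \<in> Ihat T" "y \<in> Ihat T" "x \<noteq> y"
  shows "app (serre (qi T x) (N x y) (opM (GE b x)) (opM (GE b y))) m \<in> R"
proof (cases b)
  case Pos
  then show ?thesis using serre_E[OF assms] by (simp add: R_closed)
next
  case Neg
  then show ?thesis using RgenI[OF assms, of "[]" m] by simp
qed

text \<open>All relations act by zero, except the Serre relations of the f's, whose values lie in
  \<open>R\<close> by construction.\<close>

lemma relations_R:
  assumes r: "r \<in> relations T" shows "app (feval opM r) m \<in> R"
proof -
  have z: "feval opM r = 0 \<Longrightarrow> ?thesis" by (simp add: R_closed)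
  from r consider "r \<in> rel_torus T" | "r \<in> rel_weight T" | "r \<in> rel_comm T" | "r \<in> rel_serre T" | "r \<in> rel_central T"
    by (auto simp: relations_def)
  then show ?thesis
  proof cases
    case 1
    then have "feval opM r = 0"
      by (auto simp: rel_torus_def feval_simps KK' KK_comm)
    then show ?thesis by (rule z)
  next
    case 2
    then obtain b x y where x: "x \<in> Ihat T" "y \<in> Ihat T"
      and r: "r = FK x * FE b y - fscal (qi T x powi (sgi b * csig T x y)) * FE b y * FK x"
      by (auto simp: rel_weight_def)
    have "feval opM r = 0"
      using x qi_csig[OF x] by (cases b)
        (simp_all add: r feval_simps KE KF csc_mult_left power_int_minus)
    then show ?thesis by (rule z)
  next
    case 3
    then obtain x y where r: "r = FE Pos x * FE Neg y - FE Neg y * FE Pos x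
        - (if x = y then fscal (1 / (qi T x - inverse (qi T x))) * (FK x - FKinv x) else 0)"
      by (auto simp: rel_comm_def)
    have "feval opM r = 0"
      unfolding r by (cases "x = y") (simp_all add: feval_simps EF csc_mult_left)
    then show ?thesis by (rule z)
  next
    case 4
    then obtain b x y n where x: "x \<in> Ihat T" "y \<in> Ihat T" "x \<noteq> y" and n: "int n = 1 - csig T x y"
      and r: "r = (\<Sum>i\<le>n. fscal ((- 1) ^ i * qbinom (qi T x) n i) * FE b x ^ (n - i) * FE b y * FE b x ^ i)"
      by (auto simp: rel_serre_def)
    have "feval opM r = serre (qi T x) (N x y) (opM (GE b x)) (opM (GE b y))"
      unfolding r N_eq[OF n] by (simp add: feval_simps serre_def csc_mult_left mult.assoc)
    then show ?thesis using serre_zero_or_R[OF x] by simp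
  next
    case 5
    then obtain xs where xs: "distinct xs" "set xs = Ihat T"
      and r: "r = prod_list (map (\<lambda>x. FK x ^ marks T x) xs) - 1" by (auto simp: rel_central_def)
    have "feval opM r = prod_list (map (\<lambda>x. K x ^ marks T x) xs) - 1"
      by (simp add: r feval_simps o_def)
    then have "feval opM r = 0" using K_central[OF xs] by simp
    then show ?thesis by (rule z)
  qed
qed

text \<open>The elements with all values in \<open>R\<close> form a two-sided ideal: left
  multiplication preserves \<open>R\<close>, right multiplication only changes the vector acted on,
  and that vector is arbitrary.\<close>

lemma rel_ideal_R:
  assumes "p \<in> rel_ideal T" shows "app (feval opM p) m \<in> R"
proof -
  let ?J = "{p \<in> carrier (free_algebra (Gens T)). \<forall>m. app (feval opM p) m \<in> R}"
  have "ideal ?J (free_algebra (Gens T))"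
    by (rule free_ideal_I)
      (auto simp: feval_add feval_minus feval_mult R_closed R_feval free_algebra_closed free_algebra_basic)
  moreover have "relations T \<subseteq> ?J" using relations_carrier relations_R by auto
  ultimately have "rel_ideal T \<subseteq> ?J"
    unfolding rel_ideal_def by (rule ring.genideal_minimal[OF free_algebra_ring])
  then show ?thesis using assms by auto
qed

end

section \<open>The algebra as a type\<close>

lemma ucls_ring_hom: "ucls T \<in> ring_hom (free_algebra (Gens T)) (Uq T)"
  unfolding ucls_def[abs_def] Uq_def by (rule ideal.rcos_ring_hom[OF rel_ideal_ideal])

text \<open>The carrier depends on \<open>T\<close>, so its identification with a type of class
  \<open>calg\<close> is assumed here; an instance is constructed at the end.\<close>

locale uq_type = datum +
  fixes cl :: "uq \<Rightarrow> 'u::calg"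
  assumes cl_inj: "inj_on cl (carrier (Uq T))"
    and cl_surj: "cl ` carrier (Uq T) = UNIV"
    and cl_one: "cl \<one>\<^bsub>Uq T\<^esub> = 1"
    and cl_add: "a \<in> carrier (Uq T) \<Longrightarrow> b \<in> carrier (Uq T) \<Longrightarrow> cl (a \<oplus>\<^bsub>Uq T\<^esub> b) = cl a + cl b"
    and cl_mult: "a \<in> carrier (Uq T) \<Longrightarrow> b \<in> carrier (Uq T) \<Longrightarrow> cl (a \<otimes>\<^bsub>Uq T\<^esub> b) = cl a * cl b"
    and cl_smult: "a \<in> carrier (Uq T) \<Longrightarrow> cl (usmult T z a) = z \<star> cl a"
begin

abbreviation "FA \<equiv> free_algebra (Gens T)"

lemma ucls_hom:
  assumes "p \<in> carrier FA" "r \<in> carrier FA"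
  shows "ucls T p \<in> carrier (Uq T)" "ucls T (p + r) = ucls T p \<oplus>\<^bsub>Uq T\<^esub> ucls T r"
    "ucls T (p * r) = ucls T p \<otimes>\<^bsub>Uq T\<^esub> ucls T r" "ucls T 1 = \<one>\<^bsub>Uq T\<^esub>"
proof -
  note h = ucls_ring_hom[of T]
  show "ucls T p \<in> carrier (Uq T)" by (rule ring_hom_closed[OF h assms(1)])
  show "ucls T (p + r) = ucls T p \<oplus>\<^bsub>Uq T\<^esub> ucls T r"
    using ring_hom_add[OF h assms] by (simp add: free_algebra_def)
  show "ucls T (p * r) = ucls T p \<otimes>\<^bsub>Uq T\<^esub> ucls T r"
    using ring_hom_mult[OF h assms] by (simp add: free_algebra_def)
  show "ucls T 1 = \<one>\<^bsub>Uq T\<^esub>" using ring_hom_one[OF h] by (simp add: free_algebra_def)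
qed

lemma cl_eq: "a \<in> carrier (Uq T) \<Longrightarrow> b \<in> carrier (Uq T) \<Longrightarrow> cl a = cl b \<longleftrightarrow> a = b"
  using cl_inj by (auto simp: inj_on_def)

lemma cl_zero: "cl \<zero>\<^bsub>Uq T\<^esub> = 0"
proof -
  interpret U: ring "Uq T" by (rule Uq_ring)
  have "cl (\<zero>\<^bsub>Uq T\<^esub> \<oplus>\<^bsub>Uq T\<^esub> \<zero>\<^bsub>Uq T\<^esub>) = cl \<zero>\<^bsub>Uq T\<^esub> + cl \<zero>\<^bsub>Uq T\<^esub>" by (rule cl_add) auto
  then show ?thesis by simp
qed

lemma cl_minus: "a \<in> carrier (Uq T) \<Longrightarrow> cl (\<ominus>\<^bsub>Uq T\<^esub> a) = - cl a"
proof -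
  interpret U: ring "Uq T" by (rule Uq_ring)
  assume a: "a \<in> carrier (Uq T)"
  have "cl a + cl (\<ominus>\<^bsub>Uq T\<^esub> a) = 0" using cl_add[OF a, of "\<ominus>\<^bsub>Uq T\<^esub> a"] a by (simp add: U.r_neg cl_zero)
  then show ?thesis by (simp add: eq_neg_iff_add_eq_0 add.commute)
qed

definition pr :: "falg \<Rightarrow> 'u" where
  "pr p = cl (ucls T p)"

lemma pr_hom:
  assumes "p \<in> carrier FA" "r \<in> carrier FA"
  shows "pr (p + r) = pr p + pr r" "pr (p * r) = pr p * pr r" "pr 1 = 1"
  using ucls_hom[OF assms] ucls_hom(1)[OF assms(2,2)] by (auto simp: pr_def cl_add cl_mult cl_one)

lemma pr_zero: "pr 0 = 0"
  using pr_hom(1)[of 0 0] by (simp add: free_algebra_basic)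

lemma pr_eq_0: "p \<in> carrier FA \<Longrightarrow> pr p = 0 \<longleftrightarrow> p \<in> rel_ideal T"
proof -
  assume p: "p \<in> carrier FA"
  interpret I: ideal "rel_ideal T" FA by (rule rel_ideal_ideal)
  have z: "ucls T 0 = \<zero>\<^bsub>Uq T\<^esub>"
    using ring_hom_zero[OF ideal.rcos_ring_hom[OF rel_ideal_ideal] free_algebra_ring Uq_ring[unfolded Uq_def], of T]
    by (simp add: ucls_def Uq_def free_algebra_def)
  have "pr p = 0 \<longleftrightarrow> ucls T p = ucls T 0"
    using cl_eq[OF ucls_hom(1)[OF p p], of "\<zero>\<^bsub>Uq T\<^esub>"] ring.ring_simprules(2)[OF Uq_ring, of T] z
    by (simp add: pr_def cl_zero)
  also have "\<dots> \<longleftrightarrow> p \<ominus>\<^bsub>FA\<^esub> 0 \<in> rel_ideal T"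
    unfolding ucls_def
    using ring.quotient_eq_iff_same_a_r_cos[OF free_algebra_ring rel_ideal_ideal p free_algebra_basic(3)] by simp
  also have "p \<ominus>\<^bsub>FA\<^esub> 0 = p"
  proof -
    have "p \<ominus>\<^bsub>FA\<^esub> \<zero>\<^bsub>FA\<^esub> = p" using p by (simp add: a_minus_def)
    then show ?thesis by (simp add: free_algebra_def)
  qed
  finally show ?thesis .
qed

lemma pr_fscal: "pr (fscal z) = z \<star> 1"
proof -
  have "usmult T z \<one>\<^bsub>Uq T\<^esub> = uscal T z"
    using ucls_hom(1)[of "fscal z" "fscal z"]
    by (simp add: usmult_def uscal_def free_algebra_basic ring.ring_simprules(6) Uq_ring monoid.r_one ring.is_monoid)
  then show ?thesis using cl_smult[of "\<one>\<^bsub>Uq T\<^esub>" z] ring.ring_simprules(6)[OF Uq_ring]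
    by (simp add: pr_def uscal_def cl_one)
qed

text \<open>The values off \<open>Gens T\<close> make the commutation relations hold for all indices.\<close>

fun op :: "gen \<Rightarrow> 'u" where
  "op g = (if g \<in> Gens T then pr (fgen g) else case g of GE b x \<Rightarrow> 0 | GK x \<Rightarrow> 1 | GKinv x \<Rightarrow> 1)"

declare op.simps [simp del]

lemma single_Cons: "Poly_Mapping.single (Word (g # w)) z = fgen g * Poly_Mapping.single (Word w) z"
  by (simp add: fgen_def mult_single plus_word_def)

lemma pr_word:
  "set w \<subseteq> Gens T \<Longrightarrow> pr (Poly_Mapping.single (Word w) z) = z \<star> prod_list (map op w)"
proof (induction w)
  case Nil
  then show ?case using pr_fscal[of z] by (simp add: fscal_def zero_word_def)
next
  case (Cons g w)
  have "fgen g \<in> carrier FA" "Poly_Mapping.single (Word w) z \<in> carrier FA"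
    using Cons by (auto simp: free_algebra_basic) (auto simp: free_algebra_def)
  then show ?case
    using Cons unfolding single_Cons by (simp add: pr_hom op.simps csc_mult_right)
qed

lemma pr_feval: "p \<in> carrier FA \<Longrightarrow> pr p = feval op p"
proof -
  assume p: "p \<in> carrier FA"
  have "pr (\<Sum>w\<in>A. Poly_Mapping.single w (Poly_Mapping.lookup p w)) =
      (\<Sum>w\<in>A. Poly_Mapping.lookup p w \<star> prod_list (map op (letters w))) \<and>
      (\<Sum>w\<in>A. Poly_Mapping.single w (Poly_Mapping.lookup p w)) \<in> carrier FA"
    if "finite A" "A \<subseteq> Poly_Mapping.keys p" for A
    using that
  proof induction
    case (insert w A)
    have w: "set (letters w) \<subseteq> Gens T" using insert p by (auto simp: free_algebra_def)
    then have c: "Poly_Mapping.single w (Poly_Mapping.lookup p w) \<in> carrier FA" by (auto simp: free_algebra_def)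
    have "pr (Poly_Mapping.single w (Poly_Mapping.lookup p w)) = Poly_Mapping.lookup p w \<star> prod_list (map op (letters w))"
      using pr_word[OF w] by simp
    then show ?case using insert c by (simp add: pr_hom free_algebra_closed)
  qed (simp add: pr_zero free_algebra_basic)
  from this[of "Poly_Mapping.keys p"]
  have "pr (\<Sum>w\<in>Poly_Mapping.keys p. Poly_Mapping.single w (Poly_Mapping.lookup p w)) = feval op p"
    by (simp add: feval_def)
  moreover have "(\<Sum>w\<in>Poly_Mapping.keys p. Poly_Mapping.single w (Poly_Mapping.lookup p w)) = p"
    by (rule poly_mapping_eqI) (auto simp: lookup_sum lookup_single when_def in_keys_iff sum.delta)
  ultimately show ?thesis by simp
qed

lemma feval_eq_0: "p \<in> carrier FA \<Longrightarrow> feval op p = 0 \<longleftrightarrow> p \<in> rel_ideal T"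
  using pr_eq_0 pr_feval by simp

lemma u_feval: "\<exists>p\<in>carrier FA. u = feval op p"
proof -
  obtain a where a: "a \<in> carrier (Uq T)" "u = cl a" using cl_surj by (metis UNIV_I imageE)
  then obtain p where p: "p \<in> carrier FA" "a = ucls T p"
    by (auto simp: Uq_def FactRing_def A_RCOSETS_def' ucls_def)
  then show ?thesis using a pr_feval by (auto simp: pr_def)
qed

definition e :: "anode \<Rightarrow> 'u" where "e x = op (GE Pos x)"
definition f :: "anode \<Rightarrow> 'u" where "f x = op (GE Neg x)"
definition k :: "anode \<Rightarrow> 'u" where "k x = op (GK x)"
definition k' :: "anode \<Rightarrow> 'u" where "k' x = op (GKinv x)"

lemma gens_out: "x \<notin> Ihat T \<Longrightarrow> e x = 0 \<and> f x = 0 \<and> k x = 1 \<and> k' x = 1"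
  by (auto simp: e_def f_def k_def k'_def op.simps Gens_def)

lemma cl_gens:
  assumes "x \<in> Ihat T"
  shows "cl (ue T Pos x) = e x" "cl (ue T Neg x) = f x" "cl (kk T Pos x) = k x" "cl (kk T Neg x) = k' x"
  using assms by (auto simp: e_def f_def k_def k'_def op.simps Gens_def ue_def kk_def pr_def)

lemma gens_carrier:
  assumes "x \<in> Ihat T"
  shows "ue T b x \<in> carrier (Uq T)" "kk T b x \<in> carrier (Uq T)"
proof -
  have "FE b x \<in> carrier FA" "FK x \<in> carrier FA" "FKinv x \<in> carrier FA"
    using assms by (auto intro!: free_algebra_basic simp: Gens_def)
  then show "ue T b x \<in> carrier (Uq T)" "kk T b x \<in> carrier (Uq T)"
    by (auto simp: ue_def kk_def ucls_hom split: sign.split)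
qed

lemma uscal_carrier: "uscal T z \<in> carrier (Uq T)" and cl_uscal: "cl (uscal T z) = z \<star> 1"
  using ucls_hom(1)[of "fscal z" "fscal z"] pr_fscal[of z] by (auto simp: uscal_def free_algebra_basic pr_def)

lemma relation_feval: "r \<in> relations T \<Longrightarrow> feval op r = 0"
proof -
  assume r: "r \<in> relations T"
  then have "r \<in> rel_ideal T"
    unfolding rel_ideal_def using ring.genideal_self[OF free_algebra_ring relations_carrier] by blast
  then show ?thesis using r relations_carrier feval_eq_0 by blast
qed

lemma fold_gens: "op (GE Pos x) = e x" "op (GE Neg x) = f x" "op (GK x) = k x" "op (GKinv x) = k' x"
  by (simp_all add: e_def f_def k_def k'_def)

lemma kk': "k x * k' x = 1" "k' x * k x = 1"
proof -
  have "k x * k' x = 1 \<and> k' x * k x = 1"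
  proof (cases "x \<in> Ihat T")
    case True
    then have "FK x * FKinv x - 1 \<in> relations T" "FKinv x * FK x - 1 \<in> relations T"
      by (auto simp: relations_def rel_torus_def)
    from this[THEN relation_feval] show ?thesis by (simp add: feval_simps fold_gens)
  qed (simp add: gens_out)
  then show "k x * k' x = 1" "k' x * k x = 1" by auto
qed

lemma kk_comm: "k x * k y = k y * k x"
proof (cases "x \<in> Ihat T \<and> y \<in> Ihat T")
  case True
  then have "FK x * FK y - FK y * FK x \<in> relations T"
    by (auto simp: relations_def rel_torus_def)
  from this[THEN relation_feval] show ?thesis by (simp add: feval_simps fold_gens)
qed (auto simp: gens_out)

lemma ke: "k x * e y = Q x y \<star> (e y * k x)" and kf: "k x * f y = inverse (Q x y) \<star> (f y * k x)"
proof -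
  have "k x * e y = Q x y \<star> (e y * k x) \<and> k x * f y = inverse (Q x y) \<star> (f y * k x)"
  proof (cases "x \<in> Ihat T \<and> y \<in> Ihat T")
    case True
    then have "FK x * FE b y - fscal (qi T x powi (sgi b * csig T x y)) * FE b y * FK x \<in> relations T" for b
      by (auto simp: relations_def rel_weight_def)
    from this[of Pos, THEN relation_feval] this[of Neg, THEN relation_feval] show ?thesis
      using True qi_csig[of x y] by (simp add: feval_simps fold_gens csc_mult_left power_int_minus)
  qed (auto simp: gens_out Q_def csc_one)
  then show "k x * e y = Q x y \<star> (e y * k x)" "k x * f y = inverse (Q x y) \<star> (f y * k x)" by auto
qed

abbreviation "cc x \<equiv> 1 / (qi T x - inverse (qi T x))"

lemma ef: "e x * f y = f y * e x + (if x = y then cc x \<star> (k x - k' x) else 0)"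
proof (cases "x \<in> Ihat T \<and> y \<in> Ihat T")
  case True
  then have "FE Pos x * FE Neg y - FE Neg y * FE Pos x
        - (if x = y then fscal (1 / (qi T x - inverse (qi T x))) * (FK x - FKinv x) else 0) \<in> relations T"
    by (auto simp: relations_def rel_comm_def)
  from this[THEN relation_feval] show ?thesis
    by (cases "x = y") (simp_all add: feval_simps fold_gens csc_mult_left algebra_simps)
qed (auto simp: gens_out)

lemma serre_e: "x \<in> Ihat T \<Longrightarrow> y \<in> Ihat T \<Longrightarrow> x \<noteq> y \<Longrightarrow> serre (qi T x) (N x y) (e x) (e y) = 0"
proof -
  assume x: "x \<in> Ihat T" "y \<in> Ihat T" "x \<noteq> y"
  have "int (N x y) = 1 - csig T x y" using csig_le[OF x] by (simp add: N_def)
  then have "(\<Sum>i\<le>N x y. fscal ((- 1) ^ i * qbinom (qi T x) (N x y) i) * FE Pos x ^ (N x y - i) * FE Pos y * FE Pos x ^ i) \<in> relations T"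
    using x by (auto simp: relations_def rel_serre_def)
  from this[THEN relation_feval] show ?thesis
    by (simp add: feval_simps fold_gens serre_def csc_mult_left mult.assoc)
qed

lemma central_k:
  assumes "distinct xs" "set xs = Ihat T" shows "prod_list (map (\<lambda>x. k x ^ marks T x) xs) = 1"
proof -
  have "prod_list (map (\<lambda>x. FK x ^ marks T x) xs) - 1 \<in> relations T"
    using assms by (auto simp: relations_def rel_central_def)
  from this[THEN relation_feval] show ?thesis by (simp add: feval_simps fold_gens o_def)
qed

end

section \<open>Words and weights\<close>

lemma span_image_clin:
  assumes "u \<in> cvec.span S" "clin g" "\<And>s. s \<in> S \<Longrightarrow> g s \<in> cvec.span S'"
  shows "g u \<in> cvec.span S'"
  using assms(1)
proof (induction rule: cvec.span_induct_alt)
  case base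
  show ?case by (simp add: clinD[OF assms(2)] cvec.span_zero)
next
  case (step c x y)
  then show ?case using assms(3) by (simp add: clinD[OF assms(2)] cvec.span_add cvec.span_scale)
qed

context vector_space
begin

lemma eigenvectors_span_zero:
  assumes lin: "\<And>P x y. P \<in> I \<Longrightarrow> A P (x + y) = A P x + A P y" "\<And>P c x. P \<in> I \<Longrightarrow> A P (scale c x) = scale c (A P x)"
    and "finite F"
    and "\<And>t. t \<in> F \<Longrightarrow> (\<forall>P\<in>I. A P t = scale (\<psi> t P) t) \<and> (\<exists>P\<in>I. \<psi> t P \<noteq> \<chi> P)"
    and "u \<in> span F" "\<forall>P\<in>I. A P u = scale (\<chi> P) u"
  shows "u = 0"
  using assms(3-)
proof (induction F arbitrary: u rule: finite_induct)
  case (insert t F)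
  obtain P where P: "P \<in> I" "\<psi> t P \<noteq> \<chi> P" "A P t = scale (\<psi> t P) t" using insert.prems(1)[of t] by blast
  obtain a where a: "u - scale a t \<in> span F"
    using insert.prems(2) by (auto simp: span_insert)
  have z: "A P 0 = 0" using lin(2)[OF P(1), of 0 0] by simp
  have AF: "A P r \<in> span F" if "r \<in> span F" for r
    using that
  proof (induction rule: span_induct_alt)
    case (step c x y)
    then have "A P x = scale (\<psi> x P) x" using insert.prems(1)[of x] P(1) by blast
    then show ?case using step by (simp add: lin P(1) span_add span_scale span_base)
  qed (simp add: z span_zero)
  have Au: "A P (u - scale a t) = scale (\<chi> P) u - scale (a * \<psi> t P) t"
    using lin(1)[OF P(1), of "u - scale a t" "scale a t"] lin(2)[OF P(1), of a t] insert.prems(3) P(1,3)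
    by (simp add: algebra_simps)
  have "A P (u - scale a t) - scale (\<psi> t P) (u - scale a t) \<in> span F"
    by (rule span_diff[OF AF[OF a] span_scale[OF a]])
  moreover have "A P (u - scale a t) - scale (\<psi> t P) (u - scale a t) = scale (\<chi> P - \<psi> t P) u"
    unfolding Au by (simp add: scale_right_diff_distrib scale_left_diff_distrib mult.commute)
  ultimately have "scale (inverse (\<chi> P - \<psi> t P)) (scale (\<chi> P - \<psi> t P) u) \<in> span F"
    by (metis span_scale)
  then have "u \<in> span F" using P(2) by simp
  then show ?case using insert.IH[of u] insert.prems by blast
qed simp

text \<open>Projection to a simultaneous eigenspace: only the spanning vectors with the right
  eigenvalues are used. It is applied to conjugation by the k's, to the twists, and to the
  module.\<close>

lemma eigenvectors_span:
  assumes lin: "\<And>P x y. P \<in> I \<Longrightarrow> A P (x + y) = A P x + A P y" "\<And>P c x. P \<in> I \<Longrightarrow> A P (scale c x) = scale c (A P x)"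
    and S: "\<And>t. t \<in> S \<Longrightarrow> \<exists>\<psi>. \<forall>P\<in>I. A P t = scale (\<psi> P) t"
    and u: "u \<in> span S" "\<forall>P\<in>I. A P u = scale (\<chi> P) u"
  shows "u \<in> span {t \<in> S. \<forall>P\<in>I. A P t = scale (\<chi> P) t}"
proof -
  let ?E = "{t \<in> S. \<forall>P\<in>I. A P t = scale (\<chi> P) t}"
  obtain \<psi> where \<psi>: "\<And>t. t \<in> S \<Longrightarrow> \<forall>P\<in>I. A P t = scale (\<psi> t P) t" using S by metis
  obtain G where G: "finite G" "G \<subseteq> S" "u \<in> span G"
    using u(1) by (auto simp: span_explicit intro: span_sum span_scale span_base)
  have "G = (G \<inter> ?E) \<union> (G - ?E)" by blast
  then obtain v w where vw: "u = v + w" "v \<in> span (G \<inter> ?E)" "w \<in> span (G - ?E)"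
    using G(3) span_Un[of "G \<inter> ?E" "G - ?E"] by auto
  have v: "A P v = scale (\<chi> P) v" if P: "P \<in> I" for P
    using vw(2)
  proof (induction rule: span_induct_alt)
    case base
    show ?case using lin(2)[OF P, of 0 0] by simp
  next
    case (step c x y)
    then show ?case using P by (simp add: lin scale_right_distrib mult.commute)
  qed
  have "\<forall>P\<in>I. A P w = scale (\<chi> P) w"
  proof
    fix P assume P: "P \<in> I"
    have "A P v + A P w = scale (\<chi> P) v + scale (\<chi> P) w"
      using u(2) P vw(1) by (simp add: lin(1) scale_right_distrib)
    then show "A P w = scale (\<chi> P) w" using v[OF P] by simp
  qed
  moreover have "(\<forall>P\<in>I. A P t = scale (\<psi> t P) t) \<and> (\<exists>P\<in>I. \<psi> t P \<noteq> \<chi> P)" if "t \<in> G - ?E" for t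
    using that \<psi>[of t] G(2) by fastforce
  ultimately have "w = 0"
    using eigenvectors_span_zero[of I A "G - ?E" \<psi> \<chi> w] lin G(1) vw(3) by blast
  then show ?thesis using vw span_mono[of "G \<inter> ?E" ?E] by auto
qed

end

context uq_type
begin

section \<open>Monomials in the torus generators\<close>

definition IL :: "anode list" where
  "IL = (SOME xs. distinct xs \<and> set xs = Ihat T)"

lemma IL: "distinct IL" "set IL = Ihat T"
  using someI_ex[OF finite_distinct_list[OF finite_Ihat]] by (auto simp: IL_def conj_commute)

definition kpow :: "anode \<Rightarrow> int \<Rightarrow> 'u" where
  "kpow x n = (if 0 \<le> n then k x ^ nat n else k' x ^ nat (- n))"

definition kp :: "(anode \<Rightarrow> int) \<Rightarrow> 'u" where
  "kp m = prod_list (map (\<lambda>x. kpow x (m x)) IL)"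

text \<open>q to the inner product of the lattice element \<open>m\<close> with the simple root of
  y.\<close>

definition qch :: "(anode \<Rightarrow> int) \<Rightarrow> anode \<Rightarrow> complex" where
  "qch m y = (\<Prod>x\<in>Ihat T. Q x y powi m x)"

lemma qch_nz [simp]: "qch m y \<noteq> 0"
  by (simp add: qch_def)

lemma kpow_0 [simp]: "kpow x 0 = 1" and kpow_1 [simp]: "kpow x 1 = k x" "kpow x (- 1) = k' x"
  by (simp_all add: kpow_def)

lemma kpow_Suc: "kpow x (n + 1) = k x * kpow x n" and kpow_pred: "kpow x (n - 1) = k' x * kpow x n"
proof -
  have 1: "kpow x (n + 1) = k x * kpow x n" for n
  proof (cases "0 \<le> n")
    case True
    then show ?thesis by (simp add: kpow_def nat_add_distrib)
  next
    case False
    then have "nat (- n) = Suc (nat (- (n + 1)))" by simp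
    then have "kpow x n = k' x * k' x ^ nat (- (n + 1))" using False by (simp add: kpow_def)
    then have "k x * kpow x n = k' x ^ nat (- (n + 1))"
      by (simp add: mult.assoc[symmetric] kk')
    moreover have "kpow x (n + 1) = k' x ^ nat (- (n + 1))"
    proof (cases "n = - 1")
      case True then show ?thesis by (simp add: kpow_def)
    qed (use False in \<open>simp add: kpow_def\<close>)
    ultimately show ?thesis by simp
  qed
  show "kpow x (n + 1) = k x * kpow x n" by (rule 1)
  show "kpow x (n - 1) = k' x * kpow x n"
    using 1[of "n - 1"] by (simp add: mult.assoc[symmetric] kk')
qed

lemma kpow_add: "kpow x (m + n) = kpow x m * kpow x n"
proof (induction m rule: int_induct[where k = 0])
  case (step1 i)
  have "kpow x (i + 1 + n) = k x * kpow x (i + n)"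
    using kpow_Suc[of x "i + n"] by (simp only: add.commute add.left_commute)
  then show ?case by (simp only: kpow_Suc step1 mult.assoc)
next
  case (step2 i)
  have "kpow x (i - 1 + n) = k' x * kpow x (i + n)"
    using kpow_pred[of x "i + n"] by (simp only: diff_add_eq)
  then show ?case by (simp only: kpow_pred step2 mult.assoc)
qed simp

lemma comm_power: "a * b = b * a \<Longrightarrow> a * b ^ n = b ^ n * (a::'u)"
proof (induction n)
  case (Suc n)
  have "a * b ^ Suc n = (a * b) * b ^ n" by (simp add: mult.assoc)
  also have "\<dots> = b * (a * b ^ n)" by (simp only: Suc.prems mult.assoc)
  finally show ?case by (simp add: Suc mult.assoc)
qed simp

lemma kpow_comm1: "a * k y = k y * a \<Longrightarrow> a * kpow y n = kpow y n * a"
  using commute_inverse[OF _ kk'(1) kk'(2), of a y] by (simp add: kpow_def comm_power)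

lemma kpow_comm: "kpow x m * kpow y n = kpow y n * kpow x m"
  by (intro kpow_comm1 kpow_comm1[symmetric] kk_comm)

lemma kpow_prod_comm: "kpow x n * prod_list (map (\<lambda>y. kpow y (m y)) xs) = prod_list (map (\<lambda>y. kpow y (m y)) xs) * kpow x n"
proof (induction xs)
  case (Cons y xs)
  have "kpow x n * (kpow y (m y) * prod_list (map (\<lambda>y. kpow y (m y)) xs)) =
      kpow y (m y) * (kpow x n * prod_list (map (\<lambda>y. kpow y (m y)) xs))"
    by (simp only: mult.assoc[symmetric] kpow_comm)
  then show ?case by (simp add: Cons mult.assoc)
qed simp

lemma kp_add: "kp (\<lambda>x. m x + n x) = kp m * kp n"
proof -
  have "prod_list (map (\<lambda>x. kpow x (m x + n x)) xs) =
    prod_list (map (\<lambda>x. kpow x (m x)) xs) * prod_list (map (\<lambda>x. kpow x (n x)) xs)" for xs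
  proof (induction xs)
    case (Cons y xs)
    let ?p = "\<lambda>m. prod_list (map (\<lambda>x. kpow x (m x)) xs)"
    have "prod_list (map (\<lambda>x. kpow x (m x + n x)) (y # xs)) = kpow y (m y + n y) * (?p m * ?p n)"
      by (simp only: list.map prod_list.Cons Cons)
    also have "\<dots> = kpow y (m y) * (kpow y (n y) * ?p m) * ?p n"
      by (simp only: kpow_add mult.assoc)
    also have "kpow y (n y) * ?p m = ?p m * kpow y (n y)" by (rule kpow_prod_comm)
    finally show ?case by (simp only: list.map prod_list.Cons mult.assoc)
  qed simp
  then show ?thesis by (simp add: kp_def)
qed

lemma kp_0: "kp (\<lambda>x. 0) = 1"
proof -
  have "prod_list (map (\<lambda>x. 1::'u) xs) = 1" for xs :: "anode list" by (induction xs) auto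
  then show ?thesis by (simp add: kp_def)
qed

lemma kp_single: "x \<in> Ihat T \<Longrightarrow> kp (\<lambda>y. if y = x then n else 0) = kpow x n"
proof -
  assume x: "x \<in> Ihat T"
  have "distinct xs \<Longrightarrow> prod_list (map (\<lambda>y. kpow y (if y = x then n else 0)) xs) = (if x \<in> set xs then kpow x n else 1)" for xs
    by (induction xs) auto
  then show ?thesis using IL x by (simp add: kp_def)
qed

lemma kp_comm: "kp m * kp n = kp n * kp m"
  using kp_add[of m n] kp_add[of n m] by (simp add: add.commute)

lemma kp_uminus: "kp m * kp (\<lambda>x. - m x) = 1" "kp (\<lambda>x. - m x) * kp m = 1"
  using kp_add[of m "\<lambda>x. - m x"] kp_comm[of m "\<lambda>x. - m x"] by (simp_all add: kp_0)

lemma k_eq_kp: "x \<in> Ihat T \<Longrightarrow> k x = kp (\<lambda>y. if y = x then 1 else 0)"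
  "x \<in> Ihat T \<Longrightarrow> k' x = kp (\<lambda>y. if y = x then - 1 else 0)"
  by (simp_all only: kp_single kpow_1)

lemma kp_marks: "kp (\<lambda>x. n * int (marks T x)) = 1"
proof -
  have 1: "kp (\<lambda>x. int (marks T x)) = 1"
    using central_k[OF IL] by (simp add: kp_def kpow_def)
  show ?thesis
  proof (induction n rule: int_induct[where k = 0])
    case (step1 i)
    then show ?case using kp_add[of "\<lambda>x. i * int (marks T x)" "\<lambda>x. int (marks T x)"] 1 by (simp add: distrib_right)
  next
    case (step2 i)
    then show ?case using kp_add[of "\<lambda>x. (i - 1) * int (marks T x)" "\<lambda>x. int (marks T x)"] 1
      by (simp add: left_diff_distrib)
  qed (simp add: kp_0)
qed

lemma k_kp:
  assumes "x \<in> Ihat T"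
  shows "k x * kp m = kp (\<lambda>y. (if y = x then 1 else 0) + m y)" "k' x * kp m = kp (\<lambda>y. (if y = x then - 1 else 0) + m y)"
  using assms by (simp_all only: kp_add k_eq_kp)

text \<open>The premise \<open>m x \<noteq> 0\<close> is recorded so that a monomial with exponent 0
  at \<open>None\<close> is reached without the affine k.\<close>

lemma kp_induct:
  assumes "P 1" and k: "\<And>x u. x \<in> Ihat T \<Longrightarrow> m x \<noteq> 0 \<Longrightarrow> P u \<Longrightarrow> P (k x * u)"
    and k': "\<And>x u. x \<in> Ihat T \<Longrightarrow> m x \<noteq> 0 \<Longrightarrow> P u \<Longrightarrow> P (k' x * u)"
  shows "P (kp m)"
proof -
  have kpow: "P (kpow x n * u)" if "x \<in> Ihat T" "m x \<noteq> 0" "P u" for x n u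
    by (induction n rule: int_induct[where k = 0]) (simp_all add: kpow_Suc kpow_pred mult.assoc k k' that)
  have "set xs \<subseteq> Ihat T \<Longrightarrow> P (prod_list (map (\<lambda>x. kpow x (m x)) xs))" for xs
  proof (induction xs)
    case (Cons x xs)
    then show ?case by (cases "m x = 0") (simp_all add: kpow)
  qed (simp add: assms)
  then show ?thesis by (simp add: kp_def IL)
qed

text \<open>The affine mark is 1, so the central relation expresses the affine k through the
  others.\<close>

lemma kp_normal: "\<exists>n. n None = 0 \<and> kp m = kp n"
proof -
  have a: "int (marks T None) = 1" using marks by (simp add: is_marks_def)
  have "kp m = kp (\<lambda>x. (m x - m None * int (marks T x)) + m None * int (marks T x))" by simp
  also have "\<dots> = kp (\<lambda>x. m x - m None * int (marks T x))" by (simp only: kp_add kp_marks mult_1_right)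
  finally show ?thesis by (intro exI[of _ "\<lambda>x. m x - m None * int (marks T x)"]) (simp add: a)
qed

lemma k'f: "k' x * f y = Q x y \<star> (f y * k' x)"
  using inv_weight[OF kk' kf, of x y] by simp

lemma commute_scal_power:
  assumes "a * b = z \<star> (b * (a::'u))" shows "a ^ n * b = (z ^ n) \<star> (b * a ^ n)"
proof (induction n)
  case (Suc n)
  have "a ^ Suc n * b = a * (a ^ n * b)" by (simp add: mult.assoc)
  also have "\<dots> = z ^ n \<star> ((a * b) * a ^ n)" by (simp add: Suc csc_mult_right mult.assoc)
  finally show ?case by (simp add: assms csc_mult_left csc_csc mult.assoc mult.commute)
qed (simp add: csc_one)

lemma kpow_scal: assumes "k x * u = z \<star> (u * k x)" "z \<noteq> 0" shows "kpow x n * u = (z powi n) \<star> (u * kpow x n)"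
  using commute_scal_power[OF assms(1)] commute_scal_power[OF inv_weight[OF kk' assms]] assms(2)
  by (auto simp: kpow_def power_int_def)

lemma kp_scal:
  assumes "\<And>x. x \<in> Ihat T \<Longrightarrow> k x * u = z x \<star> (u * k x) \<and> z x \<noteq> 0"
  shows "kp m * u = (\<Prod>x\<in>Ihat T. z x powi m x) \<star> (u * kp m)"
proof -
  have "set xs \<subseteq> Ihat T \<Longrightarrow> prod_list (map (\<lambda>x. kpow x (m x)) xs) * u =
     prod_list (map (\<lambda>x. z x powi m x) xs) \<star> (u * prod_list (map (\<lambda>x. kpow x (m x)) xs))" for xs
  proof (induction xs)
    case (Cons x xs)
    let ?p = "prod_list (map (\<lambda>x. kpow x (m x)) xs)" and ?z = "prod_list (map (\<lambda>x. z x powi m x) xs)"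
    have "kpow x (m x) * ?p * u = ?z \<star> ((kpow x (m x) * u) * ?p)"
      using Cons by (simp add: mult.assoc csc_mult_right)
    also have "\<dots> = (?z * z x powi m x) \<star> (u * (kpow x (m x) * ?p))"
      using kpow_scal[of x u "z x" "m x"] assms[of x] Cons.prems by (simp add: csc_mult_left csc_csc mult.assoc)
    finally show ?case by (simp add: mult.commute)
  qed (simp add: csc_one)
  from this[of IL] show ?thesis
    using prod.distinct_set_conv_list[OF IL(1), of "\<lambda>x. z x powi m x"] IL(2) by (simp add: kp_def)
qed

lemma kp_f: "kp m * f y = inverse (qch m y) \<star> (f y * kp m)"
proof -
  have "kp m * f y = (\<Prod>x\<in>Ihat T. inverse (Q x y) powi m x) \<star> (f y * kp m)"
    by (rule kp_scal) (simp add: kf)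
  then show ?thesis
    using prod_inversef[of "\<lambda>x. Q x y powi m x" "Ihat T"] by (simp add: qch_def power_int_inverse o_def)
qed

section \<open>Words, the Borel subalgebra as a span, and normal forms\<close>

definition ew :: "anode list \<Rightarrow> 'u" where "ew w = prod_list (map e w)"
definition fw :: "anode list \<Rightarrow> 'u" where "fw w = prod_list (map f w)"

lemma ew_simps [simp]: "ew [] = 1" "ew (x # w) = e x * ew w"
  and fw_simps [simp]: "fw [] = 1" "fw (x # w) = f x * fw w"
  by (simp_all add: ew_def fw_def)

lemma k_ew: "k x * ew w = Qw x w \<star> (ew w * k x)"
proof (induction w)
  case (Cons y w)
  have "k x * (e y * ew w) = Q x y \<star> (e y * (k x * ew w))"
    by (simp add: mult.assoc[symmetric] ke csc_mult_left)
  then show ?case by (simp add: Cons csc_mult_right csc_csc mult.assoc)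
qed (simp add: csc_one)

lemma k_fw: "k x * fw w = inverse (Qw x w) \<star> (fw w * k x)"
proof (induction w)
  case (Cons y w)
  have "k x * (f y * fw w) = inverse (Q x y) \<star> (f y * (k x * fw w))"
    by (simp add: mult.assoc[symmetric] kf csc_mult_left)
  then show ?case by (simp add: Cons csc_mult_right csc_csc mult.assoc)
qed (simp add: csc_one)

text \<open>The image of the Borel subalgebra, described by a spanning set of weight vectors instead
  of closure under products; it is shown to be multiplicatively closed afterwards.\<close>

definition Bs :: "'u set" where
  "Bs = cvec.span {ew w * kp m | w m. True}"

lemma Bs_closed:
  "0 \<in> Bs" "a \<in> Bs \<Longrightarrow> b \<in> Bs \<Longrightarrow> a + b \<in> Bs" "a \<in> Bs \<Longrightarrow> z \<star> a \<in> Bs"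
  "a \<in> Bs \<Longrightarrow> - a \<in> Bs" "a \<in> Bs \<Longrightarrow> b \<in> Bs \<Longrightarrow> a - b \<in> Bs"
  "(\<And>i. i \<in> I \<Longrightarrow> g i \<in> Bs) \<Longrightarrow> sum g I \<in> Bs"
  unfolding Bs_def by (auto intro: cvec.span_zero cvec.span_add cvec.span_scale cvec.span_neg cvec.span_diff cvec.span_sum)

lemma Bs_word: "ew w * kp m \<in> Bs"
  unfolding Bs_def by (rule cvec.span_base) blast

lemma kp_Bs: "kp m \<in> Bs"
  using Bs_word[of "[]"] by simp

lemma Bs_1: "1 \<in> Bs"
  using kp_Bs[of "\<lambda>x. 0"] by (simp add: kp_0)

lemma Bs_induct [consumes 1, case_names one zero add scal e k k']:
  assumes "b \<in> Bs" "P 1" "P 0" "\<And>a b. a \<in> Bs \<Longrightarrow> b \<in> Bs \<Longrightarrow> P a \<Longrightarrow> P b \<Longrightarrow> P (a + b)" "\<And>z b. b \<in> Bs \<Longrightarrow> P b \<Longrightarrow> P (z \<star> b)"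
    and e: "\<And>x b. b \<in> Bs \<Longrightarrow> P b \<Longrightarrow> x \<in> Ihat T \<Longrightarrow> P (e x * b)"
    and k: "\<And>x b. b \<in> Bs \<Longrightarrow> P b \<Longrightarrow> x \<in> Ihat T \<Longrightarrow> P (k x * b)"
    and k': "\<And>x b. b \<in> Bs \<Longrightarrow> P b \<Longrightarrow> x \<in> Ihat T \<Longrightarrow> P (k' x * b)"
  shows "P b"
proof -
  have kp: "P (kp m)" for m
  proof -
    have "(\<exists>n. kp m = kp n) \<and> P (kp m)"
    proof (rule kp_induct)
      show "(\<exists>n. 1 = kp n) \<and> P 1" using kp_0 assms(2) by metis
      show "(\<exists>n. k x * u = kp n) \<and> P (k x * u)" if "x \<in> Ihat T" "(\<exists>n. u = kp n) \<and> P u" for x u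
        using that k_kp(1)[OF that(1)] k[OF kp_Bs] by metis
      show "(\<exists>n. k' x * u = kp n) \<and> P (k' x * u)" if "x \<in> Ihat T" "(\<exists>n. u = kp n) \<and> P u" for x u
        using that k_kp(2)[OF that(1)] k'[OF kp_Bs] by metis
    qed
    then show ?thesis ..
  qed
  have w: "P (ew w * kp m)" for w m
  proof (induction w)
    case Nil
    then show ?case using kp by simp
  next
    case (Cons x w)
    show ?case
    proof (cases "x \<in> Ihat T")
      case True
      then show ?thesis using e[OF Bs_word Cons True] by (simp add: mult.assoc)
    next
      case False
      then show ?thesis using assms(3) by (simp add: gens_out)
    qed
  qed
  have "b \<in> Bs \<and> P b"
    using assms(1) unfolding Bs_def
  proof (induction rule: cvec.span_induct_alt)
    case base
    show ?case using assms(3) by (simp add: cvec.span_zero)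
  next
    case (step c u b)
    then have "u \<in> Bs" "P u" using w Bs_word by auto
    then show ?case using step assms(4)[of "c \<star> u" b] assms(5)[of u c] Bs_closed unfolding Bs_def by blast
  qed
  then show ?thesis by simp
qed

lemma Bs_gen: "b \<in> Bs \<Longrightarrow> e x * b \<in> Bs" "b \<in> Bs \<Longrightarrow> k x * b \<in> Bs" "b \<in> Bs \<Longrightarrow> k' x * b \<in> Bs"
proof -
  show "b \<in> Bs \<Longrightarrow> e x * b \<in> Bs"
    unfolding Bs_def
  proof (erule span_image_clin[OF _ clin_mult(1)])
    fix u assume "u \<in> {ew w * kp m | w m. True}"
    then obtain w m where "u = ew w * kp m" by blast
    then have "e x * u = ew (x # w) * kp m" by (simp add: mult.assoc)
    then show "e x * u \<in> cvec.span {ew w * kp m | w m. True}" using Bs_word[of "x # w" m] unfolding Bs_def by (simp only:)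
  qed
  show 1: "b \<in> Bs \<Longrightarrow> k x * b \<in> Bs"
  proof (cases "x \<in> Ihat T")
    case x: True
    show "b \<in> Bs \<Longrightarrow> k x * b \<in> Bs"
      unfolding Bs_def
    proof (erule span_image_clin[OF _ clin_mult(1)])
      fix u assume "u \<in> {ew w * kp m | w m. True}"
      then obtain w m where u: "u = ew w * kp m" by blast
      have "k x * u = Qw x w \<star> (ew w * (k x * kp m))"
        by (simp add: u mult.assoc[symmetric] k_ew csc_mult_left)
      also note k_kp(1)[OF x]
      finally show "k x * u \<in> cvec.span {ew w * kp m | w m. True}" using Bs_closed(3)[OF Bs_word] unfolding Bs_def by (simp only:)
    qed
  qed (simp add: gens_out)
  show "b \<in> Bs \<Longrightarrow> k' x * b \<in> Bs"
  proof (cases "x \<in> Ihat T")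
    case x: True
    show "b \<in> Bs \<Longrightarrow> k' x * b \<in> Bs"
      unfolding Bs_def
    proof (erule span_image_clin[OF _ clin_mult(1)])
      fix u assume "u \<in> {ew w * kp m | w m. True}"
      then obtain w m where u: "u = ew w * kp m" by blast
      have "k' x * u = inverse (Qw x w) \<star> (ew w * (k' x * kp m))"
        using inv_weight[OF kk' k_ew[of x w]] by (simp add: u mult.assoc[symmetric] csc_mult_left)
      also note k_kp(2)[OF x]
      finally show "k' x * u \<in> cvec.span {ew w * kp m | w m. True}" using Bs_closed(3)[OF Bs_word] unfolding Bs_def by (simp only:)
    qed
  qed (simp add: gens_out)
qed

lemma Bs_mult: "a \<in> Bs \<Longrightarrow> b \<in> Bs \<Longrightarrow> a * b \<in> Bs"
  by (induction rule: Bs_induct) (auto simp: Bs_closed Bs_gen distrib_right csc_mult_left mult.assoc)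

lemma Bs_gens: "e x \<in> Bs" "k x \<in> Bs" "k' x \<in> Bs"
  using Bs_gen[OF Bs_1] by simp_all

lemma u_induct [case_names one zero add scal f e k k']:
  assumes "P 1" "P 0" "\<And>a b. P a \<Longrightarrow> P b \<Longrightarrow> P (a + b)" "\<And>z b. P b \<Longrightarrow> P (z \<star> b)"
    "\<And>x b. x \<in> Ihat T \<Longrightarrow> P b \<Longrightarrow> P (f x * b)" "\<And>x b. x \<in> Ihat T \<Longrightarrow> P b \<Longrightarrow> P (e x * b)"
    "\<And>x b. x \<in> Ihat T \<Longrightarrow> P b \<Longrightarrow> P (k x * b)" "\<And>x b. x \<in> Ihat T \<Longrightarrow> P b \<Longrightarrow> P (k' x * b)"
  shows "P u"
proof -
  have sum: "(\<And>i. i \<in> I \<Longrightarrow> P (g i)) \<Longrightarrow> P (sum g I)" for I and g :: "gen word \<Rightarrow> 'u"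
    by (induction I rule: infinite_finite_induct) (use assms(2,3) in auto)
  have w: "set w \<subseteq> Gens T \<Longrightarrow> P (prod_list (map op w))" for w
  proof (induction w)
    case (Cons g w)
    then have "g \<in> Gens T" "P (prod_list (map op w))" by auto
    moreover then obtain x where "x \<in> Ihat T" "g \<in> {GE Pos x, GE Neg x, GK x, GKinv x}"
      unfolding Gens_def by (auto) (metis sign.exhaust)
    ultimately show ?case using assms(5-8) by (auto simp: fold_gens)
  qed (simp add: assms)
  obtain p where p: "p \<in> carrier FA" "u = feval op p" using u_feval by blast
  show ?thesis unfolding p(2) feval_def
    by (rule sum) (use p(1) w assms(4) in \<open>auto simp: free_algebra_def\<close>)
qed

lemma normal_form: "u \<in> cvec.span {fw v * b | v b. b \<in> Bs}"
proof -
  let ?S = "{fw v * b | v b. b \<in> Bs}"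
  have f: "u \<in> cvec.span ?S \<Longrightarrow> f x * u \<in> cvec.span ?S" for x u
  proof (erule span_image_clin[OF _ clin_mult(1)])
    fix u assume "u \<in> ?S"
    then obtain v b where "u = fw v * b" "b \<in> Bs" by blast
    then have "f x * u = fw (x # v) * b" "b \<in> Bs" by (simp_all add: mult.assoc)
    then show "f x * u \<in> cvec.span ?S" by (intro cvec.span_base) blast
  qed
  have k: "u \<in> cvec.span ?S \<Longrightarrow> k x * u \<in> cvec.span ?S" for x u
  proof (erule span_image_clin[OF _ clin_mult(1)])
    fix u assume "u \<in> ?S"
    then obtain v b where u: "u = fw v * b" "b \<in> Bs" by blast
    then have "k x * u = inverse (Qw x v) \<star> (fw v * (k x * b))"
      by (simp add: mult.assoc[symmetric] k_fw csc_mult_left)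
    moreover have "fw v * (k x * b) \<in> ?S" using u Bs_gen by blast
    ultimately show "k x * u \<in> cvec.span ?S" by (simp add: cvec.span_base cvec.span_scale)
  qed
  have k': "u \<in> cvec.span ?S \<Longrightarrow> k' x * u \<in> cvec.span ?S" for x u
  proof (erule span_image_clin[OF _ clin_mult(1)])
    fix u assume "u \<in> ?S"
    then obtain v b where u: "u = fw v * b" "b \<in> Bs" by blast
    then have "k' x * u = Qw x v \<star> (fw v * (k' x * b))"
      using inv_weight[OF kk' k_fw[of x v]] by (simp add: mult.assoc[symmetric] csc_mult_left)
    moreover have "fw v * (k' x * b) \<in> ?S" using u Bs_gen by blast
    ultimately show "k' x * u \<in> cvec.span ?S" by (simp add: cvec.span_base cvec.span_scale)
  qed
  \<comment> \<open>The one case that reorders generators: e is moved through the f's, and each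
    commutator leaves a torus element in front of a shorter word.\<close>
  have ev: "e x * (fw v * b) \<in> cvec.span ?S" if "b \<in> Bs" for x v b
  proof (induction v)
    case Nil
    have "fw [] * (e x * b) \<in> ?S" using Bs_gen that by blast
    then show ?case by (simp add: cvec.span_base)
  next
    case (Cons y v)
    have s: "fw v * b \<in> cvec.span ?S" using that by (intro cvec.span_base) blast
    have "e x * (fw (y # v) * b) = f y * (e x * (fw v * b)) +
        (if x = y then cc x \<star> (k x * (fw v * b) - k' x * (fw v * b)) else 0)"
      by (simp add: mult.assoc[symmetric] ef) (simp add: calg_norm)
    then show ?case using Cons f k[OF s] k'[OF s]
      by (auto intro!: cvec.span_add cvec.span_scale cvec.span_diff)
  qed
  have e: "u \<in> cvec.span ?S \<Longrightarrow> e x * u \<in> cvec.span ?S" for x u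
    by (erule span_image_clin[OF _ clin_mult(1)]) (use ev in auto)
  have one: "1 \<in> cvec.span ?S"
  proof -
    have "fw [] * 1 \<in> ?S" using Bs_1 by blast
    then show ?thesis by (simp add: cvec.span_base)
  qed
  show ?thesis
    by (induction u rule: u_induct)
      (rule one cvec.span_zero cvec.span_add cvec.span_scale f e k k' | assumption)+
qed

lemma word_span: "u \<in> cvec.span {fw v * (ew w * kp m) | v w m. True}"
proof -
  have "fw v * b \<in> cvec.span {fw v * (ew w * kp m) | v w m. True}" if "b \<in> Bs" for v b
  proof (rule span_image_clin[OF that[unfolded Bs_def]])
    show "clin (\<lambda>b. fw v * b)" by (rule clin_mult)
  qed (auto intro!: cvec.span_base)
  then have "{fw v * b | v b. b \<in> Bs} \<subseteq> cvec.span {fw v * (ew w * kp m) | v w m. True}" by blast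
  then show ?thesis using normal_form[of u] cvec.span_minimal[OF _ cvec.subspace_span] by blast
qed
end

section \<open>Functionals from induced modules\<close>

context datum_rep
begin

lemma lookup_K: "Poly_Mapping.lookup (app (K x) m) w = inverse (Qw x w) \<star> app (\<kappa> x) (Poly_Mapping.lookup m w)"
  by (induction m rule: pm_single_induct)
    (auto simp: app_lin lookup_add lookup_single when_def csc_add_right)

lemma lookup_K': "Poly_Mapping.lookup (app (K' x) m) w = Qw x w \<star> app (\<kappa>' x) (Poly_Mapping.lookup m w)"
  by (induction m rule: pm_single_induct)
    (auto simp: app_lin lookup_add lookup_single when_def csc_add_right)

text \<open>Apart from the empty word itself, only the word \<open>[x]\<close> contributes at the
  empty word, so words of length below 2 suffice to describe the action there.\<close>

lemma lookup_E: "Poly_Mapping.lookup (app (E x) m) [] = app (\<epsilon> x) (Poly_Mapping.lookup m []) +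
   (1 / (qi T x - inverse (qi T x))) \<star> (app (\<kappa> x) (Poly_Mapping.lookup m [x]) - app (\<kappa>' x) (Poly_Mapping.lookup m [x]))"
proof (induction m rule: pm_single_induct)
  case (2 p r)
  then show ?case by (simp add: app_lin lookup_add csc_add_right csc_diff algebra_simps)
next
  case (3 w l)
  show ?case
  proof (cases w)
    case Nil
    then show ?thesis by (simp add: lookup_single app_lin)
  next
    case (Cons y v)
    then show ?thesis
      by (auto simp: E_single lookup_add lookup_F lookup_single when_def app_lin lookup_K lookup_K'
          lookup_minus csc_one)
  qed
qed (simp add: app_lin)

end

context uq_type
begin

text \<open>\<open>pz u\<close> and \<open>pj j u\<close> are the components of \<open>u l\<close> in the induced module at the words \<open>[]\<close> and \<open>[j]\<close>.
  They are well defined because the relations act with values in words of length at least two.\<close>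

definition functionals ::
    "(anode \<Rightarrow> 'l::cvec endo) \<Rightarrow> (anode \<Rightarrow> 'l endo) \<Rightarrow> (anode \<Rightarrow> 'l endo) \<Rightarrow> 'l \<Rightarrow> ('u \<Rightarrow> 'l) \<Rightarrow> (anode \<Rightarrow> 'u \<Rightarrow> 'l) \<Rightarrow> bool" where
  "functionals \<epsilon> \<kappa> \<kappa>' l pz pj \<longleftrightarrow>
     clin pz \<and> (\<forall>j. clin (pj j)) \<and> pz 1 = l \<and> (\<forall>j. \<forall>b\<in>Bs. pj j b = 0) \<and>
     (\<forall>x u. pz (f x * u) = 0) \<and> (\<forall>j\<in>Ihat T. \<forall>x u. pj j (f x * u) = (if x = j then pz u else 0)) \<and>
     (\<forall>x\<in>Ihat T. \<forall>u. pz (k x * u) = app (\<kappa> x) (pz u) \<and> pz (k' x * u) = app (\<kappa>' x) (pz u) \<and>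
        pz (e x * u) = app (\<epsilon> x) (pz u) + cc x \<star> (app (\<kappa> x) (pj x u) - app (\<kappa>' x) (pj x u)))"

lemma functionals_exist:
  fixes \<epsilon> \<kappa> \<kappa>' :: "anode \<Rightarrow> 'l::cvec endo"
  assumes "borel_rep \<epsilon> \<kappa> \<kappa>'"
  shows "\<exists>pz pj. functionals \<epsilon> \<kappa> \<kappa>' l pz pj"
proof -
  interpret D: datum_rep T \<epsilon> \<kappa> \<kappa>'
    by unfold_locales (rule assms)
  define r where "r u = (SOME p. p \<in> carrier FA \<and> u = feval op p)" for u
  have r: "r u \<in> carrier FA" "feval op (r u) = u" for u
    using someI_ex[OF u_feval[of u, unfolded Bex_def]] unfolding r_def by simp_all
  define L where "L p = app (feval D.opM p) (Poly_Mapping.single [] l)" for p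
  define G where "G w u = Poly_Mapping.lookup (L (r u)) w" for w u
  \<comment> \<open>Independence of the chosen representative: two representatives differ by an
    element of the relation ideal, whose values have no coefficient at words of length below
    2.\<close>
  have G: "G w (feval op p) = Poly_Mapping.lookup (L p) w" if "p \<in> carrier FA" "length w < 2" for p w
  proof -
    have "r (feval op p) - p \<in> carrier FA" using r that by (simp add: free_algebra_closed)
    moreover have "feval op (r (feval op p) - p) = 0" using r by (simp add: feval_diff)
    ultimately have "r (feval op p) - p \<in> rel_ideal T" using feval_eq_0 by blast
    then have "app (feval D.opM (r (feval op p) - p)) (Poly_Mapping.single [] l) \<in> D.R" by (rule D.rel_ideal_R)
    then have "Poly_Mapping.lookup (L (r (feval op p)) - L p) w = 0"
      using D.R_supp that(2) by (fastforce simp: L_def feval_diff D.supp_ge_def)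
    then show ?thesis by (simp add: G_def lookup_minus)
  qed
  have Gen: "fgen g \<in> carrier FA" if "g \<in> Gens T" for g using that by (rule free_algebra_basic(4))
  have op: "G w (op g * u) = Poly_Mapping.lookup (app (D.opM g) (L (r u))) w" if "g \<in> Gens T" "length w < 2" for g u w
  proof -
    have "op g * u = feval op (fgen g * r u)" by (simp add: feval_mult feval_fgen r)
    then have "G w (op g * u) = Poly_Mapping.lookup (L (fgen g * r u)) w"
      using G[OF free_algebra_closed(1)[OF Gen[OF that(1)] r(1)[of u]] that(2)] by simp
    then show ?thesis by (simp add: L_def feval_mult feval_fgen)
  qed
  have gs: "GE b x \<in> Gens T" "GK x \<in> Gens T" "GKinv x \<in> Gens T" if "x \<in> Ihat T" for x b
    using that by (auto simp: Gens_def)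
  have lin: "clin (G w)" if "length w < 2" for w
  proof (rule clinI)
    fix u v a
    have "G w (u + v) = G w (feval op (r u + r v))" by (simp add: feval_add r)
    also have "\<dots> = Poly_Mapping.lookup (L (r u + r v)) w" by (rule G) (simp_all add: r that free_algebra_closed)
    finally show "G w (u + v) = G w u + G w v" by (simp add: G_def L_def feval_add lookup_add)
    have "G w (a \<star> u) = G w (feval op (fscal a * r u))" by (simp add: feval_mult feval_fscal r csc_mult_left)
    also have "\<dots> = Poly_Mapping.lookup (L (fscal a * r u)) w"
      by (rule G) (simp_all add: r that free_algebra_closed free_algebra_basic)
    finally show "G w (a \<star> u) = a \<star> G w u" by (simp add: G_def L_def feval_mult feval_fscal)
  qed
  have one: "G w 1 = Poly_Mapping.lookup (Poly_Mapping.single [] l) w" if "length w < 2" for w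
    using G[of 1 w] that by (simp add: free_algebra_basic L_def)
  \<comment> \<open>Elements of the Borel subalgebra have a representative without f's, which keeps
    the vector in the empty-word layer; hence the functionals at one-letter words vanish on
    \<open>Bs\<close>.\<close>
  have B: "\<exists>p\<in>carrier FA. feval op p = b \<and> (\<exists>l'. L p = Poly_Mapping.single [] l')" if "b \<in> Bs" for b
    using that
  proof (induction rule: Bs_induct)
    case one
    show ?case by (rule bexI[of _ 1]) (auto simp: L_def free_algebra_basic)
  next
    case zero
    show ?case by (rule bexI[of _ 0]) (auto simp: L_def free_algebra_basic intro: exI[of _ 0])
  next
    case (add a b)
    then obtain p p' l1 l2 where "p \<in> carrier FA" "p' \<in> carrier FA" "feval op p = a" "feval op p' = b"
      "L p = Poly_Mapping.single [] l1" "L p' = Poly_Mapping.single [] l2" by blast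
    then show ?case
      by (intro bexI[of _ "p + p'"]) (auto simp: L_def feval_add free_algebra_closed single_add[symmetric])
  next
    case (scal z b)
    then obtain p l1 where "p \<in> carrier FA" "feval op p = b" "L p = Poly_Mapping.single [] l1" by blast
    then show ?case
      by (intro bexI[of _ "fscal z * p"])
        (auto simp: L_def feval_mult feval_fscal free_algebra_closed free_algebra_basic csc_mult_left csc_single)
  next
    case (e x b)
    then obtain p l1 where "p \<in> carrier FA" "feval op p = b" "L p = Poly_Mapping.single [] l1" by blast
    then show ?case
      by (intro bexI[of _ "FE Pos x * p"])
        (auto simp: L_def feval_mult feval_fgen free_algebra_closed Gen gs e fold_gens)
  next
    case (k x b)
    then obtain p l1 where "p \<in> carrier FA" "feval op p = b" "L p = Poly_Mapping.single [] l1" by blast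
    then show ?case
      by (intro bexI[of _ "FK x * p"])
        (auto simp: L_def feval_mult feval_fgen free_algebra_closed Gen gs k fold_gens)
  next
    case (k' x b)
    then obtain p l1 where "p \<in> carrier FA" "feval op p = b" "L p = Poly_Mapping.single [] l1" by blast
    then show ?case
      by (intro bexI[of _ "FKinv x * p"])
        (auto simp: L_def feval_mult feval_fgen free_algebra_closed Gen gs k' fold_gens)
  qed
  have B0: "G [j] b = 0" if "b \<in> Bs" for b j
  proof -
    obtain p l' where p: "p \<in> carrier FA" "feval op p = b" "L p = Poly_Mapping.single [] l'" using B[OF \<open>b \<in> Bs\<close>] by blast
    then show ?thesis using G[of p "[j]"] by (simp add: lookup_single)
  qed
  have F0: "G [] (f x * u) = 0" for x u
  proof (cases "x \<in> Ihat T")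
    case True
    then show ?thesis using op[OF gs(1)[OF True, of Neg], of "[]" u] by (simp add: fold_gens D.lookup_F)
  qed (simp add: gens_out clinD[OF lin])
  have F1: "G [j] (f x * u) = (if x = j then G [] u else 0)" if "j \<in> Ihat T" for x j u
  proof (cases "x \<in> Ihat T")
    case True
    then show ?thesis using op[OF gs(1)[OF True, of Neg], of "[j]" u] by (simp add: fold_gens D.lookup_F G_def)
  qed (use that in \<open>auto simp: gens_out clinD[OF lin]\<close>)
  have K: "G [] (k x * u) = app (\<kappa> x) (G [] u)" "G [] (k' x * u) = app (\<kappa>' x) (G [] u)"
     "G [] (e x * u) = app (\<epsilon> x) (G [] u) + cc x \<star> (app (\<kappa> x) (G [x] u) - app (\<kappa>' x) (G [x] u))"
    if x: "x \<in> Ihat T" for x u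
    using op[OF gs(2)[OF x], of "[]" u] op[OF gs(3)[OF x], of "[]" u] op[OF gs(1)[OF x, of Pos], of "[]" u]
    by (simp_all add: fold_gens D.lookup_K D.lookup_K' D.lookup_E csc_one G_def)
  have "functionals \<epsilon> \<kappa> \<kappa>' l (G []) (\<lambda>j. G [j])"
    unfolding functionals_def using lin one B0 F0 F1 K by simp
  then show ?thesis by blast
qed

subsection \<open>The Borel part\<close>

definition Lm :: "'u \<Rightarrow> 'u endo" where "Lm u = Endo (\<lambda>v. u * v)"

lemma app_Lm [simp]: "app (Lm u) v = u * v"
  by (simp add: Lm_def app_Endo clinI distrib_left csc_mult_right)

lemma Lm_hom: "Lm (u * v) = Lm u * Lm v" "Lm (u + v) = Lm u + Lm v" "Lm (z \<star> u) = z \<star> Lm u" "Lm 1 = 1" "Lm 0 = 0"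
  by (rule endo_eqI, simp add: mult.assoc distrib_right csc_mult_left)+

lemma Lm_power: "Lm (u ^ n) = Lm u ^ n"
  by (induction n) (simp_all add: Lm_hom)

lemma Lm_sum: "Lm (sum g I) = (\<Sum>i\<in>I. Lm (g i))"
  by (induction I rule: infinite_finite_induct) (simp_all add: Lm_hom)

lemma serre_Lm: "serre q n (Lm u) (Lm v) = Lm (serre q n u v)"
  by (simp add: serre_def Lm_sum Lm_hom Lm_power)

text \<open>Left multiplication with the torus rescaled by \<open>\<chi>\<close>. The product
  condition on \<open>\<chi>\<close> is exactly what the central relation demands.\<close>

lemma twisted_rep:
  assumes "\<And>x. \<chi> x \<noteq> 0" "(\<Prod>x\<in>Ihat T. \<chi> x ^ marks T x) = 1"
  shows "borel_rep (\<lambda>x. Lm (e x)) (\<lambda>x. \<chi> x \<star> Lm (k x)) (\<lambda>x. inverse (\<chi> x) \<star> Lm (k' x))"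
proof -
  have 1: "prod_list (map (\<lambda>x. (\<chi> x \<star> Lm (k x)) ^ marks T x) xs) = 1" if xs: "distinct xs" "set xs = Ihat T" for xs
  proof -
    have pw: "(z \<star> Lm u) ^ n = (z ^ n) \<star> Lm (u ^ n)" for z u n
      by (induction n) (simp_all add: Lm_hom csc_mult_left csc_mult_right csc_csc csc_one mult.commute)
    have "prod_list (map (\<lambda>x. (\<chi> x \<star> Lm (k x)) ^ marks T x) ys) =
        prod_list (map (\<lambda>x. \<chi> x ^ marks T x) ys) \<star> Lm (prod_list (map (\<lambda>x. k x ^ marks T x) ys))" for ys
      by (induction ys) (simp_all add: pw Lm_hom csc_mult_left csc_mult_right csc_csc csc_one mult.commute)
    then show ?thesis
      using central_k[OF xs] assms(2) prod.distinct_set_conv_list[OF xs(1), of "\<lambda>x. \<chi> x ^ marks T x"] xs(2)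
      by (simp add: Lm_hom csc_one)
  qed
  show ?thesis
    unfolding borel_rep_def
    using assms(1) 1 kk' kk_comm ke serre_e
    by (auto simp: csc_mult_left csc_mult_right csc_csc csc_one Lm_hom[symmetric] serre_Lm mult.commute)
qed

text \<open>Induce from left multiplication on U itself, with starting vector 1: the functional at
  the empty word is the identity on \<open>Bs\<close> but kills everything that begins with an f.
  The functional at \<open>[j]\<close> gives the second claim.\<close>

lemma Bs_f_disjoint: "b \<in> Bs \<Longrightarrow> b = (\<Sum>i\<in>I. f (x i) * u i) \<Longrightarrow> b = 0"
  and f_Bs: "j \<in> Ihat T \<Longrightarrow> b \<in> Bs \<Longrightarrow> f j * b \<in> Bs \<Longrightarrow> b = 0"
proof -
  have "borel_rep (\<lambda>x. Lm (e x)) (\<lambda>x. Lm (k x)) (\<lambda>x. Lm (k' x))"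
    using twisted_rep[of "\<lambda>x. 1"] by (simp add: csc_one)
  then obtain pz pj where F: "functionals (\<lambda>x. Lm (e x)) (\<lambda>x. Lm (k x)) (\<lambda>x. Lm (k' x)) 1 pz pj"
    using functionals_exist by blast
  have lin: "clin pz" using F by (simp add: functionals_def)
  have b: "pz b = b" if "b \<in> Bs" for b
    using that
  proof (induction rule: Bs_induct)
    case (e x b)
    then show ?case using F by (simp add: functionals_def)
  qed (use F in \<open>auto simp: functionals_def clinD csc_one\<close>)
  show "b = 0" if "b \<in> Bs" "b = (\<Sum>i\<in>I. f (x i) * u i)" for b and I :: "'b set" and x u
  proof -
    have "b = (\<Sum>i\<in>I. pz (f (x i) * u i))" using b[OF that(1)] that(2) clinD(6)[OF lin] by metis
    also have "\<dots> = 0" using F by (auto simp: functionals_def intro!: sum.neutral)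
    finally show ?thesis .
  qed
  show "b = 0" if "j \<in> Ihat T" "b \<in> Bs" "f j * b \<in> Bs"
  proof -
    have "pj j (f j * b) = pz b" using F that(1) by (simp add: functionals_def)
    moreover have "pj j (f j * b) = 0" using F that(3) unfolding functionals_def by blast
    ultimately show ?thesis using b[OF that(2)] by simp
  qed
qed

section \<open>Skew derivations of the Borel subalgebra\<close>

text \<open>On \<open>Bs\<close> this is the automorphism fixing the e's and scaling the k's by
  \<open>\<chi>\<close>. As \<open>Bs\<close> is a subalgebra of a quotient, not given by relations,
  the map is obtained as the empty-word functional of the twisted representation.\<close>

definition tw :: "(anode \<Rightarrow> complex) \<Rightarrow> 'u \<Rightarrow> 'u" where
  "tw \<chi> = (SOME pz. \<exists>pj. functionals (\<lambda>x. Lm (e x)) (\<lambda>x. \<chi> x \<star> Lm (k x)) (\<lambda>x. inverse (\<chi> x) \<star> Lm (k' x)) 1 pz pj)"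

definition chars :: "(anode \<Rightarrow> complex) set" where
  "chars = {\<chi>. (\<forall>x. \<chi> x \<noteq> 0) \<and> (\<Prod>x\<in>Ihat T. \<chi> x ^ marks T x) = 1}"

lemma tw:
  assumes "\<chi> \<in> chars"
  shows "clin (tw \<chi>)" "tw \<chi> 1 = 1"
    "x \<in> Ihat T \<Longrightarrow> tw \<chi> (k x * u) = \<chi> x \<star> (k x * tw \<chi> u)"
    "x \<in> Ihat T \<Longrightarrow> tw \<chi> (k' x * u) = inverse (\<chi> x) \<star> (k' x * tw \<chi> u)"
    "x \<in> Ihat T \<Longrightarrow> b \<in> Bs \<Longrightarrow> tw \<chi> (e x * b) = e x * tw \<chi> b"
proof -
  have "\<exists>pj. functionals (\<lambda>x. Lm (e x)) (\<lambda>x. \<chi> x \<star> Lm (k x)) (\<lambda>x. inverse (\<chi> x) \<star> Lm (k' x)) 1 (tw \<chi>) pj"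
    using someI_ex[OF functionals_exist[OF twisted_rep[of \<chi>], of 1]] assms
    unfolding tw_def chars_def by blast
  then obtain pj where F: "functionals (\<lambda>x. Lm (e x)) (\<lambda>x. \<chi> x \<star> Lm (k x)) (\<lambda>x. inverse (\<chi> x) \<star> Lm (k' x)) 1 (tw \<chi>) pj" ..
  show "clin (tw \<chi>)" "tw \<chi> 1 = 1" using F by (auto simp: functionals_def)
  show "x \<in> Ihat T \<Longrightarrow> tw \<chi> (k x * u) = \<chi> x \<star> (k x * tw \<chi> u)"
    "x \<in> Ihat T \<Longrightarrow> tw \<chi> (k' x * u) = inverse (\<chi> x) \<star> (k' x * tw \<chi> u)"
    "x \<in> Ihat T \<Longrightarrow> b \<in> Bs \<Longrightarrow> tw \<chi> (e x * b) = e x * tw \<chi> b"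
    using F by (auto simp: functionals_def)
qed

lemmas tw_lin = clinD[OF tw(1)]

lemma tw_Bs: "\<chi> \<in> chars \<Longrightarrow> b \<in> Bs \<Longrightarrow> tw \<chi> b \<in> Bs"
  by (rotate_tac 1, induction rule: Bs_induct)
    (auto simp: tw tw_lin Bs_closed Bs_1 Bs_gen)

lemma tw_mult: "\<chi> \<in> chars \<Longrightarrow> b \<in> Bs \<Longrightarrow> b' \<in> Bs \<Longrightarrow> tw \<chi> (b * b') = tw \<chi> b * tw \<chi> b'"
  by (rotate_tac 1, induction rule: Bs_induct)
    (auto simp: tw tw_lin distrib_right csc_mult_left mult.assoc Bs_mult)

lemma tw_comm: "\<chi> \<in> chars \<Longrightarrow> \<psi> \<in> chars \<Longrightarrow> b \<in> Bs \<Longrightarrow> tw \<chi> (tw \<psi> b) = tw \<psi> (tw \<chi> b)"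
  by (rotate_tac 2, induction rule: Bs_induct)
    (auto simp: tw tw_lin tw_Bs csc_csc mult.commute)

lemma tw_inv: "\<chi> \<in> chars \<Longrightarrow> \<psi> \<in> chars \<Longrightarrow> (\<And>x. \<chi> x * \<psi> x = 1) \<Longrightarrow> b \<in> Bs \<Longrightarrow> tw \<chi> (tw \<psi> b) = b"
proof (rotate_tac 3, induction rule: Bs_induct)
  case (k x b)
  then have "\<psi> x * \<chi> x = 1" by (simp add: mult.commute)
  then show ?case using k by (simp add: tw tw_lin csc_csc csc_one)
next
  case (k' x b)
  then have "inverse (\<psi> x) * inverse (\<chi> x) = 1" by (metis inverse_mult_distrib inverse_1 mult.commute)
  then show ?case using k' by (simp add: tw tw_lin csc_csc csc_one)
qed (auto simp: tw tw_lin tw_Bs)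

lemma chars_Q: "(\<lambda>x. inverse (Q x j)) \<in> chars" "(\<lambda>x. Q x j) \<in> chars"
  using mk_Q[of j] by (auto simp: chars_def power_inverse prod_inversef[unfolded o_def])

lemma tw_kpow: "\<chi> \<in> chars \<Longrightarrow> x \<in> Ihat T \<Longrightarrow> tw \<chi> (kpow x n * u) = \<chi> x powi n \<star> (kpow x n * tw \<chi> u)"
proof (induction n rule: int_induct[where k = 0])
  case (step1 i)
  then have "\<chi> x \<noteq> 0" by (simp add: chars_def)
  with step1 show ?case by (simp add: kpow_Suc tw mult.assoc csc_mult_right csc_csc power_int_add mult.commute)
next
  case (step2 i)
  then have "\<chi> x \<noteq> 0" by (simp add: chars_def)
  with step2 show ?case
    by (simp add: kpow_pred tw mult.assoc csc_mult_right csc_csc power_int_diff divide_inverse mult.commute)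
qed (simp add: csc_one)

lemma tw_kp: "\<chi> \<in> chars \<Longrightarrow> tw \<chi> (kp m) = (\<Prod>x\<in>Ihat T. \<chi> x powi m x) \<star> kp m"
proof -
  assume c: "\<chi> \<in> chars"
  have "set xs \<subseteq> Ihat T \<Longrightarrow> tw \<chi> (prod_list (map (\<lambda>x. kpow x (m x)) xs)) =
     prod_list (map (\<lambda>x. \<chi> x powi m x) xs) \<star> prod_list (map (\<lambda>x. kpow x (m x)) xs)" for xs
    by (induction xs) (simp_all add: tw(2)[OF c] tw_kpow[OF c] csc_one csc_mult_right csc_csc)
  from this[of IL] show ?thesis
    using IL(2) prod.distinct_set_conv_list[OF IL(1), of "\<lambda>x. \<chi> x powi m x"] by (simp add: kp_def)
qed

lemma tw_word: "\<chi> \<in> chars \<Longrightarrow> tw \<chi> (ew w * kp m) = (\<Prod>x\<in>Ihat T. \<chi> x powi m x) \<star> (ew w * kp m)"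
proof (induction w)
  case (Cons x w)
  show ?case
  proof (cases "x \<in> Ihat T")
    case True
    then show ?thesis using Cons tw(5)[OF Cons.prems True Bs_word] by (simp add: mult.assoc csc_mult_right)
  qed (simp add: gens_out tw_lin Cons)
qed (simp add: tw_kp)

text \<open>The character is the factor with which the k's pass \<open>f j\<close>, so that
  \<open>k x * f j = f j * ta j (k x)\<close>; \<open>ta'\<close> is the inverse twist on
  \<open>Bs\<close>.\<close>

definition ta :: "anode \<Rightarrow> 'u \<Rightarrow> 'u" where "ta j = tw (\<lambda>x. inverse (Q x j))"
definition ta' :: "anode \<Rightarrow> 'u \<Rightarrow> 'u" where "ta' j = tw (\<lambda>x. Q x j)"

lemma clin_ta: "clin (ta j)" "clin (ta' j)"
  by (simp_all add: ta_def ta'_def tw chars_Q)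

lemmas ta_lin = clinD[OF clin_ta(1)] clinD[OF clin_ta(2)]

lemma ta_simps:
  "ta j 1 = 1" "ta' j 1 = 1"
  "x \<in> Ihat T \<Longrightarrow> ta j (k x * u) = inverse (Q x j) \<star> (k x * ta j u)"
  "x \<in> Ihat T \<Longrightarrow> ta j (k' x * u) = Q x j \<star> (k' x * ta j u)"
  "x \<in> Ihat T \<Longrightarrow> b \<in> Bs \<Longrightarrow> ta j (e x * b) = e x * ta j b"
  "x \<in> Ihat T \<Longrightarrow> ta' j (k x * u) = Q x j \<star> (k x * ta' j u)"
  "x \<in> Ihat T \<Longrightarrow> ta' j (k' x * u) = inverse (Q x j) \<star> (k' x * ta' j u)"
  "x \<in> Ihat T \<Longrightarrow> b \<in> Bs \<Longrightarrow> ta' j (e x * b) = e x * ta' j b"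
  "b \<in> Bs \<Longrightarrow> ta j b \<in> Bs" "b \<in> Bs \<Longrightarrow> ta' j b \<in> Bs"
  "b \<in> Bs \<Longrightarrow> ta j (ta' j b) = b"
  "b \<in> Bs \<Longrightarrow> b' \<in> Bs \<Longrightarrow> ta j (b * b') = ta j b * ta j b'"
  by (simp_all add: ta_def ta'_def tw chars_Q tw_Bs tw_inv tw_mult)

lemma ta_comm: "b \<in> Bs \<Longrightarrow> ta i (ta j b) = ta j (ta i b)"
  by (simp add: ta_def tw_comm chars_Q)

lemma ta_gens: "x \<in> Ihat T \<Longrightarrow> ta j (e x) = e x" "x \<in> Ihat T \<Longrightarrow> ta j (k x) = inverse (Q x j) \<star> k x"
  "x \<in> Ihat T \<Longrightarrow> ta j (k' x) = Q x j \<star> k' x"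
  using ta_simps(5)[of x 1 j] ta_simps(3)[of x j 1] ta_simps(4)[of x j 1] Bs_1 by (simp_all add: ta_simps)

lemma ta_word: "ta j (ew w * kp m) = inverse (qch m j) \<star> (ew w * kp m)"
  using prod_inversef[of "\<lambda>x. Q x j powi m x" "Ihat T"]
  by (simp add: ta_def tw_word chars_Q qch_def power_int_inverse o_def)

text \<open>The remainder when \<open>f j\<close> is moved to the left. It annihilates torus
  elements and obeys a skew Leibniz rule, so it stays inside the Borel subalgebra.\<close>

definition D :: "anode \<Rightarrow> 'u \<Rightarrow> 'u" where "D j b = b * f j - f j * ta j b"

lemma clin_D: "clin (D j)"
  by (rule clinI) (simp_all add: D_def ta_lin algebra_simps csc_mult_left csc_mult_right csc_diff)

lemma D_simps:
  "D j 1 = 0"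
  "x \<in> Ihat T \<Longrightarrow> b \<in> Bs \<Longrightarrow> D j (e x * b) = e x * D j b + (if x = j then cc j \<star> ((k j - k' j) * ta j b) else 0)"
  "x \<in> Ihat T \<Longrightarrow> D j (k x * u) = k x * D j u"
  "x \<in> Ihat T \<Longrightarrow> D j (k' x * u) = k' x * D j u"
proof -
  show "D j 1 = 0" by (simp add: D_def ta_simps)
  show "D j (e x * b) = e x * D j b + (if x = j then cc j \<star> ((k j - k' j) * ta j b) else 0)"
    if "x \<in> Ihat T" "b \<in> Bs"
  proof -
    have "D j (e x * b) = e x * D j b + (e x * f j - f j * e x) * ta j b"
      using that by (simp add: D_def ta_simps algebra_simps mult.assoc)
    then show ?thesis by (simp add: ef csc_mult_left)
  qed
  show "x \<in> Ihat T \<Longrightarrow> D j (k x * u) = k x * D j u"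
    by (simp add: D_def ta_simps right_diff_distrib mult.assoc csc_mult_right)
      (simp add: mult.assoc[symmetric] kf csc_mult_left)
  show "x \<in> Ihat T \<Longrightarrow> D j (k' x * u) = k' x * D j u"
    by (simp add: D_def ta_simps right_diff_distrib mult.assoc csc_mult_right)
      (simp add: mult.assoc[symmetric] k'f csc_mult_left)
qed

lemma D_Bs: "b \<in> Bs \<Longrightarrow> D j b \<in> Bs"
proof (induction rule: Bs_induct)
  case (e x b)
  then have "(k j - k' j) * ta j b \<in> Bs" by (intro Bs_mult Bs_closed Bs_gens ta_simps)
  then show ?case using e by (auto simp: D_simps Bs_closed Bs_gen)
qed (auto simp: D_simps clinD[OF clin_D] Bs_closed Bs_gen)

text \<open>The parts of \<open>D j\<close> that produce \<open>k j\<close> and its inverse from \<open>e j\<close>; conjugation with \<open>ta j\<close>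
  separates them.\<close>

definition Dp :: "anode \<Rightarrow> 'u \<Rightarrow> 'u" where
  "Dp j b = inverse (inverse (Q j j) - Q j j) \<star> (ta j (D j (ta' j b)) - Q j j \<star> D j b)"

definition Dm :: "anode \<Rightarrow> 'u \<Rightarrow> 'u" where "Dm j b = D j b - Dp j b"

lemma Q_ne_1: "j \<in> Ihat T \<Longrightarrow> 0 < n \<Longrightarrow> Q j j ^ n \<noteq> 1"
proof -
  assume j: "j \<in> Ihat T" "0 < n"
  have "Q j j ^ n = qi T j ^ (2 * n)" using Q_diag[OF j(1)] by (simp add: power_mult)
  then show ?thesis using q_root[OF j(1)] j(2) by simp
qed

lemma Q_inverse_ne: "j \<in> Ihat T \<Longrightarrow> inverse (Q j j) - Q j j \<noteq> 0"
proof
  assume j: "j \<in> Ihat T" "inverse (Q j j) - Q j j = 0"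
  then have "Q j j ^ 2 = 1" by (simp add: power2_eq_square) (metis Q_nz right_inverse)
  then show False using Q_ne_1[OF j(1), of 2] by simp
qed

lemma clin_Dp: "clin (Dp j)" and clin_Dm: "clin (Dm j)"
proof -
  show 1: "clin (Dp j)"
    by (rule clinI) (simp_all add: Dp_def clinD[OF clin_D] ta_lin algebra_simps csc_norm mult.left_commute mult.commute)
  show "clin (Dm j)"
    by (rule clinI) (simp_all add: Dm_def clinD[OF clin_D] clinD[OF 1] csc_norm)
qed

lemmas Dp_lin = clinD[OF clin_Dp] and Dm_lin = clinD[OF clin_Dm] and D_lin = clinD[OF clin_D]

lemma Dp_Bs: "b \<in> Bs \<Longrightarrow> Dp j b \<in> Bs" and Dm_Bs: "b \<in> Bs \<Longrightarrow> Dm j b \<in> Bs"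
  by (auto simp: Dp_def Dm_def intro!: Bs_closed D_Bs ta_simps)

text \<open>Conjugation by \<open>ta j\<close> multiplies the \<open>k j\<close>-part of
  \<open>D j\<close> by \<open>inverse (Q j j)\<close> and the \<open>k' j\<close>-part by
  \<open>Q j j\<close>. The combination in \<open>Dp\<close> removes the second and normalizes the
  first.\<close>

lemma Dp_simps:
  assumes "j \<in> Ihat T" "x \<in> Ihat T" "b \<in> Bs"
  shows "Dp j (e x * b) = e x * Dp j b + (if x = j then cc j \<star> (k j * ta j b) else 0)"
    "Dp j (k x * b) = k x * Dp j b" "Dp j (k' x * b) = k' x * Dp j b"
proof -
  let ?q = "Q j j" and ?r = "inverse (inverse (Q j j) - Q j j)"
  have z: "?r * (inverse ?q - ?q) = 1" using Q_inverse_ne[OF assms(1)] by simp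
  have 1: "ta j (D j (ta' j (e x * b))) = e x * ta j (D j (ta' j b)) +
     (if x = j then cc j \<star> ((inverse ?q \<star> k j - ?q \<star> k' j) * ta j b) else 0)"
  proof -
    have m: "(k j - k' j) * b \<in> Bs" using assms by (intro Bs_mult Bs_closed Bs_gens)
    have "ta j ((k j - k' j) * b) = (inverse ?q \<star> k j - ?q \<star> k' j) * ta j b"
      using assms by (simp add: left_diff_distrib ta_lin ta_simps csc_mult_left)
    then show ?thesis using assms m
      by (simp add: ta_simps D_simps ta_lin D_Bs)
  qed
  have 2: "(inverse ?q \<star> k j - ?q \<star> k' j) * u - ?q \<star> ((k j - k' j) * u) = (inverse ?q - ?q) \<star> (k j * u)" for u
    by (simp add: left_diff_distrib csc_mult_left csc_diff)
  have "Dp j (e x * b) = e x * Dp j b + (if x = j then (?r * cc j) \<star>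
     ((inverse ?q \<star> k j - ?q \<star> k' j) * ta j b - ?q \<star> ((k j - k' j) * ta j b)) else 0)"
    unfolding Dp_def 1 D_simps(2)[OF assms(2,3)]
    by (auto simp: csc_norm csc_mult_right right_diff_distrib algebra_simps)
  also have "\<dots> = e x * Dp j b + (if x = j then cc j \<star> (k j * ta j b) else 0)"
  proof -
    have "?r * cc j * (inverse ?q - ?q) = cc j" using z by (metis mult.assoc mult.commute mult.right_neutral)
    then show ?thesis unfolding 2 csc_csc by simp
  qed
  finally show "Dp j (e x * b) = e x * Dp j b + (if x = j then cc j \<star> (k j * ta j b) else 0)" .
  show "Dp j (k x * b) = k x * Dp j b" "Dp j (k' x * b) = k' x * Dp j b"
    using assms
    by (simp_all add: Dp_def ta_simps D_simps D_lin ta_lin csc_csc csc_mult_right right_diff_distrib csc_one)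
qed

lemma Dp_1: "Dp j 1 = 0"
  by (simp add: Dp_def ta_simps D_simps ta_lin)

lemma Dm_1: "Dm j 1 = 0"
  by (simp add: Dm_def Dp_1 D_simps)

lemma Dm_simps:
  assumes "j \<in> Ihat T" "x \<in> Ihat T" "b \<in> Bs"
  shows "Dm j (e x * b) = e x * Dm j b - (if x = j then cc j \<star> (k' j * ta j b) else 0)"
    "Dm j (k x * b) = k x * Dm j b" "Dm j (k' x * b) = k' x * Dm j b"
  using assms unfolding Dm_def
  by (simp_all add: Dp_simps D_simps left_diff_distrib right_diff_distrib csc_diff)

lemma Dm_mult:
  assumes "j \<in> Ihat T" "b' \<in> Bs"
  shows "b \<in> Bs \<Longrightarrow> Dm j (b * b') = b * Dm j b' + Dm j b * ta j b'"
proof (induction rule: Bs_induct)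
  case (add a b)
  then show ?case by (simp add: Dm_lin algebra_simps)
next
  case (e x b)
  have "Dm j (e x * (b * b')) = e x * Dm j (b * b') - (if x = j then cc j \<star> (k' j * ta j (b * b')) else 0)"
    using assms e by (simp add: Dm_simps Bs_mult)
  then show ?case using assms e
    by (auto simp: Dm_simps ta_simps algebra_simps csc_mult_left mult.assoc)
qed (use assms in \<open>auto simp: Dm_lin Dm_1 Dm_simps csc_norm csc_mult_left csc_mult_right Bs_mult mult.assoc distrib_left\<close>)

lemma ta_Dp: "j \<in> Ihat T \<Longrightarrow> b \<in> Bs \<Longrightarrow> ta l (Dp j b) = inverse (Q j l) \<star> Dp j (ta l b)"
proof (rotate_tac 1, induction rule: Bs_induct)
  case (e x b)
  have "ta l (Dp j (e x * b)) = e x * ta l (Dp j b) + (if x = j then (cc j * inverse (Q j l)) \<star> (k j * ta l (ta j b)) else 0)"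
    using e by (simp add: Dp_simps ta_lin ta_simps Dp_Bs csc_csc)
  then show ?case using e ta_comm[of b l j]
    by (simp add: ta_simps Dp_simps csc_norm csc_mult_right mult.commute)
qed (auto simp: Dp_lin Dp_1 ta_lin ta_simps Dp_simps csc_norm csc_mult_right mult.commute)

lemma ta_Dm: "j \<in> Ihat T \<Longrightarrow> b \<in> Bs \<Longrightarrow> ta l (Dm j b) = Q j l \<star> Dm j (ta l b)"
proof (rotate_tac 1, induction rule: Bs_induct)
  case (e x b)
  have "ta l (Dm j (e x * b)) = e x * ta l (Dm j b) - (if x = j then (cc j * Q j l) \<star> (k' j * ta l (ta j b)) else 0)"
    using e by (simp add: Dm_simps ta_lin ta_simps Dm_Bs csc_csc)
  then show ?case using e ta_comm[of b l j]
    by (simp add: ta_simps Dm_simps csc_norm csc_mult_right mult.commute)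
qed (auto simp: Dm_lin Dm_1 ta_lin ta_simps Dm_simps csc_norm csc_mult_right mult.commute)

text \<open>Up to torus factors, \<open>Dp\<close> and \<open>Dm\<close> are the right and left skew
  derivations \<open>r_j\<close> and \<open>_jr\<close> of the positive part. Those commute, and
  moving the torus factors past them leaves the power of q.\<close>

lemma Dm_Dp:
  assumes "j \<in> Ihat T" "l \<in> Ihat T"
  shows "b \<in> Bs \<Longrightarrow> Dp l (Dm j b) = Q j l \<star> Dm j (Dp l b)"
proof (induction rule: Bs_induct)
  case (e x b)
  have 1: "Dp l (Dm j (e x * b)) = e x * Dp l (Dm j b) + (if x = l then cc l \<star> (k l * ta l (Dm j b)) else 0)
      - (if x = j then cc j \<star> (k' j * Dp l (ta j b)) else 0)"
    using assms e by (simp add: Dm_simps Dp_simps Dp_lin Dm_Bs ta_simps)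
  have 2: "Dm j (Dp l (e x * b)) = e x * Dm j (Dp l b) - (if x = j then cc j \<star> (k' j * ta j (Dp l b)) else 0)
      + (if x = l then cc l \<star> (k l * Dm j (ta l b)) else 0)"
    using assms e by (simp add: Dm_simps Dp_simps Dm_lin Dp_Bs ta_simps)
  show ?case unfolding 1 2 using assms e Q_sym[of l j]
    by (simp add: ta_Dp ta_Dm csc_norm csc_mult_right mult.commute csc_add_right csc_diff)
qed (use assms in \<open>auto simp: Dm_lin Dp_lin Dm_1 Dp_1 Dm_simps Dp_simps Dm_Bs Dp_Bs csc_norm csc_mult_right mult.commute\<close>)

lemma Dm_k: "j \<in> Ihat T \<Longrightarrow> x \<in> Ihat T \<Longrightarrow> Dm j (k x) = 0" "j \<in> Ihat T \<Longrightarrow> x \<in> Ihat T \<Longrightarrow> Dm j (k' x) = 0"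
  using Dm_simps(2,3)[OF _ _ Bs_1, of j x] by (simp_all add: Dm_1)

lemma Dm_weight:
  assumes "j \<in> Ihat T" "x \<in> Ihat T" "b \<in> Bs" "k x * b = z \<star> (b * k x)"
  shows "k x * Dm j b = (z * inverse (Q x j)) \<star> (Dm j b * k x)"
proof -
  have "k x * Dm j b = Dm j (k x * b)" by (rule Dm_simps(2)[OF assms(1-3), symmetric])
  also have "\<dots> = Dm j (z \<star> (b * k x))" by (simp only: assms(4))
  also have "\<dots> = z \<star> (Dm j b * ta j (k x))" using assms by (simp add: Dm_lin Dm_mult Bs_gens Dm_k)
  finally show ?thesis using assms by (simp add: ta_gens csc_mult_right csc_csc)
qed

lemma Dm_nilpotent: assumes j: "j \<in> Ihat T" and b: "b \<in> Bs" shows "\<exists>n. (Dm j ^^ n) b = 0"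
proof -
  \<comment> \<open>Filtration by the number of letters j in a word: \<open>Dm j\<close> removes one
    such letter.\<close>
  define F where "F n = cvec.span {ew w * kp m | w m. count_list w j < n}" for n
  have mono: "F m \<subseteq> F n" if "m \<le> n" for m n unfolding F_def by (rule cvec.span_mono) (use that in force)
  have FB: "F n \<subseteq> Bs" for n unfolding F_def Bs_def by (rule cvec.span_mono) blast
  have eF: "e x * u \<in> F (if x = j then Suc n else n)" if "u \<in> F n" for x u n
    using that unfolding F_def
  proof (rule span_image_clin[OF _ clin_mult(1)])
    fix s assume "s \<in> {ew w * kp m | w m. count_list w j < n}"
    then obtain w m where s: "s = ew w * kp m" "count_list w j < n" by blast
    then have "e x * s = ew (x # w) * kp m" "count_list (x # w) j < (if x = j then Suc n else n)"
      by (simp_all add: mult.assoc)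
    then show "e x * s \<in> cvec.span {ew w * kp m | w m. count_list w j < (if x = j then Suc n else n)}"
      by (intro cvec.span_base) blast
  qed
  have w: "Dm j (ew w * kp m) \<in> F (count_list w j)" for w m
  proof (induction w)
    case Nil
    have "kp m \<in> Bs \<and> Dm j (kp m) = 0"
      by (rule kp_induct) (simp_all add: Dm_1 Bs_1 Bs_gen Dm_simps j)
    then show ?case by (simp add: F_def cvec.span_zero)
  next
    case (Cons x w)
    show ?case
    proof (cases "x \<in> Ihat T")
      case True
      have "k' j * ta j (ew w * kp m) \<in> F (Suc (count_list w j))"
      proof -
        have "k' j * ew w = inverse (Qw j w) \<star> (ew w * k' j)" by (rule inv_weight[OF kk' k_ew]) simp
        then have "k' j * ta j (ew w * kp m) = (inverse (qch m j) * inverse (Qw j w)) \<star> (ew w * (k' j * kp m))"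
          by (simp add: ta_word csc_mult_right mult.assoc[symmetric] csc_mult_left csc_csc)
        also note k_kp(2)[OF j]
        finally show ?thesis unfolding F_def by (simp only:) (intro cvec.span_scale cvec.span_base, blast)
      qed
      then show ?thesis using Cons eF[OF Cons, of x] Dm_simps(1)[OF j True Bs_word]
        by (auto simp: mult.assoc F_def intro!: cvec.span_diff cvec.span_scale split: if_splits)
    qed (simp add: gens_out Dm_lin F_def cvec.span_zero)
  qed
  have step: "Dm j u \<in> F n" if "u \<in> F (Suc n)" for u n
    using that unfolding F_def[of "Suc n"] unfolding F_def
  proof (rule span_image_clin[OF _ clin_Dm])
    fix s assume "s \<in> {ew w * kp m | w m. count_list w j < Suc n}"
    then obtain v m where "s = ew v * kp m" "count_list v j \<le> n" by auto
    then show "Dm j s \<in> cvec.span {ew w * kp m | w m. count_list w j < n}"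
      using w[of v m] mono[of "count_list v j" n] unfolding F_def by blast
  qed
  have "u \<in> F n \<Longrightarrow> (Dm j ^^ n) u = 0" for u n
  proof (induction n arbitrary: u)
    case (Suc n)
    then show ?case using step[OF Suc.prems] by (simp add: funpow_swap1)
  qed (simp add: F_def)
  moreover have "\<exists>n. b \<in> F n"
    using b unfolding Bs_def
  proof (induction rule: cvec.span_induct_alt)
    case base
    show ?case by (simp add: F_def cvec.span_zero)
  next
    case (step c s b)
    then obtain n w m where n: "b \<in> F n" "s = ew w * kp m" by blast
    then have "s \<in> F (Suc (count_list w j))" unfolding F_def by (intro cvec.span_base) blast
    then have "s \<in> F (max n (Suc (count_list w j)))" "b \<in> F (max n (Suc (count_list w j)))"
      using n mono by (meson max.cobounded1 max.cobounded2 subsetD)+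
    then have "c \<star> s + b \<in> F (max n (Suc (count_list w j)))"
      unfolding F_def by (simp add: cvec.span_add cvec.span_scale)
    then show ?case by blast
  qed
  ultimately show ?thesis by blast
qed

end

section \<open>Exponentials of power series\<close>

primrec sp :: "(nat \<Rightarrow> 'a::calg) \<Rightarrow> nat \<Rightarrow> nat \<Rightarrow> 'a" where
  "sp g 0 m = (if m = 0 then 1 else 0)"
| "sp g (Suc n) m = (\<Sum>l\<le>m. g l * sp g n (m - l))"

definition sexp :: "(nat \<Rightarrow> 'a::calg) \<Rightarrow> nat \<Rightarrow> 'a" where
  "sexp g m = (\<Sum>n\<le>m. (1 / fact n) \<star> sp g n m)"

lemma sum_swap_diff:
  fixes g :: "nat \<Rightarrow> nat \<Rightarrow> 'a::comm_monoid_add"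
  shows "(\<Sum>l\<le>m. \<Sum>t\<le>m - l. g l t) = (\<Sum>t\<le>m. \<Sum>l\<le>m - t. g l t)"
proof -
  have 1: "{..m - l} = {t \<in> {..m}. l + t \<le> m}" if "l \<le> m" for l using that by auto
  have 2: "{..m - t} = {l \<in> {..m}. l + t \<le> m}" if "t \<le> m" for t using that by auto
  have "(\<Sum>l\<le>m. \<Sum>t\<le>m - l. g l t) = (\<Sum>l\<le>m. \<Sum>t | t \<in> {..m} \<and> l + t \<le> m. g l t)"
    by (rule sum.cong) (simp_all add: 1)
  also have "\<dots> = (\<Sum>t\<le>m. \<Sum>l | l \<in> {..m} \<and> l + t \<le> m. g l t)"
    by (rule sum.swap_restrict) simp_all
  also have "\<dots> = (\<Sum>t\<le>m. \<Sum>l\<le>m - t. g l t)"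
    by (rule sum.cong) (simp_all add: 2)
  finally show ?thesis .
qed

text \<open>Coefficientwise form of \<open>u d/du (g^(n+1)) = (n+1) (u dg/du) g^n\<close>, valid
  because the coefficients of g commute.\<close>

lemma sp_log_derivative:
  fixes g :: "nat \<Rightarrow> 'a::calg"
  assumes "\<And>i j. g i * g j = g j * g i"
  shows "of_nat m \<star> sp g (Suc n) m = of_nat (Suc n) \<star> (\<Sum>t\<le>m. of_nat t \<star> (g t * sp g n (m - t)))"
proof (induction n arbitrary: m)
  case 0
  have "of_nat m \<star> sp g (Suc 0) m = of_nat m \<star> (\<Sum>l\<le>m. if l = m then g l else 0)"
    unfolding sp.simps by (rule arg_cong[where f = "\<lambda>u. of_nat m \<star> u"], rule sum.cong) auto
  also have "\<dots> = (\<Sum>l\<le>m. if l = m then of_nat m \<star> g l else 0)" by (simp add: sum.delta)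
  also have "\<dots> = (\<Sum>t\<le>m. of_nat t \<star> (g t * sp g 0 (m - t)))" by (rule sum.cong) auto
  finally show ?case by (simp add: csc_one)
next
  case (Suc n)
  have split: "of_nat m \<star> (g l * sp g (Suc n) (m - l)) =
      of_nat l \<star> (g l * sp g (Suc n) (m - l)) + g l * (of_nat (m - l) \<star> sp g (Suc n) (m - l))" if "l \<le> m" for l
    using that by (simp add: csc_mult_right csc_add_left[symmetric] of_nat_diff del: sp.simps)
  have "of_nat m \<star> sp g (Suc (Suc n)) m = (\<Sum>l\<le>m. of_nat m \<star> (g l * sp g (Suc n) (m - l)))"
    by (simp only: sp.simps(2)[of g "Suc n"] csc_sum)
  also have "\<dots> = (\<Sum>l\<le>m. of_nat l \<star> (g l * sp g (Suc n) (m - l)) +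
      g l * (of_nat (Suc n) \<star> (\<Sum>t\<le>m - l. of_nat t \<star> (g t * sp g n (m - l - t)))))"
    by (rule sum.cong) (simp_all only: split Suc atMost_iff)
  also have "\<dots> = (\<Sum>l\<le>m. of_nat l \<star> (g l * sp g (Suc n) (m - l))) +
      of_nat (Suc n) \<star> (\<Sum>l\<le>m. \<Sum>t\<le>m - l. of_nat t \<star> (g l * (g t * sp g n (m - l - t))))"
    by (simp add: sum.distrib csc_sum sum_distrib_left csc_mult_right del: sp.simps of_nat_Suc)
  also have "(\<Sum>l\<le>m. \<Sum>t\<le>m - l. of_nat t \<star> (g l * (g t * sp g n (m - l - t)))) =
      (\<Sum>t\<le>m. of_nat t \<star> (g t * sp g (Suc n) (m - t)))"
  proof (subst sum_swap_diff, rule sum.cong[OF refl])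
    fix t assume "t \<in> {..m}"
    have key: "of_nat t \<star> (g l * (g t * sp g n (m - l - t))) = of_nat t \<star> (g t * (g l * sp g n (m - t - l)))" for l
      by (simp only: mult.assoc[symmetric] assms[of l t] diff_diff_left add.commute)
    show "(\<Sum>l\<le>m - t. of_nat t \<star> (g l * (g t * sp g n (m - l - t)))) = of_nat t \<star> (g t * sp g (Suc n) (m - t))"
      by (simp only: key sp.simps(2) csc_sum sum_distrib_left)
  qed
  also have "(\<Sum>l\<le>m. of_nat l \<star> (g l * sp g (Suc n) (m - l))) +
      of_nat (Suc n) \<star> (\<Sum>t\<le>m. of_nat t \<star> (g t * sp g (Suc n) (m - t))) =
      of_nat (Suc (Suc n)) \<star> (\<Sum>t\<le>m. of_nat t \<star> (g t * sp g (Suc n) (m - t)))"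
    unfolding of_nat_Suc[of "Suc n"] csc_add_left csc_one ..
  finally show ?case .
qed

lemma sp_vanish: "g 0 = 0 \<Longrightarrow> m < n \<Longrightarrow> sp g n m = 0"
proof (induction n arbitrary: m)
  case (Suc n)
  have "g l * sp g n (m - l) = 0" if "l \<le> m" for l
    using Suc that by (cases "l = 0") auto
  then show ?case by simp
qed simp

text \<open>The equation \<open>u d/du exp g = (u dg/du) exp g\<close>. All later uses of the series
  phi go through this recursion, not through the expansion of the exponential.\<close>

lemma sexp_log_derivative:
  fixes g :: "nat \<Rightarrow> 'a::calg"
  assumes c: "\<And>i j. g i * g j = g j * g i" and z: "g 0 = 0"
  shows "of_nat m \<star> sexp g m = (\<Sum>t\<in>{1..m}. of_nat t \<star> (g t * sexp g (m - t)))"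
proof (cases m)
  case (Suc m')
  have 1: "(of_nat m * (1 / fact (Suc n))) \<star> sp g (Suc n) m = (\<Sum>t\<le>m. of_nat t \<star> (g t * ((1 / fact n) \<star> sp g n (m - t))))" for n
  proof -
    have "(of_nat m * (1 / fact (Suc n))) \<star> sp g (Suc n) m = (1 / fact (Suc n)) \<star> of_nat m \<star> sp g (Suc n) m"
      by (simp only: csc_csc mult.commute)
    also have "\<dots> = (1 / fact n) \<star> (\<Sum>t\<le>m. of_nat t \<star> (g t * sp g n (m - t)))"
    proof -
      have "1 / fact (Suc n) * of_nat (Suc n) = (1 / fact n :: complex)"
        by (simp add: fact_Suc divide_simps del: of_nat_Suc)
      then show ?thesis unfolding sp_log_derivative[of g, OF c] csc_csc by simp
    qed
    finally show ?thesis by (simp add: csc_sum csc_mult_right csc_csc mult.commute)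
  qed
  have "of_nat m \<star> sexp g m = (\<Sum>n\<le>m. (of_nat m * (1 / fact n)) \<star> sp g n m)"
    by (simp add: sexp_def csc_sum csc_csc)
  also have "\<dots> = (\<Sum>n<m. (of_nat m * (1 / fact (Suc n))) \<star> sp g (Suc n) m)"
  proof -
    have "(\<Sum>n\<le>Suc m'. (of_nat m * (1 / fact n)) \<star> sp g n m) =
      (of_nat m * (1 / fact 0)) \<star> sp g 0 m + (\<Sum>n\<le>m'. (of_nat m * (1 / fact (Suc n))) \<star> sp g (Suc n) m)"
      by (rule sum.atMost_Suc_shift)
    then show ?thesis by (simp add: Suc lessThan_Suc_atMost del: sp.simps(2) of_nat_Suc)
  qed
  also have "\<dots> = (\<Sum>n<m. \<Sum>t\<le>m. of_nat t \<star> (g t * ((1 / fact n) \<star> sp g n (m - t))))"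
    unfolding 1 ..
  also have "\<dots> = (\<Sum>t\<le>m. of_nat t \<star> (g t * (\<Sum>n<m. (1 / fact n) \<star> sp g n (m - t))))"
    by (subst sum.swap) (simp add: sum_distrib_left csc_sum)
  also have "\<dots> = (\<Sum>t\<in>{1..m}. of_nat t \<star> (g t * (\<Sum>n<m. (1 / fact n) \<star> sp g n (m - t))))"
    by (rule sum.mono_neutral_right) (auto simp: not_le)
  also have "\<dots> = (\<Sum>t\<in>{1..m}. of_nat t \<star> (g t * sexp g (m - t)))"
  proof (rule sum.cong[OF refl])
    fix t assume t: "t \<in> {1..m}"
    \<comment> \<open>The bound \<open>n < m\<close> may replace \<open>n \<le> m - t\<close>, since
      higher powers of g start in higher degree; \<open>t \<ge> 1\<close> is used here.\<close>
    have "(\<Sum>n<m. (1 / fact n) \<star> sp g n (m - t)) = sexp g (m - t)"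
      unfolding sexp_def by (rule sum.mono_neutral_right) (use t sp_vanish[of g, OF z] in auto)
    then show "of_nat t \<star> (g t * (\<Sum>n<m. (1 / fact n) \<star> sp g n (m - t))) = of_nat t \<star> (g t * sexp g (m - t))" by simp
  qed
  finally show ?thesis .
qed simp

lemma sexp_0: "g 0 = 0 \<Longrightarrow> sexp g 0 = 1"
  by (simp add: sexp_def csc_one)

section \<open>Drinfeld generators\<close>

inductive_set alg :: "'a::calg set \<Rightarrow> 'a set" for S where
  base: "u \<in> S \<Longrightarrow> u \<in> alg S"
| one: "1 \<in> alg S"
| add: "u \<in> alg S \<Longrightarrow> v \<in> alg S \<Longrightarrow> u + v \<in> alg S"
| scal: "u \<in> alg S \<Longrightarrow> z \<star> u \<in> alg S"
| mult: "u \<in> alg S \<Longrightarrow> v \<in> alg S \<Longrightarrow> u * v \<in> alg S"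

lemma alg_closed:
  "0 \<in> alg S" "u \<in> alg S \<Longrightarrow> - u \<in> alg S" "u \<in> alg S \<Longrightarrow> v \<in> alg S \<Longrightarrow> u - v \<in> alg S"
  "(\<And>i. i \<in> I \<Longrightarrow> g i \<in> alg S) \<Longrightarrow> sum g I \<in> alg S" "u \<in> alg S \<Longrightarrow> u ^ n \<in> alg S"
proof -
  show z: "0 \<in> alg S" using alg.scal[OF alg.one, of 0] by simp
  show m: "u \<in> alg S \<Longrightarrow> - u \<in> alg S" for u using alg.scal[of u S "-1"] by (simp add: csc_minus csc_one)
  show "u \<in> alg S \<Longrightarrow> v \<in> alg S \<Longrightarrow> u - v \<in> alg S" using alg.add[of u S "- v"] m by simp
  show "(\<And>i. i \<in> I \<Longrightarrow> g i \<in> alg S) \<Longrightarrow> sum g I \<in> alg S"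
    by (induction I rule: infinite_finite_induct) (auto intro: z alg.add)
  show "u \<in> alg S \<Longrightarrow> u ^ n \<in> alg S" by (induction n) (auto intro: alg.one alg.mult)
qed

context uq_type
begin

sublocale U: ring "Uq T" by (rule Uq_ring)

lemma subalgebra_cl:
  assumes "S \<subseteq> carrier (Uq T)"
  shows "a \<in> subalgebra_gen T S \<Longrightarrow> a \<in> carrier (Uq T) \<and> cl a \<in> alg (cl ` S)"
  unfolding subalgebra_gen_def
proof (induction rule: generate_ring.induct)
  case (incl u)
  then show ?case using assms uscal_carrier by (auto simp: cl_uscal intro: alg.base alg.scal[OF alg.one])
qed (auto simp: cl_one cl_minus cl_add cl_mult intro: alg.intros alg_closed)

lemma subalgebra_closed:
  "uscal T z \<in> subalgebra_gen T S" "a \<in> S \<Longrightarrow> a \<in> subalgebra_gen T S" "\<one>\<^bsub>Uq T\<^esub> \<in> subalgebra_gen T S"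
  "a \<in> subalgebra_gen T S \<Longrightarrow> b \<in> subalgebra_gen T S \<Longrightarrow> a \<oplus>\<^bsub>Uq T\<^esub> b \<in> subalgebra_gen T S"
  "a \<in> subalgebra_gen T S \<Longrightarrow> b \<in> subalgebra_gen T S \<Longrightarrow> a \<otimes>\<^bsub>Uq T\<^esub> b \<in> subalgebra_gen T S"
  by (auto simp: subalgebra_gen_def intro: generate_ring.intros)

lemma borel_carrier: "a \<in> borel T \<Longrightarrow> a \<in> carrier (Uq T)"
  and borel_Bs: "a \<in> borel T \<Longrightarrow> cl a \<in> Bs"
proof -
  let ?S = "{ue T Pos x | x. x \<in> Ihat T} \<union> {kk T b x | b x. x \<in> Ihat T}"
  have S: "?S \<subseteq> carrier (Uq T)" using gens_carrier by blast
  have c: "cl (kk T b x) \<in> Bs" if "x \<in> Ihat T" for b x using cl_gens[OF that] Bs_gens by (cases b) auto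
  have "u \<in> alg (cl ` ?S) \<Longrightarrow> u \<in> Bs" for u
    by (induction rule: alg.induct) (auto simp: cl_gens Bs_gens Bs_closed Bs_1 Bs_mult c)
  then show "a \<in> borel T \<Longrightarrow> a \<in> carrier (Uq T)" "a \<in> borel T \<Longrightarrow> cl a \<in> Bs"
    using subalgebra_cl[OF S] by (auto simp: borel_def)
qed

lemma borel_gens: "x \<in> Ihat T \<Longrightarrow> ue T Pos x \<in> borel T" "x \<in> Ihat T \<Longrightarrow> kk T b x \<in> borel T"
  unfolding borel_def by (rule subalgebra_closed, blast)+

lemmas borel_closed = subalgebra_closed[where S = "{ue T Pos x | x. x \<in> Ihat T} \<union> {kk T b x | b x. x \<in> Ihat T}", folded borel_def]

lemma Bs_borel: "b \<in> Bs \<Longrightarrow> \<exists>a\<in>borel T. cl a = b"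
proof (induction rule: Bs_induct)
  case one
  then show ?case using borel_closed(3) cl_one by blast
next
  case zero
  then show ?case using borel_closed(1)[of 0] cl_uscal[of 0] by auto
next
  case (add a b)
  then show ?case using borel_closed(4) cl_add borel_carrier by blast
next
  case (scal z b)
  then obtain a where "a \<in> borel T" "cl a = b" by blast
  then show ?case using borel_closed(5)[OF borel_closed(1)[of z]] cl_mult[OF uscal_carrier] cl_uscal[of z] borel_carrier
    by (metis csc_mult_left mult_1)
next
  case (e x b)
  then show ?case using borel_closed(5)[OF borel_gens(1)] cl_mult borel_carrier cl_gens(1) gens_carrier by metis
next
  case (k x b)
  then show ?case using borel_closed(5)[OF borel_gens(2)] cl_mult borel_carrier cl_gens(3) gens_carrier by metis
next
  case (k' x b)
  then show ?case using borel_closed(5)[OF borel_gens(2)] cl_mult borel_carrier cl_gens(4) gens_carrier by metis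
qed

lemma cl_finsum: "finite I \<Longrightarrow> (\<And>i. i \<in> I \<Longrightarrow> g i \<in> carrier (Uq T)) \<Longrightarrow>
   cl (\<Oplus>\<^bsub>Uq T\<^esub>i\<in>I. g i) = (\<Sum>i\<in>I. cl (g i))"
proof (induction rule: finite_induct)
  case empty
  then show ?case by (simp add: cl_zero)
next
  case (insert i I)
  then have "(\<Oplus>\<^bsub>Uq T\<^esub>i\<in>I. g i) \<in> carrier (Uq T)" by (intro U.finsum_closed) auto
  then show ?case using insert by (simp add: cl_add U.finsum_insert Pi_def)
qed

lemma usmult_carrier: "a \<in> carrier (Uq T) \<Longrightarrow> usmult T z a \<in> carrier (Uq T)"
  by (simp add: usmult_def uscal_carrier)

lemma cl_diff: "a \<in> carrier (Uq T) \<Longrightarrow> b \<in> carrier (Uq T) \<Longrightarrow> cl (a \<ominus>\<^bsub>Uq T\<^esub> b) = cl a - cl b"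
  by (simp add: a_minus_def cl_add cl_minus)

lemma cl_ucomm: "a \<in> carrier (Uq T) \<Longrightarrow> b \<in> carrier (Uq T) \<Longrightarrow> cl (ucomm T a b) = cl a * cl b - cl b * cl a"
  by (simp add: ucomm_def cl_diff cl_mult)

lemma cl_ser_power:
  assumes "\<And>l. g l \<in> carrier (Uq T)"
  shows "ser_power T g n m \<in> carrier (Uq T) \<and> cl (ser_power T g n m) = sp (\<lambda>l. cl (g l)) n m"
proof (induction n arbitrary: m)
  case 0
  then show ?case by (simp add: ser_power_def cl_one cl_zero)
next
  case (Suc n)
  have "ser_power T g (Suc n) m = (\<Oplus>\<^bsub>Uq T\<^esub>l\<in>{..m}. g l \<otimes>\<^bsub>Uq T\<^esub> ser_power T g n (m - l))"
    by (simp add: ser_power_def ser_mult_def)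
  then show ?case using Suc assms by (simp add: cl_finsum cl_mult U.finsum_closed)
qed

lemma cl_ser_exp:
  assumes "\<And>l. g l \<in> carrier (Uq T)"
  shows "ser_exp T g m \<in> carrier (Uq T)" "cl (ser_exp T g m) = sexp (\<lambda>l. cl (g l)) m"
  using cl_ser_power[of g, OF assms]
  by (simp_all add: ser_exp_def sexp_def cl_finsum usmult_carrier cl_smult U.finsum_closed)

end

lemma alg_subset: "u \<in> alg S \<Longrightarrow> (\<And>s. s \<in> S \<Longrightarrow> s \<in> alg S') \<Longrightarrow> u \<in> alg S'"
  by (induction rule: alg.induct) (auto intro: alg.one alg.add alg.scal alg.mult)

locale uq_drinfeld = uq_type T cl for T and cl :: "uq \<Rightarrow> 'u::calg" +
  fixes X :: "sign \<Rightarrow> nat \<Rightarrow> int \<Rightarrow> uq" and H :: "nat \<Rightarrow> int \<Rightarrow> uq"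
  assumes dg: "drinfeld_generators T X H"
begin

definition xp :: "sign \<Rightarrow> nat \<Rightarrow> int \<Rightarrow> 'u" where "xp b i m = cl (X b i m)"
definition hh :: "nat \<Rightarrow> int \<Rightarrow> 'u" where "hh i r = cl (H i r)"
definition ph :: "nat \<Rightarrow> nat \<Rightarrow> 'u" where "ph i m = cl (phi T H Pos i (int m))"
abbreviation kn :: "nat \<Rightarrow> 'u" where "kn i \<equiv> k (Some (orb T i))"
abbreviation kn' :: "nat \<Rightarrow> 'u" where "kn' i \<equiv> k' (Some (orb T i))"

lemma IhatI [simp]: "P \<in> Isig T \<Longrightarrow> Some P \<in> Ihat T" "None \<in> Ihat T"
  by (auto simp: Ihat_def)

lemma cl_kn: "i \<in> nd \<Longrightarrow> cl (Defs.kn T Pos i) = kn i" "i \<in> nd \<Longrightarrow> cl (Defs.kn T Neg i) = kn' i"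
  "i \<in> nd \<Longrightarrow> Defs.kn T b i \<in> carrier (Uq T)"
  by (simp_all add: kn_def cl_gens gens_carrier)

lemma X_carrier: "i \<in> nd \<Longrightarrow> X b i m \<in> carrier (Uq T)"
  and H_carrier: "i \<in> nd \<Longrightarrow> r \<noteq> 0 \<Longrightarrow> H i r \<in> carrier (Uq T)"
  using dg by (auto simp: drinfeld_generators_def)

lemma xp_zero: "P \<in> Isig T \<Longrightarrow> xp Pos (rep P) 0 = e (Some P)" "P \<in> Isig T \<Longrightarrow> xp Neg (rep P) 0 = f (Some P)"
proof -
  have "X b (rep P) 0 = ue T b (Some P)" if "P \<in> Isig T" for b using dg that by (simp add: drinfeld_generators_def)
  then show "P \<in> Isig T \<Longrightarrow> xp Pos (rep P) 0 = e (Some P)" "P \<in> Isig T \<Longrightarrow> xp Neg (rep P) 0 = f (Some P)"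
    by (simp_all add: xp_def cl_gens)
qed

lemma gen_U: "u \<in> alg ({xp b i m | b i m. i \<in> nd} \<union> {hh i r | i r. i \<in> nd \<and> r \<noteq> 0} \<union> {kn i | i. i \<in> nd} \<union> {kn' i | i. i \<in> nd})"
proof -
  let ?S = "{X b i m | b i m. i \<in> nd} \<union> {H i r | i r. i \<in> nd \<and> r \<noteq> 0} \<union> {Defs.kn T b i | b i. i \<in> nd}"
  let ?S' = "{xp b i m | b i m. i \<in> nd} \<union> {hh i r | i r. i \<in> nd \<and> r \<noteq> 0} \<union> {kn i | i. i \<in> nd} \<union> {kn' i | i. i \<in> nd}"
  have S: "?S \<subseteq> carrier (Uq T)" using X_carrier H_carrier cl_kn(3) by blast
  obtain a where a: "a \<in> carrier (Uq T)" "u = cl a" using cl_surj by (metis UNIV_I imageE)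
  have "subalgebra_gen T ?S = carrier (Uq T)" using dg by (simp add: drinfeld_generators_def)
  then have u: "u \<in> alg (cl ` ?S)" using subalgebra_cl[OF S, of a] a by simp
  have k: "cl (Defs.kn T b i) \<in> ?S'" if "i \<in> nd" for b i
    using cl_kn[OF that] that by (cases b) auto
  have s: "cl ` ?S \<subseteq> ?S'" using k unfolding xp_def hh_def by blast
  show ?thesis by (rule alg_subset[OF u], rule alg.base) (rule subsetD[OF s])
qed

lemma xp_Bs: "i \<in> nd \<Longrightarrow> 0 \<le> r \<Longrightarrow> xp Pos i r \<in> Bs" and ph_Bs: "i \<in> nd \<Longrightarrow> ph i m \<in> Bs"
  using dg borel_Bs by (auto simp: drinfeld_generators_def xp_def ph_def)

lemma xp_aut: "i \<in> nd \<Longrightarrow> xp b (\<sigma> i) m = (\<omega> powi m) \<star> xp b i m"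
  using dg by (simp add: drinfeld_generators_def xp_def cl_smult X_carrier)

lemma hh_aut: "i \<in> nd \<Longrightarrow> r \<noteq> 0 \<Longrightarrow> hh (\<sigma> i) r = (\<omega> powi r) \<star> hh i r"
  using dg by (simp add: drinfeld_generators_def hh_def cl_smult H_carrier)

lemma hh_comm: "i \<in> nd \<Longrightarrow> j \<in> nd \<Longrightarrow> r \<noteq> 0 \<Longrightarrow> t \<noteq> 0 \<Longrightarrow> hh i r * hh j t = hh j t * hh i r"
proof -
  assume a: "i \<in> nd" "j \<in> nd" "r \<noteq> 0" "t \<noteq> 0"
  then have "ucomm T (H i r) (H j t) = \<zero>\<^bsub>Uq T\<^esub>" using dg by (simp add: drinfeld_generators_def)
  then show ?thesis using cl_ucomm[of "H i r" "H j t"] a by (simp add: hh_def H_carrier cl_zero)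
qed

lemma kn_hh: "i \<in> nd \<Longrightarrow> j \<in> nd \<Longrightarrow> r \<noteq> 0 \<Longrightarrow> kn i * hh j r = hh j r * kn i"
proof -
  assume a: "i \<in> nd" "j \<in> nd" "r \<noteq> 0"
  then have "ucomm T (Defs.kn T Pos i) (H j r) = \<zero>\<^bsub>Uq T\<^esub>" using dg by (simp add: drinfeld_generators_def)
  then show ?thesis using cl_ucomm[of "Defs.kn T Pos i" "H j r"] a by (simp add: hh_def H_carrier cl_zero cl_kn)
qed

lemma kn_xp: "i \<in> nd \<Longrightarrow> j \<in> nd \<Longrightarrow> kn i * xp b j m = (qpar T powi (sgi b * csum T i j)) \<star> (xp b j m * kn i)"
proof -
  assume a: "i \<in> nd" "j \<in> nd"
  then have "Defs.kn T Pos i \<otimes>\<^bsub>Uq T\<^esub> X b j m = usmult T (qpar T powi (sgi b * csum T i j)) (X b j m \<otimes>\<^bsub>Uq T\<^esub> Defs.kn T Pos i)"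
    using dg by (simp add: drinfeld_generators_def)
  then have "cl (Defs.kn T Pos i \<otimes>\<^bsub>Uq T\<^esub> X b j m) = cl (usmult T (qpar T powi (sgi b * csum T i j)) (X b j m \<otimes>\<^bsub>Uq T\<^esub> Defs.kn T Pos i))" by simp
  then show ?thesis using a by (simp add: cl_mult cl_smult X_carrier cl_kn xp_def)
qed

lemma hh_xp: "i \<in> nd \<Longrightarrow> j \<in> nd \<Longrightarrow> t \<noteq> 0 \<Longrightarrow>
  hh i t * xp b j l = xp b j l * hh i t + (of_int (sgi b) * h_coeff T i j t) \<star> xp b j (t + l)"
proof -
  assume a: "i \<in> nd" "j \<in> nd" "t \<noteq> 0"
  then have "ucomm T (H i t) (X b j l) = usmult T (of_int (sgi b) * h_coeff T i j t) (X b j (t + l))"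
    using dg by (simp add: drinfeld_generators_def)
  then have "cl (ucomm T (H i t) (X b j l)) = cl (usmult T (of_int (sgi b) * h_coeff T i j t) (X b j (t + l)))" by simp
  then show ?thesis using a by (simp add: cl_ucomm cl_smult X_carrier H_carrier xp_def hh_def algebra_simps)
qed

text \<open>Coefficients of the logarithm of \<open>kn' i * ph i\<close>, with constant term
  0.\<close>

definition hq :: "nat \<Rightarrow> nat \<Rightarrow> 'u" where
  "hq i t = (if t = 0 then 0 else (qn T i - inverse (qn T i)) \<star> hh i (int t))"

lemma phi_carrier:
  assumes "i \<in> nd" shows "phi T H b i m \<in> carrier (Uq T)"
    "cl (phi T H Pos i (int n)) = kn i * sexp (hq i) n"
    "cl (phi T H Neg i 0) = kn' i" "0 < m \<Longrightarrow> phi T H Neg i m = \<zero>\<^bsub>Uq T\<^esub>"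
proof -
  let ?g = "\<lambda>b l. if l = 0 then \<zero>\<^bsub>Uq T\<^esub>
            else usmult T (of_int (sgi b) * (qn T i - inverse (qn T i))) (H i (sgi b * int l))"
  have g: "?g b l \<in> carrier (Uq T)" for b l
    using assms by (cases b) (auto intro!: usmult_carrier H_carrier)
  show "phi T H b i m \<in> carrier (Uq T)"
    unfolding phi_def using cl_ser_exp(1)[OF g] assms by (auto simp: cl_kn)
  have "(\<lambda>l. cl (?g Pos l)) = hq i"
    using assms by (auto simp: fun_eq_iff hq_def hh_def cl_smult H_carrier cl_zero)
  then show "cl (phi T H Pos i (int n)) = kn i * sexp (hq i) n"
    unfolding phi_def using cl_ser_exp[OF g[of _ Pos]] assms by (simp add: cl_mult cl_kn)
  have "sexp (\<lambda>l. cl (?g Neg l)) 0 = 1" by (rule sexp_0) (simp add: cl_zero)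
  then show "cl (phi T H Neg i 0) = kn' i"
    unfolding phi_def using cl_ser_exp[OF g[of _ Neg], where m = 0] assms by (simp add: cl_mult cl_kn)
  show "0 < m \<Longrightarrow> phi T H Neg i m = \<zero>\<^bsub>Uq T\<^esub>" by (simp add: phi_def)
qed

lemma ph_eq: "i \<in> nd \<Longrightarrow> ph i m = kn i * sexp (hq i) m"
  by (simp add: ph_def phi_carrier)

lemma hq_0: "hq i 0 = 0"
  by (simp add: hq_def)

lemma ph_0: "i \<in> nd \<Longrightarrow> ph i 0 = kn i"
  by (simp add: ph_eq sexp_0 hq_0)

lemma kn_hq: "i \<in> nd \<Longrightarrow> j \<in> nd \<Longrightarrow> kn i * hq j t = hq j t * kn i"
  by (simp add: hq_def kn_hh csc_mult_left csc_mult_right)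

lemma ph_rec: "i \<in> nd \<Longrightarrow> of_nat m \<star> ph i m = (\<Sum>t\<in>{1..m}. of_nat t \<star> (hq i t * ph i (m - t)))"
proof -
  assume i: "i \<in> nd"
  have "hq i a * hq i b = hq i b * hq i a" for a b
    using hh_comm[OF i i, of "int a" "int b"] by (simp add: hq_def csc_mult_left csc_mult_right csc_csc mult.commute)
  then have "of_nat m \<star> sexp (hq i) m = (\<Sum>t\<in>{1..m}. of_nat t \<star> (hq i t * sexp (hq i) (m - t)))"
    by (rule sexp_log_derivative) (rule hq_0)
  then have "kn i * (of_nat m \<star> sexp (hq i) m) = kn i * (\<Sum>t\<in>{1..m}. of_nat t \<star> (hq i t * sexp (hq i) (m - t)))" by simp
  then have "of_nat m \<star> ph i m = (\<Sum>t\<in>{1..m}. of_nat t \<star> ((kn i * hq i t) * sexp (hq i) (m - t)))"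
    using i by (simp add: ph_eq csc_mult_right sum_distrib_left mult.assoc)
  then show ?thesis by (simp only: kn_hq[OF i i] mult.assoc ph_eq[OF i, symmetric])
qed

text \<open>For nonnegative total mode the negative series contributes only its constant term,
  namely the inverse of \<open>kn i\<close> at mode 0.\<close>

lemma xp_xp:
  assumes "i \<in> nd" "j \<in> nd" "0 \<le> r + l"
  shows "xp Pos i r * xp Neg j l = xp Neg j l * xp Pos i r +
    x_coeff T i j l \<star> (ph i (nat (r + l)) - (if r + l = 0 then kn' i else 0))"
proof -
  have "ucomm T (X Pos i r) (X Neg j l) = usmult T (x_coeff T i j l) (phi T H Pos i (r + l) \<ominus>\<^bsub>Uq T\<^esub> phi T H Neg i (r + l))"
    using dg assms by (simp add: drinfeld_generators_def)
  then have "cl (ucomm T (X Pos i r) (X Neg j l)) =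
      x_coeff T i j l \<star> (cl (phi T H Pos i (r + l)) - cl (phi T H Neg i (r + l)))"
    using assms phi_carrier(1) by (simp add: cl_smult cl_diff)
  moreover have "cl (phi T H Pos i (r + l)) = ph i (nat (r + l))" using assms by (simp add: ph_def)
  moreover have "cl (phi T H Neg i (r + l)) = (if r + l = 0 then kn' i else 0)"
    using assms phi_carrier(3,4)[OF assms(1)] by (auto simp: cl_zero)
  ultimately show ?thesis using assms by (simp add: cl_ucomm X_carrier xp_def algebra_simps)
qed

subsection \<open>The grading\<close>

definition grading :: "(int \<Rightarrow> uq set) \<Rightarrow> bool" where
  "grading V \<longleftrightarrow> algebra_grading T V \<and>
        (\<forall>b. \<forall>i\<in>nodes T. \<forall>m. X b i m \<in> V m) \<and>
        (\<forall>i\<in>nodes T. \<forall>r. r \<noteq> 0 \<longrightarrow> H i r \<in> V r) \<and>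
        (\<forall>b. \<forall>i\<in>nodes T. Defs.kn T b i \<in> V 0) \<and>
        (\<forall>b. ue T b None \<in> V (sgi b))"

definition Vg :: "int \<Rightarrow> uq set" where "Vg = (SOME V. grading V)"
definition Vd :: "int \<Rightarrow> 'u set" where "Vd m = cl ` Vg m"

lemma Vg: "grading Vg"
proof -
  have "\<exists>V. grading V" unfolding grading_def using dg unfolding drinfeld_generators_def by blast
  then show ?thesis unfolding Vg_def by (rule someI_ex)
qed

lemma Vg_carrier: "a \<in> Vg m \<Longrightarrow> a \<in> carrier (Uq T)"
  using Vg by (auto simp: grading_def algebra_grading_def)

lemma VdI: "a \<in> Vg m \<Longrightarrow> cl a \<in> Vd m"
  by (simp add: Vd_def)

lemma VdE: "u \<in> Vd m \<Longrightarrow> \<exists>a\<in>Vg m. u = cl a"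
  by (auto simp: Vd_def)

lemma Vd_closed:
  "0 \<in> Vd m" "1 \<in> Vd 0" "u \<in> Vd m \<Longrightarrow> v \<in> Vd m \<Longrightarrow> u + v \<in> Vd m" "u \<in> Vd m \<Longrightarrow> z \<star> u \<in> Vd m"
  "u \<in> Vd m \<Longrightarrow> v \<in> Vd n \<Longrightarrow> u * v \<in> Vd (m + n)"
proof -
  have V: "algebra_grading T Vg" using Vg by (simp add: grading_def)
  have "\<zero>\<^bsub>Uq T\<^esub> \<in> Vg m" "\<one>\<^bsub>Uq T\<^esub> \<in> Vg 0" using V by (auto simp: algebra_grading_def)
  then show "0 \<in> Vd m" "1 \<in> Vd 0" using VdI cl_zero cl_one by metis+
  show "u \<in> Vd m \<Longrightarrow> v \<in> Vd m \<Longrightarrow> u + v \<in> Vd m"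
  proof -
    assume "u \<in> Vd m" "v \<in> Vd m"
    then obtain a b where ab: "a \<in> Vg m" "b \<in> Vg m" "u = cl a" "v = cl b" using VdE by blast
    then have "a \<oplus>\<^bsub>Uq T\<^esub> b \<in> Vg m" using V by (auto simp: algebra_grading_def)
    then show ?thesis using ab VdI cl_add[OF Vg_carrier Vg_carrier] by metis
  qed
  show "u \<in> Vd m \<Longrightarrow> z \<star> u \<in> Vd m"
  proof -
    assume "u \<in> Vd m"
    then obtain a where ab: "a \<in> Vg m" "u = cl a" using VdE by blast
    then have "usmult T z a \<in> Vg m" using V by (auto simp: algebra_grading_def)
    then show ?thesis using ab VdI cl_smult[OF Vg_carrier] by metis
  qed
  show "u \<in> Vd m \<Longrightarrow> v \<in> Vd n \<Longrightarrow> u * v \<in> Vd (m + n)"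
  proof -
    assume "u \<in> Vd m" "v \<in> Vd n"
    then obtain a b where ab: "a \<in> Vg m" "b \<in> Vg n" "u = cl a" "v = cl b" using VdE by blast
    then have "a \<otimes>\<^bsub>Uq T\<^esub> b \<in> Vg (m + n)" using V by (auto simp: algebra_grading_def)
    then show ?thesis using ab VdI cl_mult[OF Vg_carrier Vg_carrier] by metis
  qed
qed

text \<open>Existence and uniqueness of homogeneous components are transported along
  \<open>cl\<close>, which is injective on the carrier.\<close>

lemma Vd_ex1: "\<exists>!g. (\<forall>m. g m \<in> Vd m) \<and> finite {m. g m \<noteq> 0} \<and> u = (\<Sum>m | g m \<noteq> 0. g m)"
proof -
  have V: "algebra_grading T Vg" using Vg by (simp add: grading_def)
  obtain a where a: "a \<in> carrier (Uq T)" "u = cl a" using cl_surj by (metis UNIV_I imageE)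
  let ?P = "\<lambda>g. (\<forall>m. g m \<in> Vg m) \<and> finite {m. g m \<noteq> \<zero>\<^bsub>Uq T\<^esub>} \<and> a = (\<Oplus>\<^bsub>Uq T\<^esub>m\<in>{m. g m \<noteq> \<zero>\<^bsub>Uq T\<^esub>}. g m)"
  have ex1: "\<exists>!g. ?P g"
    using V unfolding algebra_grading_def by (elim conjE) (erule bspec[OF _ a(1)])
  have nz: "g m \<noteq> \<zero>\<^bsub>Uq T\<^esub> \<longleftrightarrow> cl (g m) \<noteq> 0" if "\<forall>m. g m \<in> Vg m" for g m
    using cl_eq[OF Vg_carrier U.zero_closed, of "g m" m] that by (simp add: cl_zero)
  have P: "?P g \<longleftrightarrow> finite {m. cl (g m) \<noteq> 0} \<and> u = (\<Sum>m | cl (g m) \<noteq> 0. cl (g m))" if g: "\<forall>m. g m \<in> Vg m" for g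
  proof (cases "finite {m. cl (g m) \<noteq> 0}")
    case True
    have c: "g m \<in> carrier (Uq T)" for m using g Vg_carrier by blast
    have "(\<Oplus>\<^bsub>Uq T\<^esub>m\<in>{m. cl (g m) \<noteq> 0}. g m) \<in> carrier (Uq T)" by (rule U.finsum_closed) (use c in auto)
    then have "a = (\<Oplus>\<^bsub>Uq T\<^esub>m\<in>{m. cl (g m) \<noteq> 0}. g m) \<longleftrightarrow> u = (\<Sum>m | cl (g m) \<noteq> 0. cl (g m))"
      using cl_eq[OF a(1)] cl_finsum[OF True, of g] c a(2) by metis
    then show ?thesis using True g nz[OF g] by simp
  qed (simp add: nz[OF g])
  obtain g where g: "?P g" using ex1 by blast
  show ?thesis
  proof (rule ex1I[of _ "\<lambda>m. cl (g m)"])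
    show "(\<forall>m. cl (g m) \<in> Vd m) \<and> finite {m. cl (g m) \<noteq> 0} \<and> u = (\<Sum>m | cl (g m) \<noteq> 0. cl (g m))"
      using g P[of g] VdI by blast
  next
    fix g' assume g': "(\<forall>m. g' m \<in> Vd m) \<and> finite {m. g' m \<noteq> 0} \<and> u = (\<Sum>m | g' m \<noteq> 0. g' m)"
    then have "\<forall>m. \<exists>a\<in>Vg m. g' m = cl a" using VdE by blast
    then obtain g'' where g'': "\<And>m. g'' m \<in> Vg m" "\<And>m. g' m = cl (g'' m)" by metis
    then have "?P g''" using g' P[of g''] by simp
    then have "g'' = g" using ex1 g by blast
    then show "g' = (\<lambda>m. cl (g m))" using g'' by auto
  qed
qed

definition proj :: "int \<Rightarrow> 'u \<Rightarrow> 'u" where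
  "proj m u = (THE g. (\<forall>m. g m \<in> Vd m) \<and> finite {m. g m \<noteq> 0} \<and> u = (\<Sum>m | g m \<noteq> 0. g m)) m"

lemma proj: "proj m u \<in> Vd m" "finite {m. proj m u \<noteq> 0}" "u = (\<Sum>m | proj m u \<noteq> 0. proj m u)"
  using theI'[OF Vd_ex1[of u]] unfolding proj_def by blast+

lemma proj_unique:
  assumes "\<And>m. g m \<in> Vd m" "finite A" "\<And>m. m \<notin> A \<Longrightarrow> g m = 0" "u = (\<Sum>m\<in>A. g m)"
  shows "proj m u = g m"
proof -
  have A: "{m. g m \<noteq> 0} \<subseteq> A" using assms(3) by blast
  have "(\<Sum>m\<in>A. g m) = (\<Sum>m | g m \<noteq> 0. g m)" by (rule sum.mono_neutral_right) (use assms in auto)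
  then have "(\<forall>m. g m \<in> Vd m) \<and> finite {m. g m \<noteq> 0} \<and> u = (\<Sum>m | g m \<noteq> 0. g m)"
    using assms(1,4) finite_subset[OF A assms(2)] by simp
  then show ?thesis unfolding proj_def using the1_equality[OF Vd_ex1[of u]] by simp
qed

lemma clin_proj: "clin (proj d)"
proof (rule clinI)
  fix u v a
  let ?A = "{m. proj m u \<noteq> 0} \<union> {m. proj m v \<noteq> 0}"
  have u: "u = (\<Sum>m\<in>?A. proj m u)" and v: "v = (\<Sum>m\<in>?A. proj m v)"
    using proj(3)[of u] proj(3)[of v] by (auto intro!: sum.mono_neutral_left proj(2) elim!: trans)
  have "u + v = (\<Sum>m\<in>?A. proj m u + proj m v)" by (subst u, subst v) (simp only: sum.distrib)
  then show "proj d (u + v) = proj d u + proj d v"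
    by (intro proj_unique[of "\<lambda>m. proj m u + proj m v" ?A] Vd_closed proj) (auto intro: proj(2))
  have "a \<star> u = (\<Sum>m | proj m u \<noteq> 0. a \<star> proj m u)" by (subst proj(3)[of u]) (simp only: csc_sum)
  then show "proj d (a \<star> u) = a \<star> proj d u"
    by (intro proj_unique[of "\<lambda>m. a \<star> proj m u" "{m. proj m u \<noteq> 0}"] Vd_closed proj) (auto intro: proj(2))
qed

lemma proj_Vd: "u \<in> Vd m \<Longrightarrow> proj d u = (if d = m then u else 0)"
  by (rule proj_unique[of "\<lambda>d. if d = m then u else 0" "{m}"]) (auto simp: Vd_closed)

lemma Vd_gens:
  "i \<in> nd \<Longrightarrow> xp b i m \<in> Vd m" "i \<in> nd \<Longrightarrow> r \<noteq> 0 \<Longrightarrow> hh i r \<in> Vd r"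
  "i \<in> nd \<Longrightarrow> kn i \<in> Vd 0" "i \<in> nd \<Longrightarrow> kn' i \<in> Vd 0" "e None \<in> Vd 1" "f None \<in> Vd (- 1)"
proof -
  show "i \<in> nd \<Longrightarrow> xp b i m \<in> Vd m" "i \<in> nd \<Longrightarrow> r \<noteq> 0 \<Longrightarrow> hh i r \<in> Vd r"
    using Vg VdI by (auto simp: grading_def xp_def hh_def)
  have "i \<in> nd \<Longrightarrow> Defs.kn T b i \<in> Vg 0" for i b using Vg by (simp add: grading_def)
  then show "i \<in> nd \<Longrightarrow> kn i \<in> Vd 0" "i \<in> nd \<Longrightarrow> kn' i \<in> Vd 0"
    using VdI cl_kn by metis+
  have "ue T b None \<in> Vg (sgi b)" for b using Vg by (simp add: grading_def)
  from this[of Pos] this[of Neg] show "e None \<in> Vd 1" "f None \<in> Vd (- 1)"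
    using VdI cl_gens(1,2)[of None] by fastforce+
qed

lemma Vd_e: "e x \<in> Vd (if x = None then 1 else 0)" and Vd_f: "f x \<in> Vd (if x = None then - 1 else 0)"
proof -
  have "e (Some P) \<in> Vd 0 \<and> f (Some P) \<in> Vd 0" for P
  proof (cases "P \<in> Isig T")
    case True
    then show ?thesis using Vd_gens(1)[of "rep P" _ 0] xp_zero rep_in(2) by metis
  next
    case False
    then have "Some P \<notin> Ihat T" by (auto simp: Ihat_def)
    then show ?thesis by (simp add: gens_out Vd_closed)
  qed
  then show "e x \<in> Vd (if x = None then 1 else 0)" "f x \<in> Vd (if x = None then - 1 else 0)"
    using Vd_gens(5,6) by (cases x; simp)+
qed

text \<open>The degree is prescribed only for the k's of the finite nodes; the affine k is first
  eliminated by \<open>kp_normal\<close>.\<close>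

lemma Vd_kp: "kp m \<in> Vd 0"
proof -
  obtain n where n: "n None = 0" "kp m = kp n" using kp_normal by blast
  have "kp n \<in> Vd 0"
  proof (rule kp_induct)
    fix x u assume x: "x \<in> Ihat T" "n x \<noteq> 0" and u: "u \<in> Vd 0"
    then obtain P where P: "P \<in> Isig T" "x = Some P" using n(1) by (auto simp: Ihat_def)
    have "k x \<in> Vd 0" "k' x \<in> Vd 0" using Vd_gens(3,4)[OF rep_in(2)[OF P(1)]] rep_in(3)[OF P(1)] P(2) by simp_all
    then show "k x * u \<in> Vd 0" "k' x * u \<in> Vd 0" using Vd_closed(5)[OF _ u, of _ 0] by simp_all
  qed (rule Vd_closed)
  then show ?thesis by (simp add: n(2))
qed

abbreviation dgw :: "anode list \<Rightarrow> int" where "dgw w \<equiv> int (count_list w None)"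

lemma Vd_ew: "ew w \<in> Vd (dgw w)"
proof (induction w)
  case (Cons x w)
  then show ?case using Vd_closed(5)[OF Vd_e[of x] Cons] by (auto simp: add.commute)
qed (simp add: Vd_closed)

lemma Vd_fw: "fw w \<in> Vd (- dgw w)"
proof (induction w)
  case (Cons x w)
  then show ?case using Vd_closed(5)[OF Vd_f[of x] Cons] by (auto simp: add.commute)
qed (simp add: Vd_closed)

lemma Vd_word: "ew w * kp m \<in> Vd (dgw w)"
  using Vd_closed(5)[OF Vd_ew[of w] Vd_kp[of m]] by simp

lemma span_proj:
  assumes "u \<in> cvec.span S" "u \<in> Vd d" "\<And>t. t \<in> S \<Longrightarrow> \<exists>d'. t \<in> Vd d'"
  shows "u \<in> cvec.span {t \<in> S. t \<in> Vd d}"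
proof -
  have "proj d u \<in> cvec.span {t \<in> S. t \<in> Vd d}"
    using assms(1) clin_proj
  proof (rule span_image_clin)
    fix t assume t: "t \<in> S"
    then obtain d' where "t \<in> Vd d'" using assms(3) by blast
    then show "proj d t \<in> cvec.span {t \<in> S. t \<in> Vd d}"
      using t proj_Vd[of t d' d] by (auto simp: cvec.span_base cvec.span_zero)
  qed
  then show ?thesis using proj_Vd[OF assms(2), of d] by simp
qed

end

section \<open>The affine generator\<close>

context uq_type
begin

lemma cc_nz: "j \<in> Ihat T \<Longrightarrow> cc j \<noteq> 0"
proof -
  assume j: "j \<in> Ihat T"
  have "qi T j - inverse (qi T j) \<noteq> 0"
  proof
    assume "qi T j - inverse (qi T j) = 0"
    then have "qi T j ^ 2 = 1" using q_nz[OF j] by (simp add: power2_eq_square) (metis right_inverse)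
    then show False using q_root[OF j] by (meson zero_less_numeral)
  qed
  then show ?thesis by simp
qed

text \<open>The commutator equals \<open>f j * (e l * b - b * e l)\<close> plus an element of
  \<open>Bs\<close>. So \<open>f j\<close> times an element of \<open>Bs\<close> lies in
  \<open>Bs\<close>, and that element is zero by \<open>f_Bs\<close>.\<close>

lemma f_Bs_commute:
  assumes "j \<in> Ihat T" "l \<in> Ihat T" "b \<in> Bs" "e l * (f j * b) - (f j * b) * e l \<in> Bs"
  shows "e l * b = b * e l"
proof -
  let ?c = "if l = j then cc l \<star> ((k l - k' l) * b) else 0"
  have "e l * (f j * b) = f j * (e l * b) + ?c"
    by (simp add: mult.assoc[symmetric] ef) (simp add: distrib_right csc_mult_left mult.assoc)
  then have "e l * (f j * b) - (f j * b) * e l = f j * (e l * b - b * e l) + ?c"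
    by (simp add: right_diff_distrib mult.assoc)
  moreover have "?c \<in> Bs" using assms(3) by (auto intro: Bs_closed Bs_mult Bs_gens)
  ultimately have "f j * (e l * b - b * e l) \<in> Bs"
    using Bs_closed(5)[OF assms(4), of ?c] by simp
  then have "e l * b - b * e l = 0"
    by (rule f_Bs[OF assms(1), rotated]) (intro Bs_closed Bs_mult Bs_gens assms)
  then show ?thesis by simp
qed

text \<open>An \<open>sl\<^sub>2\<close> argument: \<open>z\<close> would be a highest weight vector on which \<open>Dm j\<close> is nilpotent, but of a
  weight for which no power of the lowering operator can vanish.\<close>

lemma no_highest_weight:
  assumes j: "j \<in> Ihat T" and z: "z \<in> Bs" "e j * z = z * e j" "ta j z = (Q j j ^ 2) \<star> z" "k j * z = z * k j"
  shows "z = 0"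
proof -
  define q where "q = Q j j"
  define y where "y n = (Dm j ^^ n) z" for n
  have q0: "q \<noteq> 0" by (simp add: q_def)
  have yS: "Dm j (y n) = y (Suc n)" for n by (simp add: y_def)
  have yB: "y n \<in> Bs" for n by (induction n) (auto simp: yS[symmetric] Dm_Bs y_def z(1) simp del: funpow.simps(2), simp add: y_def Dm_Bs)
  have yt: "ta j (y n) = (q ^ (n + 2)) \<star> y n" for n
  proof (induction n)
    case (Suc n)
    then show ?case using ta_Dm[OF j yB[of n], of j] by (simp add: yS Dm_lin csc_csc q_def)
  qed (simp add: y_def z q_def power2_eq_square)
  have yk: "k j * y n = (inverse q ^ n) \<star> (y n * k j)" for n
  proof (induction n)
    case (Suc n)
    then show ?case using Dm_weight[OF j j yB[of n] Suc] by (simp add: yS q_def mult.commute)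
  qed (simp add: y_def z csc_one)
  have yk': "y n * k' j = (inverse q ^ n) \<star> (k' j * y n)" for n
  proof -
    have "k' j * y n = inverse (inverse q ^ n) \<star> (y n * k' j)"
      by (rule inv_weight[OF kk' yk]) (simp add: q0)
    then show ?thesis using q0 by (simp add: csc_csc csc_one)
  qed
  define G where "G n = (\<Sum>m\<le>n. q ^ (m + 2) - inverse q ^ m)" for n
  have De: "Dm j (e j * y n) = e j * y (Suc n) - (cc j * q ^ (n + 2)) \<star> (k' j * y n)"
    "Dm j (y n * e j) = y (Suc n) * e j - (cc j * inverse q ^ n) \<star> (k' j * y n)" for n
  proof -
    show "Dm j (e j * y n) = e j * y (Suc n) - (cc j * q ^ (n + 2)) \<star> (k' j * y n)"
      by (simp only: Dm_simps(1)[OF j j yB] yS yt if_True simp_thms csc_mult_right csc_csc)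
    have "Dm j (e j) = - (cc j \<star> k' j)" using Dm_simps(1)[OF j j Bs_1] by (simp add: Dm_1 ta_simps)
    then have "Dm j (y n * e j) = y (Suc n) * e j - cc j \<star> (y n * k' j)"
      using Dm_mult[OF j Bs_gens(1)[of j] yB[of n]] ta_gens(1)[OF j, of j] by (simp add: yS csc_mult_right)
    then show "Dm j (y n * e j) = y (Suc n) * e j - (cc j * inverse q ^ n) \<star> (k' j * y n)"
      by (simp only: yk' csc_csc)
  qed
  have key: "e j * y (Suc n) - y (Suc n) * e j = (cc j * G n) \<star> (k' j * y n)" for n
  proof (induction n)
    case 0
    have "Dm j (e j * y 0) = Dm j (y 0 * e j)" by (simp add: y_def z)
    then have "e j * y 1 - y 1 * e j = (cc j * q ^ 2) \<star> (k' j * y 0) - cc j \<star> (k' j * y 0)"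
      using De[of 0] by (simp add: algebra_simps power2_eq_square)
    then show ?case by (simp add: G_def csc_diff right_diff_distrib power2_eq_square)
  next
    case (Suc n)
    have "Dm j (e j * y (Suc n) - y (Suc n) * e j) = (cc j * G n) \<star> (k' j * y (Suc n))"
      unfolding Suc by (simp add: Dm_lin Dm_simps j yB yS)
    then have "e j * y (Suc (Suc n)) - y (Suc (Suc n)) * e j =
       (cc j * G n) \<star> (k' j * y (Suc n)) + ((cc j * q ^ (Suc n + 2)) \<star> (k' j * y (Suc n)) - (cc j * inverse q ^ Suc n) \<star> (k' j * y (Suc n)))"
      using De[of "Suc n"] by (simp only: Dm_lin) (simp add: algebra_simps)
    also have "\<dots> = (cc j * G (Suc n)) \<star> (k' j * y (Suc n))"
      by (simp only: csc_diff(2)[symmetric] csc_add_left[symmetric] G_def sum.atMost_Suc distrib_left right_diff_distrib)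
    finally show ?case .
  qed
  have G: "G n \<noteq> 0" for n
  proof -
    \<comment> \<open>Closed form of the geometric sums; both factors on the right are nonzero
      because \<open>Q j j\<close> is not a root of unity.\<close>
    have "(q - 1) * q ^ n * G n = (q ^ (n + 1) - 1) * (q ^ (n + 2) - 1)"
    proof (induction n)
      case (Suc n)
      have "(q - 1) * q ^ Suc n * G (Suc n) = q * ((q - 1) * q ^ n * G n) + (q - 1) * q ^ Suc n * (q ^ (Suc n + 2) - inverse q ^ Suc n)"
        by (simp add: G_def algebra_simps)
      also have "(q - 1) * q ^ Suc n * (q ^ (Suc n + 2) - inverse q ^ Suc n) = (q - 1) * (q ^ Suc n * q ^ (Suc n + 2) - (q * inverse q) ^ Suc n)"
        by (simp only: right_diff_distrib power_mult_distrib mult.assoc)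
      also have "q * inverse q = 1" using q0 by simp
      finally show ?case unfolding Suc by (simp add: algebra_simps)
    qed (simp add: G_def algebra_simps power2_eq_square)
    moreover have "q ^ (n + 1) \<noteq> 1" "q ^ (n + 2) \<noteq> 1" using Q_ne_1[OF j] by (auto simp: q_def simp del: power_Suc)
    ultimately show ?thesis by auto
  qed
  have down: "y (Suc n) = 0 \<Longrightarrow> y n = 0" for n
  proof -
    assume "y (Suc n) = 0"
    then have "(cc j * G n) \<star> (k' j * y n) = 0" using key[of n] by simp
    then have "k' j * y n = 0" using G cc_nz[OF j] by (simp add: csc_eq_0)
    then have "k j * (k' j * y n) = 0" by simp
    then show "y n = 0" by (simp add: mult.assoc[symmetric] kk')
  qed
  obtain n where "y n = 0" using Dm_nilpotent[OF j z(1)] by (auto simp: y_def)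
  then have "y 0 = 0" by (induction n) (auto dest: down)
  then show ?thesis by (simp add: y_def)
qed

end

context uq_drinfeld
begin

section \<open>The elements \<open>hh i 1\<close> and their skew derivatives\<close>

lemma hh1: "i \<in> nd \<Longrightarrow> ph i 1 = (qn T i - inverse (qn T i)) \<star> (hh i 1 * kn i)"
  using ph_rec[of i 1] ph_0[of i] by (simp add: csc_one hq_def csc_mult_left)

lemma hh1_Bs: "i \<in> nd \<Longrightarrow> hh i 1 \<in> Bs"
proof -
  assume i: "i \<in> nd"
  have "hh i 1 = inverse (qn T i - inverse (qn T i)) \<star> (ph i 1 * kn' i)"
    using qn_diff[OF i] by (simp add: hh1[OF i] csc_mult_left csc_csc csc_one mult.assoc kk' del: One_nat_def)
  then show ?thesis using i by (simp add: Bs_closed Bs_mult Bs_gens ph_Bs)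
qed

lemma e_xp: "P \<in> Isig T \<Longrightarrow> e (Some P) = xp Pos (rep P) 0" and f_xp: "P \<in> Isig T \<Longrightarrow> f (Some P) = xp Neg (rep P) 0"
  by (simp_all add: xp_zero)

lemma f_hh1:
  assumes "i \<in> nd" "R \<in> Isig T"
  shows "hh i 1 * f (Some R) = f (Some R) * hh i 1 - h_coeff T i (rep R) 1 \<star> xp Neg (rep R) 1"
  using hh_xp[of i "rep R" 1 Neg 0] assms rep_in by (simp add: f_xp csc_minus)

text \<open>\<open>f_R\<close> times the difference equals, up to the Borel element
  \<open>D\<close>, a multiple of \<open>x^-_{R,1}\<close>. The commutator of the latter with
  \<open>e_L\<close> is a multiple of \<open>ph (rep L) 1\<close>, so \<open>f_Bs_commute\<close>
  applies.\<close>

lemma ta_hh1_comm: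
  assumes i: "i \<in> nd" and R: "R \<in> Isig T" and L: "L \<in> Isig T"
  shows "e (Some L) * (ta (Some R) (hh i 1) - hh i 1) = (ta (Some R) (hh i 1) - hh i 1) * e (Some L)"
proof (rule f_Bs_commute)
  let ?Z = "ta (Some R) (hh i 1) - hh i 1" and ?Y = "h_coeff T i (rep R) 1 \<star> xp Neg (rep R) 1"
  show "?Z \<in> Bs" using hh1_Bs[OF i] by (simp add: Bs_closed ta_simps)
  have fZ: "f (Some R) * ?Z = - ?Y - D (Some R) (hh i 1)"
    using f_hh1[OF i R] by (simp add: D_def right_diff_distrib)
  have "e (Some L) * xp Neg (rep R) 1 - xp Neg (rep R) 1 * e (Some L) = x_coeff T (rep L) (rep R) 1 \<star> ph (rep L) 1"
    using xp_xp[of "rep L" "rep R" 0 1] R L rep_in by (simp add: e_xp)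
  then have 1: "e (Some L) * ?Y - ?Y * e (Some L) \<in> Bs"
    using ph_Bs[of "rep L" 1] L rep_in by (simp add: csc_mult_left csc_mult_right csc_diff[symmetric] Bs_closed)
  have 2: "e (Some L) * D (Some R) (hh i 1) - D (Some R) (hh i 1) * e (Some L) \<in> Bs"
    by (intro Bs_closed Bs_mult Bs_gens D_Bs hh1_Bs i)
  have "e (Some L) * (f (Some R) * ?Z) - f (Some R) * ?Z * e (Some L) =
      - (e (Some L) * ?Y - ?Y * e (Some L)) - (e (Some L) * D (Some R) (hh i 1) - D (Some R) (hh i 1) * e (Some L))"
    unfolding fZ by (simp add: algebra_simps)
  then show "e (Some L) * (f (Some R) * ?Z) - f (Some R) * ?Z * e (Some L) \<in> Bs"
    using Bs_closed(5)[OF Bs_closed(4)[OF 1] 2] by simp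
qed (use R L in auto)

text \<open>\<open>X1\<close> is a multiple of the commutator of h with \<open>e_P\<close> and is
  fixed by all twists, while \<open>D\<close> sends it back to a multiple of \<open>h * k_P\<close>.
  The halves of \<open>D\<close> split h into a twist-invariant part a and a part z of twist weight
  \<open>Q ^ 2\<close>; z must vanish by \<open>no_highest_weight\<close>.\<close>

lemma hh1_invariant:
  assumes P: "P \<in> Isig T" and nf: "\<sigma> (rep P) \<noteq> rep P" and R: "R \<in> Isig T"
  shows "ta (Some R) (hh (rep P) 1) = hh (rep P) 1" "Dm (Some R) (hh (rep P) 1) = 0"
    "x \<in> Some ` Isig T \<Longrightarrow> k x * hh (rep P) 1 = hh (rep P) 1 * k x"
proof -
  let ?i = "rep P" and ?p = "Some P"
  define h where "h = hh ?i 1"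
  define X1 where "X1 = xp Pos ?i 1"
  have i: "?i \<in> nd" "orb T ?i = P" using rep_in[OF P] by auto
  note pI = IhatI(1)[OF P]
  have hB: "h \<in> Bs" unfolding h_def by (rule hh1_Bs[OF i(1)])
  have XB: "X1 \<in> Bs" unfolding X1_def by (rule xp_Bs) (use i in auto)
  have kh: "k x * h = h * k x" if x: "x \<in> Some ` Isig T" for x
  proof -
    obtain L where L: "L \<in> Isig T" "x = Some L" using x by blast
    then show ?thesis using kn_hh[of "rep L" ?i 1] rep_in[OF L(1)] i by (simp add: h_def)
  qed
  \<comment> \<open>The defect \<open>ta h - h\<close> commutes with \<open>e_P\<close> and so
    disappears from the commutator that defines \<open>X1\<close>. The factor \<open>h_coeff\<close>
    is nonzero because the node is not fixed.\<close>
  have taX: "ta (Some L) X1 = X1" if L: "L \<in> Isig T" for L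
  proof -
    have c: "h_coeff T ?i ?i 1 \<noteq> 0" by (rule h_coeff_diag[OF i(1) nf])
    have "h_coeff T ?i ?i 1 \<star> X1 = h * e ?p - e ?p * h"
      using hh_xp[of ?i ?i 1 Pos 0] i by (simp add: e_xp P X1_def h_def)
    then have X: "X1 = inverse (h_coeff T ?i ?i 1) \<star> (h * e ?p - e ?p * h)"
      using c by (metis csc_csc csc_one left_inverse)
    have z: "e ?p * (ta (Some L) h - h) = (ta (Some L) h - h) * e ?p"
      unfolding h_def by (rule ta_hh1_comm[OF i(1) L P])
    have "ta (Some L) (h * e ?p - e ?p * h) = ta (Some L) h * e ?p - e ?p * ta (Some L) h"
      using hB pI by (simp add: ta_lin ta_simps Bs_gens ta_gens)
    also have "\<dots> = h * e ?p - e ?p * h" using z by (simp add: algebra_simps)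
    finally show ?thesis by (subst (1 2) X) (simp add: ta_lin)
  qed
  define \<kappa> where "\<kappa> = x_coeff T ?i ?i 0 * (qn T ?i - inverse (qn T ?i))"
  have \<kappa>: "\<kappa> \<noteq> 0" using x_coeff_diag[OF i(1)] qn_diff[OF i(1)] by (simp add: \<kappa>_def)
  have "X1 * f ?p = f ?p * X1 + \<kappa> \<star> (h * k ?p)"
    using xp_xp[OF i(1) i(1), of 1 0] hh1[OF i(1)] i(2) by (simp add: f_xp P X1_def h_def \<kappa>_def csc_csc)
  then have DX: "D ?p X1 = \<kappa> \<star> (h * k ?p)" by (simp add: D_def taX[OF P])
  define a where "a = inverse \<kappa> \<star> (Dp ?p X1 * k' ?p)"
  define z where "z = inverse \<kappa> \<star> (Dm ?p X1 * k' ?p)"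
  have haz: "h = a + z"
  proof -
    have "h = inverse \<kappa> \<star> (D ?p X1 * k' ?p)"
      using \<kappa> by (simp add: DX csc_mult_left csc_csc csc_one mult.assoc kk')
    then show ?thesis by (simp add: a_def z_def Dm_def left_diff_distrib csc_diff)
  qed
  have zB: "z \<in> Bs" unfolding z_def by (intro Bs_closed Bs_mult Bs_gens Dm_Bs XB)
  have tak: "ta (Some L) (k' ?p) = Q ?p (Some L) \<star> k' ?p" for L by (rule ta_gens(3)[OF pI])
  have az: "ta (Some L) a = a" "ta (Some L) z = (Q ?p (Some L) ^ 2) \<star> z" if L: "L \<in> Isig T" for L
    using ta_Dp[OF pI XB, of "Some L"] ta_Dm[OF pI XB, of "Some L"] XB
    by (simp_all add: a_def z_def ta_lin ta_simps taX[OF L] Dp_Bs Dm_Bs Bs_gens tak csc_mult_left csc_mult_right csc_csc csc_one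
        power2_eq_square mult.commute mult.left_commute)
  have q2: "Q ?p ?p ^ 2 - 1 \<noteq> 0" using Q_ne_1[OF pI, of 2] by simp
  \<comment> \<open>z is a multiple of the twist defect of h, so it inherits commutation with
    \<open>e_P\<close> and with the torus.\<close>
  have zz: "(Q ?p ?p ^ 2 - 1) \<star> z = ta ?p h - h"
    unfolding haz by (simp add: ta_lin az[OF P] csc_diff csc_one)
  have z0: "z = 0"
  proof (rule no_highest_weight[OF pI zB])
    show "ta ?p z = (Q ?p ?p ^ 2) \<star> z" by (rule az[OF P])
    have "(Q ?p ?p ^ 2 - 1) \<star> (e ?p * z) = (Q ?p ?p ^ 2 - 1) \<star> (z * e ?p)"
      using ta_hh1_comm[OF i(1) P P] zz unfolding h_def by (metis csc_mult_left csc_mult_right)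
    then show "e ?p * z = z * e ?p" using csc_cancel[OF q2] by blast
    have "ta ?p (k ?p * h) = ta ?p (h * k ?p)" using kh[of ?p] P by simp
    then have "inverse (Q ?p ?p) \<star> (k ?p * ta ?p h) = inverse (Q ?p ?p) \<star> (ta ?p h * k ?p)"
      using hB pI by (simp add: ta_simps Bs_gens ta_gens csc_mult_right csc_mult_left)
    then have "k ?p * ta ?p h = ta ?p h * k ?p" by (simp add: csc_cancel)
    moreover have "(Q ?p ?p ^ 2 - 1) \<star> (k ?p * z) = k ?p * (ta ?p h - h)" by (simp add: zz[symmetric] csc_mult_right)
    moreover have "(Q ?p ?p ^ 2 - 1) \<star> (z * k ?p) = (ta ?p h - h) * k ?p" by (simp add: zz[symmetric] csc_mult_left)
    ultimately have "(Q ?p ?p ^ 2 - 1) \<star> (k ?p * z) = (Q ?p ?p ^ 2 - 1) \<star> (z * k ?p)"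
      using kh[of ?p] P by (simp add: right_diff_distrib left_diff_distrib)
    then show "k ?p * z = z * k ?p" using csc_cancel[OF q2] by blast
  qed
  show "ta (Some R) (hh ?i 1) = hh ?i 1" using haz az(1)[OF R] z0 by (simp add: h_def)
  show "x \<in> Some ` Isig T \<Longrightarrow> k x * hh (rep P) 1 = hh (rep P) 1 * k x" using kh[of x] by (simp add: h_def)
  have "Dm (Some R) X1 = 0"
  proof (cases "R = P")
    case True
    have "Dm ?p X1 = \<kappa> \<star> (z * k ?p)" using \<kappa> by (simp add: z_def csc_mult_left csc_csc csc_one mult.assoc kk')
    then show ?thesis using z0 True by simp
  next
    case False
    let ?r = "Some R"
    note rI = IhatI(1)[OF R]
    have "x_coeff T ?i (rep R) 0 = 0" by (rule x_coeff_other) (use False i rep_in[OF R] in auto)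
    then have "X1 * f ?r = f ?r * X1" using xp_xp[of ?i "rep R" 1 0] i rep_in[OF R] by (simp add: f_xp R X1_def)
    then have "D ?r X1 = 0" by (simp add: D_def taX[OF R])
    \<comment> \<open>The two halves cancel, yet the twist scales them by inverse factors; hence
      both vanish.\<close>
    then have pm: "Dp ?r X1 = - Dm ?r X1" by (simp add: Dm_def)
    have "- (Q ?r ?r \<star> Dm ?r X1) = ta ?r (Dp ?r X1)" using ta_Dm[OF rI XB, of ?r] by (simp add: pm ta_lin taX[OF R])
    also have "\<dots> = - (inverse (Q ?r ?r) \<star> Dm ?r X1)" using ta_Dp[OF rI XB, of ?r] by (simp add: pm taX[OF R] csc_minus)
    finally have "Q ?r ?r \<star> Dm ?r X1 = inverse (Q ?r ?r) \<star> Dm ?r X1" by (simp only: neg_equal_iff_equal)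
    then have "(inverse (Q ?r ?r) - Q ?r ?r) \<star> Dm ?r X1 = 0" unfolding csc_diff by (simp only: diff_self)
    then show ?thesis using Q_inverse_ne[OF rI] unfolding csc_eq_0 by blast
  qed
  \<comment> \<open>With z = 0, h is a multiple of \<open>Dp ?p X1 * k' ?p\<close>, and
    \<open>Dm\<close> q-commutes with \<open>Dp\<close>.\<close>
  then have "Q (Some R) ?p \<star> Dm (Some R) (Dp ?p X1) = 0"
    using Dm_Dp[OF IhatI(1)[OF R] pI XB] by (simp add: Dp_lin)
  then have "Dm (Some R) (Dp ?p X1) = 0" by (simp add: csc_eq_0)
  then show "Dm (Some R) (hh ?i 1) = 0"
    using haz z0 Dm_mult[OF IhatI(1)[OF R] Bs_gens(3)[of ?p] Dp_Bs[OF XB, of ?p]] Dm_k[OF IhatI(1)[OF R] pI]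
    by (simp add: a_def h_def Dm_lin)
qed

text \<open>Only orbits without fixed point occur: at a fixed node
  \<open>hh i 1 = \<omega> hh i 1\<close> forces the element to vanish.\<close>

inductive_set VV :: "'u set" where
  base: "P \<in> Isig T \<Longrightarrow> \<sigma> (rep P) \<noteq> rep P \<Longrightarrow> hh (rep P) 1 \<in> VV"
| step: "b \<in> VV \<Longrightarrow> R \<in> Isig T \<Longrightarrow> D (Some R) b \<in> VV"

definition Uhat :: "'u set" where
  "Uhat = alg ({xp b i (int r) | b i r. i \<in> nd} \<union> {ph i r | i r. i \<in> nd} \<union> {kn' i | i. i \<in> nd})"

lemma Uhat_closed: "1 \<in> Uhat" "0 \<in> Uhat" "u \<in> Uhat \<Longrightarrow> v \<in> Uhat \<Longrightarrow> u + v \<in> Uhat" "u \<in> Uhat \<Longrightarrow> z \<star> u \<in> Uhat"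
  "u \<in> Uhat \<Longrightarrow> v \<in> Uhat \<Longrightarrow> u * v \<in> Uhat" "u \<in> Uhat \<Longrightarrow> v \<in> Uhat \<Longrightarrow> u - v \<in> Uhat"
  "u \<in> Uhat \<Longrightarrow> u ^ n \<in> Uhat"
  unfolding Uhat_def by (auto intro: alg.intros alg_closed)

lemma Uhat_gens: "i \<in> nd \<Longrightarrow> 0 \<le> r \<Longrightarrow> xp b i r \<in> Uhat" "i \<in> nd \<Longrightarrow> ph i n \<in> Uhat" "i \<in> nd \<Longrightarrow> kn' i \<in> Uhat" "i \<in> nd \<Longrightarrow> kn i \<in> Uhat"
proof -
  have "i \<in> nd \<Longrightarrow> xp b i (int n) \<in> Uhat" for n unfolding Uhat_def by (rule alg.base) blast
  from this[of "nat r"] show "i \<in> nd \<Longrightarrow> 0 \<le> r \<Longrightarrow> xp b i r \<in> Uhat" by simp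
  show p: "i \<in> nd \<Longrightarrow> ph i n \<in> Uhat" for n unfolding Uhat_def by (rule alg.base) blast
  show "i \<in> nd \<Longrightarrow> kn' i \<in> Uhat" unfolding Uhat_def by (rule alg.base) blast
  show "i \<in> nd \<Longrightarrow> kn i \<in> Uhat" using p[of 0] ph_0 by metis
qed

lemma hh1_Uhat: "i \<in> nd \<Longrightarrow> hh i 1 \<in> Uhat"
proof -
  assume i: "i \<in> nd"
  have "hh i 1 = inverse (qn T i - inverse (qn T i)) \<star> (ph i 1 * kn' i)"
    using qn_diff[OF i] by (simp add: hh1[OF i] csc_mult_left csc_csc csc_one mult.assoc kk' del: One_nat_def)
  then show ?thesis using i by (simp add: Uhat_closed Uhat_gens)
qed

text \<open>The vanishing of all \<open>Dm\<close> gives \<open>D = Dp\<close> on \<open>VV\<close>,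
  which preserves both this vanishing and the eigenvector property under the twists. The latter
  turns \<open>D\<close> into a q-commutator with f, and this keeps the element in
  \<open>Uhat\<close>.\<close>

lemma VV_props:
  assumes "b \<in> VV"
  shows "b \<in> Bs \<and> b \<in> Vd 1 \<and> b \<in> Uhat \<and> (\<forall>R\<in>Isig T. Dm (Some R) b = 0) \<and>
    (\<exists>w. set w \<subseteq> Some ` Isig T \<and> (\<forall>L\<in>Isig T. ta (Some L) b = inverse (Qw (Some L) w) \<star> b \<and>
       k (Some L) * b = inverse (Qw (Some L) w) \<star> (b * k (Some L))))"
  using assms
proof induction
  case (base P)
  then show ?case
    using hh1_invariant[OF base] hh1_Bs hh1_Uhat Vd_gens(2)[of "rep P" 1] rep_in[OF base(1)]
    by (auto intro!: exI[of _ "[]"] simp: csc_one)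
next
  case (step b R)
  then obtain w where w: "set w \<subseteq> Some ` Isig T" "\<And>L. L \<in> Isig T \<Longrightarrow> ta (Some L) b = inverse (Qw (Some L) w) \<star> b"
    "\<And>L. L \<in> Isig T \<Longrightarrow> k (Some L) * b = inverse (Qw (Some L) w) \<star> (b * k (Some L))"
    and b: "b \<in> Bs" "b \<in> Vd 1" "b \<in> Uhat" "\<And>R. R \<in> Isig T \<Longrightarrow> Dm (Some R) b = 0" by blast
  let ?z = "inverse (Qw (Some R) w)"
  note R = step.hyps(2) note rI = IhatI(1)[OF R]
  have D: "D (Some R) b = b * f (Some R) - ?z \<star> (f (Some R) * b)"
    using w(2)[OF R] by (simp add: D_def csc_mult_right)
  have Dp: "D (Some R) b = Dp (Some R) b" using b(4)[OF R] by (simp add: Dm_def)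
  have 1: "D (Some R) b \<in> Bs" by (rule D_Bs[OF b(1)])
  have 2: "D (Some R) b \<in> Vd 1"
  proof -
    have "b * f (Some R) \<in> Vd 1" "f (Some R) * b \<in> Vd 1"
      using Vd_closed(5)[OF b(2) Vd_f[of "Some R"]] Vd_closed(5)[OF Vd_f[of "Some R"] b(2)] by simp_all
    then have "b * f (Some R) + (- ?z) \<star> (f (Some R) * b) \<in> Vd 1" by (intro Vd_closed)
    then show ?thesis by (simp add: D csc_minus)
  qed
  have 3: "D (Some R) b \<in> Uhat"
    unfolding D using Uhat_gens(1)[of "rep R" 0 Neg] R rep_in[OF R] b(3)
    by (auto simp: f_xp intro!: Uhat_closed)
  have 4: "Dm (Some L) (D (Some R) b) = 0" if L: "L \<in> Isig T" for L
  proof -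
    have "Q (Some L) (Some R) \<star> Dm (Some L) (Dp (Some R) b) = 0"
      using Dm_Dp[OF IhatI(1)[OF L] rI b(1)] b(4)[OF L] by (simp add: Dp_lin)
    then show ?thesis unfolding Dp by (simp add: csc_eq_0)
  qed
  have 5: "ta (Some L) (D (Some R) b) = inverse (Qw (Some L) (Some R # w)) \<star> D (Some R) b \<and>
       k (Some L) * D (Some R) b = inverse (Qw (Some L) (Some R # w)) \<star> (D (Some R) b * k (Some L))" if L: "L \<in> Isig T" for L
  proof
    show "ta (Some L) (D (Some R) b) = inverse (Qw (Some L) (Some R # w)) \<star> D (Some R) b"
      unfolding Dp using ta_Dp[OF rI b(1), of "Some L"] w(2)[OF L] Q_sym[of "Some R" "Some L"]
      by (simp add: Dp_lin csc_csc)
    let ?y = "inverse (Qw (Some L) w)"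
    have "k (Some L) * (b * f (Some R)) = (?y * inverse (Q (Some L) (Some R))) \<star> (b * f (Some R) * k (Some L))"
    proof -
      have "k (Some L) * (b * f (Some R)) = ?y \<star> (b * (k (Some L) * f (Some R)))"
        by (simp add: mult.assoc[symmetric] w(3)[OF L] csc_mult_left)
      then show ?thesis by (simp add: kf csc_mult_right csc_csc mult.assoc)
    qed
    moreover have "k (Some L) * (f (Some R) * b) = (?y * inverse (Q (Some L) (Some R))) \<star> (f (Some R) * b * k (Some L))"
    proof -
      have "k (Some L) * (f (Some R) * b) = inverse (Q (Some L) (Some R)) \<star> (f (Some R) * (k (Some L) * b))"
        by (simp add: mult.assoc[symmetric] kf csc_mult_left)
      then show ?thesis by (simp add: w(3)[OF L] csc_mult_right csc_csc mult.assoc mult.commute)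
    qed
    ultimately show "k (Some L) * D (Some R) b = inverse (Qw (Some L) (Some R # w)) \<star> (D (Some R) b * k (Some L))"
      unfolding D by (simp add: right_diff_distrib left_diff_distrib csc_mult_right csc_mult_left csc_diff csc_csc mult.commute mult.left_commute)
  qed
  have 6: "set (Some R # w) \<subseteq> Some ` Isig T" using w(1) R by simp
  show ?case using 1 2 3 4 5 6 by blast
qed

end

lemma eigenvectors_span_image:
  fixes A :: "'p \<Rightarrow> 'a::cvec \<Rightarrow> 'a"
  assumes lin: "\<And>P. P \<in> I \<Longrightarrow> clin (A P)"
    and S: "\<And>i. i \<in> S \<Longrightarrow> \<forall>P\<in>I. A P (g i) = \<psi> i P \<star> g i"
    and u: "u \<in> cvec.span (g ` S)" "\<forall>P\<in>I. A P u = \<chi> P \<star> u"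
  shows "u \<in> cvec.span (g ` {i \<in> S. \<forall>P\<in>I. \<psi> i P = \<chi> P})"
proof -
  have "u \<in> cvec.span {t \<in> g ` S. \<forall>P\<in>I. A P t = \<chi> P \<star> t}"
    by (rule cvec.eigenvectors_span[where A = A and \<chi> = \<chi>])
      (use S u in \<open>auto simp: clinD[OF lin]\<close>)
  moreover have "{t \<in> g ` S. \<forall>P\<in>I. A P t = \<chi> P \<star> t} \<subseteq> cvec.span (g ` {i \<in> S. \<forall>P\<in>I. \<psi> i P = \<chi> P})"
  proof
    fix t assume "t \<in> {t \<in> g ` S. \<forall>P\<in>I. A P t = \<chi> P \<star> t}"
    then obtain i where i: "i \<in> S" "t = g i" "\<And>P. P \<in> I \<Longrightarrow> A P (g i) = \<chi> P \<star> g i" by blast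
    show "t \<in> cvec.span (g ` {i \<in> S. \<forall>P\<in>I. \<psi> i P = \<chi> P})"
    proof (cases "t = 0")
      case False
      have "\<psi> i P = \<chi> P" if "P \<in> I" for P
      proof -
        have "(\<psi> i P - \<chi> P) \<star> g i = 0" using S[OF i(1)] i(3)[OF that] that by (simp add: csc_diff)
        then show ?thesis using False i(2) by (simp add: csc_eq_0)
      qed
      then show ?thesis using i by (intro cvec.span_base) blast
    qed (simp add: cvec.span_zero)
  qed
  ultimately show ?thesis using cvec.span_minimal[OF _ cvec.subspace_span] by blast
qed

context uq_type
begin

section \<open>Characters of the finite torus, and a functional detecting the affine
  generator\<close>

lemma qch_powi: "y \<in> Ihat T \<Longrightarrow> qch m y = s powi (\<Sum>x\<in>Ihat T. m x * BB x y)"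
proof -
  assume y: "y \<in> Ihat T"
  have "(\<Prod>x\<in>A. Q x y powi m x) = s powi (\<Sum>x\<in>A. m x * BB x y)" if "finite A" "A \<subseteq> Ihat T" for A
    using that
    by (induction A rule: finite_induct) (use y in \<open>auto simp: Q_def power_int_add power_int_mult[symmetric] mult.commute\<close>)
  from this[of "Ihat T"] show ?thesis by (simp add: qch_def)
qed

text \<open>Subtracting the multiple of the null root with the same affine coordinate leaves a
  kernel vector of the finite form, which is zero.\<close>

lemma qch_trivial:
  assumes "\<And>L. L \<in> Isig T \<Longrightarrow> qch m (Some L) = 1" and x: "x \<in> Ihat T"
  shows "m x = m None * int (marks T x)"
proof -
  define d where "d P = m (Some P) - m None * int (marks T (Some P))" for P
  note mk = marks[unfolded is_marks_def]
  have "d P = 0" if P: "P \<in> Isig T" for P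
  proof (rule nondegenerate[OF _ P])
    fix L assume L: "L \<in> Isig T"
    then have LI: "Some L \<in> Ihat T" by (simp add: Ihat_def)
    have "(\<Sum>x\<in>Ihat T. m x * BB x (Some L)) = 0"
      using assms(1)[OF L] qch_powi[OF LI] s_powi_eq_1 by metis
    moreover have "(\<Sum>x\<in>Ihat T. int (marks T x) * BB x (Some L)) = 0"
      using mk LI by (auto simp: BB_def mult.assoc)
    ultimately have "(\<Sum>x\<in>Ihat T. (m x - m None * int (marks T x)) * BB x (Some L)) = 0"
      by (simp add: left_diff_distrib sum_subtractf mult.assoc sum_distrib_left[symmetric])
    then have "(\<Sum>P\<in>Isig T. d P * BB (Some P) (Some L)) = 0"
      using mk by (simp add: sum_Ihat d_def)
    then have "2 * (\<Sum>P\<in>Isig T. d P * csum T (rep P) (rep L)) = 0"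
      using L by (simp add: BB_Some sum_distrib_left mult.left_commute cong: sum.cong)
    then show "(\<Sum>P\<in>Isig T. d P * csum T (rep P) (rep L)) = 0" by simp
  qed
  then show ?thesis using x mk by (auto simp: Ihat_def d_def)
qed

lemma qch_add: "qch (\<lambda>x. m x + n x) y = qch m y * qch n y"
  by (simp add: qch_def power_int_add prod.distrib)

lemma qch_uminus: "qch (\<lambda>x. - m x) y = inverse (qch m y)"
  using prod_inversef[of "\<lambda>x. Q x y powi m x" "Ihat T"] by (simp add: qch_def power_int_minus o_def)

lemma qch_single: "x \<in> Ihat T \<Longrightarrow> qch (\<lambda>z. if z = x then 1 else 0) y = Q x y"
proof -
  assume x: "x \<in> Ihat T"
  have "(\<Prod>z\<in>Ihat T. Q z y powi (if z = x then 1 else 0)) = (\<Prod>z\<in>Ihat T. if z = x then Q x y else 1)"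
    by (rule prod.cong) auto
  then show ?thesis using x by (simp add: qch_def prod.delta)
qed

lemma Qw_qch: "set w \<subseteq> Ihat T \<Longrightarrow> Qw y w = qch (\<lambda>x. int (count_list w x)) y"
proof (induction w)
  case (Cons z w)
  have "(\<lambda>x. int (count_list (z # w) x)) = (\<lambda>x. (if x = z then 1 else 0) + int (count_list w x))"
    by (auto simp: fun_eq_iff)
  then show ?case using Cons Q_sym[of y z] by (simp only: qch_add) (simp add: qch_single)
qed (simp add: qch_def)

lemma kp_trivial: "(\<And>L. L \<in> Isig T \<Longrightarrow> qch m (Some L) = 1) \<Longrightarrow> kp m = 1"
proof -
  assume a: "\<And>L. L \<in> Isig T \<Longrightarrow> qch m (Some L) = 1"
  have "kp m = kp (\<lambda>x. m None * int (marks T x))"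
    unfolding kp_def by (rule arg_cong[where f = prod_list], rule map_cong) (use qch_trivial[OF a] IL in auto)
  then show ?thesis by (simp add: kp_marks)
qed

lemma ew_out: "\<not> set w \<subseteq> Ihat T \<Longrightarrow> ew w = 0"
proof (induction w)
  case (Cons x w)
  then show ?case by (cases "x \<in> Ihat T") (simp_all add: gens_out)
qed simp

text \<open>A two-dimensional Borel representation: \<open>True\<close> has trivial weight,
  \<open>False\<close> has the weight of minus the affine root, and the affine e maps
  \<open>False\<close> to \<open>True\<close>. The map \<open>\<kappa>2\<close> is the torus
  action.\<close>

definition \<epsilon>2 :: "anode \<Rightarrow> (bool \<Rightarrow>\<^sub>0 complex) endo" where
  "\<epsilon>2 x = (if x = None then Endo (lext (\<lambda>b z. if b then 0 else Poly_Mapping.single True z)) else 0)"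
definition \<kappa>2 :: "(anode \<Rightarrow> complex) \<Rightarrow> anode \<Rightarrow> (bool \<Rightarrow>\<^sub>0 complex) endo" where
  "\<kappa>2 c x = Endo (lext (\<lambda>b z. Poly_Mapping.single b ((if b then 1 else c x) * z)))"

lemma \<epsilon>2_single: "app (\<epsilon>2 x) (Poly_Mapping.single b z) = (if x = None \<and> \<not> b then Poly_Mapping.single True z else 0)"
proof -
  have l: "clin (\<lambda>z. if b then 0 else Poly_Mapping.single True z)" for b
    by (rule clinI) (auto simp: single_add csc_single)
  show ?thesis by (simp only: \<epsilon>2_def app_Endo[OF clin_lext[OF l]] lext_single[OF l] if_distrib[where f = "\<lambda>A. app A _"] app_simps) simp
qed

lemma \<kappa>2_single: "app (\<kappa>2 c x) (Poly_Mapping.single b z) = Poly_Mapping.single b ((if b then 1 else c x) * z)"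
proof -
  have "clin (\<lambda>z. Poly_Mapping.single b ((if b then 1 else c x) * z))" for b
    by (rule clinI) (auto simp: single_add csc_single csc_complex_def algebra_simps)
  then show ?thesis by (auto simp: \<kappa>2_def app_Endo clin_lext lext_single)
qed

lemma rep2: "borel_rep \<epsilon>2 (\<kappa>2 (\<lambda>x. inverse (Q x None))) (\<kappa>2 (\<lambda>x. Q x None))"
proof -
  let ?c = "\<lambda>x. inverse (Q x None)"
  have 1: "\<kappa>2 ?c x * \<kappa>2 (\<lambda>x. Q x None) x = 1" "\<kappa>2 (\<lambda>x. Q x None) x * \<kappa>2 ?c x = 1" for x
    by (rule endo_pm_eqI, simp add: \<kappa>2_single mult.assoc[symmetric])+
  have 2: "\<kappa>2 ?c x * \<kappa>2 ?c y = \<kappa>2 ?c y * \<kappa>2 ?c x" for x y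
    by (rule endo_pm_eqI) (simp add: \<kappa>2_single mult.left_commute)
  have 3: "\<kappa>2 ?c x * \<epsilon>2 y = Q x y \<star> (\<epsilon>2 y * \<kappa>2 ?c x)" for x y
    by (rule endo_pm_eqI) (auto simp: \<kappa>2_single \<epsilon>2_single csc_single csc_complex_def app_lin mult.assoc[symmetric])
  have 4: "serre (qi T x) (N x y) (\<epsilon>2 x) (\<epsilon>2 y) = 0" if "x \<in> Ihat T" "y \<in> Ihat T" "x \<noteq> y" for x y
  proof (cases "x = None")
    case True
    then have "\<epsilon>2 y = 0" using that by (cases y) (simp_all add: \<epsilon>2_def)
    then show ?thesis by (simp add: serre_def)
  next
    case False
    then have x0: "\<epsilon>2 x = 0" by (cases x) (simp_all add: \<epsilon>2_def)
    have z: "0 < n \<Longrightarrow> (0 :: (bool \<Rightarrow>\<^sub>0 complex) endo) ^ n = 0" for n by (cases n) simp_all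
    have "\<epsilon>2 x ^ (N x y - r) * \<epsilon>2 y * \<epsilon>2 x ^ r = 0" if "r \<le> N x y" for r
      using N_pos[OF \<open>x \<in> Ihat T\<close> \<open>y \<in> Ihat T\<close> \<open>x \<noteq> y\<close>] that
      by (cases "r = 0") (simp_all add: x0 z)
    then show ?thesis by (simp add: serre_def)
  qed
  have 5: "prod_list (map (\<lambda>x. \<kappa>2 ?c x ^ marks T x) xs) = 1" if xs: "distinct xs" "set xs = Ihat T" for xs
  proof -
    have pw: "app (\<kappa>2 ?c x ^ n) (Poly_Mapping.single b z) = Poly_Mapping.single b ((if b then 1 else ?c x ^ n) * z)" for x n b z
      by (induction n) (simp_all add: \<kappa>2_single mult.assoc)
    have "app (prod_list (map (\<lambda>x. \<kappa>2 ?c x ^ marks T x) ys)) (Poly_Mapping.single b z) =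
       Poly_Mapping.single b ((if b then 1 else prod_list (map (\<lambda>x. ?c x ^ marks T x) ys)) * z)" for ys b z
      by (induction ys) (simp_all add: pw mult.assoc)
    moreover have "prod_list (map (\<lambda>x. ?c x ^ marks T x) xs) = 1"
      using prod.distinct_set_conv_list[OF xs(1), of "\<lambda>x. ?c x ^ marks T x"] xs(2) chars_Q(1)[of None] by (simp add: chars_def)
    ultimately show ?thesis by (intro endo_pm_eqI) simp
  qed
  show ?thesis unfolding borel_rep_def using 1 2 3 4 5 by blast
qed

text \<open>The coefficient of \<open>True\<close> in the induced functional started at
  \<open>False\<close>: on the Borel subalgebra it sees only the single letter
  \<open>e None\<close>, up to torus factors.\<close>

lemma \<Psi>_exists:
  "\<exists>\<Psi> :: 'u \<Rightarrow> complex. clin \<Psi> \<and> \<Psi> 1 = 0 \<and> \<Psi> (e None) = 1 \<and> (\<forall>x u. \<Psi> (f x * u) = 0) \<and>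
    (\<forall>x\<in>Ihat T. \<forall>u. \<Psi> (k x * u) = \<Psi> u \<and> \<Psi> (k' x * u) = \<Psi> u) \<and>
    (\<forall>P u. \<Psi> (e (Some P) * u) = 0) \<and> (\<forall>x. \<forall>b\<in>Bs. \<Psi> (e None * (e x * b)) = 0)"
proof -
  obtain pz pj where F: "functionals \<epsilon>2 (\<kappa>2 (\<lambda>x. inverse (Q x None))) (\<kappa>2 (\<lambda>x. Q x None)) (Poly_Mapping.single False 1) pz pj"
    using functionals_exist[OF rep2] by blast
  then have lin: "clin pz" by (simp add: functionals_def)
  have ep: "Poly_Mapping.lookup (app (\<epsilon>2 x) m) b = (if x = None \<and> b then Poly_Mapping.lookup m False else 0)" for x m b
    by (induction m rule: pm_single_induct) (auto simp: app_lin lookup_add \<epsilon>2_single lookup_single when_def)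
  have kap: "Poly_Mapping.lookup (app (\<kappa>2 c x) m) True = Poly_Mapping.lookup m True" for c x m
    by (induction m rule: pm_single_induct) (auto simp: app_lin lookup_add \<kappa>2_single lookup_single when_def)
  have eB: "pz (e x * b) = app (\<epsilon>2 x) (pz b)" if "b \<in> Bs" for x b
  proof (cases "x \<in> Ihat T")
    case True
    then show ?thesis using F that by (simp add: functionals_def app_lin)
  next
    case False
    then have "\<epsilon>2 x = 0" by (auto simp: \<epsilon>2_def Ihat_def)
    then show ?thesis using False by (simp add: gens_out clinD[OF lin])
  qed
  have N: "None \<in> Ihat T" by (simp add: Ihat_def)
  \<comment> \<open>Valid for arbitrary u, not only in \<open>Bs\<close>: the correction terms with
    \<open>\<kappa>\<close> and \<open>\<kappa>'\<close> cancel because the weight at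
    \<open>True\<close> is trivial.\<close>
  have P: "Poly_Mapping.lookup (pz (e (Some P) * u)) True = 0" for P u
  proof (cases "Some P \<in> Ihat T")
    case True
    then show ?thesis using F by (simp add: functionals_def lookup_add lookup_minus ep kap)
  qed (simp add: gens_out clinD[OF lin])
  show ?thesis
  proof (rule exI[of _ "\<lambda>u. Poly_Mapping.lookup (pz u) True"], intro conjI allI ballI)
    show "clin (\<lambda>u. Poly_Mapping.lookup (pz u) True)"
      by (rule clinI) (simp_all add: clinD[OF lin] lookup_add)
    show "Poly_Mapping.lookup (pz 1) True = 0" using F by (simp add: functionals_def lookup_single)
    show "Poly_Mapping.lookup (pz (e None)) True = 1"
      using eB[OF Bs_1, of None] F by (simp add: functionals_def ep lookup_single)
    show "Poly_Mapping.lookup (pz (f x * u)) True = 0" for x u using F by (simp add: functionals_def)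
    show "Poly_Mapping.lookup (pz (k x * u)) True = Poly_Mapping.lookup (pz u) True"
      "Poly_Mapping.lookup (pz (k' x * u)) True = Poly_Mapping.lookup (pz u) True" if "x \<in> Ihat T" for x u
      using F that by (simp_all add: functionals_def kap)
    show "Poly_Mapping.lookup (pz (e (Some P) * u)) True = 0" for P u by (rule P)
    show "Poly_Mapping.lookup (pz (e None * (e x * b))) True = 0" if "b \<in> Bs" for x b
      using that by (simp add: eB Bs_gen ep)
  qed
qed

end

context uq_drinfeld
begin

section \<open>Degree and weight components in the Borel subalgebra, and the affine generator in
  \<open>Uhat\<close>\<close>

lemma Bs_degree:
  assumes "b \<in> Bs" "b \<in> Vd d"
  shows "b \<in> cvec.span {ew w * kp m | w m. set w \<subseteq> Ihat T \<and> dgw w = d}"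
proof -
  have "b \<in> cvec.span {t \<in> {ew w * kp m | w m. True}. t \<in> Vd d}"
    by (rule span_proj[OF assms(1)[unfolded Bs_def] assms(2)]) (use Vd_word in blast)
  moreover have "t \<in> cvec.span {ew w * kp m | w m. set w \<subseteq> Ihat T \<and> dgw w = d}"
    if "t \<in> {t \<in> {ew w * kp m | w m. True}. t \<in> Vd d}" for t
  proof -
    from that obtain w m where t: "t = ew w * kp m" "t \<in> Vd d" by blast
    have "proj d t = t" using proj_Vd[OF t(2), of d] by simp
    moreover have "proj d t = (if d = dgw w then t else 0)" unfolding t(1) by (rule proj_Vd[OF Vd_word])
    ultimately have "t = 0 \<or> d = dgw w" by metis
    then consider "t = 0" | "d = dgw w" "set w \<subseteq> Ihat T" by (cases "set w \<subseteq> Ihat T") (auto simp: t(1) ew_out)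
    then show ?thesis using t(1) by cases (auto simp: cvec.span_zero intro: cvec.span_base)
  qed
  ultimately show ?thesis by (meson cvec.span_minimal cvec.subspace_span subsetD subsetI)
qed

definition Ad :: "anode \<Rightarrow> 'u \<Rightarrow> 'u" where "Ad x u = k x * u * k' x"

lemma clin_Ad: "clin (Ad x)"
  by (rule clinI) (simp_all add: Ad_def distrib_left distrib_right csc_mult_left csc_mult_right)

lemma Ad_iff: "Ad x u = z \<star> u \<longleftrightarrow> k x * u = z \<star> (u * k x)"
proof
  assume "Ad x u = z \<star> u"
  then have "k x * u * (k' x * k x) = z \<star> (u * k x)" by (simp add: Ad_def mult.assoc[symmetric] csc_mult_left)
  then show "k x * u = z \<star> (u * k x)" by (simp add: kk')
qed (simp add: Ad_def csc_mult_left mult.assoc kk')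

lemma k_word: "x \<in> Ihat T \<Longrightarrow> k x * (ew w * kp m) = Qw x w \<star> (ew w * kp m * k x)"
proof -
  assume x: "x \<in> Ihat T"
  have "k x * kp m = kp m * k x" using x by (simp only: k_eq_kp kp_comm)
  then show ?thesis by (simp add: mult.assoc[symmetric] k_ew csc_mult_left) (simp add: mult.assoc)
qed

lemma Bs_weight:
  assumes "b \<in> cvec.span {ew w * kp m | w m. set w \<subseteq> Ihat T \<and> dgw w = d}"
    and "\<And>L. L \<in> Isig T \<Longrightarrow> k (Some L) * b = \<chi> L \<star> (b * k (Some L))"
  shows "b \<in> cvec.span {ew w * kp m | w m. set w \<subseteq> Ihat T \<and> dgw w = d \<and> (\<forall>L\<in>Isig T. Qw (Some L) w = \<chi> L)}"
proof -
  let ?S = "{(w, m). set w \<subseteq> Ihat T \<and> dgw w = d}" and ?g = "\<lambda>(w, m). ew w * kp m"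
  have S: "?g ` ?S = {ew w * kp m | w m. set w \<subseteq> Ihat T \<and> dgw w = d}" by force
  have "b \<in> cvec.span (?g ` {i \<in> ?S. \<forall>L\<in>Isig T. Qw (Some L) (fst i) = \<chi> L})"
  proof (rule eigenvectors_span_image[where A = "\<lambda>L. Ad (Some L)"])
    show "b \<in> cvec.span (?g ` ?S)" using assms(1) unfolding S .
    show "\<forall>L\<in>Isig T. Ad (Some L) (?g i) = Qw (Some L) (fst i) \<star> ?g i" for i
      by (simp add: Ad_iff case_prod_unfold k_word)
  qed (use assms(2) in \<open>auto simp: Ad_iff clin_Ad\<close>)
  then show ?thesis by (rule subsetD[OF cvec.span_mono, rotated]) auto
qed

text \<open>The finite weight fixes the letter counts up to multiples of the marks, and degree 1
  removes this ambiguity.\<close>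

lemma affine_word:
  assumes "set w \<subseteq> Ihat T" "dgw w = 1" "\<And>L. L \<in> Isig T \<Longrightarrow> Qw (Some L) w = Q (Some L) None"
  shows "w = [None]"
proof -
  define m where "m x = int (count_list w x) + (if x = None then - 1 else 0)" for x
  have c: "qch (\<lambda>x. if x = None then - 1 else 0) y = inverse (Q y None)" for y
    using qch_uminus[of "\<lambda>z. if z = None then 1 else 0" y] qch_single[of None y] Q_sym[of None y]
    by (simp add: if_distrib[of uminus] cong: if_cong)
  have "qch m (Some L) = 1" if "L \<in> Isig T" for L
    unfolding m_def qch_add c Qw_qch[OF assms(1), symmetric] assms(3)[OF that] by simp
  then have "m x = 0" if "x \<in> Ihat T" for x
    using qch_trivial[of m x] that assms(2) by (simp add: m_def)
  then have "count_list w x = 0" if "x \<noteq> None" for x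
  proof (cases "x \<in> Ihat T")
    case True
    then show ?thesis using \<open>\<And>x. x \<in> Ihat T \<Longrightarrow> m x = 0\<close>[OF True] that by (simp add: m_def)
  next
    case False
    then show ?thesis using assms(1) by (auto simp: count_list_0_iff)
  qed
  then have "set w \<subseteq> {None}" by (metis count_list_0_iff insertCI subsetI)
  then have "w = replicate (length w) None" by (auto simp: list_eq_iff_nth_eq in_set_conv_nth subset_iff)
  moreover have "count_list (replicate n None) None = n" for n :: nat by (induction n) auto
  ultimately have "w = replicate (length w) None" "count_list w None = length w" by metis+
  then show ?thesis using assms(2) by simp
qed

lemma sig_orb_rep: "i \<in> nd \<Longrightarrow> \<exists>r. i = sig T r (rep (orb T i))"
  using rep_in[of "orb T i"] orb_self[of i] orb_iff[of "rep (orb T i)" i] by auto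

lemma xp_orb: "i \<in> nd \<Longrightarrow> \<exists>z. xp b i t = z \<star> xp b (rep (orb T i)) t"
proof -
  assume i: "i \<in> nd"
  have r: "rep (orb T i) \<in> nd" using rep_in(2)[OF IsigI[OF i]] .
  have "\<exists>z. xp b (sig T n (rep (orb T i))) t = z \<star> xp b (rep (orb T i)) t" for n
  proof (induction n)
    case 0
    show ?case by (rule exI[of _ 1]) (simp add: csc_one)
  next
    case (Suc n)
    then obtain z where "xp b (sig T n (rep (orb T i))) t = z \<star> xp b (rep (orb T i)) t" by blast
    then show ?case using xp_aut[of "sig T n (rep (orb T i))" b t] r by (auto simp: csc_csc)
  qed
  then show ?thesis using sig_orb_rep[OF i] by metis
qed

lemma hh_orb: "i \<in> nd \<Longrightarrow> t \<noteq> 0 \<Longrightarrow> \<exists>z. hh i t = z \<star> hh (rep (orb T i)) t"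
proof -
  assume i: "i \<in> nd" and t: "t \<noteq> 0"
  have r: "rep (orb T i) \<in> nd" using rep_in(2)[OF IsigI[OF i]] .
  have "\<exists>z. hh (sig T n (rep (orb T i))) t = z \<star> hh (rep (orb T i)) t" for n
  proof (induction n)
    case 0
    show ?case by (rule exI[of _ 1]) (simp add: csc_one)
  next
    case (Suc n)
    then obtain z where "hh (sig T n (rep (orb T i))) t = z \<star> hh (rep (orb T i)) t" by blast
    then show ?case using hh_aut[of "sig T n (rep (orb T i))" t] r t by (auto simp: csc_csc)
  qed
  then show ?thesis using sig_orb_rep[OF i] by metis
qed

text \<open>Modes are raised through commutators with \<open>h_{i,1}\<close> at nodes that are not
  fixed and with \<open>h_{i,M}\<close> of a neighbour at fixed ones; connectedness reaches every
  node. All generators being scalars modulo the right ideal, so is every element.\<close>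

lemma right_ideal_generators:
  assumes lin: "\<And>u v. u \<in> RR \<Longrightarrow> v \<in> RR \<Longrightarrow> u + v \<in> RR" "\<And>u v. u \<in> RR \<Longrightarrow> u * v \<in> RR"
    and gens: "\<And>P. P \<in> Isig T \<Longrightarrow> e (Some P) \<in> RR" "\<And>P. P \<in> Isig T \<Longrightarrow> f (Some P) \<in> RR"
      "\<And>P. P \<in> Isig T \<Longrightarrow> k (Some P) - 1 \<in> RR" "\<And>P. P \<in> Isig T \<Longrightarrow> k' (Some P) - 1 \<in> RR"
      "\<And>d u. d < 0 \<Longrightarrow> u \<in> Vd d \<Longrightarrow> u \<in> RR"
    and h1: "\<And>P. P \<in> Isig T \<Longrightarrow> \<sigma> (rep P) \<noteq> rep P \<Longrightarrow> hh (rep P) 1 \<in> RR"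
  shows "\<exists>z. u - z \<star> 1 \<in> RR"
proof -
  have scal: "z \<star> v \<in> RR" if "v \<in> RR" for z v using lin(2)[OF that, of "z \<star> 1"] by (simp add: csc_mult_right)
  have RRz: "0 \<in> RR" using scal[OF gens(1)[OF eps_Isig], of 0] by simp
  have diff: "v - v' \<in> RR" if "v \<in> RR" "v' \<in> RR" for v v'
    using lin(1)[OF that(1) scal[OF that(2), of "- 1"]] by (simp add: csc_minus csc_one)
  have divide: "v \<in> RR" if "z \<star> v \<in> RR" "z \<noteq> 0" for z v
    using scal[OF that(1), of "inverse z"] that(2) by (simp add: csc_csc csc_one)
  have x0: "xp b i 0 \<in> RR" if i: "i \<in> nd" for b i
  proof -
    obtain z where "xp b i 0 = z \<star> xp b (rep (orb T i)) 0" using xp_orb[OF i] by blast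
    then show ?thesis using gens(1,2)[OF IsigI[OF i]] scal i by (cases b) (auto simp: e_xp f_xp)
  qed
  have ph: "ph i m \<in> RR" if "i \<in> nd" "0 < m" "xp Pos i (int m) \<in> RR" for i m
  proof -
    have "x_coeff T i i 0 \<star> ph i m = xp Pos i (int m) * xp Neg i 0 - xp Neg i 0 * xp Pos i (int m)"
      using xp_xp[OF that(1,1), of "int m" 0] that(2) by simp
    also have "\<dots> \<in> RR" by (intro diff lin(2) that x0)
    finally show ?thesis by (rule divide) (rule x_coeff_diag[OF that(1)])
  qed
  have hRR: "hq i t \<in> RR" if "i \<in> nd" "0 < t" "\<And>m. 0 < m \<Longrightarrow> ph i m \<in> RR" for i t
    using that(2)
  proof (induction t rule: less_induct)
    case (less t)
    \<comment> \<open>The recursion for phi is solved for its top term; the others begin with an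
      earlier \<open>hq\<close>, already in the right ideal.\<close>
    have eq: "of_nat t \<star> ph i t = of_nat t \<star> (hq i t * kn i) + (\<Sum>a\<in>{1..<t}. of_nat a \<star> (hq i a * ph i (t - a)))"
    proof -
      have "{1..t} = insert t {1..<t}" using less.prems by auto
      then show ?thesis using ph_rec[OF that(1), of t] ph_0[OF that(1)] by simp
    qed
    have S: "(\<Sum>a\<in>{1..<t}. of_nat a \<star> (hq i a * ph i (t - a))) \<in> RR"
    proof -
      have "finite A \<Longrightarrow> A \<subseteq> {1..<t} \<Longrightarrow> (\<Sum>a\<in>A. of_nat a \<star> (hq i a * ph i (t - a))) \<in> RR" for A
        by (induction A rule: finite_induct) (auto intro!: RRz lin scal less.IH)
      then show ?thesis by simp
    qed
    have "of_nat t \<star> (hq i t * kn i) \<in> RR"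
      using diff[OF scal[OF that(3)[OF less.prems], of "of_nat t"] S] unfolding eq by simp
    then have "hq i t * kn i \<in> RR" by (rule divide) (use less.prems in simp)
    then have "hq i t * kn i * kn' i \<in> RR" by (rule lin(2))
    then show ?case by (simp add: mult.assoc kk')
  qed
  have hh: "hh i (int t) \<in> RR" if "i \<in> nd" "0 < t" "\<And>r. 0 < r \<Longrightarrow> xp Pos i (int r) \<in> RR" for i t
  proof -
    have "hq i t \<in> RR" by (rule hRR[OF that(1,2)]) (rule ph[OF that(1) _ that(3)])
    then have "(qn T i - inverse (qn T i)) \<star> hh i (int t) \<in> RR" using that(2) by (simp add: hq_def)
    then show ?thesis by (rule divide) (rule qn_diff[OF that(1)])
  qed
  \<comment> \<open>The commutator of two elements of a right ideal lies in it, and here it is a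
    nonzero multiple of the generator with the higher mode.\<close>
  have step: "xp b j (int t + r) \<in> RR"
    if "i \<in> nd" "j \<in> nd" "0 < t" "hh i (int t) \<in> RR" "h_coeff T i j (int t) \<noteq> 0" "xp b j r \<in> RR" for i j t b r
  proof -
    have "(of_int (sgi b) * h_coeff T i j (int t)) \<star> xp b j (int t + r) = hh i (int t) * xp b j r - xp b j r * hh i (int t)"
      using hh_xp[OF that(1,2), of "int t" b r] that(3) by simp
    also have "\<dots> \<in> RR" by (intro diff lin(2) that)
    finally show ?thesis by (rule divide) (use that(5) in \<open>cases b; simp\<close>)
  qed
  let ?G = "{i. (\<forall>b t. xp b i (int t) \<in> RR) \<and> (\<forall>t. hh i (int (Suc t)) \<in> RR)}"
  have nf: "i \<in> ?G" if i: "i \<in> nd" "\<sigma> i \<noteq> i" for i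
  proof -
    have "\<sigma> (rep (orb T i)) \<noteq> rep (orb T i)"
      using i fixed_orb[OF i(1), of "rep (orb T i)"] rep_in(1)[OF IsigI[OF i(1)]] by simp
    moreover obtain z where "hh i 1 = z \<star> hh (rep (orb T i)) 1" using hh_orb[OF i(1), of 1] by auto
    ultimately have h: "hh i (int 1) \<in> RR" using scal[OF h1[OF IsigI[OF i(1)]]] by simp
    have x: "xp b i (int t) \<in> RR" for b t
    proof (induction t)
      case (Suc t)
      then show ?case using step[OF i(1) i(1) _ h, of b "int t"] h_coeff_diag[OF i] by simp
    qed (simp add: x0 i)
    moreover have "hh i (int (Suc t)) \<in> RR" for t by (rule hh[OF i(1) zero_less_Suc x])
    ultimately show ?thesis by blast
  qed
  have fx: "j \<in> ?G" if i: "i \<in> ?G" "i \<in> nd" and j: "j \<in> nd" "\<sigma> j = j" "adj T i j" for i j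
  proof -
    have h: "hh i (int M) \<in> RR" using i(1) M_pos(1) by (metis (mono_tags, lifting) gr0_implies_Suc mem_Collect_eq)
    have m: "xp b j (int (M * t)) \<in> RR" for b t
    proof (induction t)
      case (Suc t)
      then show ?case using step[OF i(2) j(1) _ h, of b "int (M * t)"] h_coeff_adj[OF i(2) j(2,3), of "int M"] by simp
    qed (simp add: x0 j)
    have x: "xp b j (int t) \<in> RR" for b t
    proof (cases "M dvd t")
      case True
      then show ?thesis using m by (auto simp: dvd_def)
    next
      case False
      \<comment> \<open>At a fixed node the symmetry \<open>x_{j,t} = \<omega>^t x_{j,t}\<close>
        kills the modes not divisible by M, so steps of size M suffice.\<close>
      then have "\<omega> powi int t \<noteq> 1" by (simp only: omega_powi_eq_1 int_dvd_int_iff) simp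
      moreover have "(\<omega> powi int t - 1) \<star> xp b j (int t) = 0"
        using xp_aut[OF j(1), of b "int t"] j(2) by (simp add: csc_diff csc_one)
      ultimately have "xp b j (int t) = 0" unfolding csc_eq_0 by simp
      then show ?thesis by (simp add: RRz)
    qed
    moreover have "hh j (int (Suc t)) \<in> RR" for t by (rule hh[OF j(1) zero_less_Suc x])
    ultimately show ?thesis by blast
  qed
  have all: "i \<in> ?G" if "i \<in> nd" for i
  proof -
    obtain a where a: "a \<in> nd" "\<sigma> a \<noteq> a" using nontrivial by blast
    show ?thesis
    proof (rule node_induct[OF nf[OF a] a(1) _ that])
      fix i j assume "i \<in> ?G" "i \<in> nd" "j \<in> nd" "adj T i j"
      then show "j \<in> ?G" using nf[of j] fx[of i j] by blast
    qed
  qed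
  have gen: "\<exists>z. v - z \<star> 1 \<in> RR" if "v \<in> {xp b i m | b i m. i \<in> nd} \<union> {hh i r | i r. i \<in> nd \<and> r \<noteq> 0} \<union> {kn i | i. i \<in> nd} \<union> {kn' i | i. i \<in> nd}" for v
  proof -
    from that consider b i m where "i \<in> nd" "v = xp b i m" | i r where "i \<in> nd" "r \<noteq> 0" "v = hh i r"
      | i where "i \<in> nd" "v = kn i" | i where "i \<in> nd" "v = kn' i" by blast
    then show ?thesis
    proof cases
      case 1
      have "v \<in> RR"
      proof (cases "m < 0")
        case True
        then show ?thesis using gens(5)[OF True] Vd_gens(1)[OF 1(1)] 1(2) by simp
      next
        case False
        then show ?thesis using all[OF 1(1)] 1(2) by (auto elim!: allE[of _ b] allE[of _ "nat m"])
      qed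
      then show ?thesis by (intro exI[of _ 0]) simp
    next
      case 2
      have "v \<in> RR"
      proof (cases "r < 0")
        case True
        then show ?thesis using gens(5)[OF True] Vd_gens(2)[OF 2(1,2)] 2(3) by simp
      next
        case False
        then have "r = int (Suc (nat (r - 1)))" using 2(2) by simp
        then show ?thesis using all[OF 2(1)] 2(3) by (metis (mono_tags, lifting) mem_Collect_eq)
      qed
      then show ?thesis by (intro exI[of _ 0]) simp
    next
      case 3
      then show ?thesis using gens(3)[OF IsigI] by (intro exI[of _ 1]) (simp add: csc_one)
    next
      case 4
      then show ?thesis using gens(4)[OF IsigI] by (intro exI[of _ 1]) (simp add: csc_one)
    qed
  qed
  from gen_U[of u] show ?thesis
  proof (induction rule: alg.induct)
    case (base u)
    then show ?case by (rule gen)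
  next
    case one
    show ?case using RRz by (intro exI[of _ 1]) (simp add: csc_one)
  next
    case (add u v)
    then obtain y z where "u - y \<star> 1 \<in> RR" "v - z \<star> 1 \<in> RR" by blast
    from lin(1)[OF this] show ?case by (intro exI[of _ "y + z"]) (simp add: csc_add_left algebra_simps)
  next
    case (scal u z)
    then obtain y where "u - y \<star> 1 \<in> RR" by blast
    then have "z \<star> (u - y \<star> 1) \<in> RR" by (rule \<open>\<And>z v. v \<in> RR \<Longrightarrow> z \<star> v \<in> RR\<close>)
    then show ?case by (intro exI[of _ "z * y"]) (simp add: csc_diff csc_csc)
  next
    case (mult u v)
    then obtain y z where uv: "u - y \<star> 1 \<in> RR" "v - z \<star> 1 \<in> RR" by blast
    \<comment> \<open>This is \<open>u * v - (y * z) \<star> 1\<close>, written so that only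
      multiplication from the right occurs.\<close>
    have "(u - y \<star> 1) * v + y \<star> (v - z \<star> 1) \<in> RR"
      by (rule lin(1)[OF lin(2)[OF uv(1)] \<open>\<And>z v. v \<in> RR \<Longrightarrow> z \<star> v \<in> RR\<close>[OF uv(2)]])
    then show ?case by (intro exI[of _ "y * z"]) (simp add: left_diff_distrib csc_mult_left csc_diff csc_csc)
  qed
qed

lemma kp_times_f: "\<exists>z. kp m * (f x * u) = z \<star> (f x * (kp m * u))"
  by (rule exI[of _ "inverse (qch m x)"]) (simp add: mult.assoc[symmetric] kp_f csc_mult_left)

lemma ew_f_None: "None \<notin> set w \<Longrightarrow> ew w * f None = f None * ew w"
proof (induction w)
  case (Cons x w)
  have "e x * f None = f None * e x" using ef[of x None] Cons.prems by auto
  then have "e x * (ew w * f None) = f None * (e x * ew w)"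
    using Cons by (simp add: mult.assoc[symmetric])
  then show ?case by (simp add: mult.assoc)
qed simp

text \<open>Otherwise the largest right ideal on which \<open>\<Psi>\<close> vanishes would contain \<open>VV\<close>, and then all Drinfeld
  generators modulo scalars.\<close>

lemma VV_affine: "\<exists>b\<in>VV. b \<noteq> 0 \<and> (\<forall>L\<in>Isig T. k (Some L) * b = Q (Some L) None \<star> (b * k (Some L)))"
proof (rule ccontr)
  assume "\<not> ?thesis"
  then have no: "b = 0" if "b \<in> VV" "\<And>L. L \<in> Isig T \<Longrightarrow> k (Some L) * b = Q (Some L) None \<star> (b * k (Some L))" for b
    using that by blast
  obtain \<Psi> :: "'u \<Rightarrow> complex" where lin: "clin \<Psi>" and \<Psi>1: "\<Psi> 1 = 0" "\<Psi> (e None) = 1"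
    and \<Psi>f: "\<And>x u. \<Psi> (f x * u) = 0"
    and \<Psi>k: "\<And>x u. x \<in> Ihat T \<Longrightarrow> \<Psi> (k x * u) = \<Psi> u" "\<And>x u. x \<in> Ihat T \<Longrightarrow> \<Psi> (k' x * u) = \<Psi> u"
    and \<Psi>e: "\<And>P u. \<Psi> (e (Some P) * u) = 0" "\<And>x b. b \<in> Bs \<Longrightarrow> \<Psi> (e None * (e x * b)) = 0"
    using \<Psi>_exists by blast
  note \<Psi> = clinD[OF lin]
  define RR where "RR = {u. \<forall>v. \<Psi> (u * v) = 0}"
  \<comment> \<open>A nonzero normal-form word of negative degree must begin with some f, which
    \<open>\<Psi>\<close> kills.\<close>
  have neg: "u \<in> RR" if "d < 0" "u \<in> Vd d" for u d
  proof -
    have "u \<in> cvec.span {t \<in> {fw v * (ew w * kp m) | v w m. True}. t \<in> Vd d}"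
      by (rule span_proj[OF word_span that(2)]) (use Vd_closed(5)[OF Vd_fw Vd_word] in blast)
    moreover have "\<Psi> (t * u) = 0" if t: "t \<in> {t \<in> {fw v * (ew w * kp m) | v w m. True}. t \<in> Vd d}" for t u
    proof -
      from t obtain v w m where t: "t = fw v * (ew w * kp m)" "t \<in> Vd d" by blast
      show ?thesis
      proof (cases v)
        case Nil
        have "t \<in> Vd (dgw w)" using Vd_word[of w m] by (simp add: t(1) Nil)
        then have "t = 0" using proj_Vd[OF t(2), of d] proj_Vd[of t "dgw w" d] \<open>d < 0\<close> by simp
        then show ?thesis by (simp add: \<Psi>)
      next
        case (Cons x v')
        then show ?thesis by (simp add: t(1) mult.assoc \<Psi>f)
      qed
    qed
    ultimately have "\<Psi> (u * v) = 0" for v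
    proof (induction rule: cvec.span_induct_alt)
      case (step c x y)
      then show ?case by (simp add: distrib_right csc_mult_left \<Psi>)
    qed (simp add: \<Psi>)
    then show ?thesis by (simp add: RR_def)
  qed
  \<comment> \<open>In degree 1 the affine e occurs once. If it is the first letter, the affine f
    passes the other letters and meets it, and the resulting \<open>k - k'\<close> is invisible to
    \<open>\<Psi>\<close>; any other first letter is killed directly.\<close>
  have word: "\<Psi> (b * (f None * u)) = 0" if "b \<in> VV" for b u
  proof -
    have b: "b \<in> Bs" "b \<in> Vd 1" using VV_props[OF that] by auto
    from Bs_degree[OF this] show ?thesis
    proof (induction rule: cvec.span_induct_alt)
      case (step c x y)
      then obtain w m where x: "x = ew w * kp m" "dgw w = 1" by blast
      obtain z where z: "kp m * (f None * u) = z \<star> (f None * (kp m * u))" using kp_times_f by blast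
      have "\<Psi> (x * (f None * u)) = 0"
      proof (cases w)
        case (Cons y w')
        show ?thesis
        proof (cases y)
          case None
          have "None \<notin> set w'"
            using x(2) Cons None by (simp add: count_list_0_iff)
          then have "x * (f None * u) = z \<star> (e None * f None * (ew w' * (kp m * u)))"
            by (simp add: x(1) Cons None mult.assoc z csc_mult_right) (simp add: mult.assoc[symmetric] ew_f_None)
          also have "e None * f None = f None * e None + cc None \<star> (k None - k' None)"
            using ef[of None None] by simp
          finally show ?thesis by (simp add: \<Psi> csc_mult_left distrib_right left_diff_distrib mult.assoc \<Psi>f \<Psi>k)
        qed (simp add: x Cons mult.assoc \<Psi>e)
      qed (use x in simp)
      then show ?case using step by (simp add: distrib_right csc_mult_left \<Psi>)
    qed (simp add: \<Psi>)
  qed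
  have B: "\<Psi> (b * b0) = 0" if bV: "b \<in> VV" and b0: "b0 \<in> Bs" for b b0
  proof -
    have b: "b \<in> Bs" "b \<in> Vd 1" using VV_props[OF bV] by auto
    obtain v where v: "\<And>L. L \<in> Isig T \<Longrightarrow> k (Some L) * b = inverse (Qw (Some L) v) \<star> (b * k (Some L))"
      using VV_props[OF bV] by blast
    show ?thesis
    proof (cases "\<forall>L\<in>Isig T. inverse (Qw (Some L) v) = Q (Some L) None")
      case True
      then have "b = 0" using no[OF bV] v by simp
      then show ?thesis by (simp add: \<Psi>)
    next
      case False
      have "b \<in> cvec.span {ew w * kp m | w m. set w \<subseteq> Ihat T \<and> dgw w = 1 \<and> (\<forall>L\<in>Isig T. Qw (Some L) w = inverse (Qw (Some L) v))}"
        by (rule Bs_weight[OF Bs_degree[OF b] v])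
      then show ?thesis
      proof (induction rule: cvec.span_induct_alt)
        case (step c x y)
        then obtain w m where x: "x = ew w * kp m" "dgw w = 1" "\<forall>L\<in>Isig T. Qw (Some L) w = inverse (Qw (Some L) v)" by blast
        have "w \<noteq> [None]" using x(3) False by auto
        then have "\<Psi> (x * b0) = 0"
        proof (cases w)
          case (Cons y w')
          show ?thesis
          proof (cases y)
            case None
            then have "w' \<noteq> []" using \<open>w \<noteq> [None]\<close> Cons by simp
            then obtain y' w'' where w': "w' = y' # w''" by (cases w') auto
            have kB: "kp m \<in> Bs" using Bs_word[of "[]" m] by simp
            have eB: "ew w'' \<in> Bs" using Bs_word[of w'' "\<lambda>x. 0"] by (simp add: kp_0)
            have "ew w'' * (kp m * b0) \<in> Bs" by (intro Bs_mult eB kB b0)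
            then show ?thesis by (simp add: x(1) Cons None w' mult.assoc \<Psi>e)
          qed (simp add: x Cons mult.assoc \<Psi>e)
        qed (use x in simp)
        then show ?case using step by (simp add: distrib_right csc_mult_left \<Psi>)
      qed (simp add: \<Psi>)
    qed
  qed
  \<comment> \<open>A finite f moved to the left replaces b by its skew derivative, again in
    \<open>VV\<close>; this is why \<open>VV\<close> is closed under all
    \<open>D (Some R)\<close>.\<close>
  have VVf: "b0 \<in> Bs \<Longrightarrow> b \<in> VV \<Longrightarrow> \<Psi> (b * (fw v * b0)) = 0" for b v b0
  proof (induction v arbitrary: b)
    case Nil
    then show ?case using B by simp
  next
    case (Cons x v)
    show ?case
    proof (cases "x \<in> Ihat T")
      case True
      then consider "x = None" | R where "R \<in> Isig T" "x = Some R" by (auto simp: Ihat_def)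
      then show ?thesis
      proof cases
        case 1
        then show ?thesis using word[OF Cons.prems(2)] by (simp add: mult.assoc)
      next
        case 2
        have "b * f x = D x b + f x * ta x b" by (simp add: D_def)
        then have "b * (fw (x # v) * b0) = D x b * (fw v * b0) + f x * (ta x b * (fw v * b0))"
          by (simp add: mult.assoc[symmetric] distrib_right)
        then show ?thesis using Cons.IH[OF Cons.prems(1) VV.step[OF Cons.prems(2) 2(1)]] 2(2) by (simp add: \<Psi> \<Psi>f)
      qed
    qed (simp add: gens_out \<Psi>)
  qed
  have VR: "b \<in> RR" if "b \<in> VV" for b
  proof -
    have "\<Psi> (b * v) = 0" for v
      using normal_form[of v]
    proof (induction rule: cvec.span_induct_alt)
      case (step c x y)
      then show ?case using VVf that by (auto simp: distrib_left csc_mult_right \<Psi>)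
    qed (simp add: \<Psi>)
    then show ?thesis by (simp add: RR_def)
  qed
  have "\<exists>z. e None - z \<star> 1 \<in> RR"
  proof (rule right_ideal_generators)
    show "e (Some P) \<in> RR" "f (Some P) \<in> RR" for P by (simp_all add: RR_def \<Psi>e \<Psi>f)
    show "k (Some P) - 1 \<in> RR" "k' (Some P) - 1 \<in> RR" if "P \<in> Isig T" for P
      using that by (simp_all add: RR_def left_diff_distrib \<Psi> \<Psi>k)
    show "d < 0 \<Longrightarrow> u \<in> Vd d \<Longrightarrow> u \<in> RR" for d u by (rule neg)
    show "P \<in> Isig T \<Longrightarrow> \<sigma> (rep P) \<noteq> rep P \<Longrightarrow> hh (rep P) 1 \<in> RR" for P by (rule VR[OF VV.base])
  qed (simp_all add: RR_def distrib_right \<Psi> mult.assoc)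
  then obtain z where "e None - z \<star> 1 \<in> RR" by blast
  then have "\<Psi> ((e None - z \<star> 1) * 1) = 0" unfolding RR_def by blast
  then show False by (simp add: \<Psi> \<Psi>1)
qed

lemma kp_Uhat: "kp m \<in> Uhat"
proof -
  obtain n where n: "n None = 0" "kp m = kp n" using kp_normal by blast
  have "kp n \<in> Uhat"
  proof (rule kp_induct)
    fix x u assume x: "x \<in> Ihat T" "n x \<noteq> 0" and u: "u \<in> Uhat"
    then obtain P where P: "P \<in> Isig T" "x = Some P" using n(1) by (auto simp: Ihat_def)
    have "k x \<in> Uhat" "k' x \<in> Uhat" using Uhat_gens(3,4)[OF rep_in(2)[OF P(1)]] rep_in(3)[OF P(1)] P(2) by simp_all
    then show "k x * u \<in> Uhat" "k' x * u \<in> Uhat" using u by (simp_all add: Uhat_closed)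
  qed (rule Uhat_closed)
  then show ?thesis by (simp add: n(2))
qed

text \<open>By degree and weight, the element of \<open>VV\<close> found above is the affine e times
  a combination of torus monomials. Being an eigenvector of the twists, it involves a single torus
  monomial, which can be inverted in \<open>Uhat\<close>.\<close>

lemma e_None_Uhat: "e None \<in> Uhat"
proof -
  obtain b where b: "b \<in> VV" "b \<noteq> 0" "\<And>L. L \<in> Isig T \<Longrightarrow> k (Some L) * b = Q (Some L) None \<star> (b * k (Some L))"
    using VV_affine by blast
  have bB: "b \<in> Bs" "b \<in> Vd 1" "b \<in> Uhat" using VV_props[OF b(1)] by auto
  obtain v where v: "set v \<subseteq> Some ` Isig T" "\<And>L. L \<in> Isig T \<Longrightarrow> ta (Some L) b = inverse (Qw (Some L) v) \<star> b"
    using VV_props[OF b(1)] by blast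
  let ?m = "\<lambda>x. int (count_list v x)"
  have vI: "set v \<subseteq> Ihat T" using v(1) by (auto simp: Ihat_def)
  have "b \<in> cvec.span {ew w * kp m | w m. set w \<subseteq> Ihat T \<and> dgw w = 1 \<and> (\<forall>L\<in>Isig T. Qw (Some L) w = Q (Some L) None)}"
    by (rule Bs_weight[OF Bs_degree[OF bB(1,2)] b(3)])
  moreover have "{ew w * kp m | w m. set w \<subseteq> Ihat T \<and> dgw w = 1 \<and> (\<forall>L\<in>Isig T. Qw (Some L) w = Q (Some L) None)}
      \<subseteq> range (\<lambda>m. e None * kp m)"
  proof
    fix t assume "t \<in> {ew w * kp m | w m. set w \<subseteq> Ihat T \<and> dgw w = 1 \<and> (\<forall>L\<in>Isig T. Qw (Some L) w = Q (Some L) None)}"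
    then obtain w m where t: "t = ew w * kp m" "set w \<subseteq> Ihat T" "dgw w = 1" "\<forall>L\<in>Isig T. Qw (Some L) w = Q (Some L) None" by blast
    then have "w = [None]" using affine_word by blast
    then show "t \<in> range (\<lambda>m. e None * kp m)" using t(1) by simp
  qed
  ultimately have "b \<in> cvec.span (range (\<lambda>m. e None * kp m))" using cvec.span_mono by blast
  then have "b \<in> cvec.span ((\<lambda>m. e None * kp m) ` {m \<in> UNIV. \<forall>L\<in>Isig T. inverse (qch m (Some L)) = inverse (Qw (Some L) v)})"
  proof (rule eigenvectors_span_image[where A = "\<lambda>L. ta (Some L)", rotated 2])
    show "\<forall>L\<in>Isig T. ta (Some L) (e None * kp m) = inverse (qch m (Some L)) \<star> (e None * kp m)" for m
      using ta_word[of _ "[None]" m] by simp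
  qed (use v(2) in \<open>auto simp: clin_ta\<close>)
  moreover have "kp m = kp ?m" if "\<forall>L\<in>Isig T. inverse (qch m (Some L)) = inverse (Qw (Some L) v)" for m
  proof -
    have "kp (\<lambda>x. m x + - ?m x) = 1"
    proof (rule kp_trivial)
      fix L assume L: "L \<in> Isig T"
      have "qch m (Some L) = qch ?m (Some L)" using that L Qw_qch[OF vI, of "Some L"] by simp
      then show "qch (\<lambda>x. m x + - ?m x) (Some L) = 1" by (simp only: qch_add qch_uminus) simp
    qed
    then have "kp m * kp (\<lambda>x. - ?m x) * kp ?m = kp ?m" by (simp only: kp_add mult_1_left)
    then show ?thesis by (simp only: mult.assoc kp_uminus mult_1_right)
  qed
  ultimately have "b \<in> cvec.span {e None * kp ?m}"
    using cvec.span_mono[of _ "{e None * kp ?m}"] by (smt (verit) image_subset_iff mem_Collect_eq singletonI subsetD)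
  then obtain c where c: "b = c \<star> (e None * kp ?m)" by (auto simp: cvec.span_singleton)
  then have c0: "c \<noteq> 0" using b(2) by auto
  have "e None = inverse c \<star> (b * kp (\<lambda>x. - ?m x))"
    using c0 by (simp add: c csc_mult_left csc_csc csc_one mult.assoc kp_uminus)
  then show ?thesis using bB(3) by (simp add: Uhat_closed kp_Uhat)
qed

lemma k_Uhat: "x \<in> Ihat T \<Longrightarrow> k x \<in> Uhat" "x \<in> Ihat T \<Longrightarrow> k' x \<in> Uhat"
  by (simp_all only: k_eq_kp kp_Uhat)

lemma Bs_Uhat: "b \<in> Bs \<Longrightarrow> b \<in> Uhat"
proof (induction rule: Bs_induct)
  case (e x b)
  have "e (Some P) \<in> Uhat" if "P \<in> Isig T" for P
    using Uhat_gens(1)[OF rep_in(2)[OF that], of 0 Pos] by (simp add: e_xp that)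
  then have "e x \<in> Uhat" using e(2) e_None_Uhat by (auto simp: Ihat_def)
  then show ?case using e by (simp add: Uhat_closed)
qed (auto simp: Uhat_closed k_Uhat)

end

section \<open>Straightening\<close>

text \<open>Straightening depends only on the constant terms of the highest weight series and on a
  bound \<open>NN\<close> for their degrees.\<close>

locale uq_weight = uq_drinfeld T cl X H for T and cl :: "uq \<Rightarrow> 'u::calg" and X and H +
  fixes \<Gamma> :: "nat \<Rightarrow> nat \<Rightarrow> complex" and NN :: nat
  assumes \<Gamma>0: "i \<in> nd \<Longrightarrow> \<Gamma> i 0 = 1" and \<Gamma>N: "i \<in> nd \<Longrightarrow> NN < m \<Longrightarrow> \<Gamma> i m = 0"
begin

section \<open>The left ideal of the highest weight, and monomials in the \<open>x^-\<close> modulo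
  it\<close>

definition GJ :: "'u set" where
  "GJ = {xp Pos i (int r) | i r. i \<in> nd} \<union> {ph i r - \<Gamma> i r \<star> 1 | i r. i \<in> nd}"

definition J :: "'u set" where "J = cvec.span {u * g | u g. g \<in> GJ}"

lemma J_closed: "0 \<in> J" "a \<in> J \<Longrightarrow> b \<in> J \<Longrightarrow> a + b \<in> J" "a \<in> J \<Longrightarrow> z \<star> a \<in> J" "a \<in> J \<Longrightarrow> b \<in> J \<Longrightarrow> a - b \<in> J"
  "g \<in> GJ \<Longrightarrow> u * g \<in> J"
  unfolding J_def by (auto intro: cvec.span_zero cvec.span_add cvec.span_scale cvec.span_diff cvec.span_base)

lemma J_left: "a \<in> J \<Longrightarrow> u * a \<in> J"
  unfolding J_def
proof (erule span_image_clin)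
  show "clin (\<lambda>v. u * v)" by (rule clin_mult)
  fix t assume "t \<in> {u * g | u g. g \<in> GJ}"
  then obtain w g where "t = w * g" "g \<in> GJ" by blast
  then have "u * t = (u * w) * g" "g \<in> GJ" by (simp_all add: mult.assoc)
  then show "u * t \<in> cvec.span {u * g | u g. g \<in> GJ}" by (intro cvec.span_base) blast
qed

lemma J_gens: "i \<in> nd \<Longrightarrow> xp Pos i (int r) \<in> J" "i \<in> nd \<Longrightarrow> ph i r - \<Gamma> i r \<star> 1 \<in> J"
  "i \<in> nd \<Longrightarrow> kn' i - 1 \<in> J"
proof -
  have "g \<in> GJ \<Longrightarrow> g \<in> J" for g using J_closed(5)[of g 1] by simp
  then show "i \<in> nd \<Longrightarrow> xp Pos i (int r) \<in> J" and p: "i \<in> nd \<Longrightarrow> ph i r - \<Gamma> i r \<star> 1 \<in> J" for r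
    unfolding GJ_def by blast+
  assume i: "i \<in> nd"
  have "(- 1) \<star> (kn' i * (ph i 0 - \<Gamma> i 0 \<star> 1)) \<in> J" by (rule J_closed(3)[OF J_left[OF p[OF i]]])
  moreover have "(- 1) \<star> (kn' i * (ph i 0 - \<Gamma> i 0 \<star> 1)) = kn' i - 1"
    using i by (simp add: ph_0 \<Gamma>0 csc_one right_diff_distrib kk' csc_minus)
  ultimately show "kn' i - 1 \<in> J" by simp
qed

definition mn :: "(nat \<times> nat) list \<Rightarrow> 'u" where
  "mn l = prod_list (map (\<lambda>(i, r). xp Neg i (int r)) l)"

lemma mn_simps [simp]: "mn [] = 1" "mn ((i, r) # l) = xp Neg i (int r) * mn l"
  by (simp_all add: mn_def)

definition JS :: "(nat \<times> nat) list set \<Rightarrow> 'u set" where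
  "JS A = cvec.span (J \<union> mn ` A)"

lemma JS_closed: "0 \<in> JS A" "a \<in> JS A \<Longrightarrow> b \<in> JS A \<Longrightarrow> a + b \<in> JS A" "a \<in> JS A \<Longrightarrow> z \<star> a \<in> JS A"
  "a \<in> JS A \<Longrightarrow> b \<in> JS A \<Longrightarrow> a - b \<in> JS A" "a \<in> J \<Longrightarrow> a \<in> JS A" "l \<in> A \<Longrightarrow> mn l \<in> JS A"
  "(\<And>i. i \<in> I \<Longrightarrow> g i \<in> JS A) \<Longrightarrow> sum g I \<in> JS A"
  unfolding JS_def by (auto intro: cvec.span_zero cvec.span_add cvec.span_scale cvec.span_diff cvec.span_base cvec.span_sum)

lemma JS_mono: "A \<subseteq> B \<Longrightarrow> a \<in> JS A \<Longrightarrow> a \<in> JS B"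
  unfolding JS_def by (rule subsetD[OF cvec.span_mono]) auto

lemma JS_left:
  assumes "a \<in> JS A" "\<And>l. l \<in> A \<Longrightarrow> u * mn l \<in> JS B"
  shows "u * a \<in> JS B"
  using assms(1) unfolding JS_def
proof (rule span_image_clin)
  show "clin (\<lambda>v. u * v)" by (rule clin_mult)
  fix t assume "t \<in> J \<union> mn ` A"
  then show "u * t \<in> cvec.span (J \<union> mn ` B)"
    using J_left[of t u] assms(2) by (auto simp: JS_def intro: cvec.span_base)
qed

text \<open>Models the effect of a coefficient of phi on a monomial: the nodes are kept and the
  modes can only rise.\<close>

definition shift :: "(nat \<times> nat) list \<Rightarrow> (nat \<times> nat) list \<Rightarrow> bool" where
  "shift l l' \<longleftrightarrow> list_all2 (\<lambda>p p'. fst p' = fst p \<and> snd p \<le> snd p') l l'"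

definition sm :: "(nat \<times> nat) list \<Rightarrow> nat" where "sm l = sum_list (map snd l)"

definition nl :: "(nat \<times> nat) list set" where "nl = {l. \<forall>p\<in>set l. fst p \<in> nd}"

lemma sm_simps [simp]: "sm [] = 0" "sm (p # l) = snd p + sm l" "sm (l @ l') = sm l + sm l'"
  by (simp_all add: sm_def)

lemma nl_simps [simp]: "[] \<in> nl" "p # l \<in> nl \<longleftrightarrow> fst p \<in> nd \<and> l \<in> nl" "l @ l' \<in> nl \<longleftrightarrow> l \<in> nl \<and> l' \<in> nl"
  by (auto simp: nl_def)

lemma shift_simps: "shift [] l' \<longleftrightarrow> l' = []" "shift l l' \<Longrightarrow> shift ((i, r) # l) ((i, r + t) # l')" "shift l l"
  by (auto simp: shift_def list_all2_refl)

lemma shift_sm: "shift l l' \<Longrightarrow> sm l \<le> sm l' \<and> length l' = length l"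
  unfolding shift_def by (induction rule: list_all2_induct) auto

lemma shift_nl: "shift l l' \<Longrightarrow> l \<in> nl \<Longrightarrow> l' \<in> nl"
  unfolding shift_def by (induction rule: list_all2_induct) auto

lemma hq_xm:
  assumes "i \<in> nd" "j \<in> nd"
  shows "hq i t * xp Neg j l = xp Neg j l * hq i t +
    (if t = 0 then 0 else - ((qn T i - inverse (qn T i)) * h_coeff T i j (int t))) \<star> xp Neg j (int t + l)"
  using hh_xp[OF assms, of "int t" Neg l]
  by (simp add: hq_def csc_mult_left csc_mult_right csc_add_right csc_csc csc_minus csc_diff(1))

text \<open>The factors \<open>a\<close> are the coefficients of a power of q times the exponential
  of a scalar series; they do not depend on m or r. Both sides satisfy the recursion of the
  logarithmic derivative, which determines them.\<close>

lemma ph_xm: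
  assumes i: "i \<in> nd" and j: "j \<in> nd"
  shows "\<exists>a. \<forall>m r. ph i m * xp Neg j r = (\<Sum>t\<le>m. a t \<star> (xp Neg j (int t + r) * ph i (m - t)))"
proof -
  define c where "c t = (if t = 0 then 0 else - ((qn T i - inverse (qn T i)) * h_coeff T i j (int t)))" for t
  define c0 where "c0 = qpar T powi (- csum T i j)"
  define a where "a t = c0 * sexp c t" for t
  have arec: "of_nat t * a t = (\<Sum>s\<in>{1..t}. of_nat s * (c s * a (t - s)))" for t
    using arg_cong[OF sexp_log_derivative[of c t], of "\<lambda>z. c0 * z"]
    by (simp add: c_def csc_complex_def a_def sum_distrib_left mult.left_commute)
  have hx: "hq i t * xp Neg j l = xp Neg j l * hq i t + c t \<star> xp Neg j (int t + l)" for t l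
    unfolding c_def by (rule hq_xm[OF i j])
  have main: "ph i m * xp Neg j r = (\<Sum>t\<le>m. a t \<star> (xp Neg j (int t + r) * ph i (m - t)))" for m r
  proof (induction m rule: less_induct)
    case (less m)
    show ?case
    proof (cases "m = 0")
      case True
      have "sexp c 0 = 1" by (rule sexp_0) (simp add: c_def)
      then show ?thesis using kn_xp[OF i j, of Neg r] True by (simp add: ph_0[OF i] a_def c0_def)
    next
      case False
      let ?x = "\<lambda>t. xp Neg j (int t + r)"
      \<comment> \<open>The double sum is reorganized twice: this form collects the recursion for
        phi, the next one, \<open>resum\<close>, the recursion for the factors
        \<open>a\<close>.\<close>
      have swap: "(\<Sum>s\<in>{1..m}. \<Sum>t\<le>m - s. g s t) = (\<Sum>t\<le>m. \<Sum>s\<in>{1..m - t}. g s t)" for g :: "nat \<Rightarrow> nat \<Rightarrow> 'u"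
      proof -
        have 1: "(\<Sum>s\<in>{1..m}. \<Sum>t\<le>m - s. g s t) = (\<Sum>s\<in>{1..m}. \<Sum>t | t \<in> {..m} \<and> s + t \<le> m. g s t)"
          by (rule sum.cong[OF refl], rule sum.cong) auto
        have 2: "(\<Sum>t\<le>m. \<Sum>s | s \<in> {1..m} \<and> s + t \<le> m. g s t) = (\<Sum>t\<le>m. \<Sum>s\<in>{1..m - t}. g s t)"
          by (rule sum.cong[OF refl], rule sum.cong) auto
        show ?thesis unfolding 1 2[symmetric] by (rule sum.swap_restrict) simp_all
      qed
      have resum: "(\<Sum>s\<in>{1..m}. \<Sum>t\<le>m - s. g s (s + t)) = (\<Sum>t\<le>m. \<Sum>s\<in>{1..t}. g s t)" for g :: "nat \<Rightarrow> nat \<Rightarrow> 'u"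
      proof -
        have "(\<Sum>t\<le>m - s. g s (s + t)) = (\<Sum>t | t \<in> {..m} \<and> s \<le> t. g s t)" if "s \<in> {1..m}" for s
          by (rule sum.reindex_bij_witness[of _ "\<lambda>t. t - s" "\<lambda>t. s + t"]) (use that in auto)
        then have "(\<Sum>s\<in>{1..m}. \<Sum>t\<le>m - s. g s (s + t)) = (\<Sum>s\<in>{1..m}. \<Sum>t | t \<in> {..m} \<and> s \<le> t. g s t)"
          by (rule sum.cong[OF refl])
        also have "\<dots> = (\<Sum>t\<le>m. \<Sum>s | s \<in> {1..m} \<and> s \<le> t. g s t)" by (rule sum.swap_restrict) simp_all
        also have "\<dots> = (\<Sum>t\<le>m. \<Sum>s\<in>{1..t}. g s t)"
          by (rule sum.cong[OF refl], rule sum.cong) auto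
        finally show ?thesis .
      qed
      have "of_nat m \<star> (ph i m * xp Neg j r) = (of_nat m \<star> ph i m) * xp Neg j r" by (simp add: csc_mult_left)
      also have "\<dots> = (\<Sum>s\<in>{1..m}. of_nat s \<star> (hq i s * (ph i (m - s) * xp Neg j r)))"
        unfolding ph_rec[OF i] by (simp add: sum_distrib_right csc_mult_left mult.assoc)
      also have "\<dots> = (\<Sum>s\<in>{1..m}. of_nat s \<star> (hq i s * (\<Sum>t\<le>m - s. a t \<star> (?x t * ph i (m - s - t)))))"
        by (rule sum.cong[OF refl]) (use less in auto)
      also have "\<dots> = (\<Sum>s\<in>{1..m}. \<Sum>t\<le>m - s. (of_nat s * a t) \<star> (hq i s * ?x t * ph i (m - s - t)))"
        by (simp add: sum_distrib_left csc_sum csc_mult_right csc_csc mult.assoc)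
      also have "\<dots> = (\<Sum>s\<in>{1..m}. \<Sum>t\<le>m - s. (of_nat s * a t) \<star> (?x t * (hq i s * ph i (m - t - s)))
          + (of_nat s * (c s * a (s + t - s))) \<star> (?x (s + t) * ph i (m - (s + t))))"
      proof (intro sum.cong refl)
        fix s t
        have "int s + (int t + r) = int (s + t) + r" by simp
        then have "hq i s * ?x t = ?x t * hq i s + c s \<star> ?x (s + t)" using hx[of s "int t + r"] by (simp only:)
        moreover have "m - s - t = m - t - s" "m - s - t = m - (s + t)" by simp_all
        ultimately show "(of_nat s * a t) \<star> (hq i s * ?x t * ph i (m - s - t)) =
            (of_nat s * a t) \<star> (?x t * (hq i s * ph i (m - t - s))) + (of_nat s * (c s * a (s + t - s))) \<star> (?x (s + t) * ph i (m - (s + t)))"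
          by (simp add: distrib_right csc_add_right csc_mult_left csc_csc mult.assoc mult.commute mult.left_commute)
      qed
      also have "\<dots> = (\<Sum>s\<in>{1..m}. \<Sum>t\<le>m - s. (of_nat s * a t) \<star> (?x t * (hq i s * ph i (m - t - s))))
          + (\<Sum>s\<in>{1..m}. \<Sum>t\<le>m - s. (of_nat s * (c s * a (s + t - s))) \<star> (?x (s + t) * ph i (m - (s + t))))"
        by (simp only: sum.distrib)
      also have "(\<Sum>s\<in>{1..m}. \<Sum>t\<le>m - s. (of_nat s * a t) \<star> (?x t * (hq i s * ph i (m - t - s)))) =
          (\<Sum>t\<le>m. (a t * of_nat (m - t)) \<star> (?x t * ph i (m - t)))"
      proof -
        have "(\<Sum>s\<in>{1..m - t}. (of_nat s * a t) \<star> (?x t * (hq i s * ph i (m - t - s)))) =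
            a t \<star> (?x t * (\<Sum>s\<in>{1..m - t}. of_nat s \<star> (hq i s * ph i (m - t - s))))" for t
          by (simp add: sum_distrib_left csc_sum csc_mult_right csc_csc mult.commute)
        then show ?thesis unfolding swap ph_rec[OF i, symmetric] by (simp add: csc_mult_right csc_csc)
      qed
      also have "(\<Sum>s\<in>{1..m}. \<Sum>t\<le>m - s. (of_nat s * (c s * a (s + t - s))) \<star> (?x (s + t) * ph i (m - (s + t)))) =
          (\<Sum>t\<le>m. (of_nat t * a t) \<star> (?x t * ph i (m - t)))"
        unfolding resum[of "\<lambda>s t. (of_nat s * (c s * a (t - s))) \<star> (?x t * ph i (m - t))"] arec
        by (simp add: cvec.scale_sum_left)
      also have "(\<Sum>t\<le>m. (a t * of_nat (m - t)) \<star> (?x t * ph i (m - t))) + (\<Sum>t\<le>m. (of_nat t * a t) \<star> (?x t * ph i (m - t)))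
          = (\<Sum>t\<le>m. of_nat m \<star> a t \<star> (?x t * ph i (m - t)))"
        unfolding sum.distrib[symmetric]
      proof (rule sum.cong[OF refl])
        fix t assume "t \<in> {..m}"
        then have "of_nat (m - t) + of_nat t = (of_nat m :: complex)" by (simp add: of_nat_add[symmetric] del: of_nat_add)
        then have "a t * of_nat (m - t) + of_nat t * a t = of_nat m * a t"
          by (metis distrib_left mult.commute)
        then show "(a t * of_nat (m - t)) \<star> (?x t * ph i (m - t)) + (of_nat t * a t) \<star> (?x t * ph i (m - t)) =
            of_nat m \<star> a t \<star> (?x t * ph i (m - t))"
          by (simp only: csc_csc csc_add_left[symmetric])
      qed
      also have "\<dots> = of_nat m \<star> (\<Sum>t\<le>m. a t \<star> (?x t * ph i (m - t)))" by (simp add: csc_sum)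
      finally show ?thesis using csc_cancel[of "of_nat m"] False by simp
    qed
  qed
  then show ?thesis by blast
qed

text \<open>Whatever part of m is not spent on raising modes reaches 1, where phi acts as a value of
  \<open>\<Gamma>\<close>; this vanishes beyond \<open>NN\<close>. Hence the sum of modes rises by
  at least \<open>m - NN\<close>.\<close>

lemma ph_mn:
  assumes "i \<in> nd" "l \<in> nl"
  shows "ph i m * mn l \<in> JS {l'. shift l l' \<and> sm l' \<le> sm l + m \<and> m \<le> NN + (sm l' - sm l)}"
  using assms(2)
proof (induction l arbitrary: m)
  case Nil
  have eq: "ph i m * mn [] = (ph i m - \<Gamma> i m \<star> 1) + \<Gamma> i m \<star> mn []" by simp
  have "\<Gamma> i m \<star> mn [] \<in> JS {l'. shift [] l' \<and> sm l' \<le> sm [] + m \<and> m \<le> NN + (sm l' - sm [])}"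
  proof (cases "m \<le> NN")
    case True
    then show ?thesis by (intro JS_closed) (auto simp: shift_simps)
  next
    case False
    then show ?thesis using \<Gamma>N[OF assms(1), of m] by (simp add: JS_closed)
  qed
  then show ?case unfolding eq by (rule JS_closed(2)[OF JS_closed(5)[OF J_gens(2)[OF assms(1)]]])
next
  case (Cons p l)
  obtain j r where p: "p = (j, r)" by (cases p)
  have j: "j \<in> nd" "l \<in> nl" using Cons.prems p by auto
  obtain a where a: "ph i m * xp Neg j (int r) = (\<Sum>t\<le>m. a t \<star> (xp Neg j (int t + int r) * ph i (m - t)))"
    using ph_xm[OF assms(1) j(1)] by blast
  let ?A = "{l'. shift (p # l) l' \<and> sm l' \<le> sm (p # l) + m \<and> m \<le> NN + (sm l' - sm (p # l))}"
  have "xp Neg j (int t + int r) * (ph i (m - t) * mn l) \<in> JS ?A" if t: "t \<le> m" for t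
  proof (rule JS_left[OF Cons.IH[OF j(2)]])
    fix l' assume l': "l' \<in> {l'. shift l l' \<and> sm l' \<le> sm l + (m - t) \<and> m - t \<le> NN + (sm l' - sm l)}"
    then have "(j, r + t) # l' \<in> ?A" using t shift_sm[of l l'] by (auto simp: p shift_simps)
    then have "mn ((j, r + t) # l') \<in> JS ?A" by (rule JS_closed(6))
    then show "xp Neg j (int t + int r) * mn l' \<in> JS ?A" by (simp add: add.commute)
  qed
  then have "(\<Sum>t\<le>m. a t \<star> (xp Neg j (int t + int r) * (ph i (m - t) * mn l))) \<in> JS ?A"
    by (intro JS_closed(7) JS_closed(3)) auto
  moreover have "ph i m * mn (p # l) = (\<Sum>t\<le>m. a t \<star> (xp Neg j (int t + int r) * (ph i (m - t) * mn l)))"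
    by (simp add: p mult.assoc[symmetric] a sum_distrib_right csc_mult_left)
  ultimately show ?case by simp
qed

lemma kn'_mn: "i \<in> nd \<Longrightarrow> l \<in> nl \<Longrightarrow> kn' i * mn l \<in> JS {l}"
proof -
  assume i: "i \<in> nd" and l: "l \<in> nl"
  have "\<exists>z. kn' i * mn l = z \<star> (mn l * kn' i)"
    using l
  proof (induction l)
    case Nil
    then show ?case by (intro exI[of _ 1]) (simp add: csc_one)
  next
    case (Cons p l)
    obtain j r where p: "p = (j, r)" by (cases p)
    have j: "j \<in> nd" "l \<in> nl" using Cons.prems p by auto
    obtain z where z: "kn' i * mn l = z \<star> (mn l * kn' i)" using Cons.IH[OF j(2)] by blast
    have "qpar T \<noteq> 0" by (simp add: qpar_def)
    then obtain y where "kn' i * xp Neg j (int r) = y \<star> (xp Neg j (int r) * kn' i)"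
      using inv_weight[OF kk' kn_xp[OF i j(1), of Neg "int r"]] by auto
    then have "kn' i * mn (p # l) = (y * z) \<star> (mn (p # l) * kn' i)"
      by (simp add: p mult.assoc[symmetric] csc_mult_left) (simp add: mult.assoc z csc_mult_right csc_csc)
    then show ?case by blast
  qed
  then obtain z where z: "kn' i * mn l = z \<star> (mn l * kn' i)" by blast
  also have "\<dots> = z \<star> (mn l * (kn' i - 1) + mn l)" by (simp add: right_diff_distrib)
  also have "\<dots> \<in> JS {l}" using J_left[OF J_gens(3)[OF i]] by (intro JS_closed) auto
  finally show ?thesis .
qed

text \<open>Meeting a factor of mode r, \<open>x^+_m\<close> replaces it by
  \<open>phi_{m+r}\<close>, which then acts on the factors to the right; the condition is the lower
  bound of \<open>ph_mn\<close> with \<open>m + r\<close> for m.\<close>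

lemma xp_mn:
  assumes "i \<in> nd" "l \<in> nl"
  shows "xp Pos i (int m) * mn l \<in> JS {l1 @ l2' | l1 j r l2 l2'. l = l1 @ (j, r) # l2 \<and> shift l2 l2' \<and> m + r + sm l2 \<le> NN + sm l2'}"
  using assms(2)
proof (induction l)
  case Nil
  show ?case using J_gens(1)[OF assms(1), of m] by (simp add: JS_closed)
next
  case (Cons p l)
  obtain j r where p: "p = (j, r)" by (cases p)
  have j: "j \<in> nd" "l \<in> nl" using Cons.prems p by auto
  let ?B = "\<lambda>l. {l1 @ l2' | l1 j r l2 l2'. l = l1 @ (j, r) # l2 \<and> shift l2 l2' \<and> m + r + sm l2 \<le> NN + sm l2'}"
  have "xp Pos i (int m) * mn (p # l) = xp Neg j (int r) * (xp Pos i (int m) * mn l) +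
      x_coeff T i j (int r) \<star> (ph i (m + r) * mn l - (if m + r = 0 then kn' i * mn l else 0))"
    using xp_xp[OF assms(1) j(1), of "int m" "int r"]
    by (simp add: p mult.assoc[symmetric] nat_add_distrib) (simp add: distrib_right left_diff_distrib csc_mult_left mult.assoc)
  moreover have "xp Neg j (int r) * (xp Pos i (int m) * mn l) \<in> JS (?B (p # l))"
  proof (rule JS_left[OF Cons.IH[OF j(2)]])
    fix l' assume "l' \<in> ?B l"
    then obtain l1 j' r' l2 l2' where l': "l' = l1 @ l2'" "l = l1 @ (j', r') # l2" "shift l2 l2'" "m + r' + sm l2 \<le> NN + sm l2'" by blast
    then have "p # l' = (p # l1) @ l2'" "p # l = (p # l1) @ (j', r') # l2" by simp_all
    then have "p # l' \<in> ?B (p # l)" using l'(3,4) by blast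
    then have "mn (p # l') \<in> JS (?B (p # l))" by (rule JS_closed(6))
    then show "xp Neg j (int r) * mn l' \<in> JS (?B (p # l))" unfolding p by (simp only: mn_simps)
  qed
  moreover have "ph i (m + r) * mn l \<in> JS (?B (p # l))"
  proof (rule JS_mono[OF _ ph_mn[OF assms(1) j(2)]], rule subsetI)
    fix l' assume "l' \<in> {l'. shift l l' \<and> sm l' \<le> sm l + (m + r) \<and> m + r \<le> NN + (sm l' - sm l)}"
    then have "shift l l'" "m + r + sm l \<le> NN + sm l'" using shift_sm[of l l'] by auto
    moreover have "l' = [] @ l'" "p # l = [] @ (j, r) # l" by (simp_all add: p)
    ultimately show "l' \<in> ?B (p # l)" by blast
  qed
  moreover have "(if m + r = 0 then kn' i * mn l else 0) \<in> JS (?B (p # l))"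
  proof (cases "m + r = 0")
    case True
    have "l = [] @ l" "p # l = [] @ (j, r) # l" "shift l l" "m + r + sm l \<le> NN + sm l" using True by (simp_all add: p shift_simps)
    then have "{l} \<subseteq> ?B (p # l)" by blast
    then have "kn' i * mn l \<in> JS (?B (p # l))" using kn'_mn[OF assms(1) j(2)] by (rule JS_mono)
    then show ?thesis by (simp only: True if_True simp_thms)
  next
    case False
    then show ?thesis by (simp only: if_False JS_closed)
  qed
  ultimately show ?case by (simp only: JS_closed)
qed

text \<open>Moving \<open>x\<^sup>+\<close> through a monomial removes one factor, and the modes of the factors to its right grow
  by at least the removed mode minus \<open>NN\<close>, because \<open>\<phi>\<^sub>m\<close> acts as \<open>\<Gamma> i m = 0\<close> on \<open>1\<close> for \<open>m > NN\<close>.\<close>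

definition bad :: "(nat \<times> nat) list \<Rightarrow> bool" where
  "bad l \<longleftrightarrow> (\<exists>l1 l2. l = l1 @ l2 \<and> NN * length l2 < sm l2)"

lemma bad_shift: "shift l l' \<Longrightarrow> bad l \<Longrightarrow> bad l'"
proof -
  assume s: "shift l l'" and "bad l"
  then obtain l1 l2 where l: "l = l1 @ l2" "NN * length l2 < sm l2" by (auto simp: bad_def)
  from s obtain m1 m2 where m: "l' = m1 @ m2" "shift l2 m2" unfolding shift_def l(1) by (auto simp: list_all2_append1)
  then show ?thesis using l(2) shift_sm[OF m(2)] unfolding bad_def by (metis le_trans less_le_trans)
qed

text \<open>If the witnessing suffix contains the removed factor, its threshold drops by
  \<open>NN\<close> and its sum by at most \<open>NN\<close>. If it starts later, it is only
  shifted.\<close>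

lemma bad_remove:
  assumes "bad (l1 @ (j, r) # l2)" "shift l2 l2'" "r + sm l2 \<le> NN + sm l2'"
  shows "bad (l1 @ l2')"
proof -
  obtain m1 m2 where m: "l1 @ (j, r) # l2 = m1 @ m2" "NN * length m2 < sm m2" using assms(1) by (auto simp: bad_def)
  note s = shift_sm[OF assms(2)]
  from m(1) consider us where "l1 = m1 @ us" "us @ (j, r) # l2 = m2"
    | us where "l1 @ us = m1" "(j, r) # l2 = us @ m2" by (auto simp: append_eq_append_conv2)
  then show ?thesis
  proof cases
    case 1
    then have "NN * length (us @ l2') < sm (us @ l2')" using m(2) s assms(3) by auto
    then show ?thesis unfolding bad_def 1(1) by (metis append.assoc)
  next
    case 2
    show ?thesis
    proof (cases us)
      case Nil
      then have "NN * length l2' < sm l2'" using 2(2) m(2) s assms(3) by auto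
      then show ?thesis unfolding bad_def by blast
    next
      case (Cons u us')
      then have "bad l2" using 2(2) m(2) by (auto simp: bad_def)
      then have "bad l2'" by (rule bad_shift[OF assms(2)])
      then show ?thesis unfolding bad_def by (metis append.assoc)
    qed
  qed
qed

text \<open>The closure conditions on \<open>A\<close> mirror the generators: a new factor from
  \<open>x^-\<close>, raised modes from phi, a removed factor from \<open>x^+\<close>. It is used
  for all monomials and for the bad ones.\<close>

lemma Uhat_JS:
  assumes A: "A \<subseteq> nl" "\<And>i r l. i \<in> nd \<Longrightarrow> l \<in> A \<Longrightarrow> (i, r) # l \<in> A" "\<And>l l'. l \<in> A \<Longrightarrow> shift l l' \<Longrightarrow> l' \<in> A"
    "\<And>l1 j r l2 l2'. l1 @ (j, r) # l2 \<in> A \<Longrightarrow> shift l2 l2' \<Longrightarrow> r + sm l2 \<le> NN + sm l2' \<Longrightarrow> l1 @ l2' \<in> A"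
  shows "u \<in> Uhat \<Longrightarrow> a \<in> JS A \<Longrightarrow> u * a \<in> JS A"
  unfolding Uhat_def
proof (induction arbitrary: a rule: alg.induct)
  case (base u)
  show ?case
  proof (rule JS_left[OF base(2)])
    fix l assume l: "l \<in> A"
    have ln: "l \<in> nl" using l A(1) by blast
    from base(1) consider b i r where "i \<in> nd" "u = xp b i (int r)" | i r where "i \<in> nd" "u = ph i r"
      | i where "i \<in> nd" "u = kn' i" by blast
    then show "u * mn l \<in> JS A"
    proof cases
      case 1
      show ?thesis
      proof (cases b)
        case Neg
        then show ?thesis using JS_closed(6)[OF A(2)[OF 1(1) l, of r]] 1(2) by simp
      next
        case Pos
        show ?thesis unfolding 1(2) Pos
          by (rule JS_mono[OF _ xp_mn[OF 1(1) ln, of r]]) (use A(4) l in fastforce)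
      qed
    next
      case 2
      show ?thesis unfolding 2(2)
        by (rule JS_mono[OF _ ph_mn[OF 2(1) ln, of r]]) (use A(3) l in blast)
    next
      case 3
      show ?thesis unfolding 3(2)
        by (rule JS_mono[OF _ kn'_mn[OF 3(1) ln]]) (use l in blast)
    qed
  qed
next
  case (mult u v)
  then show ?case by (simp add: mult.assoc)
qed (auto simp: distrib_right csc_mult_left JS_closed)

lemma Uhat_JS_all: "u \<in> Uhat \<Longrightarrow> u \<in> JS nl"
  using Uhat_JS[of nl u "mn []"] JS_closed(6)[of "[]" nl] shift_nl by force

lemma Uhat_JS_bad: "u \<in> Uhat \<Longrightarrow> a \<in> JS {l \<in> nl. bad l} \<Longrightarrow> u * a \<in> JS {l \<in> nl. bad l}"
proof (rule Uhat_JS)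
  fix i r l assume "i \<in> nd" "l \<in> {l \<in> nl. bad l}"
  then show "(i, r) # l \<in> {l \<in> nl. bad l}" by (auto simp: bad_def) (metis append_Cons)
next
  fix l1 j r l2 l2' assume a: "l1 @ (j, r) # l2 \<in> {l \<in> nl. bad l}" "shift l2 l2'" "r + sm l2 \<le> NN + sm l2'"
  then show "l1 @ l2' \<in> {l \<in> nl. bad l}" using bad_remove[OF _ a(2,3)] shift_nl[OF a(2)] by auto
qed (auto intro: bad_shift shift_nl)

end

section \<open>The highest weight module\<close>

context uq_drinfeld
begin

section \<open>Weight vectors of U and its decomposition modulo the f's\<close>

definition weightvec :: "'u set" where
  "weightvec = {u. \<exists>\<psi>. \<forall>L\<in>Isig T. Ad (Some L) u = \<psi> L \<star> u}"

lemma Ad_mult: "Ad x (u * u') = Ad x u * Ad x u'"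
proof -
  have "Ad x u * Ad x u' = k x * u * (k' x * k x) * u' * k' x" by (simp only: Ad_def mult.assoc)
  then show ?thesis by (simp add: kk' Ad_def mult.assoc)
qed

lemma weightvecI: "(\<And>L. L \<in> Isig T \<Longrightarrow> k (Some L) * u = \<psi> L \<star> (u * k (Some L))) \<Longrightarrow> u \<in> weightvec"
  unfolding weightvec_def using Ad_iff by blast

lemma weightvec_mult: "u \<in> weightvec \<Longrightarrow> u' \<in> weightvec \<Longrightarrow> u * u' \<in> weightvec"
proof -
  assume "u \<in> weightvec" "u' \<in> weightvec"
  then obtain \<psi> \<psi>' where "\<forall>L\<in>Isig T. Ad (Some L) u = \<psi> L \<star> u" "\<forall>L\<in>Isig T. Ad (Some L) u' = \<psi>' L \<star> u'"
    by (auto simp: weightvec_def)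
  then have "\<forall>L\<in>Isig T. Ad (Some L) (u * u') = (\<psi> L * \<psi>' L) \<star> (u * u')"
    by (simp add: Ad_mult csc_mult_left csc_mult_right csc_csc)
  then show ?thesis unfolding weightvec_def by (intro CollectI exI[of _ "\<lambda>L. \<psi> L * \<psi>' L"])
qed

lemma Q_qpar: "L \<in> Isig T \<Longrightarrow> j \<in> nd \<Longrightarrow> Q (Some L) (Some (orb T j)) = qpar T powi csum T (rep L) j"
proof -
  assume L: "L \<in> Isig T" and j: "j \<in> nd"
  have "csum T (rep L) (rep (orb T j)) = csum T (rep L) j"
    using csum_rep[of "rep L" j] csum_rep1[of "rep L" j] rep_in[OF L] j by simp
  then show ?thesis using L j by (simp add: Q_def BB_Some qpar_powi)
qed

lemma k_xp: "L \<in> Isig T \<Longrightarrow> j \<in> nd \<Longrightarrow> k (Some L) * xp Pos j m = Q (Some L) (Some (orb T j)) \<star> (xp Pos j m * k (Some L))"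
  "L \<in> Isig T \<Longrightarrow> j \<in> nd \<Longrightarrow> k (Some L) * xp Neg j m = inverse (Q (Some L) (Some (orb T j))) \<star> (xp Neg j m * k (Some L))"
  using kn_xp[of "rep L" j Pos m] kn_xp[of "rep L" j Neg m] rep_in[of L] by (simp_all add: Q_qpar power_int_minus)

text \<open>For \<open>m > 0\<close>, phi is a nonzero multiple of a commutator of
  \<open>x^+_m\<close> and \<open>x^-_0\<close>, whose weights cancel.\<close>

lemma k_ph: "L \<in> Isig T \<Longrightarrow> i \<in> nd \<Longrightarrow> k (Some L) * ph i m = ph i m * k (Some L)"
proof (cases "m = 0")
  case False
  assume L: "L \<in> Isig T" and i: "i \<in> nd"
  let ?k = "k (Some L)" and ?x = "xp Pos i (int m)" and ?y = "xp Neg i 0" and ?q = "Q (Some L) (Some (orb T i))"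
  have c: "x_coeff T i i 0 \<star> ph i m = ?x * ?y - ?y * ?x"
    using xp_xp[OF i i, of "int m" 0] False by simp
  have "?k * (?x * ?y) = ?x * ?y * ?k"
    using k_xp[OF L i, of "int m"] k_xp[OF L i, of 0]
    by (simp add: mult.assoc[symmetric] csc_mult_left) (simp add: mult.assoc csc_mult_right csc_csc csc_one)
  moreover have "?k * (?y * ?x) = ?y * ?x * ?k"
    using k_xp[OF L i, of "int m"] k_xp[OF L i, of 0]
    by (simp add: mult.assoc[symmetric] csc_mult_left) (simp add: mult.assoc csc_mult_right csc_csc csc_one)
  moreover have "x_coeff T i i 0 \<star> (?k * ph i m) = ?k * (?x * ?y - ?y * ?x)"
    "x_coeff T i i 0 \<star> (ph i m * ?k) = (?x * ?y - ?y * ?x) * ?k"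
    by (simp_all only: c[symmetric] csc_mult_left csc_mult_right)
  ultimately have "x_coeff T i i 0 \<star> (?k * ph i m) = x_coeff T i i 0 \<star> (ph i m * ?k)"
    by (simp add: right_diff_distrib left_diff_distrib)
  then show ?thesis using csc_cancel[OF x_coeff_diag[OF i]] by blast
qed (simp add: ph_0 kk_comm)

lemma weightvec_word: "fw v * (ew w * kp m) \<in> weightvec"
proof (rule weightvec_mult)
  show "fw v \<in> weightvec" by (rule weightvecI) (rule k_fw)
  show "ew w * kp m \<in> weightvec" by (rule weightvecI[of _ "\<lambda>L. Qw (Some L) w"]) (simp add: k_word)
qed

lemma f_span_sum: "u \<in> cvec.span {f x * y | x y. True} \<Longrightarrow> \<exists>g. u = (\<Sum>x\<in>Ihat T. f x * g x)"
proof (induction rule: cvec.span_induct_alt)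
  case base
  show ?case by (rule exI[of _ "\<lambda>x. 0"]) simp
next
  case (step c t u)
  then obtain g x y where u: "u = (\<Sum>x\<in>Ihat T. f x * g x)" and t: "t = f x * y" by blast
  have 1: "c \<star> t = (\<Sum>z\<in>Ihat T. if z = x then f z * (c \<star> y) else 0)"
    by (cases "x \<in> Ihat T") (simp_all add: t csc_mult_right gens_out)
  have "c \<star> t + u = (\<Sum>z\<in>Ihat T. (if z = x then f z * (c \<star> y) else 0) + f z * g z)"
    by (simp only: 1 u sum.distrib)
  also have "\<dots> = (\<Sum>z\<in>Ihat T. f z * (g z + (if z = x then c \<star> y else 0)))"
    by (rule sum.cong) (auto simp: distrib_left)
  finally show ?case by (rule exI[of _ "\<lambda>z. g z + (if z = x then c \<star> y else 0)"])
qed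

lemma Bs_plus_f: "\<exists>b\<in>Bs. u - b \<in> cvec.span {f x * y | x y. True}"
  using normal_form[of u]
proof (induction rule: cvec.span_induct_alt)
  case base
  show ?case by (rule bexI[of _ 0]) (simp_all add: Bs_closed cvec.span_zero)
next
  case (step c t u)
  then obtain b v b' where b: "b \<in> Bs" "u - b \<in> cvec.span {f x * y | x y. True}" and t: "t = fw v * b'" "b' \<in> Bs" by blast
  show ?case
  proof (cases v)
    case Nil
    then have "c \<star> t + u - (c \<star> b' + b) = u - b" "c \<star> b' + b \<in> Bs" using b t by (simp_all add: Bs_closed)
    then show ?thesis using b(2) by metis
  next
    case (Cons x v')
    have "f x * (fw v' * b') \<in> {f x * y | x y. True}" by blast
    then have "c \<star> t \<in> cvec.span {f x * y | x y. True}"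
      unfolding t Cons fw_simps mult.assoc by (intro cvec.span_scale cvec.span_base)
    then have "c \<star> t + (u - b) \<in> cvec.span {f x * y | x y. True}" using b(2) by (rule cvec.span_add)
    moreover have "c \<star> t + (u - b) = c \<star> t + u - b" by simp
    ultimately show ?thesis using b(1) by (intro bexI[of _ b]) (simp_all only:)
  qed
qed

end

context uq_weight
begin

definition lw :: "(nat \<times> nat) list \<Rightarrow> anode list" where
  "lw l = map (\<lambda>p. Some (orb T (fst p))) l"

lemma k_mn: "L \<in> Isig T \<Longrightarrow> l \<in> nl \<Longrightarrow> k (Some L) * mn l = inverse (Qw (Some L) (lw l)) \<star> (mn l * k (Some L))"
proof (induction l)
  case Nil
  then show ?case by (simp add: lw_def csc_one)
next
  case (Cons p l)
  obtain j r where p: "p = (j, r)" by (cases p)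
  have j: "j \<in> nd" "l \<in> nl" using Cons.prems p by auto
  have "k (Some L) * mn (p # l) = inverse (Q (Some L) (Some (orb T j))) \<star> (xp Neg j (int r) * (k (Some L) * mn l))"
    using k_xp(2)[OF Cons.prems(1) j(1)] by (simp add: p mult.assoc[symmetric] csc_mult_left)
  then show ?case using Cons.IH[OF Cons.prems(1) j(2)]
    by (simp add: p lw_def csc_mult_right csc_csc mult.assoc)
qed

lemma lw_Ihat: "l \<in> nl \<Longrightarrow> set (lw l) \<subseteq> Ihat T" "None \<notin> set (lw l)"
  by (auto simp: lw_def nl_def)

text \<open>The weight determines the letter counts up to the null root; since \<open>None\<close>
  never occurs in \<open>lw\<close>, the counts agree.\<close>

lemma lw_inj:
  assumes "l \<in> nl" "l' \<in> nl" "\<And>L. L \<in> Isig T \<Longrightarrow> Qw (Some L) (lw l) = Qw (Some L) (lw l')"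
  shows "length l = length l'"
proof -
  let ?m = "\<lambda>x. int (count_list (lw l) x) + - int (count_list (lw l') x)"
  have z: "?m x = 0" if x: "x \<in> Ihat T" for x
  proof -
    have "qch ?m (Some L) = 1" if "L \<in> Isig T" for L
      using assms(3)[OF that] unfolding Qw_qch[OF lw_Ihat(1)[OF assms(1)]] Qw_qch[OF lw_Ihat(1)[OF assms(2)]]
      by (simp only: qch_add qch_uminus) simp
    from qch_trivial[of ?m x, OF this x] show ?thesis using lw_Ihat(2)[of l] lw_Ihat(2)[of l'] by (simp add: count_list_0_iff)
  qed
  have "length (lw l) = (\<Sum>x\<in>Ihat T. count_list (lw l) x)" "length (lw l') = (\<Sum>x\<in>Ihat T. count_list (lw l') x)"
    using lw_Ihat(1)[OF assms(1)] lw_Ihat(1)[OF assms(2)] by (simp_all add: sum_count_set)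
  moreover have "(\<Sum>x\<in>Ihat T. count_list (lw l) x) = (\<Sum>x\<in>Ihat T. count_list (lw l') x)"
    by (rule sum.cong[OF refl]) (use z in fastforce)
  ultimately show ?thesis by (simp add: lw_def)
qed

text \<open>The weight fixes the length n, and a monomial that is not bad, taken as its own suffix,
  has mode sum at most \<open>NN * n\<close>.\<close>

lemma finite_good: "finite {l \<in> nl. (\<forall>L\<in>Isig T. inverse (Qw (Some L) (lw l)) = \<chi> L) \<and> \<not> bad l}" (is "finite ?A")
proof (cases "?A = {}")
  case False
  then obtain l0 where l0: "l0 \<in> nl" "\<forall>L\<in>Isig T. inverse (Qw (Some L) (lw l0)) = \<chi> L" by blast
  let ?n = "length l0"
  have "?A \<subseteq> {l. set l \<subseteq> nd \<times> {..NN * ?n} \<and> length l = ?n}"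
  proof
    fix l assume l: "l \<in> ?A"
    have "Qw (Some L) (lw l) = Qw (Some L) (lw l0)" if "L \<in> Isig T" for L
      using l l0 that by (metis (mono_tags, lifting) inverse_inverse_eq mem_Collect_eq)
    then have n: "length l = ?n" using l l0 by (intro lw_inj) auto
    have "l = [] @ l" by simp
    then have "sm l \<le> NN * ?n" using l n unfolding bad_def by (metis (mono_tags, lifting) mem_Collect_eq not_le)
    moreover have "snd p \<le> sm l" if "p \<in> set l" for p using member_le_sum_list[of "snd p" "map snd l"] that by (auto simp: sm_def)
    ultimately show "l \<in> {l. set l \<subseteq> nd \<times> {..NN * ?n} \<and> length l = ?n}"
      using l n by (auto simp: nl_def) (meson le_trans snd_conv)+
  qed
  then show ?thesis by (rule finite_subset) (simp add: finite_lists_length_eq)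
next
  case True
  show ?thesis unfolding True by simp
qed

text \<open>A spanning set of \<open>J\<close> made of weight vectors, so that weight components can
  be taken inside \<open>J\<close>.\<close>

definition Jw :: "'u set" where
  "Jw = {fw v * (ew w * kp m) * g | v w m g. g \<in> GJ}"

lemma Jw_span: "J \<subseteq> cvec.span Jw" "Jw \<subseteq> J"
proof -
  have "u * g \<in> cvec.span Jw" if g: "g \<in> GJ" for u g
    using word_span[of u]
  proof (rule span_image_clin)
    show "clin (\<lambda>u. u * g)" by (rule clin_mult)
    fix t assume "t \<in> {fw v * (ew w * kp m) | v w m. True}"
    then show "t * g \<in> cvec.span Jw" using g unfolding Jw_def by (intro cvec.span_base) blast
  qed
  then show "J \<subseteq> cvec.span Jw" unfolding J_def by (intro cvec.span_minimal cvec.subspace_span) blast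
  show "Jw \<subseteq> J"
  proof
    fix t assume "t \<in> Jw"
    then obtain v w m g where "t = fw v * (ew w * kp m) * g" "g \<in> GJ" unfolding Jw_def by blast
    then show "t \<in> J" using J_closed(5) by simp
  qed
qed

lemma GJ_weight: "g \<in> GJ \<Longrightarrow> g \<in> weightvec"
proof -
  assume "g \<in> GJ"
  then consider i r where "i \<in> nd" "g = xp Pos i (int r)" | i r where "i \<in> nd" "g = ph i r - \<Gamma> i r \<star> 1"
    by (auto simp: GJ_def)
  then show ?thesis
  proof cases
    case 1
    then show ?thesis by (intro weightvecI) (auto simp: k_xp)
  next
    case 2
    then show ?thesis
      by (intro weightvecI[of _ "\<lambda>L. 1"]) (simp add: right_diff_distrib left_diff_distrib csc_mult_left csc_mult_right csc_one k_ph)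
  qed
qed

text \<open>The extra set \<open>S\<close> accommodates Borel words of other weights, which are
  split off when the submodule of bad monomials is shown to be proper.\<close>

lemma JS_weight:
  assumes "u \<in> cvec.span (Jw \<union> mn ` A \<union> S)" "A \<subseteq> nl" "S \<subseteq> weightvec" "\<And>L. L \<in> Isig T \<Longrightarrow> Ad (Some L) u = \<chi> L \<star> u"
  shows "u \<in> cvec.span (J \<union> mn ` {l \<in> A. \<forall>L\<in>Isig T. inverse (Qw (Some L) (lw l)) = \<chi> L} \<union> {t \<in> S. \<forall>L\<in>Isig T. Ad (Some L) t = \<chi> L \<star> t})"
proof -
  let ?B = "J \<union> mn ` {l \<in> A. \<forall>L\<in>Isig T. inverse (Qw (Some L) (lw l)) = \<chi> L} \<union> {t \<in> S. \<forall>L\<in>Isig T. Ad (Some L) t = \<chi> L \<star> t}"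
  have mw: "Ad (Some L) (mn l) = inverse (Qw (Some L) (lw l)) \<star> mn l" if "l \<in> A" "L \<in> Isig T" for l L
    using k_mn[OF that(2), of l] that assms(2) by (auto simp: Ad_iff)
  have "t \<in> weightvec" if "t \<in> Jw \<union> mn ` A \<union> S" for t
  proof -
    from that consider "t \<in> Jw" | l where "l \<in> A" "t = mn l" | "t \<in> S" by blast
    then show ?thesis
    proof cases
      case 1
      then show ?thesis unfolding Jw_def using weightvec_mult[OF weightvec_word GJ_weight] by blast
    next
      case 2
      then show ?thesis unfolding weightvec_def
        by (intro CollectI exI[of _ "\<lambda>L. inverse (Qw (Some L) (lw l))"]) (simp add: mw)
    qed (use assms(3) in blast)
  qed
  then have "u \<in> cvec.span {t \<in> Jw \<union> mn ` A \<union> S. \<forall>L\<in>Isig T. Ad (Some L) t = \<chi> L \<star> t}"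
    by (intro cvec.eigenvectors_span[where A = "\<lambda>L. Ad (Some L)" and \<chi> = \<chi>])
      (use assms(1,4) in \<open>auto simp: clinD[OF clin_Ad] weightvec_def\<close>)
  moreover have "{t \<in> Jw \<union> mn ` A \<union> S. \<forall>L\<in>Isig T. Ad (Some L) t = \<chi> L \<star> t} \<subseteq> cvec.span ?B"
  proof
    fix t assume t: "t \<in> {t \<in> Jw \<union> mn ` A \<union> S. \<forall>L\<in>Isig T. Ad (Some L) t = \<chi> L \<star> t}"
    then consider "t \<in> ?B" | l where "l \<in> A" "t = mn l" using Jw_span(2) by blast
    then show "t \<in> cvec.span ?B"
    proof cases
      case 2
      show ?thesis
      proof (cases "t = 0")
        case False
        have "inverse (Qw (Some L) (lw l)) = \<chi> L" if "L \<in> Isig T" for L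
        proof -
          have "inverse (Qw (Some L) (lw l)) \<star> t = Ad (Some L) t" using mw[OF 2(1) that] by (simp only: 2(2))
          also have "\<dots> = \<chi> L \<star> t" using t that by blast
          finally have "(inverse (Qw (Some L) (lw l)) - \<chi> L) \<star> t = 0" unfolding csc_diff(2) by (simp only: diff_self)
          then show ?thesis using False by (simp add: csc_eq_0)
        qed
        then show ?thesis using 2 by (intro cvec.span_base) blast
      qed (simp add: cvec.span_zero)
    qed (rule cvec.span_base)
  qed
  ultimately show ?thesis using cvec.span_minimal[OF _ cvec.subspace_span] by blast
qed

lemma Bs_JS:
  assumes "b \<in> Bs" "\<And>L. L \<in> Isig T \<Longrightarrow> Ad (Some L) b = \<chi> L \<star> b"
  shows "b \<in> JS {l \<in> nl. \<forall>L\<in>Isig T. inverse (Qw (Some L) (lw l)) = \<chi> L}"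
proof -
  have "J \<union> mn ` nl \<subseteq> cvec.span (Jw \<union> mn ` nl \<union> {})"
    using Jw_span(1) cvec.span_mono[of Jw "Jw \<union> mn ` nl \<union> {}"] by (auto intro: cvec.span_base)
  then have "b \<in> cvec.span (Jw \<union> mn ` nl \<union> {})"
    using Uhat_JS_all[OF Bs_Uhat[OF assms(1)]] cvec.span_minimal[OF _ cvec.subspace_span] unfolding JS_def by blast
  from JS_weight[OF this _ _ assms(2)] show ?thesis by (simp add: JS_def)
qed

end

locale uq_module = uq_weight T cl X H \<Gamma> NN
  for T and cl :: "uq \<Rightarrow> 'u::calg" and X and H and \<Gamma> and NN +
  fixes sc :: "complex \<Rightarrow> 'v \<Rightarrow> 'v::ab_group_add" and act :: "uq \<Rightarrow> 'v \<Rightarrow> 'v" and v :: 'v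
  assumes simple: "simple_borel_module T sc act"
    and cyc: "\<exists>a\<in>borel T. w = act a v"
    and kill: "i \<in> nd \<Longrightarrow> act (X Pos i (int r)) v = 0"
    and eig: "i \<in> nd \<Longrightarrow> act (phi T H Pos i (int r)) v = sc (\<Gamma> i r) v"
begin

section \<open>The action of the Borel subalgebra on the highest weight module\<close>

lemma bm: "borel_module T sc act"
  using simple by (simp add: simple_borel_module_def)

sublocale S: vector_space sc
  using bm by (simp add: borel_module_def)

definition ac :: "'u \<Rightarrow> 'v \<Rightarrow> 'v" where "ac b = act (SOME a. a \<in> borel T \<and> cl a = b)"

lemma ac_cl: "a \<in> borel T \<Longrightarrow> ac (cl a) = act a"
proof -
  assume a: "a \<in> borel T"
  have "a' = a" if "a' \<in> borel T \<and> cl a' = cl a" for a'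
    using that cl_eq borel_carrier a by blast
  then have "(SOME a'. a' \<in> borel T \<and> cl a' = cl a) = a" using a by (intro some_equality) auto
  then show ?thesis by (simp add: ac_def)
qed

lemma ac_uscal: "ac (z \<star> 1) w = sc z w"
  using ac_cl[OF borel_closed(1)[of z]] bm by (simp add: cl_uscal borel_module_def)

lemma ac_add: "b \<in> Bs \<Longrightarrow> b' \<in> Bs \<Longrightarrow> ac (b + b') w = ac b w + ac b' w"
  and ac_mult: "b \<in> Bs \<Longrightarrow> b' \<in> Bs \<Longrightarrow> ac (b * b') w = ac b (ac b' w)"
proof -
  assume "b \<in> Bs" "b' \<in> Bs"
  then obtain a a' where a: "a \<in> borel T" "cl a = b" "a' \<in> borel T" "cl a' = b'" using Bs_borel by metis
  have "ac (cl (a \<oplus>\<^bsub>Uq T\<^esub> a')) w = act a w + act a' w"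
    unfolding ac_cl[OF borel_closed(4)[OF a(1,3)]] using bm a by (simp add: borel_module_def)
  then show "ac (b + b') w = ac b w + ac b' w"
    using cl_add[OF borel_carrier[OF a(1)] borel_carrier[OF a(3)]] ac_cl[OF a(1)] ac_cl[OF a(3)] a(2,4) by simp
  have "ac (cl (a \<otimes>\<^bsub>Uq T\<^esub> a')) w = act a (act a' w)"
    unfolding ac_cl[OF borel_closed(5)[OF a(1,3)]] using bm a by (simp add: borel_module_def)
  then show "ac (b * b') w = ac b (ac b' w)"
    using cl_mult[OF borel_carrier[OF a(1)] borel_carrier[OF a(3)]] ac_cl[OF a(1)] ac_cl[OF a(3)] a(2,4) by simp
qed

lemma ac_scal: "b \<in> Bs \<Longrightarrow> ac (z \<star> b) w = sc z (ac b w)"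
  using ac_mult[OF Bs_closed(3)[OF Bs_1, of z], of b w] by (simp add: csc_mult_left ac_uscal)

lemma ac_linear: "b \<in> Bs \<Longrightarrow> ac b (w + w') = ac b w + ac b w'" "b \<in> Bs \<Longrightarrow> ac b (sc z w) = sc z (ac b w)" "b \<in> Bs \<Longrightarrow> ac b 0 = 0"
proof -
  have l: "Vector_Spaces.linear sc sc (ac b)" if b: "b \<in> Bs" for b
  proof -
    obtain a where "a \<in> borel T" "cl a = b" using Bs_borel[OF b] by blast
    then show ?thesis using bm ac_cl by (auto simp: borel_module_def)
  qed
  then have m: "module_hom sc sc (ac b)" if "b \<in> Bs" for b
    using that by (simp add: Vector_Spaces.linear_def)
  show "b \<in> Bs \<Longrightarrow> ac b (w + w') = ac b w + ac b w'" using module_hom.add[OF m] .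
  show s: "b \<in> Bs \<Longrightarrow> ac b (sc z w) = sc z (ac b w)" for z w using module_hom.scale[OF m] .
  show "b \<in> Bs \<Longrightarrow> ac b 0 = 0" using s[of 0 0] by simp
qed

lemma ac_diff: "b \<in> Bs \<Longrightarrow> b' \<in> Bs \<Longrightarrow> ac (b - b') w = ac b w - ac b' w" "ac 0 w = 0" "ac 1 w = w"
proof -
  show "ac 0 w = 0" using ac_uscal[of 0 w] by simp
  show "ac 1 w = w" using ac_uscal[of 1 w] by (simp add: csc_one)
  show "b \<in> Bs \<Longrightarrow> b' \<in> Bs \<Longrightarrow> ac (b - b') w = ac b w - ac b' w"
    using ac_add[of "b - b'" b' w] Bs_closed(5)[of b b'] by simp
qed

lemma cyc_Bs: "\<exists>b\<in>Bs. w = ac b v"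
  using cyc[of w] borel_Bs ac_cl by metis

lemma v_nz: "v \<noteq> 0"
proof
  assume v: "v = 0"
  have "w = 0" for w :: 'v using cyc_Bs[of w] ac_linear(3) v by auto
  then show False using simple unfolding simple_borel_module_def by blast
qed

lemma drinfeld_borel: "i \<in> nd \<Longrightarrow> X Pos i (int r) \<in> borel T" "i \<in> nd \<Longrightarrow> phi T H Pos i (int r) \<in> borel T"
  using dg by (auto simp: drinfeld_generators_def)

lemma GJ_v: "g \<in> GJ \<Longrightarrow> g \<in> Bs \<and> ac g v = 0"
proof -
  assume "g \<in> GJ"
  then consider i r where "i \<in> nd" "g = xp Pos i (int r)" | i r where "i \<in> nd" "g = ph i r - \<Gamma> i r \<star> 1"
    by (auto simp: GJ_def)
  then show ?thesis
  proof cases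
    case 1
    then show ?thesis using xp_Bs[of i "int r"] ac_cl[OF drinfeld_borel(1)[of i r]] kill by (simp add: xp_def)
  next
    case 2
    have "ac (ph i r) v = sc (\<Gamma> i r) v" using ac_cl[OF drinfeld_borel(2)[of i r]] eig 2(1) by (simp add: ph_def)
    then show ?thesis using 2 ac_diff(1)[of "ph i r" "\<Gamma> i r \<star> 1" v] ph_Bs Bs_1 by (simp add: Bs_closed ac_uscal)
  qed
qed

lemma k_v: "L \<in> Isig T \<Longrightarrow> ac (k (Some L)) v = v"
proof -
  assume L: "L \<in> Isig T"
  have "ph (rep L) 0 - \<Gamma> (rep L) 0 \<star> 1 \<in> GJ" unfolding GJ_def using rep_in(2)[OF L] by blast
  moreover have "ph (rep L) 0 - \<Gamma> (rep L) 0 \<star> 1 = k (Some L) - 1"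
    using rep_in[OF L] by (simp add: ph_0 \<Gamma>0 csc_one)
  ultimately have "ac (k (Some L) - 1) v = 0" using GJ_v by metis
  then show ?thesis by (simp add: ac_diff Bs_gens Bs_1)
qed

text \<open>Left coefficients in U cannot act, so each is replaced by its Borel part modulo the
  right ideal of the f's. The resulting element of \<open>Bs\<close> kills v and differs from b by
  an element of \<open>Bs\<close> in that right ideal, which is 0.\<close>

lemma J_kill: "b \<in> J \<Longrightarrow> b \<in> Bs \<Longrightarrow> ac b v = 0"
proof -
  let ?F = "{f x * y | x y. True}"
  assume bJ: "b \<in> J" and bB: "b \<in> Bs"
  have "\<exists>b'\<in>Bs. ac b' v = 0 \<and> b - b' \<in> cvec.span ?F"
    using bJ unfolding J_def
  proof (induction rule: cvec.span_induct_alt)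
    case base
    show ?case by (rule bexI[of _ 0]) (simp_all add: Bs_closed cvec.span_zero ac_diff)
  next
    case (step c t u)
    then obtain b' y g where b': "b' \<in> Bs" "ac b' v = 0" "u - b' \<in> cvec.span ?F" and t: "t = y * g" "g \<in> GJ" by blast
    obtain b0 where b0: "b0 \<in> Bs" "y - b0 \<in> cvec.span ?F" using Bs_plus_f by blast
    have g: "g \<in> Bs" "ac g v = 0" using GJ_v[OF t(2)] by auto
    have "(y - b0) * g \<in> cvec.span ?F"
      using b0(2)
    proof (rule span_image_clin)
      show "clin (\<lambda>u. u * g)" by (rule clin_mult)
      fix u assume "u \<in> ?F"
      then obtain x z where "u * g = f x * (z * g)" by (auto simp: mult.assoc)
      then show "u * g \<in> cvec.span ?F" by (intro cvec.span_base) blast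
    qed
    then have "c \<star> ((y - b0) * g) + (u - b') \<in> cvec.span ?F" using b'(3) by (intro cvec.span_add cvec.span_scale)
    moreover have "c \<star> ((y - b0) * g) + (u - b') = c \<star> t + u - (c \<star> (b0 * g) + b')"
      by (simp add: t left_diff_distrib csc_diff)
    moreover have "c \<star> (b0 * g) \<in> Bs" using b0 g by (simp add: Bs_closed Bs_mult)
    moreover have "ac (c \<star> (b0 * g)) v = 0" using b0 g by (simp add: ac_scal Bs_mult ac_mult ac_linear)
    ultimately show ?case using b'(1,2)
      by (intro bexI[of _ "c \<star> (b0 * g) + b'"]) (simp_all add: ac_add Bs_closed)
  qed
  then obtain b' where b': "b' \<in> Bs" "ac b' v = 0" "b - b' \<in> cvec.span ?F" by blast
  obtain g where "b - b' = (\<Sum>x\<in>Ihat T. f x * g x)" using f_span_sum[OF b'(3)] by blast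
  then have "b - b' = 0" by (rule Bs_f_disjoint[OF Bs_closed(5)[OF bB b'(1)]])
  then show ?thesis using b' by simp
qed

lemma ac_span: "b \<in> cvec.span S \<Longrightarrow> S \<subseteq> Bs \<Longrightarrow> b \<in> Bs \<and> ac b v \<in> S.span ((\<lambda>t. ac t v) ` S)"
proof (induction rule: cvec.span_induct_alt)
  case base
  show ?case by (simp add: Bs_closed ac_diff S.span_zero)
next
  case (step c x y)
  then have "x \<in> Bs" "y \<in> Bs" by auto
  then have "ac (c \<star> x + y) v = sc c (ac x v) + ac y v" by (simp add: ac_add ac_scal Bs_closed)
  moreover have "sc c (ac x v) + ac y v \<in> S.span ((\<lambda>t. ac t v) ` S)"
    by (rule S.span_add[OF S.span_scale[OF S.span_base]]) (use step in blast)+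
  ultimately show ?case using \<open>x \<in> Bs\<close> \<open>y \<in> Bs\<close> by (simp add: Bs_closed)
qed

section \<open>Weight vectors of the module and finiteness of weight spaces\<close>

definition Bwords :: "'u set" where "Bwords = {ew w * kp m | w m. True}"

lemma Bwords: "Bwords \<subseteq> Bs" "t \<in> Bwords \<Longrightarrow> \<exists>\<psi>. \<forall>L\<in>Isig T. Ad (Some L) t = \<psi> L \<star> t"
proof -
  show "Bwords \<subseteq> Bs" using Bs_word by (auto simp: Bwords_def)
  show "t \<in> Bwords \<Longrightarrow> \<exists>\<psi>. \<forall>L\<in>Isig T. Ad (Some L) t = \<psi> L \<star> t"
    using weightvec_word[of "[]"] by (auto simp: Bwords_def weightvec_def)
qed

lemma ac_weight:
  assumes "b \<in> Bs" "L \<in> Isig T" "Ad (Some L) b = z \<star> b" shows "ac (k (Some L)) (ac b v) = sc z (ac b v)"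
proof -
  have "ac (k (Some L) * b) v = ac (z \<star> (b * k (Some L))) v" using assms(3) by (simp add: Ad_iff)
  then show ?thesis using assms by (simp add: ac_mult ac_scal Bs_mult Bs_gens k_v)
qed

lemma ac_Bwords: "t \<in> Bwords \<Longrightarrow> \<exists>\<psi>. \<forall>L\<in>Isig T. ac (k (Some L)) (ac t v) = sc (\<psi> L) (ac t v)"
proof -
  assume t: "t \<in> Bwords"
  then obtain \<psi> where "\<forall>L\<in>Isig T. Ad (Some L) t = \<psi> L \<star> t" using Bwords(2) by blast
  then have "\<forall>L\<in>Isig T. ac (k (Some L)) (ac t v) = sc (\<psi> L) (ac t v)" using ac_weight[of t] t Bwords(1) by blast
  then show ?thesis by (rule exI[of _ \<psi>])
qed

text \<open>Lifting b as a weight vector of the Borel subalgebra is what allows straightening to be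
  carried out weight by weight.\<close>

lemma weight_rep:
  assumes "\<And>L. L \<in> Isig T \<Longrightarrow> ac (k (Some L)) w = sc (\<chi> L) w"
  shows "\<exists>b\<in>Bs. (\<forall>L\<in>Isig T. Ad (Some L) b = \<chi> L \<star> b) \<and> w = ac b v"
proof -
  obtain b where b: "b \<in> Bs" "w = ac b v" using cyc_Bs by blast
  then have w: "w \<in> S.span ((\<lambda>t. ac t v) ` Bwords)" using ac_span[of b Bwords] Bwords(1) by (simp add: Bs_def Bwords_def)
  have "w \<in> S.span {t' \<in> (\<lambda>t. ac t v) ` Bwords. \<forall>L\<in>Isig T. ac (k (Some L)) t' = sc (\<chi> L) t'}"
    by (rule S.eigenvectors_span[where A = "\<lambda>L. ac (k (Some L))"])
      (use ac_Bwords w assms Bs_gens in \<open>auto simp: ac_linear\<close>)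
  then show ?thesis
  proof (induction rule: S.span_induct_alt)
    case base
    show ?case by (rule bexI[of _ 0]) (simp_all add: Bs_closed ac_diff clinD[OF clin_Ad])
  next
    case (step c t' u)
    then obtain t where t: "t \<in> Bwords" "t' = ac t v" "\<And>L. L \<in> Isig T \<Longrightarrow> ac (k (Some L)) t' = sc (\<chi> L) t'" by blast
    obtain b where b: "b \<in> Bs" "\<forall>L\<in>Isig T. Ad (Some L) b = \<chi> L \<star> b" "u = ac b v" using step by blast
    show ?case
    proof (cases "t' = 0")
      case True
      then show ?thesis using b by auto
    next
      case False
      obtain \<psi> where \<psi>: "\<forall>L\<in>Isig T. Ad (Some L) t = \<psi> L \<star> t" using Bwords(2)[OF t(1)] by blast
      have tB: "t \<in> Bs" using t(1) Bwords(1) by blast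
      have "\<psi> L = \<chi> L" if L: "L \<in> Isig T" for L
      proof -
        have "sc (\<psi> L) t' = ac (k (Some L)) t'" using ac_weight[OF tB L] \<psi> t(2) L by metis
        also have "\<dots> = sc (\<chi> L) t'" by (rule t(3)[OF L])
        finally show ?thesis using False by simp
      qed
      then have "\<forall>L\<in>Isig T. Ad (Some L) (c \<star> t + b) = \<chi> L \<star> (c \<star> t + b)"
        using \<psi> b(2) by (simp add: clinD[OF clin_Ad] csc_add_right csc_csc mult.commute)
      then show ?thesis using tB b t(2) by (intro bexI[of _ "c \<star> t + b"]) (simp_all add: ac_add ac_scal Bs_closed)
    qed
  qed
qed

text \<open>By simplicity: the bad monomials span a submodule not containing \<open>v\<close>.\<close>

lemma bad_kill:
  assumes b: "b \<in> Bs" "b \<in> JS {l \<in> nl. bad l}"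
  shows "ac b v = 0"
proof -
  let ?D = "JS {l \<in> nl. bad l}"
  define W where "W = {ac b v | b. b \<in> Bs \<and> b \<in> ?D}"
  have "S.subspace W"
  proof (rule S.subspaceI)
    show "0 \<in> W" unfolding W_def using ac_diff(2)[of v] Bs_closed(1) JS_closed(1) by (metis (mono_tags, lifting) mem_Collect_eq)
  next
    fix x y assume "x \<in> W" "y \<in> W"
    then obtain a b where "a \<in> Bs" "a \<in> ?D" "b \<in> Bs" "b \<in> ?D" "x = ac a v" "y = ac b v" unfolding W_def by blast
    then have "x + y = ac (a + b) v" "a + b \<in> Bs" "a + b \<in> ?D" by (simp_all add: ac_add Bs_closed JS_closed)
    then show "x + y \<in> W" unfolding W_def by blast
  next
    fix c x assume "x \<in> W"
    then obtain a where "a \<in> Bs" "a \<in> ?D" "x = ac a v" unfolding W_def by blast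
    then have "sc c x = ac (c \<star> a) v" "c \<star> a \<in> Bs" "c \<star> a \<in> ?D" by (simp_all add: ac_scal Bs_closed JS_closed)
    then show "sc c x \<in> W" unfolding W_def by blast
  qed
  moreover have "act a ` W \<subseteq> W" if a: "a \<in> borel T" for a
  proof
    fix x assume "x \<in> act a ` W"
    then obtain b where b: "b \<in> Bs" "b \<in> ?D" "x = act a (ac b v)" unfolding W_def by blast
    have c: "cl a \<in> Bs" using borel_Bs[OF a] .
    have "x = ac (cl a * b) v" using b ac_cl[OF a] c by (simp add: ac_mult)
    moreover have "cl a * b \<in> Bs" "cl a * b \<in> ?D" using b c by (simp_all add: Bs_mult Uhat_JS_bad Bs_Uhat)
    ultimately show "x \<in> W" unfolding W_def by blast
  qed
  ultimately have "W = {0} \<or> W = UNIV" using simple unfolding simple_borel_module_def by blast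
  moreover have "W \<noteq> UNIV"
  proof
    assume "W = UNIV"
    then obtain b where b: "b \<in> Bs" "b \<in> ?D" "v = ac b v" unfolding W_def by blast
    \<comment> \<open>If v = b v, then b is split into words of trivial weight and the others. The
      second part applied to v has the weight of v but lies in a sum of other weight spaces, so it
      vanishes.\<close>
    let ?S1 = "{t \<in> Bwords. \<forall>L\<in>Isig T. Ad (Some L) t = 1 \<star> t}" and ?S2 = "{t \<in> Bwords. \<exists>L\<in>Isig T. Ad (Some L) t \<noteq> 1 \<star> t}"
    have "Bwords = ?S1 \<union> ?S2" by blast
    then obtain b1 b2 where b12: "b = b1 + b2" "b1 \<in> cvec.span ?S1" "b2 \<in> cvec.span ?S2"
      using b(1) cvec.span_Un[of ?S1 ?S2] unfolding Bs_def Bwords_def[symmetric] by auto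
    have B12: "b1 \<in> Bs" "b2 \<in> Bs" "ac b2 v \<in> S.span ((\<lambda>t. ac t v) ` ?S2)"
      using ac_span[OF b12(2)] ac_span[OF b12(3)] Bwords(1) by blast+
    have w1: "Ad (Some L) b1 = 1 \<star> b1" if L: "L \<in> Isig T" for L
      using b12(2)
    proof (induction rule: cvec.span_induct_alt)
      case (step c x y)
      then show ?case using L by (simp add: clinD[OF clin_Ad] csc_one)
    qed (simp add: clinD[OF clin_Ad])
    have v12: "ac b2 v = v - ac b1 v" using b(3) B12 by (simp add: b12(1) ac_add algebra_simps)
    have "ac (k (Some L)) (ac b2 v) = sc 1 (ac b2 v)" if L: "L \<in> Isig T" for L
    proof -
      have "ac (k (Some L)) (v - ac b1 v) = ac (k (Some L)) v - ac (k (Some L)) (ac b1 v)"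
        using ac_linear(1)[OF Bs_gens(2), of "Some L" "v - ac b1 v" "ac b1 v"] by simp
      then show ?thesis using ac_weight[OF B12(1) L w1[OF L]] k_v[OF L] by (simp add: v12)
    qed
    moreover have "\<exists>\<psi>. \<forall>L\<in>Isig T. ac (k (Some L)) t' = sc (\<psi> L) t'" if "t' \<in> (\<lambda>t. ac t v) ` ?S2" for t'
      using that ac_Bwords by auto
    ultimately have "ac b2 v \<in> S.span {t' \<in> (\<lambda>t. ac t v) ` ?S2. \<forall>L\<in>Isig T. ac (k (Some L)) t' = sc 1 t'}"
      by (intro S.eigenvectors_span[where A = "\<lambda>L. ac (k (Some L))" and \<chi> = "\<lambda>L. 1"]) (use B12(3) Bs_gens in \<open>auto simp: ac_linear\<close>)
    moreover have "{t' \<in> (\<lambda>t. ac t v) ` ?S2. \<forall>L\<in>Isig T. ac (k (Some L)) t' = sc 1 t'} \<subseteq> {0}"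
    proof
      fix t' assume t': "t' \<in> {t' \<in> (\<lambda>t. ac t v) ` ?S2. \<forall>L\<in>Isig T. ac (k (Some L)) t' = sc 1 t'}"
      then obtain t L where t: "t \<in> Bwords" "t' = ac t v" "L \<in> Isig T" "Ad (Some L) t \<noteq> 1 \<star> t" by blast
      obtain \<psi> where \<psi>: "\<forall>L\<in>Isig T. Ad (Some L) t = \<psi> L \<star> t" using Bwords(2)[OF t(1)] by blast
      have "sc (\<psi> L) t' = sc 1 t'" using ac_weight[of t L "\<psi> L"] \<psi> t t' Bwords(1) by auto
      moreover have "\<psi> L \<noteq> 1" using \<psi> t by auto
      ultimately have "t' = 0" by (metis S.scale_cancel_right)
      then show "t' \<in> {0}" by simp
    qed
    ultimately have "ac b2 v \<in> S.span {0}" using S.span_mono by blast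
    then have "ac b2 v = 0" by (simp add: S.span_insert_0)
    then have v1: "v = ac b1 v" using v12 by simp
    have "b1 \<in> cvec.span (Jw \<union> mn ` {l \<in> nl. bad l} \<union> ?S2)"
    proof -
      have "J \<union> mn ` {l \<in> nl. bad l} \<subseteq> cvec.span (Jw \<union> mn ` {l \<in> nl. bad l} \<union> ?S2)"
        using Jw_span(1) cvec.span_mono[of Jw "Jw \<union> mn ` {l \<in> nl. bad l} \<union> ?S2"] by (auto intro: cvec.span_base)
      then have "b \<in> cvec.span (Jw \<union> mn ` {l \<in> nl. bad l} \<union> ?S2)"
        using b(2) cvec.span_minimal[OF _ cvec.subspace_span] unfolding JS_def by blast
      moreover have "b2 \<in> cvec.span (Jw \<union> mn ` {l \<in> nl. bad l} \<union> ?S2)"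
        using b12(3) cvec.span_mono[of ?S2] by blast
      moreover have "b1 = b - b2" using b12(1) by simp
      ultimately show ?thesis using cvec.span_diff by simp
    qed
    then have "b1 \<in> cvec.span (J \<union> mn ` {l \<in> {l \<in> nl. bad l}. \<forall>L\<in>Isig T. inverse (Qw (Some L) (lw l)) = 1}
        \<union> {t \<in> ?S2. \<forall>L\<in>Isig T. Ad (Some L) t = 1 \<star> t})"
      by (rule JS_weight) (use Bwords(2) w1 in \<open>auto simp: weightvec_def\<close>)
    \<comment> \<open>Only the empty monomial has trivial weight, and it is not bad; hence the
      weight-zero part lies in \<open>J\<close> and kills v.\<close>
    moreover have "{l \<in> {l \<in> nl. bad l}. \<forall>L\<in>Isig T. inverse (Qw (Some L) (lw l)) = 1} = {}"
    proof -
      have "length l = 0" if "l \<in> nl" "\<forall>L\<in>Isig T. inverse (Qw (Some L) (lw l)) = 1" for l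
        using lw_inj[OF that(1), of "[]"] that(2) by (simp add: lw_def)
      moreover have "\<not> bad []" by (simp add: bad_def)
      ultimately show ?thesis by auto
    qed
    moreover have "{t \<in> ?S2. \<forall>L\<in>Isig T. Ad (Some L) t = 1 \<star> t} = {}" by blast
    ultimately have "b1 \<in> cvec.span J" by (simp only: image_empty Un_empty_right)
    then have "b1 \<in> J" unfolding J_def cvec.span_span .
    then show False using J_kill[OF _ B12(1)] v1 v_nz by simp
  qed
  ultimately have "W = {0}" by blast
  then show ?thesis using b unfolding W_def by blast
qed

text \<open>The finite set \<open>G\<close> will consist of monomials in the \<open>x^-\<close>,
  which do not act on the module. Representatives are therefore chosen in \<open>Z\<close>, one for
  each element of \<open>G\<close> that \<open>Z\<close> really involves.\<close>

lemma finite_span_mod: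
  assumes "finite G" "cvec.subspace Z" "Z \<subseteq> Bs" "Z \<subseteq> cvec.span (Y \<union> G)" "\<And>b. b \<in> Bs \<Longrightarrow> b \<in> cvec.span Y \<Longrightarrow> ac b v = 0"
  shows "\<exists>B. finite B \<and> (\<forall>b\<in>Z. ac b v \<in> S.span B)"
  using assms(1-4)
proof (induction G arbitrary: Z rule: finite_induct)
  case empty
  then have "ac b v = 0" if "b \<in> Z" for b using that assms(5)[of b] by auto
  then show ?case by (intro exI[of _ "{}"]) (simp add: S.span_zero)
next
  case (insert g G)
  show ?case
  proof (cases "Z \<subseteq> cvec.span (Y \<union> G)")
    case True
    then show ?thesis using insert by blast
  next
    case False
    then obtain z0 where z0: "z0 \<in> Z" "z0 \<notin> cvec.span (Y \<union> G)" by blast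
    have dec: "\<exists>c. z - c \<star> g \<in> cvec.span (Y \<union> G)" if "z \<in> Z" for z
    proof -
      have "z \<in> cvec.span (insert g (Y \<union> G))" using insert.prems(3) that by auto
      then show ?thesis by (simp add: cvec.span_insert)
    qed
    obtain c where c: "z0 - c \<star> g \<in> cvec.span (Y \<union> G)" using dec[OF z0(1)] by blast
    have c0: "c \<noteq> 0" using c z0(2) by auto
    let ?Z = "Z \<inter> cvec.span (Y \<union> G)"
    have "\<exists>B. finite B \<and> (\<forall>b\<in>?Z. ac b v \<in> S.span B)"
      by (rule insert.IH) (use insert.prems cvec.subspace_inter[OF insert.prems(1) cvec.subspace_span] in auto)
    then obtain B where B: "finite B" "\<And>b. b \<in> ?Z \<Longrightarrow> ac b v \<in> S.span B" by blast
    have "ac b v \<in> S.span (insert (ac z0 v) B)" if b: "b \<in> Z" for b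
    proof -
      obtain d where d: "b - d \<star> g \<in> cvec.span (Y \<union> G)" using dec[OF b] by blast
      let ?b = "b - (d / c) \<star> z0"
      \<comment> \<open>The factor \<open>d / c\<close> cancels the component along g, so that the
        corrected element belongs to the smaller subspace.\<close>
      have "(b - d \<star> g) - (d / c) \<star> (z0 - c \<star> g) \<in> cvec.span (Y \<union> G)" by (rule cvec.span_diff[OF d cvec.span_scale[OF c]])
      then have "?b \<in> cvec.span (Y \<union> G)" using c0 by (simp add: csc_diff csc_csc)
      moreover have "?b \<in> Z" using insert.prems(1) b z0(1) by (simp add: cvec.subspace_diff cvec.subspace_scale)
      ultimately have "ac ?b v \<in> S.span (insert (ac z0 v) B)" using B(2)[of ?b] S.span_mono[of B "insert (ac z0 v) B"] by blast
      moreover have "ac b v = ac ?b v + sc (d / c) (ac z0 v)"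
        using b z0(1) insert.prems(2) by (simp add: ac_diff ac_scal Bs_closed subset_iff)
      ultimately show ?thesis by (simp add: S.span_add S.span_scale S.span_base)
    qed
    then show ?thesis using B(1) by (intro exI[of _ "insert (ac z0 v) B"]) simp
  qed
qed

lemma weight_finite: "\<exists>B. finite B \<and> {w. \<forall>L\<in>Isig T. ac (k (Some L)) w = sc (\<chi> L) w} \<subseteq> S.span B"
proof -
  define Z where "Z = {b \<in> Bs. \<forall>L\<in>Isig T. Ad (Some L) b = \<chi> L \<star> b}"
  define A where "A = {l \<in> nl. \<forall>L\<in>Isig T. inverse (Qw (Some L) (lw l)) = \<chi> L}"
  let ?G = "{l \<in> nl. (\<forall>L\<in>Isig T. inverse (Qw (Some L) (lw l)) = \<chi> L) \<and> \<not> bad l}"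
  have "\<exists>B. finite B \<and> (\<forall>b\<in>Z. ac b v \<in> S.span B)"
  proof (rule finite_span_mod)
    show "finite (mn ` ?G)" using finite_good[of \<chi>] by simp
    show "cvec.subspace Z"
      by (rule cvec.subspaceI) (auto simp: Z_def Bs_closed clinD[OF clin_Ad] csc_add_right csc_csc mult.commute)
    show "Z \<subseteq> Bs" by (auto simp: Z_def)
    show "Z \<subseteq> cvec.span ((J \<union> mn ` {l \<in> nl. bad l}) \<union> mn ` ?G)"
    proof
      fix b assume "b \<in> Z"
      then have "b \<in> JS A" using Bs_JS[of b \<chi>] by (simp add: Z_def A_def)
      then show "b \<in> cvec.span ((J \<union> mn ` {l \<in> nl. bad l}) \<union> mn ` ?G)"
        unfolding JS_def A_def by (rule subsetD[OF cvec.span_mono, rotated]) blast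
    qed
    show "b \<in> Bs \<Longrightarrow> b \<in> cvec.span (J \<union> mn ` {l \<in> nl. bad l}) \<Longrightarrow> ac b v = 0" for b
      by (rule bad_kill) (simp_all add: JS_def)
  qed
  then obtain B where B: "finite B" "\<forall>b\<in>Z. ac b v \<in> S.span B" by blast
  have "w \<in> S.span B" if "\<forall>L\<in>Isig T. ac (k (Some L)) w = sc (\<chi> L) w" for w
    using weight_rep[of w \<chi>] that B(2) unfolding Z_def by blast
  then show ?thesis using B(1) by blast
qed

text \<open>Otherwise no monomial has the weight of w, the lift of w to \<open>Bs\<close> lies in
  \<open>J\<close>, and w is zero.\<close>

lemma weight_lw:
  assumes "w \<noteq> 0" "\<And>L. L \<in> Isig T \<Longrightarrow> ac (k (Some L)) w = sc (\<chi> L) w"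
  shows "\<exists>l\<in>nl. \<forall>L\<in>Isig T. \<chi> L = inverse (Qw (Some L) (lw l))"
proof (rule ccontr)
  assume no: "\<not> ?thesis"
  obtain b where b: "b \<in> Bs" "\<forall>L\<in>Isig T. Ad (Some L) b = \<chi> L \<star> b" "w = ac b v" using weight_rep[OF assms(2)] by blast
  have "{l \<in> nl. \<forall>L\<in>Isig T. inverse (Qw (Some L) (lw l)) = \<chi> L} = {}" using no by force
  moreover have "b \<in> JS {l \<in> nl. \<forall>L\<in>Isig T. inverse (Qw (Some L) (lw l)) = \<chi> L}" by (rule Bs_JS) (use b in auto)
  ultimately have "b \<in> JS {}" by (simp only:)
  then have "b \<in> J" unfolding JS_def J_def by (simp add: cvec.span_span)
  then show False using J_kill[OF _ b(1)] b(3) assms(1) by simp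
qed

section \<open>Torus characters and membership in the category\<close>

lemma torus_gens: "L \<in> Isig T \<Longrightarrow> kk T b (Some L) \<in> torus T"
  unfolding torus_def by (rule subalgebra_closed(2)) blast

lemma torus_gen_scalar:
  assumes w: "\<And>L. L \<in> Isig T \<Longrightarrow> ac (k (Some L)) w = sc (\<chi> L) w" and nz: "w \<noteq> 0"
    and a: "a \<in> range (uscal T) \<union> {kk T b (Some P) | b P. P \<in> Isig T}"
  shows "a \<in> borel T \<and> (\<exists>z. act a w = sc z w)"
proof (cases "a \<in> range (uscal T)")
  case True
  then show ?thesis using borel_closed(1) bm by (auto simp: borel_module_def)
next
  case False
  then obtain b L where L: "L \<in> Isig T" "a = kk T b (Some L)" using a by blast
  have a: "a \<in> borel T" using borel_gens(2) L by simp
  have k: "act a w = ac (cl a) w" using ac_cl[OF a] by simp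
  show ?thesis
  proof (cases b)
    case Pos
    then show ?thesis using a k w[OF L(1)] L by (auto simp: cl_gens)
  next
    case Neg
    have "w = ac (k' (Some L) * k (Some L)) w" by (simp add: kk' ac_diff)
    also have "\<dots> = sc (\<chi> L) (ac (k' (Some L)) w)" using w[OF L(1)] by (simp add: ac_mult Bs_gens ac_linear)
    finally have eq: "w = sc (\<chi> L) (ac (k' (Some L)) w)" .
    then have "\<chi> L \<noteq> 0" using nz by auto
    then have "sc (inverse (\<chi> L)) w = ac (k' (Some L)) w" by (subst eq) simp
    moreover have "act a w = ac (k' (Some L)) w" using k Neg L by (simp add: cl_gens)
    ultimately have "act a w = sc (inverse (\<chi> L)) w" by simp
    then show ?thesis using a by blast
  qed
qed

lemma torus_scalar:
  assumes w: "\<And>L. L \<in> Isig T \<Longrightarrow> ac (k (Some L)) w = sc (\<chi> L) w" and nz: "w \<noteq> 0"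
  shows "a \<in> torus T \<Longrightarrow> a \<in> borel T \<and> (\<exists>z. act a w = sc z w)"
  unfolding torus_def subalgebra_gen_def
proof (induction rule: generate_ring.induct)
  case one
  have "ac 1 = act \<one>\<^bsub>Uq T\<^esub>" using ac_cl[OF borel_closed(3)] by (simp add: cl_one)
  then have "act \<one>\<^bsub>Uq T\<^esub> w = sc 1 w" using ac_diff(3)[of w] by simp
  then show ?case using borel_closed(3) by blast
next
  case (incl a)
  show ?case by (rule torus_gen_scalar[OF _ nz incl]) (rule w)
next
  case (a_inv a)
  then obtain z where a: "a \<in> borel T" and z: "act a w = sc z w" by blast
  have inv: "\<ominus>\<^bsub>Uq T\<^esub> a \<in> borel T"
    using a unfolding borel_def subalgebra_gen_def by (rule generate_ring.a_inv)
  have "act (\<ominus>\<^bsub>Uq T\<^esub> a) w = ac (0 - cl a) w"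
    using ac_cl[OF inv] cl_minus[OF borel_carrier[OF a]] by simp
  also have "\<dots> = - act a w" using ac_diff(1)[OF Bs_closed(1) borel_Bs[OF a], of w] ac_cl[OF a] by (simp add: ac_diff(2))
  finally have "act (\<ominus>\<^bsub>Uq T\<^esub> a) w = sc (- z) w" using z by simp
  then show ?case using inv by blast
next
  case (eng_add a b)
  then obtain y z where yz: "act a w = sc y w" "act b w = sc z w" by blast
  have "act (a \<oplus>\<^bsub>Uq T\<^esub> b) w = sc (y + z) w"
    using bm eng_add.IH yz by (auto simp: borel_module_def S.scale_left_distrib)
  then show ?case using eng_add.IH borel_closed(4) by blast
next
  case (eng_mult a b)
  then obtain y z where yz: "act a w = sc y w" "act b w = sc z w" by blast
  have "act (a \<otimes>\<^bsub>Uq T\<^esub> b) w = act a (sc z w)"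
    using bm eng_mult.IH yz by (auto simp: borel_module_def)
  also have "\<dots> = sc z (act a w)"
    using ac_linear(2)[OF borel_Bs, of a z w] ac_cl[of a] eng_mult.IH by simp
  finally have "act (a \<otimes>\<^bsub>Uq T\<^esub> b) w = sc (z * y) w" using yz by simp
  then show ?case using eng_mult.IH borel_closed(5) by blast
qed

lemma torus_borel: "a \<in> torus T \<Longrightarrow> a \<in> borel T"
  using torus_scalar[of v "\<lambda>L. 1" a] k_v v_nz by simp

lemma torus_ops:
  "a \<in> torus T \<Longrightarrow> b \<in> torus T \<Longrightarrow> a \<oplus>\<^bsub>Uq T\<^esub> b \<in> torus T"
  "a \<in> torus T \<Longrightarrow> b \<in> torus T \<Longrightarrow> a \<otimes>\<^bsub>Uq T\<^esub> b \<in> torus T" "uscal T z \<in> torus T"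
  unfolding torus_def by (rule subalgebra_closed; assumption)+

text \<open>A nonzero simultaneous eigenvector of the k's is an eigenvector of the whole torus, and
  its eigenvalues are multiplicative; this produces the character without a presentation of the
  torus.\<close>

lemma weight_character:
  assumes w: "\<And>L. L \<in> Isig T \<Longrightarrow> ac (k (Some L)) w = sc (\<chi> L) w" and nz: "w \<noteq> 0"
  shows "\<exists>\<nu>. torus_character T \<nu> \<and> w \<in> weight_space T sc act \<nu> \<and> (\<forall>L\<in>Isig T. \<nu> (kk T Pos (Some L)) = \<chi> L)"
proof -
  define \<nu> where "\<nu> a = (SOME z. act a w = sc z w)" for a
  have \<nu>: "act a w = sc (\<nu> a) w" if "a \<in> torus T" for a
    unfolding \<nu>_def by (rule someI_ex) (use torus_scalar[OF w nz that] in blast)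
  have eq: "\<nu> a = z" if "a \<in> torus T" "act a w = sc z w" for a z
    using \<nu>[OF that(1)] that(2) nz by (metis S.scale_cancel_right)
  have "torus_character T \<nu>"
    unfolding torus_character_def
  proof (intro conjI ballI allI)
    fix a b assume ab: "a \<in> torus T" "b \<in> torus T"
    have "act (a \<oplus>\<^bsub>Uq T\<^esub> b) w = sc (\<nu> a + \<nu> b) w"
      using bm torus_borel ab \<nu> by (auto simp: borel_module_def S.scale_left_distrib)
    then show "\<nu> (a \<oplus>\<^bsub>Uq T\<^esub> b) = \<nu> a + \<nu> b" by (rule eq[OF torus_ops(1)[OF ab]])
    have "act (a \<otimes>\<^bsub>Uq T\<^esub> b) w = act a (sc (\<nu> b) w)"
      using bm torus_borel ab \<nu> by (auto simp: borel_module_def)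
    also have "\<dots> = sc (\<nu> a * \<nu> b) w"
      using ac_linear(2)[OF borel_Bs[OF torus_borel[OF ab(1)]], of "\<nu> b" w] ac_cl[OF torus_borel[OF ab(1)]] \<nu>[OF ab(1)]
      by (simp add: mult.commute)
    finally show "\<nu> (a \<otimes>\<^bsub>Uq T\<^esub> b) = \<nu> a * \<nu> b" by (rule eq[OF torus_ops(2)[OF ab]])
  next
    fix c
    show "\<nu> (uscal T c) = c" by (rule eq[OF torus_ops(3)]) (use bm in \<open>auto simp: borel_module_def\<close>)
  qed
  moreover have "w \<in> weight_space T sc act \<nu>" using \<nu> by (simp add: weight_space_def)
  moreover have "\<nu> (kk T Pos (Some L)) = \<chi> L" if L: "L \<in> Isig T" for L
  proof (rule eq[OF torus_gens[OF L]])
    show "act (kk T Pos (Some L)) w = sc (\<chi> L) w"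
      using w[OF L] ac_cl[OF borel_gens(2)[of "Some L" Pos]] L by (simp add: cl_gens)
  qed
  ultimately show ?thesis by blast
qed

lemma weight_space_k:
  "w \<in> weight_space T sc act \<chi> \<Longrightarrow> L \<in> Isig T \<Longrightarrow> ac (k (Some L)) w = sc (\<chi> (kk T Pos (Some L))) w"
  using torus_gens[of L Pos] ac_cl[OF borel_gens(2)[of "Some L" Pos]] by (simp add: weight_space_def cl_gens)

text \<open>The number of simple roots to be added back at an orbit is the number of factors
  \<open>x^-\<close> with node in that orbit.\<close>

lemma weight_le_lw:
  assumes "l \<in> nl" "\<And>L. L \<in> Isig T \<Longrightarrow> \<chi> (kk T Pos (Some L)) = inverse (Qw (Some L) (lw l))"
    "\<And>L. L \<in> Isig T \<Longrightarrow> \<nu> (kk T Pos (Some L)) = 1"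
  shows "weight_le T \<chi> \<nu>"
  unfolding weight_le_def
proof (intro exI[of _ "\<lambda>P. count_list (lw l) (Some P)"] ballI)
  fix L assume L: "L \<in> Isig T"
  have "Qw (Some L) (lw l) = (\<Prod>x\<in>Ihat T. Q x (Some L) powi int (count_list (lw l) x))"
    using Qw_qch[OF lw_Ihat(1)[OF assms(1)]] by (simp add: qch_def)
  also have "\<dots> = (\<Prod>P\<in>Isig T. Q (Some P) (Some L) ^ count_list (lw l) (Some P))"
    using lw_Ihat(2)[of l] by (simp add: prod_Ihat count_list_0_iff)
  also have "\<dots> = (\<Prod>P\<in>Isig T. (qi T (Some P) powi csig T (Some P) (Some L)) ^ count_list (lw l) (Some P))"
    by (rule prod.cong) (use L in \<open>auto simp: qi_csig\<close>)
  finally have "Qw (Some L) (lw l) = (\<Prod>P\<in>Isig T. (qi T (Some P) powi csig T (Some P) (Some L)) ^ count_list (lw l) (Some P))" .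
  moreover have "Qw (Some L) (lw l) \<noteq> 0" by (rule Qw_nz)
  ultimately show "\<nu> (kk T Pos (Some L)) = \<chi> (kk T Pos (Some L)) *
      (\<Prod>P\<in>Isig T. (qi T (Some P) powi csig T (Some P) (Some L)) ^ count_list (lw l) (Some P))"
    using assms(2,3)[OF L] by simp
qed

lemma in_category_O: "in_category_O T sc act"
proof -
  let ?U = "\<Union>\<chi>\<in>{\<chi>. torus_character T \<chi>}. weight_space T sc act \<chi>"
  have 1: "S.span ?U = UNIV"
  proof -
    have "(\<lambda>t. ac t v) ` Bwords \<subseteq> S.span ?U"
    proof
      fix w assume "w \<in> (\<lambda>t. ac t v) ` Bwords"
      then obtain \<psi> where "\<forall>L\<in>Isig T. ac (k (Some L)) w = sc (\<psi> L) w" using ac_Bwords by auto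
      then show "w \<in> S.span ?U"
        using weight_character[of w \<psi>] by (cases "w = 0") (auto intro!: S.span_zero S.span_base)
    qed
    then have "S.span ((\<lambda>t. ac t v) ` Bwords) \<subseteq> S.span ?U" by (intro S.span_minimal S.subspace_span)
    moreover have "w \<in> S.span ((\<lambda>t. ac t v) ` Bwords)" for w
      using cyc_Bs[of w] ac_span[of _ Bwords] Bwords(1) by (auto simp: Bs_def Bwords_def)
    ultimately show ?thesis by blast
  qed
  have 2: "\<exists>B. finite B \<and> weight_space T sc act \<chi> \<subseteq> S.span B" for \<chi>
  proof -
    have "weight_space T sc act \<chi> \<subseteq> {w. \<forall>L\<in>Isig T. ac (k (Some L)) w = sc (\<chi> (kk T Pos (Some L))) w}"
      using weight_space_k by blast
    then show ?thesis using weight_finite[of "\<lambda>L. \<chi> (kk T Pos (Some L))"] by (meson subset_trans)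
  qed
  \<comment> \<open>The character of v: one cone suffices, since all weights lie below that of the
    highest weight vector.\<close>
  obtain \<nu> where \<nu>: "torus_character T \<nu>" "\<And>L. L \<in> Isig T \<Longrightarrow> \<nu> (kk T Pos (Some L)) = 1"
    using weight_character[of v "\<lambda>L. 1"] k_v v_nz by auto
  have 3: "\<chi> \<in> Dcone T \<nu>" if \<chi>: "torus_character T \<chi>" "weight_space T sc act \<chi> \<noteq> {0}" for \<chi>
  proof -
    have "0 \<in> weight_space T sc act \<chi>"
      using ac_linear(3)[OF borel_Bs[OF torus_borel]] ac_cl[OF torus_borel] by (simp add: weight_space_def)
    then obtain w where w: "w \<in> weight_space T sc act \<chi>" "w \<noteq> 0" using \<chi>(2) by blast
    obtain l where "l \<in> nl" "\<forall>L\<in>Isig T. \<chi> (kk T Pos (Some L)) = inverse (Qw (Some L) (lw l))"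
      using weight_lw[OF w(2), of "\<lambda>L. \<chi> (kk T Pos (Some L))"] weight_space_k[OF w(1)] by blast
    then have "weight_le T \<chi> \<nu>" using \<nu>(2) by (intro weight_le_lw) auto
    then show ?thesis using \<chi>(1) by (simp add: Dcone_def)
  qed
  show ?thesis
    unfolding in_category_O_def using bm 1 2 3 \<nu>(1) by (intro conjI exI[of _ "{\<nu>}"]) auto
qed

end

section \<open>Passage to a type\<close>

lemma fscal_comm: "fscal z * p = p * fscal z"
proof (induction p rule: pm_single_induct)
  case (3 w a)
  show ?case by (simp add: fscal_def mult_single mult.commute)
qed (simp_all add: distrib_left distrib_right)

lemma uscal_laws:
  assumes a: "a \<in> carrier (Uq T)"
  shows "uscal T z \<in> carrier (Uq T)" "uscal T (y + z) = uscal T y \<oplus>\<^bsub>Uq T\<^esub> uscal T z"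
    "uscal T (y * z) = uscal T y \<otimes>\<^bsub>Uq T\<^esub> uscal T z" "uscal T 1 = \<one>\<^bsub>Uq T\<^esub>"
    "uscal T z \<otimes>\<^bsub>Uq T\<^esub> a = a \<otimes>\<^bsub>Uq T\<^esub> uscal T z"
proof -
  let ?F = "free_algebra (Gens T)"
  note h = ucls_ring_hom[of T]
  have f: "fscal z \<in> carrier ?F" for z by (rule free_algebra_basic)
  show "uscal T z \<in> carrier (Uq T)" unfolding uscal_def by (rule ring_hom_closed[OF h f])
  show "uscal T (y + z) = uscal T y \<oplus>\<^bsub>Uq T\<^esub> uscal T z"
    using ring_hom_add[OF h f f, of y z] by (simp add: uscal_def free_algebra_def fscal_def single_add)
  show "uscal T (y * z) = uscal T y \<otimes>\<^bsub>Uq T\<^esub> uscal T z"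
    using ring_hom_mult[OF h f f, of y z] by (simp add: uscal_def free_algebra_def fscal_def mult_single)
  show "uscal T 1 = \<one>\<^bsub>Uq T\<^esub>"
    using ring_hom_one[OF h] by (simp add: uscal_def free_algebra_def fscal_def one_poly_mapping_def)
  obtain p where p: "p \<in> carrier ?F" "a = ucls T p"
    using a by (auto simp: Uq_def FactRing_def A_RCOSETS_def' ucls_def)
  show "uscal T z \<otimes>\<^bsub>Uq T\<^esub> a = a \<otimes>\<^bsub>Uq T\<^esub> uscal T z"
    using ring_hom_mult[OF h f p(1), of z] ring_hom_mult[OF h p(1) f, of z] fscal_comm[of z p]
    by (simp add: uscal_def p(2) free_algebra_def)
qed

text \<open>Types cannot depend on \<open>T\<close>, so the algebra is turned into a type for one particular datum: a
  counterexample to the theorem, if there is any.\<close>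

definition good_datum :: "('v::ab_group_add) itself \<Rightarrow> twisted_datum \<Rightarrow> bool" where
  "good_datum _ T \<longleftrightarrow> (\<forall>X H P (sc :: complex \<Rightarrow> 'v \<Rightarrow> 'v) act. valid_datum T \<and> drinfeld_generators T X H \<and>
     P \<in> Isig T \<and> is_L T X H (gamma_plus T P) sc act \<longrightarrow> in_category_O T sc act)"

definition datum0 :: "('v::ab_group_add) itself \<Rightarrow> twisted_datum" where
  "datum0 t = (SOME T. \<not> good_datum t T)"

typedef (overloaded) ('v::ab_group_add) uq0 = "carrier (Uq (datum0 TYPE('v)))"
  using ring.ring_simprules(2)[OF Uq_ring] by blast

setup_lifting type_definition_uq0

instantiation uq0 :: (ab_group_add) calg
begin

lift_definition zero_uq0 :: "'a uq0" is "\<zero>\<^bsub>Uq (datum0 TYPE('a))\<^esub>" by (rule ring.ring_simprules(2)[OF Uq_ring])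
lift_definition one_uq0 :: "'a uq0" is "\<one>\<^bsub>Uq (datum0 TYPE('a))\<^esub>" by (rule ring.ring_simprules(6)[OF Uq_ring])
lift_definition plus_uq0 :: "'a uq0 \<Rightarrow> 'a uq0 \<Rightarrow> 'a uq0" is "\<lambda>a b. a \<oplus>\<^bsub>Uq (datum0 TYPE('a))\<^esub> b"
  by (rule ring.ring_simprules(1)[OF Uq_ring])
lift_definition uminus_uq0 :: "'a uq0 \<Rightarrow> 'a uq0" is "\<lambda>a. \<ominus>\<^bsub>Uq (datum0 TYPE('a))\<^esub> a"
  by (rule ring.ring_simprules(3)[OF Uq_ring])
lift_definition minus_uq0 :: "'a uq0 \<Rightarrow> 'a uq0 \<Rightarrow> 'a uq0" is "\<lambda>a b. a \<ominus>\<^bsub>Uq (datum0 TYPE('a))\<^esub> b"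
  by (rule ring.ring_simprules(4)[OF Uq_ring])
lift_definition times_uq0 :: "'a uq0 \<Rightarrow> 'a uq0 \<Rightarrow> 'a uq0" is "\<lambda>a b. a \<otimes>\<^bsub>Uq (datum0 TYPE('a))\<^esub> b"
  by (rule ring.ring_simprules(5)[OF Uq_ring])
lift_definition csc_uq0 :: "complex \<Rightarrow> 'a uq0 \<Rightarrow> 'a uq0" is "\<lambda>z a. usmult (datum0 TYPE('a)) z a"
  unfolding usmult_def by (rule ring.ring_simprules(5)[OF Uq_ring uscal_laws(1)])

instance
proof
  interpret R: ring "Uq (datum0 TYPE('a))" by (rule Uq_ring)
  note u = uscal_laws[where T = "datum0 TYPE('a)"]
  fix a b c :: "'a uq0" and y z :: complex
  show "a + b + c = a + (b + c)" by transfer (simp add: R.a_assoc)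
  show "a + b = b + a" by transfer (simp add: R.a_comm)
  show "0 + a = a" by transfer simp
  show "- a + a = 0" by transfer (simp add: R.l_neg)
  show "a - b = a + - b" by transfer (simp add: a_minus_def)
  show "a * b * c = a * (b * c)" by transfer (simp add: R.m_assoc)
  show "(a + b) * c = a * c + b * c" by transfer (simp add: R.l_distr)
  show "a * (b + c) = a * b + a * c" by transfer (simp add: R.r_distr)
  show "1 * a = a" "a * 1 = a" by (transfer, simp)+
  show "z \<star> (a + b) = z \<star> a + z \<star> b" by transfer (simp add: usmult_def u(1) R.r_distr)
  show "(y + z) \<star> a = y \<star> a + z \<star> a" by transfer (simp add: usmult_def u(1,2) R.l_distr)
  show "y \<star> z \<star> a = (y * z) \<star> a" by transfer (simp add: usmult_def u(1,3) R.m_assoc)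
  show "1 \<star> a = a" by transfer (simp add: usmult_def u(4))
  show "(z \<star> a) * b = z \<star> (a * b)" by transfer (simp add: usmult_def u(1) R.m_assoc)
  show "a * (z \<star> b) = z \<star> (a * b)"
  proof transfer
    fix z and a b :: uq
    assume ab: "a \<in> carrier (Uq (datum0 TYPE('a)))" "b \<in> carrier (Uq (datum0 TYPE('a)))"
    then show "a \<otimes>\<^bsub>Uq (datum0 TYPE('a))\<^esub> usmult (datum0 TYPE('a)) z b = usmult (datum0 TYPE('a)) z (a \<otimes>\<^bsub>Uq (datum0 TYPE('a))\<^esub> b)"
      using u(5)[OF ab(1), of z] u(1)[OF ab(1), of z] by (simp add: usmult_def R.m_assoc[symmetric])
  qed
qed

end

lemma uq_type_uq0:
  assumes "valid_datum (datum0 TYPE('v::ab_group_add))"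
  shows "uq_type (datum0 TYPE('v)) (Abs_uq0 :: uq \<Rightarrow> 'v uq0)"
proof
  let ?T = "datum0 TYPE('v)"
  interpret R: ring "Uq ?T" by (rule Uq_ring)
  show "valid_datum ?T" by (rule assms)
  show "inj_on (Abs_uq0 :: uq \<Rightarrow> 'v uq0) (carrier (Uq ?T))" by (simp add: inj_on_def Abs_uq0_inject)
  show "(Abs_uq0 :: uq \<Rightarrow> 'v uq0) ` carrier (Uq ?T) = UNIV"
    by (metis Abs_uq0_cases UNIV_eq_I imageI)
  show "(Abs_uq0 \<one>\<^bsub>Uq ?T\<^esub> :: 'v uq0) = 1" by (simp add: one_uq0_def)
  fix a b z assume a: "a \<in> carrier (Uq ?T)"
  show "(Abs_uq0 (usmult ?T z a) :: 'v uq0) = z \<star> Abs_uq0 a" using a by (simp add: csc_uq0.abs_eq eq_onp_def)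
  assume b: "b \<in> carrier (Uq ?T)"
  show "(Abs_uq0 (a \<oplus>\<^bsub>Uq ?T\<^esub> b) :: 'v uq0) = Abs_uq0 a + Abs_uq0 b" using a b by (simp add: plus_uq0.abs_eq eq_onp_def)
  show "(Abs_uq0 (a \<otimes>\<^bsub>Uq ?T\<^esub> b) :: 'v uq0) = Abs_uq0 a * Abs_uq0 b" using a b by (simp add: times_uq0.abs_eq eq_onp_def)
qed

text \<open>The components are 1, a linear polynomial, or \<open>1 - u^M\<close>, so
  \<open>NN = M\<close> bounds all degrees.\<close>

lemma gamma_plus_coeffs:
  assumes "valid_datum T"
  shows "fps_nth (gamma_plus T P i) 0 = 1" "aord T < m \<Longrightarrow> fps_nth (gamma_plus T P i) m = 0"
proof -
  have M: "aord T \<in> {2, 3}" using assms by (simp add: valid_datum_def)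
  show "fps_nth (gamma_plus T P i) 0 = 1" using M by (auto simp: gamma_plus_def fps_X_power_nth)
  show "aord T < m \<Longrightarrow> fps_nth (gamma_plus T P i) m = 0" using M by (auto simp: gamma_plus_def fps_X_power_nth fps_X_nth)
qed

lemma good_datum0: "good_datum TYPE('v::ab_group_add) (datum0 TYPE('v))"
  unfolding good_datum_def
proof (intro allI impI, elim conjE)
  fix X H P and sc :: "complex \<Rightarrow> 'v \<Rightarrow> 'v" and act
  let ?T = "datum0 TYPE('v)"
  assume T: "valid_datum ?T" and D: "drinfeld_generators ?T X H" and L: "is_L ?T X H (gamma_plus ?T P) sc act"
  interpret uq_type ?T "Abs_uq0 :: uq \<Rightarrow> 'v uq0" by (rule uq_type_uq0[OF T])
  obtain v where v: "\<And>w. \<exists>a\<in>borel ?T. w = act a v" "\<And>i r. i \<in> nodes ?T \<Longrightarrow> 0 \<le> r \<Longrightarrow> act (X Pos i r) v = 0"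
    "\<And>i r. i \<in> nodes ?T \<Longrightarrow> act (phi ?T H Pos i (int r)) v = sc (fps_nth (gamma_plus ?T P i) r) v"
    using L unfolding is_L_def by blast
  interpret uq_module ?T "Abs_uq0 :: uq \<Rightarrow> 'v uq0" X H "\<lambda>i r. fps_nth (gamma_plus ?T P i) r" "aord ?T" sc act v
    by unfold_locales (use D L v gamma_plus_coeffs[OF T] in \<open>auto simp: is_L_def\<close>)
  show "in_category_O ?T sc act" by (rule in_category_O)
qed

theorem lemma4p15:
  fixes T :: twisted_datum
    and x :: "sign \<Rightarrow> nat \<Rightarrow> int \<Rightarrow> uq"
    and h :: "nat \<Rightarrow> int \<Rightarrow> uq"
    and sc :: "complex \<Rightarrow> 'v \<Rightarrow> 'v::ab_group_add"
    and act :: "uq \<Rightarrow> 'v \<Rightarrow> 'v"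
  assumes "valid_datum T"
    and "drinfeld_generators T x h"
    and "P \<in> Isig T"
    and "is_L T x h (gamma_plus T P) sc act"
  shows "in_category_O T sc act"
proof -
  have "good_datum TYPE('v) T"
  proof (rule ccontr)
    assume "\<not> good_datum TYPE('v) T"
    then have "\<not> good_datum TYPE('v) (datum0 TYPE('v))" unfolding datum0_def by (rule someI)
    then show False using good_datum0 by blast
  qed
  then show ?thesis unfolding good_datum_def using assms by blast
qed

end
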